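(* Let $k$ be a field, $Q$ a finite quiver, $J$ the arrow ideal of $kQ$, and $\Lambda=kQ/J^2$. Let $C$ be the $\Lambda$-module $\Lambda\otimes_{kQ_0}kQ^{\mathrm{op}}$ with the differential $d$ given by \[d(y\otimes z)=\sum_{\alpha\in Q_1}y\alpha\otimes\alpha^*z\qquad(y\in\Lambda,\ z\in kQ^{\mathrm{op}}).\] Then $C$ is a compact generator for the homotopy category $\underline{\mathrm{Diff}}(\Lambda\text{-}\mathrm{Proj})$ of differential projective $\Lambda$-modules.
   Context: Conventions: $Q=(Q_0,Q_1;s,t)$ has finitely many vertices and arrows; paths are written $\alpha_l\cdots\alpha_1$ with $t(\alpha_i)=s(\alpha_{i+1})$; modules are left modules. $J$ is the ideal of $kQ$ generated by all arrows. $Q^{\mathrm{op}}$ is $Q$ with all arrows reversed; $\alpha^*\colon t(\alpha)\to s(\alpha)$ is the reverse of $\alpha$. $kQ_0=\prod_{i\in Q_0}k$ is the subalgebra of both $kQ$ and $kQ^{\mathrm{op}}$ spanned by the trivial paths. A differential $\Lambda$-module is a pair $(M,d)$ with $M$ a $\Lambda$-module and $d\in\mathrm{End}_\Lambda(M)$, $d^2=0$. A differential map $f\colon(M,d)\to(N,\delta)$ is a $\Lambda$-map with $fd=\delta f$; a $\Lambda$-map $f$ is null homotopic if $f=rd+\delta r$ for some $\Lambda$-map $r\colon M\to N$. A differential projective $\Lambda$-module is a differential $\Lambda$-module whose underlying $\Lambda$-module is projective (not necessarily finitely generated). $\underline{\mathrm{Diff}}(\Lambda\text{-}\mathrm{Proj})$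 has as objects all differential projective $\Lambda$-modules and as morphisms differential maps modulo null-homotopic ones; it is triangulated (the stable category of a Frobenius category) with translation functor $\Sigma(M,d)=(M,-d)$. For a triangulated category $\mathcal T$ with all small coproducts, an object $S$ is compact if for every set $\{T_\lambda\}$ of objects the natural map $\coprod_\lambda\mathrm{Hom}_{\mathcal T}(S,T_\lambda)\to\mathrm{Hom}_{\mathcal T}(S,\coprod_\lambda T_\lambda)$ is an isomorphism. An object $S_0$ is a compact generator for $\mathcal T$ if $\mathcal T$ admits all small coproducts, $S_0$ is compact, and any $T\in\mathcal T$ with $\mathcal T(\Sigma^nS_0,T)=0$ for all $n\in\mathbb Z$ satisfies $T\simeq0$. *)

theory Defs
  imports "HOL-Algebra.Algebra" "Graph_Theory.Digraph" "Graph_Theory.Arc_Walk"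
begin

section \<open>Quivers and path algebras\<close>

text \<open>
  A finite quiver is an instance of the locale \<^locale>\<open>fin_digraph\<close>, with \<^const>\<open>tail\<close> and
  \<^const>\<open>head\<close> as source and target maps; loops and multiple arrows are allowed.
  A path is a triple of its source, its list of arrows, and its target. The list is in order of
  traversal, so \<open>(u, [a\<^sub>1, \<dots>, a\<^sub>l], v)\<close> is the path written \<open>a\<^sub>l \<cdots> a\<^sub>1\<close>.
\<close>

type_synonym ('v, 'e) qpath = "'v \<times> 'e list \<times> 'v"

definition qpaths :: "('v, 'e) pre_digraph \<Rightarrow> ('v, 'e) qpath set" where
  "qpaths Q = {(u, p, v). pre_digraph.awalk Q u p v}"

definition triv_path :: "'v \<Rightarrow> ('v, 'e) qpath" where
  "triv_path v = (v, [], v)"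

definition arrow_path :: "('v, 'e) pre_digraph \<Rightarrow> 'e \<Rightarrow> ('v, 'e) qpath" where
  "arrow_path Q a = (tail Q a, [a], head Q a)"

definition path_source :: "('v, 'e) qpath \<Rightarrow> 'v" where
  "path_source p = fst p"

definition path_target :: "('v, 'e) qpath \<Rightarrow> 'v" where
  "path_target p = snd (snd p)"

text \<open>\<open>path_comp q p\<close> is the path \<open>qp\<close>: first \<open>p\<close>, then \<open>q\<close>.\<close>

definition path_comp :: "('v, 'e) qpath \<Rightarrow> ('v, 'e) qpath \<Rightarrow> ('v, 'e) qpath" where
  "path_comp q p = (path_source p, fst (snd p) @ fst (snd q), path_target q)"

definition path_algebra :: "('v, 'e) pre_digraph \<Rightarrow> (('v, 'e) qpath \<Rightarrow>\<^sub>0 'k::field) ring" where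
  "path_algebra Q =
    \<lparr>carrier = {f. Poly_Mapping.keys f \<subseteq> qpaths Q},
     monoid.mult = (\<lambda>f g. \<Sum>q\<in>Poly_Mapping.keys f. \<Sum>p\<in>Poly_Mapping.keys g.
       if path_target p = path_source q
       then Poly_Mapping.single (path_comp q p) (Poly_Mapping.lookup f q * Poly_Mapping.lookup g p)
       else 0),
     one = (\<Sum>v\<in>verts Q. Poly_Mapping.single (triv_path v) 1),
     ring.zero = 0,
     ring.add = (+)\<rparr>"

definition arrow_elem :: "('v, 'e) pre_digraph \<Rightarrow> 'e \<Rightarrow> (('v, 'e) qpath \<Rightarrow>\<^sub>0 'k::field)" where
  "arrow_elem Q a = Poly_Mapping.single (arrow_path Q a) 1"

definition arrow_ideal :: "('v, 'e) pre_digraph \<Rightarrow> (('v, 'e) qpath \<Rightarrow>\<^sub>0 'k::field) set" where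
  "arrow_ideal Q = Idl\<^bsub>path_algebra Q\<^esub> (arrow_elem Q ` arcs Q)"

definition arrow_ideal_sq :: "('v, 'e) pre_digraph \<Rightarrow> (('v, 'e) qpath \<Rightarrow>\<^sub>0 'k::field) set" where
  "arrow_ideal_sq Q = ideal_prod (path_algebra Q) (arrow_ideal Q) (arrow_ideal Q)"

definition rad_sq_zero_algebra ::
    "('v, 'e) pre_digraph \<Rightarrow> (('v, 'e) qpath \<Rightarrow>\<^sub>0 'k::field) set ring" where
  "rad_sq_zero_algebra Q = path_algebra Q Quot arrow_ideal_sq Q"

definition rad_sq_zero_proj ::
    "('v, 'e) pre_digraph \<Rightarrow> (('v, 'e) qpath \<Rightarrow>\<^sub>0 'k::field) \<Rightarrow> (('v, 'e) qpath \<Rightarrow>\<^sub>0 'k) set" where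
  "rad_sq_zero_proj Q x = arrow_ideal_sq Q +>\<^bsub>path_algebra Q\<^esub> x"

text \<open>The reverse of an arrow \<open>a\<close> of \<open>Q\<close> is the same label \<open>a\<close>, regarded as an arrow of the
  opposite quiver.\<close>

definition op_quiver :: "('v, 'e) pre_digraph \<Rightarrow> ('v, 'e) pre_digraph" where
  "op_quiver Q = \<lparr>verts = verts Q, arcs = arcs Q, tail = head Q, head = tail Q\<rparr>"

text \<open>Since trivial paths of \<open>Q\<close> and of the opposite quiver are the same triples, the following is
  literally a subset of both path algebras.\<close>

definition vertex_algebra :: "('v, 'e) pre_digraph \<Rightarrow> (('v, 'e) qpath \<Rightarrow>\<^sub>0 'k::field) set" where
  "vertex_algebra Q = {f. Poly_Mapping.keys f \<subseteq> triv_path ` verts Q}"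


section \<open>Left modules over a not necessarily commutative ring\<close>

text \<open>
  The record \<^typ>\<open>('r, 'm) module\<close> of HOL-Algebra is reused; its ring fields \<^const>\<open>monoid.mult\<close> and
  \<^const>\<open>one\<close> carry no information for a module.
  Module maps are extensional, so that equal maps are equal functions.
\<close>

locale left_module = R?: ring R + M?: abelian_group M
    for R :: "('r, 'q) ring_scheme" (structure) and M :: "('r, 'm, 'x) module_scheme" (structure) +
  assumes smult_closed: "\<lbrakk>a \<in> carrier R; x \<in> carrier M\<rbrakk> \<Longrightarrow> a \<odot>\<^bsub>M\<^esub> x \<in> carrier M"
    and smult_l_distr: "\<lbrakk>a \<in> carrier R; b \<in> carrier R; x \<in> carrier M\<rbrakk> \<Longrightarrow>
      (a \<oplus>\<^bsub>R\<^esub> b) \<odot>\<^bsub>M\<^esub> x = a \<odot>\<^bsub>M\<^esub> x \<oplus>\<^bsub>M\<^esub> b \<odot>\<^bsub>M\<^esub> x"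
    and smult_r_distr: "\<lbrakk>a \<in> carrier R; x \<in> carrier M; y \<in> carrier M\<rbrakk> \<Longrightarrow>
      a \<odot>\<^bsub>M\<^esub> (x \<oplus>\<^bsub>M\<^esub> y) = a \<odot>\<^bsub>M\<^esub> x \<oplus>\<^bsub>M\<^esub> a \<odot>\<^bsub>M\<^esub> y"
    and smult_assoc: "\<lbrakk>a \<in> carrier R; b \<in> carrier R; x \<in> carrier M\<rbrakk> \<Longrightarrow>
      (a \<otimes>\<^bsub>R\<^esub> b) \<odot>\<^bsub>M\<^esub> x = a \<odot>\<^bsub>M\<^esub> (b \<odot>\<^bsub>M\<^esub> x)"
    and smult_one: "x \<in> carrier M \<Longrightarrow> \<one>\<^bsub>R\<^esub> \<odot>\<^bsub>M\<^esub> x = x"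

definition lmod_hom :: "('r, 'q) ring_scheme \<Rightarrow> ('r, 'm, 'x) module_scheme \<Rightarrow>
    ('r, 'n, 'y) module_scheme \<Rightarrow> ('m \<Rightarrow> 'n) set" where
  "lmod_hom R M N = {f \<in> carrier M \<rightarrow>\<^sub>E carrier N.
     (\<forall>x\<in>carrier M. \<forall>y\<in>carrier M. f (x \<oplus>\<^bsub>M\<^esub> y) = f x \<oplus>\<^bsub>N\<^esub> f y) \<and>
     (\<forall>a\<in>carrier R. \<forall>x\<in>carrier M. f (a \<odot>\<^bsub>M\<^esub> x) = a \<odot>\<^bsub>N\<^esub> f x)}"

definition free_lmod :: "('r, 'q) ring_scheme \<Rightarrow> 'b set \<Rightarrow> ('r, 'b \<Rightarrow> 'r) module" where
  "free_lmod R W =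
    \<lparr>carrier = {f \<in> W \<rightarrow>\<^sub>E carrier R. finite {x \<in> W. f x \<noteq> \<zero>\<^bsub>R\<^esub>}},
     monoid.mult = undefined, one = undefined,
     ring.zero = (\<lambda>x\<in>W. \<zero>\<^bsub>R\<^esub>),
     ring.add = (\<lambda>f g. \<lambda>x\<in>W. f x \<oplus>\<^bsub>R\<^esub> g x),
     smult = (\<lambda>a f. \<lambda>x\<in>W. a \<otimes>\<^bsub>R\<^esub> f x)\<rparr>"

text \<open>Projective means direct summand of a free module. Taking the basis \<open>W\<close> in the type of \<open>P\<close>
  is no restriction: \<open>P\<close> is a quotient of the free module on its own carrier, and if \<open>P\<close> is
  projective this quotient map splits.\<close>

definition lmod_projective :: "('r, 'q) ring_scheme \<Rightarrow> ('r, 'm, 'x) module_scheme \<Rightarrow> bool" where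
  "lmod_projective R P \<longleftrightarrow> left_module R P \<and>
    (\<exists>W :: 'm set. \<exists>i \<in> lmod_hom R P (free_lmod R W). \<exists>p \<in> lmod_hom R (free_lmod R W) P.
      \<forall>x\<in>carrier P. p (i x) = x)"


section \<open>Tensor products\<close>

text \<open>
  The tensor product of a right \<open>S\<close>-module \<open>A\<close> (with right action \<open>ra\<close>) and a left \<open>S\<close>-module
  \<open>B\<close> (with left action \<open>la\<close>) is the free abelian group on \<open>A \<times> B\<close> modulo the subgroup generated
  by the biadditivity and balancing relations. Its elements are cosets.
\<close>

definition tensor_rels :: "('a, 'x) ring_scheme \<Rightarrow> ('a \<Rightarrow> 's \<Rightarrow> 'a) \<Rightarrow> 's set \<Rightarrow>
    ('s \<Rightarrow> 'b \<Rightarrow> 'b) \<Rightarrow> ('b, 'y) ring_scheme \<Rightarrow> (('a \<times> 'b) \<Rightarrow>\<^sub>0 int) set" where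
  "tensor_rels A ra S la B =
     {frag_of (a \<oplus>\<^bsub>A\<^esub> a', b) - frag_of (a, b) - frag_of (a', b) | a a' b.
        a \<in> carrier A \<and> a' \<in> carrier A \<and> b \<in> carrier B} \<union>
     {frag_of (a, b \<oplus>\<^bsub>B\<^esub> b') - frag_of (a, b) - frag_of (a, b') | a b b'.
        a \<in> carrier A \<and> b \<in> carrier B \<and> b' \<in> carrier B} \<union>
     {frag_of (ra a s, b) - frag_of (a, la s b) | a s b.
        a \<in> carrier A \<and> s \<in> S \<and> b \<in> carrier B}"

definition tensor_null :: "('a, 'x) ring_scheme \<Rightarrow> ('a \<Rightarrow> 's \<Rightarrow> 'a) \<Rightarrow> 's set \<Rightarrow>
    ('s \<Rightarrow> 'b \<Rightarrow> 'b) \<Rightarrow> ('b, 'y) ring_scheme \<Rightarrow> (('a \<times> 'b) \<Rightarrow>\<^sub>0 int) set" where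
  "tensor_null A ra S la B =
     generate (free_Abelian_group (carrier A \<times> carrier B)) (tensor_rels A ra S la B)"

definition tensor_group :: "('a, 'x) ring_scheme \<Rightarrow> ('a \<Rightarrow> 's \<Rightarrow> 'a) \<Rightarrow> 's set \<Rightarrow>
    ('s \<Rightarrow> 'b \<Rightarrow> 'b) \<Rightarrow> ('b, 'y) ring_scheme \<Rightarrow> (('a \<times> 'b) \<Rightarrow>\<^sub>0 int) set monoid" where
  "tensor_group A ra S la B =
     free_Abelian_group (carrier A \<times> carrier B) Mod tensor_null A ra S la B"

text \<open>The additive endomorphism of the tensor product induced by \<open>(y, z) \<mapsto> \<phi> (y, z)\<close>, where
  \<open>\<phi> (y, z)\<close> is a formal sum of pairs.\<close>

definition tensor_map :: "('a, 'x) ring_scheme \<Rightarrow> ('a \<Rightarrow> 's \<Rightarrow> 'a) \<Rightarrow> 's set \<Rightarrow>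
    ('s \<Rightarrow> 'b \<Rightarrow> 'b) \<Rightarrow> ('b, 'y) ring_scheme \<Rightarrow> ('a \<times> 'b \<Rightarrow> (('a \<times> 'b) \<Rightarrow>\<^sub>0 int)) \<Rightarrow>
    (('a \<times> 'b) \<Rightarrow>\<^sub>0 int) set \<Rightarrow> (('a \<times> 'b) \<Rightarrow>\<^sub>0 int) set" where
  "tensor_map A ra S la B \<phi> = (\<lambda>c\<in>carrier (tensor_group A ra S la B).
     the_elem ((\<lambda>x. tensor_null A ra S la B
        #>\<^bsub>free_Abelian_group (carrier A \<times> carrier B)\<^esub> frag_extend \<phi> x) ` c))"


section \<open>Categories with a translation functor and compact generators\<close>

text \<open>
  The part of the structure of a triangulated category that enters the notion of compact
  generator: \<open>Hom W V\<close> is an abelian group (in multiplicative notation), \<open>Comp W V Z g f\<close> is the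
  composite of \<open>f : W \<rightarrow> V\<close> and \<open>g : V \<rightarrow> Z\<close>, and \<open>Shift\<close> is the translation on objects, assumed
  to be a bijection of the set of objects.
\<close>

record ('o, 'h) shift_category =
  Obj :: "'o set"
  Hom :: "'o \<Rightarrow> 'o \<Rightarrow> 'h monoid"
  Comp :: "'o \<Rightarrow> 'o \<Rightarrow> 'o \<Rightarrow> 'h \<Rightarrow> 'h \<Rightarrow> 'h"
  Ident :: "'o \<Rightarrow> 'h"
  Shift :: "'o \<Rightarrow> 'o"

definition shift_pow :: "('o, 'h) shift_category \<Rightarrow> int \<Rightarrow> 'o \<Rightarrow> 'o" where
  "shift_pow K n = (if n \<ge> 0 then Shift K ^^ nat n else inv_into (Obj K) (Shift K) ^^ nat (- n))"

definition cat_isomorphic :: "('o, 'h) shift_category \<Rightarrow> 'o \<Rightarrow> 'o \<Rightarrow> bool" where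
  "cat_isomorphic K W V \<longleftrightarrow> (\<exists>f \<in> carrier (Hom K W V). \<exists>g \<in> carrier (Hom K V W).
     Comp K W V W g f = Ident K W \<and> Comp K V W V f g = Ident K V)"

definition zero_object :: "('o, 'h) shift_category \<Rightarrow> 'o \<Rightarrow> bool" where
  "zero_object K Z \<longleftrightarrow> Z \<in> Obj K \<and> (\<forall>W\<in>Obj K.
     carrier (Hom K W Z) = {\<one>\<^bsub>Hom K W Z\<^esub>} \<and> carrier (Hom K Z W) = {\<one>\<^bsub>Hom K Z W\<^esub>})"

definition is_coproduct ::
    "('o, 'h) shift_category \<Rightarrow> 'i set \<Rightarrow> ('i \<Rightarrow> 'o) \<Rightarrow> 'o \<Rightarrow> ('i \<Rightarrow> 'h) \<Rightarrow> bool" where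
  "is_coproduct K I T P \<iota> \<longleftrightarrow> P \<in> Obj K \<and> (\<forall>i\<in>I. \<iota> i \<in> carrier (Hom K (T i) P)) \<and>
     (\<forall>W\<in>Obj K. \<forall>f. (\<forall>i\<in>I. f i \<in> carrier (Hom K (T i) W)) \<longrightarrow>
       (\<exists>!h. h \<in> carrier (Hom K P W) \<and> (\<forall>i\<in>I. Comp K (T i) P W h (\<iota> i) = f i)))"

text \<open>Smallness is relative to a set \<open>U\<close>: the small families are those indexed by subsets of \<open>U\<close>.\<close>

definition has_coproducts :: "'i set \<Rightarrow> ('o, 'h) shift_category \<Rightarrow> bool" where
  "has_coproducts U K \<longleftrightarrow>
     (\<forall>I T. I \<subseteq> U \<and> (\<forall>i\<in>I. T i \<in> Obj K) \<longrightarrow> (\<exists>P \<iota>. is_coproduct K I T P \<iota>))"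

definition compact_object :: "'i set \<Rightarrow> ('o, 'h) shift_category \<Rightarrow> 'o \<Rightarrow> bool" where
  "compact_object U K S \<longleftrightarrow> S \<in> Obj K \<and>
     (\<forall>I T P \<iota>. I \<subseteq> U \<and> (\<forall>i\<in>I. T i \<in> Obj K) \<and> is_coproduct K I T P \<iota> \<longrightarrow>
       (\<lambda>f. gfinprod (Hom K S P) (\<lambda>i. Comp K S (T i) P (\<iota> i) (f i)) I)
         \<in> iso (sum_group I (\<lambda>i. Hom K S (T i))) (Hom K S P))"

definition compact_generator :: "'i set \<Rightarrow> ('o, 'h) shift_category \<Rightarrow> 'o \<Rightarrow> bool" where
  "compact_generator U K S \<longleftrightarrow> has_coproducts U K \<and> compact_object U K S \<and>
     (\<forall>T\<in>Obj K. (\<forall>n::int. carrier (Hom K (shift_pow K n S) T) = {\<one>\<^bsub>Hom K (shift_pow K n S) T\<^esub>}) \<longrightarrow>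
       (\<exists>Z. zero_object K Z \<and> cat_isomorphic K T Z))"


section \<open>The homotopy category of differential projective modules\<close>

record ('r, 'm) dmodule = "('r, 'm) module" +
  dif :: "'m \<Rightarrow> 'm"

definition diff_module :: "('r, 'q) ring_scheme \<Rightarrow> ('r, 'm) dmodule \<Rightarrow> bool" where
  "diff_module R M \<longleftrightarrow> left_module R M \<and> dif M \<in> lmod_hom R M M \<and>
     (\<forall>x\<in>carrier M. dif M (dif M x) = \<zero>\<^bsub>M\<^esub>)"

definition diff_map_group :: "('r, 'q) ring_scheme \<Rightarrow> ('r, 'm) dmodule \<Rightarrow> ('r, 'n) dmodule \<Rightarrow>
    ('m \<Rightarrow> 'n) monoid" where
  "diff_map_group R M N =
    \<lparr>carrier = {f \<in> lmod_hom R M N. \<forall>x\<in>carrier M. f (dif M x) = dif N (f x)},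
     monoid.mult = (\<lambda>f g. \<lambda>x\<in>carrier M. f x \<oplus>\<^bsub>N\<^esub> g x),
     one = (\<lambda>x\<in>carrier M. \<zero>\<^bsub>N\<^esub>)\<rparr>"

definition null_homotopic :: "('r, 'q) ring_scheme \<Rightarrow> ('r, 'm) dmodule \<Rightarrow> ('r, 'n) dmodule \<Rightarrow>
    ('m \<Rightarrow> 'n) set" where
  "null_homotopic R M N =
     {\<lambda>x\<in>carrier M. r (dif M x) \<oplus>\<^bsub>N\<^esub> dif N (r x) | r. r \<in> lmod_hom R M N}"

text \<open>\<open>Diff(\<Lambda>-Proj)\<close> modulo homotopy, for modules whose underlying set is a set of elements of the
  type \<^typ>\<open>'m\<close>. The type plays the role of a universe: if it is infinite and at least as
  large as the coefficient field, the direct sum of a family of such modules indexed by elements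
  of \<^typ>\<open>'m\<close> is again isomorphic to such a module. Morphisms are cosets of the group of
  null-homotopic maps.\<close>

definition homotopy_diff_proj ::
    "('r, 'q) ring_scheme \<Rightarrow> (('r, 'm) dmodule, ('m \<Rightarrow> 'm) set) shift_category" where
  "homotopy_diff_proj R =
    \<lparr>Obj = {M. diff_module R M \<and> lmod_projective R M},
     Hom = (\<lambda>M N. diff_map_group R M N Mod null_homotopic R M N),
     Comp = (\<lambda>M N P G F. \<Union>g\<in>G. \<Union>f\<in>F.
       null_homotopic R M P #>\<^bsub>diff_map_group R M P\<^esub> compose (carrier M) g f),
     Ident = (\<lambda>M. null_homotopic R M M #>\<^bsub>diff_map_group R M M\<^esub> (\<lambda>x\<in>carrier M. x)),
     Shift = (\<lambda>M. M\<lparr>dif := (\<lambda>x\<in>carrier M. \<ominus>\<^bsub>M\<^esub> dif M x)\<rparr>)\<rparr>"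

text \<open>The isomorphic copy of a differential module along a map injective on its carrier.\<close>

definition transport_dmodule :: "('m \<Rightarrow> 'n) \<Rightarrow> ('r, 'm) dmodule \<Rightarrow> ('r, 'n) dmodule" where
  "transport_dmodule e M =
    (let e' = inv_into (carrier M) e in
      \<lparr>carrier = e ` carrier M,
       monoid.mult = undefined, one = undefined,
       ring.zero = e \<zero>\<^bsub>M\<^esub>,
       ring.add = (\<lambda>x y. e (e' x \<oplus>\<^bsub>M\<^esub> e' y)),
       smult = (\<lambda>a x. e (a \<odot>\<^bsub>M\<^esub> e' x)),
       dif = (\<lambda>x\<in>e ` carrier M. e (dif M (e' x)))\<rparr>)"


section \<open>The differential module \<open>C\<close>\<close>

text \<open>In the tensor product defining \<open>C\<close>, \<open>kQ\<^sub>0\<close> acts on \<open>\<Lambda>\<close> from the right through the projection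
  from \<open>kQ\<close>, and on the path algebra of the opposite quiver by left multiplication.\<close>

type_synonym ('v, 'e, 'k) C_carrier =
  "(((('v, 'e) qpath \<Rightarrow>\<^sub>0 'k) set \<times> (('v, 'e) qpath \<Rightarrow>\<^sub>0 'k)) \<Rightarrow>\<^sub>0 int) set"

definition C_group :: "('v, 'e) pre_digraph \<Rightarrow> ('v, 'e, 'k::field) C_carrier monoid" where
  "C_group Q = tensor_group
     (rad_sq_zero_algebra Q) (\<lambda>y s. y \<otimes>\<^bsub>rad_sq_zero_algebra Q\<^esub> rad_sq_zero_proj Q s)
     (vertex_algebra Q)
     (\<lambda>s z. s \<otimes>\<^bsub>path_algebra (op_quiver Q)\<^esub> z) (path_algebra (op_quiver Q))"

definition C_map :: "('v, 'e) pre_digraph \<Rightarrow>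
    ((('v, 'e) qpath \<Rightarrow>\<^sub>0 'k::field) set \<times> (('v, 'e) qpath \<Rightarrow>\<^sub>0 'k) \<Rightarrow>
      (((('v, 'e) qpath \<Rightarrow>\<^sub>0 'k) set \<times> (('v, 'e) qpath \<Rightarrow>\<^sub>0 'k)) \<Rightarrow>\<^sub>0 int)) \<Rightarrow>
    ('v, 'e, 'k) C_carrier \<Rightarrow> ('v, 'e, 'k) C_carrier" where
  "C_map Q = tensor_map
     (rad_sq_zero_algebra Q) (\<lambda>y s. y \<otimes>\<^bsub>rad_sq_zero_algebra Q\<^esub> rad_sq_zero_proj Q s)
     (vertex_algebra Q)
     (\<lambda>s z. s \<otimes>\<^bsub>path_algebra (op_quiver Q)\<^esub> z) (path_algebra (op_quiver Q))"

definition C_dmodule :: "('v, 'e) pre_digraph \<Rightarrow>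
    ((('v, 'e) qpath \<Rightarrow>\<^sub>0 'k::field) set, ('v, 'e, 'k) C_carrier) dmodule" where
  "C_dmodule Q =
    \<lparr>carrier = carrier (C_group Q),
     monoid.mult = undefined, one = undefined,
     ring.zero = \<one>\<^bsub>C_group Q\<^esub>,
     ring.add = (\<otimes>\<^bsub>C_group Q\<^esub>),
     smult = (\<lambda>a. C_map Q (\<lambda>(y, z). frag_of (a \<otimes>\<^bsub>rad_sq_zero_algebra Q\<^esub> y, z))),
     dif = C_map Q (\<lambda>(y, z). \<Sum>\<alpha>\<in>arcs Q.
       frag_of (y \<otimes>\<^bsub>rad_sq_zero_algebra Q\<^esub> rad_sq_zero_proj Q (arrow_elem Q \<alpha>),
                arrow_elem (op_quiver Q) \<alpha> \<otimes>\<^bsub>path_algebra (op_quiver Q)\<^esub> z))\<rparr>"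

end

theory Submission
  imports Defs
begin

text \<open>
  As a \<open>\<Lambda>\<close>-module, \<open>C\<close> is the direct sum of the modules \<open>\<Lambda> e\<^sub>v\<close> over the paths of the opposite quiver,
  \<open>v\<close> being the end of the path. If \<open>b\<^sub>p\<close> denotes the generator belonging to the path \<open>p\<close>, the
  differential is \<open>d b\<^sub>p = \<Sum>\<alpha>. \<alpha> b\<^bsub>\<alpha>p\<^esub>\<close>, so a differential map on \<open>C\<close> satisfies
  \<open>\<delta> (f b\<^sub>p) = \<Sum>\<alpha>. \<alpha> (f b\<^bsub>\<alpha>p\<^esub>)\<close>. In a projective module \<open>M\<close> an equation \<open>\<Sum>\<alpha>. \<alpha> t\<^sub>\<alpha> = j\<close> can be solved for
  every \<open>j\<close> in \<open>JM\<close>, and the \<open>t\<^sub>\<alpha>\<close> are unique modulo \<open>JM\<close>. Solving such equations path by path shows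
  that a differential map \<open>f : C \<rightarrow> M\<close> is null homotopic as soon as it vanishes on the finitely many
  \<open>b\<^sub>p\<close> with \<open>p\<close> trivial, and that every cycle of \<open>M/JM\<close> is the class of \<open>f b\<^sub>p\<close> for some \<open>f\<close>. The
  first fact gives compactness, since finitely many elements of a direct sum lie in a finite partial
  sum. The second shows that \<open>M/JM\<close> is exact if there are no nonzero morphisms \<open>C \<rightarrow> M\<close>; it then
  has a contraction, which lifts to \<open>M\<close> by projectivity, and as \<open>J\<^sup>2 = 0\<close> the lift can be corrected to
  a contraction of \<open>M\<close>.
\<close>

section \<open>Finitely supported sums and module maps\<close>

text \<open>Modules need not be finitely generated, so no counting of dimensions is available: the
  contraction of \<open>M/JM\<close> comes from Zorn's lemma, by adjoining one vector at one vertex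
  at a time. This works because \<open>\<Lambda>/J\<close> is a product of copies of the field and
  acts on such a vector by scalars. Partial contractions are relations on \<open>M\<close> that
  contain \<open>JM \<times> JM\<close>, so the quotient module is never formed. Uniqueness modulo
  \<open>JM\<close> is read off from the coefficient of one arrow in a dual basis; it is what forces
  the right-hand side of the next equation into \<open>JM\<close>, so that the recursion along paths
  can go on. Both statements about maps out of \<open>C\<close> are instances of this one recursion,
  with \<open>-d\<close> and the values of \<open>f\<close> as data in one case, with
  \<open>d\<close> and zero data in the other. A coproduct in the category is known by its universal
  property alone, so compactness is tested on an explicit direct sum, recoded so that its carrier
  lies in the universe.\<close>

lemma finsum_eq_finprod: "finsum M = finprod (add_monoid M)"
  by (simp add: finsum_def fun_eq_iff)

lemma hom_finprod:
  assumes "comm_group G" "comm_group H" "h \<in> hom G H" "f \<in> A \<rightarrow> carrier G"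
  shows "h (finprod G f A) = finprod H (\<lambda>x. h (f x)) A"
proof -
  interpret G: comm_group G by fact
  interpret H: comm_group H by fact
  interpret h: group_hom G H h by unfold_locales (fact assms)
  show ?thesis
    using assms(4)
  proof (induction A rule: infinite_finite_induct)
    case (insert x F)
    have f: "f \<in> F \<rightarrow> carrier G" and x: "f x \<in> carrier G" using insert by auto
    have "h (finprod G f (insert x F)) = h (f x \<otimes>\<^bsub>G\<^esub> finprod G f F)"
      using insert f x by simp
    also have "\<dots> = h (f x) \<otimes>\<^bsub>H\<^esub> h (finprod G f F)"
      using f x by simp
    also have "\<dots> = finprod H (\<lambda>x. h (f x)) (insert x F)"
      using insert f x by (subst H.finprod_insert) (auto simp: Pi_iff h.hom_closed)
    finally show ?case .
  qed auto
qed

lemma gfinprod_eq: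
  assumes "comm_group G" "finite F" "F \<subseteq> A" "f \<in> A \<rightarrow> carrier G"
    and "\<And>x. x \<in> A \<Longrightarrow> x \<notin> F \<Longrightarrow> f x = \<one>\<^bsub>G\<^esub>"
  shows "gfinprod G f A = finprod G f F"
proof -
  interpret comm_group G by fact
  have "gfinprod G f A = gfinprod G f F"
    by (rule gfinprod_mono_neutral_cong_right) (use assms in auto)
  also have "\<dots> = finprod G f F"
    by (rule gfinprod_eq_finprod) (use assms in auto)
  finally show ?thesis .
qed

text \<open>\<open>gfinprod\<close> takes the neutral value when the support is infinite, and a
  homomorphism can shrink an infinite support to a finite one; the finiteness assumption excludes
  this case. Both sides are then finite products over the support of \<open>f\<close>.\<close>

lemma hom_gfinprod:
  assumes "comm_group G" "comm_group H" "h \<in> hom G H" "f \<in> A \<rightarrow> carrier G"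
    and fin: "finite {x \<in> A. f x \<noteq> \<one>\<^bsub>G\<^esub>}"
  shows "h (gfinprod G f A) = gfinprod H (\<lambda>x. h (f x)) A"
proof -
  interpret G: comm_group G by fact
  interpret H: comm_group H by fact
  interpret h: group_hom G H h by unfold_locales (fact assms)
  let ?F = "{x \<in> A. f x \<noteq> \<one>\<^bsub>G\<^esub>}"
  have "gfinprod G f A = finprod G f ?F"
    by (rule gfinprod_eq) (use assms in auto)
  moreover have "gfinprod H (\<lambda>x. h (f x)) A = finprod H (\<lambda>x. h (f x)) ?F"
    by (rule gfinprod_eq) (use assms in \<open>auto simp: Pi_iff h.hom_closed\<close>)
  moreover have "h (finprod G f ?F) = finprod H (\<lambda>x. h (f x)) ?F"
    by (rule hom_finprod) (use assms in auto)
  ultimately show ?thesis by simp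
qed

section \<open>Homomorphisms of left modules and sums of finite support\<close>

lemma lmod_homI:
  assumes "\<And>x. x \<in> carrier M \<Longrightarrow> f x \<in> carrier N" "f \<in> extensional (carrier M)"
    and "\<And>x y. x \<in> carrier M \<Longrightarrow> y \<in> carrier M \<Longrightarrow> f (x \<oplus>\<^bsub>M\<^esub> y) = f x \<oplus>\<^bsub>N\<^esub> f y"
    and "\<And>a x. a \<in> carrier R \<Longrightarrow> x \<in> carrier M \<Longrightarrow> f (a \<odot>\<^bsub>M\<^esub> x) = a \<odot>\<^bsub>N\<^esub> f x"
  shows "f \<in> lmod_hom R M N"
  using assms by (auto simp: lmod_hom_def PiE_def)

lemma lmod_hom_closed: "f \<in> lmod_hom R M N \<Longrightarrow> x \<in> carrier M \<Longrightarrow> f x \<in> carrier N"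
  and lmod_hom_add: "f \<in> lmod_hom R M N \<Longrightarrow> x \<in> carrier M \<Longrightarrow> y \<in> carrier M \<Longrightarrow>
    f (x \<oplus>\<^bsub>M\<^esub> y) = f x \<oplus>\<^bsub>N\<^esub> f y"
  and lmod_hom_smult: "f \<in> lmod_hom R M N \<Longrightarrow> a \<in> carrier R \<Longrightarrow> x \<in> carrier M \<Longrightarrow>
    f (a \<odot>\<^bsub>M\<^esub> x) = a \<odot>\<^bsub>N\<^esub> f x"
  and lmod_hom_extensional: "f \<in> lmod_hom R M N \<Longrightarrow> f \<in> extensional (carrier M)"
  by (auto simp: lmod_hom_def PiE_def)

lemma lmod_hom_eqI:
  assumes "f \<in> lmod_hom R M N" "g \<in> lmod_hom R M N'" "\<And>x. x \<in> carrier M \<Longrightarrow> f x = g x"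
  shows "f = g"
  using assms by (blast intro: extensionalityI lmod_hom_extensional)

lemma (in left_module) lmod_hom_restrictI:
  assumes "\<And>x. x \<in> carrier M \<Longrightarrow> f x \<in> carrier N"
    and "\<And>x y. x \<in> carrier M \<Longrightarrow> y \<in> carrier M \<Longrightarrow> f (x \<oplus>\<^bsub>M\<^esub> y) = f x \<oplus>\<^bsub>N\<^esub> f y"
    and "\<And>a x. a \<in> carrier R \<Longrightarrow> x \<in> carrier M \<Longrightarrow> f (a \<odot>\<^bsub>M\<^esub> x) = a \<odot>\<^bsub>N\<^esub> f x"
  shows "restrict f (carrier M) \<in> lmod_hom R M N"
  by (rule lmod_homI) (use assms smult_closed in auto)

context left_module
begin

lemma smult_hom: "a \<in> carrier R \<Longrightarrow> (\<lambda>x. a \<odot>\<^bsub>M\<^esub> x) \<in> hom (add_monoid M) (add_monoid M)"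
  by (auto simp: hom_def smult_closed smult_r_distr)

lemma smult_hom_l: "x \<in> carrier M \<Longrightarrow> (\<lambda>a. a \<odot>\<^bsub>M\<^esub> x) \<in> hom (add_monoid R) (add_monoid M)"
  by (auto simp: hom_def smult_closed smult_l_distr)

lemma smult_r_null [simp]: "a \<in> carrier R \<Longrightarrow> a \<odot>\<^bsub>M\<^esub> \<zero>\<^bsub>M\<^esub> = \<zero>\<^bsub>M\<^esub>"
  using hom_one[OF smult_hom M.a_group M.a_group] by simp

lemma smult_l_null [simp]: "x \<in> carrier M \<Longrightarrow> \<zero>\<^bsub>R\<^esub> \<odot>\<^bsub>M\<^esub> x = \<zero>\<^bsub>M\<^esub>"
  using hom_one[OF smult_hom_l R.a_group M.a_group] by simp

lemma smult_r_minus: "a \<in> carrier R \<Longrightarrow> x \<in> carrier M \<Longrightarrow> a \<odot>\<^bsub>M\<^esub> (\<ominus>\<^bsub>M\<^esub> x) = \<ominus>\<^bsub>M\<^esub> (a \<odot>\<^bsub>M\<^esub> x)"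
  using group_hom.hom_inv[of "add_monoid M" "add_monoid M" "\<lambda>x. a \<odot>\<^bsub>M\<^esub> x" x] M.a_group smult_hom
  by (simp add: group_hom_def group_hom_axioms_def a_inv_def)

lemma smult_finsum: "a \<in> carrier R \<Longrightarrow> f \<in> A \<rightarrow> carrier M \<Longrightarrow>
    a \<odot>\<^bsub>M\<^esub> finsum M f A = finsum M (\<lambda>x. a \<odot>\<^bsub>M\<^esub> f x) A"
  unfolding finsum_eq_finprod
  by (rule hom_finprod[OF M.a_comm_group M.a_comm_group smult_hom]) auto

lemma finsum_smult: "x \<in> carrier M \<Longrightarrow> f \<in> A \<rightarrow> carrier R \<Longrightarrow>
    finsum R f A \<odot>\<^bsub>M\<^esub> x = finsum M (\<lambda>i. f i \<odot>\<^bsub>M\<^esub> x) A"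
  unfolding finsum_eq_finprod
  by (rule hom_finprod[OF R.a_comm_group M.a_comm_group smult_hom_l]) auto

end

lemma lmod_hom_hom: "f \<in> lmod_hom R M N \<Longrightarrow> f \<in> hom (add_monoid M) (add_monoid N)"
  by (auto simp: hom_def lmod_hom_def)

lemma lmod_hom_zero:
  "f \<in> lmod_hom R M N \<Longrightarrow> left_module R M \<Longrightarrow> left_module R N \<Longrightarrow> f \<zero>\<^bsub>M\<^esub> = \<zero>\<^bsub>N\<^esub>"
  using hom_one[OF lmod_hom_hom, of f R M N]
  by (simp add: left_module_def abelian_group.a_group)

lemma lmod_hom_minus:
  "f \<in> lmod_hom R M N \<Longrightarrow> left_module R M \<Longrightarrow> left_module R N \<Longrightarrow> x \<in> carrier M \<Longrightarrow>
    f (\<ominus>\<^bsub>M\<^esub> x) = \<ominus>\<^bsub>N\<^esub> f x"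
  using group_hom.hom_inv[of "add_monoid M" "add_monoid N" f x]
  by (simp add: group_hom_def group_hom_axioms_def a_inv_def lmod_hom_hom left_module_def abelian_group.a_group)

lemma left_module_a_comm_group: "left_module R M \<Longrightarrow> comm_group (add_monoid M)"
  by (simp add: left_module_def abelian_group.a_comm_group)

lemma lmod_hom_finsum:
  "f \<in> lmod_hom R M N \<Longrightarrow> left_module R M \<Longrightarrow> left_module R N \<Longrightarrow> g \<in> A \<rightarrow> carrier M \<Longrightarrow>
    f (finsum M g A) = finsum N (\<lambda>x. f (g x)) A"
  unfolding finsum_eq_finprod
  by (rule hom_finprod) (auto intro: left_module_a_comm_group lmod_hom_hom)

text \<open>Bases and families of summands may be infinite, so sums are taken over arbitrary index
  sets; \<open>gfinprod\<close> of the additive group is the finite sum over the support.\<close>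

abbreviation gfinsum :: "('r, 'm, 'x) module_scheme \<Rightarrow> ('w \<Rightarrow> 'm) \<Rightarrow> 'w set \<Rightarrow> 'm" where
  "gfinsum M \<equiv> gfinprod (add_monoid M)"

lemma lmod_hom_gfinsum:
  "f \<in> lmod_hom R M N \<Longrightarrow> left_module R M \<Longrightarrow> left_module R N \<Longrightarrow> g \<in> A \<rightarrow> carrier M \<Longrightarrow>
    finite {x \<in> A. g x \<noteq> \<zero>\<^bsub>M\<^esub>} \<Longrightarrow> f (gfinsum M g A) = gfinsum N (\<lambda>x. f (g x)) A"
  by (rule hom_gfinprod) (auto intro: left_module_a_comm_group lmod_hom_hom)

context left_module
begin

lemma gfinsum_eq:
  assumes "finite F" "F \<subseteq> A" "f \<in> A \<rightarrow> carrier M"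
    and "\<And>x. x \<in> A \<Longrightarrow> x \<notin> F \<Longrightarrow> f x = \<zero>\<^bsub>M\<^esub>"
  shows "gfinsum M f A = finsum M f F"
  unfolding finsum_eq_finprod
  by (rule gfinprod_eq) (use assms M.a_comm_group in auto)

lemma gfinsum_closed [simp]: "f \<in> A \<rightarrow> carrier M \<Longrightarrow> gfinsum M f A \<in> carrier M"
  by (rule M.add.gfinprod_closed)

lemma gfinsum_add:
  assumes "finite {x \<in> A. f x \<noteq> \<zero>\<^bsub>M\<^esub>}" "finite {x \<in> A. g x \<noteq> \<zero>\<^bsub>M\<^esub>}"
    "f \<in> A \<rightarrow> carrier M" "g \<in> A \<rightarrow> carrier M"
  shows "gfinsum M (\<lambda>i. f i \<oplus>\<^bsub>M\<^esub> g i) A = gfinsum M f A \<oplus>\<^bsub>M\<^esub> gfinsum M g A"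
  by (rule M.add.gfinprod_distrib) (use assms in auto)

lemma smult_gfinsum:
  assumes "a \<in> carrier R" "f \<in> A \<rightarrow> carrier M" "finite {x \<in> A. f x \<noteq> \<zero>\<^bsub>M\<^esub>}"
  shows "a \<odot>\<^bsub>M\<^esub> gfinsum M f A = gfinsum M (\<lambda>i. a \<odot>\<^bsub>M\<^esub> f i) A"
  by (rule hom_gfinprod[OF M.a_comm_group M.a_comm_group smult_hom])
     (use assms in auto)

lemma gfinsum_cong:
  assumes "\<And>x. x \<in> A \<Longrightarrow> f x = g x" "g \<in> A \<rightarrow> carrier M"
  shows "gfinsum M f A = gfinsum M g A"
  by (rule M.add.gfinprod_cong) (use assms in \<open>auto simp: simp_implies_def\<close>)

lemma gfinsum_single:
  assumes "i \<in> A" "f \<in> A \<rightarrow> carrier M" "\<And>x. x \<in> A \<Longrightarrow> x \<noteq> i \<Longrightarrow> f x = \<zero>\<^bsub>M\<^esub>"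
  shows "gfinsum M f A = f i"
proof -
  have "gfinsum M f A = finsum M f {i}"
    by (rule gfinsum_eq) (use assms in auto)
  also have "\<dots> = f i \<oplus>\<^bsub>M\<^esub> \<zero>\<^bsub>M\<^esub>"
    using assms by (subst M.finsum_insert) auto
  finally show ?thesis using assms by (simp add: Pi_iff)
qed

end

text \<open>An infinite family of maps can be added pointwise as long as only finitely many of them
  are nonzero at each element. Maps out of projective modules and out of direct sums are built as
  such locally finite sums.\<close>

lemma lmod_hom_gfinsumI:
  assumes "left_module R M" "left_module R N"
    and \<psi>: "\<And>w. w \<in> W \<Longrightarrow> \<psi> w \<in> lmod_hom R M N"
    and fin: "\<And>x. x \<in> carrier M \<Longrightarrow> finite {w \<in> W. \<psi> w x \<noteq> \<zero>\<^bsub>N\<^esub>}"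
  shows "(\<lambda>x\<in>carrier M. gfinsum N (\<lambda>w. \<psi> w x) W) \<in> lmod_hom R M N"
proof -
  interpret M: left_module R M by fact
  interpret N: left_module R N by fact
  have c: "(\<lambda>w. \<psi> w x) \<in> W \<rightarrow> carrier N" if "x \<in> carrier M" for x
    using \<psi> that by (auto intro: lmod_hom_closed)
  show ?thesis
  proof (rule M.lmod_hom_restrictI)
    fix x y assume xy: "x \<in> carrier M" "y \<in> carrier M"
    have "gfinsum N (\<lambda>w. \<psi> w (x \<oplus>\<^bsub>M\<^esub> y)) W = gfinsum N (\<lambda>w. \<psi> w x \<oplus>\<^bsub>N\<^esub> \<psi> w y) W"
      by (rule N.gfinsum_cong) (use xy in \<open>auto simp: lmod_hom_add[OF \<psi>] intro: lmod_hom_closed[OF \<psi>]\<close>)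
    also have "\<dots> = gfinsum N (\<lambda>w. \<psi> w x) W \<oplus>\<^bsub>N\<^esub> gfinsum N (\<lambda>w. \<psi> w y) W"
      by (rule N.gfinsum_add) (use xy fin c in auto)
    finally show "gfinsum N (\<lambda>w. \<psi> w (x \<oplus>\<^bsub>M\<^esub> y)) W = gfinsum N (\<lambda>w. \<psi> w x) W \<oplus>\<^bsub>N\<^esub> gfinsum N (\<lambda>w. \<psi> w y) W" .
  next
    fix a x assume ax: "a \<in> carrier R" "x \<in> carrier M"
    have "gfinsum N (\<lambda>w. \<psi> w (a \<odot>\<^bsub>M\<^esub> x)) W = gfinsum N (\<lambda>w. a \<odot>\<^bsub>N\<^esub> \<psi> w x) W"
      by (rule N.gfinsum_cong) (use ax in \<open>auto simp: lmod_hom_smult[OF \<psi>] intro!: N.smult_closed intro: lmod_hom_closed[OF \<psi>]\<close>)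
    also have "\<dots> = a \<odot>\<^bsub>N\<^esub> gfinsum N (\<lambda>w. \<psi> w x) W"
      by (rule N.smult_gfinsum[symmetric]) (use ax fin c in auto)
    finally show "gfinsum N (\<lambda>w. \<psi> w (a \<odot>\<^bsub>M\<^esub> x)) W = a \<odot>\<^bsub>N\<^esub> gfinsum N (\<lambda>w. \<psi> w x) W" .
  qed (use c in auto)
qed

lemma lmod_hom_compose:
  assumes "left_module R M" "f \<in> lmod_hom R M N" "g \<in> lmod_hom R N P"
  shows "compose (carrier M) g f \<in> lmod_hom R M P"
proof -
  interpret M: left_module R M by fact
  show ?thesis
    unfolding compose_def
    by (rule M.lmod_hom_restrictI) (use assms in \<open>auto simp: lmod_hom_add lmod_hom_smult lmod_hom_closed\<close>)
qed

lemma lmod_hom_addI: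
  assumes "left_module R M" "left_module R N" "f \<in> lmod_hom R M N" "g \<in> lmod_hom R M N"
  shows "(\<lambda>x\<in>carrier M. f x \<oplus>\<^bsub>N\<^esub> g x) \<in> lmod_hom R M N"
proof -
  interpret M: left_module R M by fact
  interpret N: left_module R N by fact
  show ?thesis
    by (rule M.lmod_hom_restrictI)
       (use assms in \<open>auto simp: lmod_hom_add lmod_hom_smult N.smult_r_distr N.M.a_ac lmod_hom_closed\<close>)
qed

lemma lmod_hom_negI:
  assumes "left_module R M" "left_module R N" "f \<in> lmod_hom R M N"
  shows "(\<lambda>x\<in>carrier M. \<ominus>\<^bsub>N\<^esub> f x) \<in> lmod_hom R M N"
proof -
  interpret M: left_module R M by fact
  interpret N: left_module R N by fact
  show ?thesis
    by (rule M.lmod_hom_restrictI)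
       (use assms in \<open>auto simp: lmod_hom_add lmod_hom_smult N.smult_r_minus N.M.minus_add lmod_hom_closed\<close>)
qed

lemma lmod_hom_zeroI:
  assumes "left_module R M" "left_module R N"
  shows "(\<lambda>x\<in>carrier M. \<zero>\<^bsub>N\<^esub>) \<in> lmod_hom R M N"
proof -
  interpret M: left_module R M by fact
  interpret N: left_module R N by fact
  show ?thesis
    by (rule M.lmod_hom_restrictI) auto
qed

lemma lmod_hom_idI:
  assumes "left_module R M"
  shows "(\<lambda>x\<in>carrier M. x) \<in> lmod_hom R M M"
proof -
  interpret M: left_module R M by fact
  show ?thesis
    by (rule M.lmod_hom_restrictI) auto
qed

section \<open>Free modules and dual bases\<close>

text \<open>The regular left module, introduced so that coordinate functionals are members of
  \<open>lmod_hom\<close>.\<close>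

definition reg_lmod :: "('r, 'q) ring_scheme \<Rightarrow> ('r, 'r) module" where
  "reg_lmod R = \<lparr>carrier = carrier R, monoid.mult = undefined, one = undefined,
     ring.zero = \<zero>\<^bsub>R\<^esub>, ring.add = (\<oplus>\<^bsub>R\<^esub>), smult = (\<otimes>\<^bsub>R\<^esub>)\<rparr>"

lemma reg_lmod_simps [simp]:
  "carrier (reg_lmod R) = carrier R" "ring.zero (reg_lmod R) = \<zero>\<^bsub>R\<^esub>"
  "ring.add (reg_lmod R) = (\<oplus>\<^bsub>R\<^esub>)" "smult (reg_lmod R) = (\<otimes>\<^bsub>R\<^esub>)"
  by (simp_all add: reg_lmod_def)

lemma (in ring) reg_lmod_left_module: "left_module R (reg_lmod R)"
proof -
  have "abelian_group (reg_lmod R)"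
    by (rule abelian_groupI) (auto simp: a_assoc intro: a_comm l_neg)
  then show ?thesis
    unfolding left_module_def left_module_axioms_def
    by (auto simp: ring_axioms l_distr r_distr m_assoc)
qed

lemma free_lmod_simps [simp]:
  "f \<in> carrier (free_lmod R W) \<longleftrightarrow> f \<in> W \<rightarrow>\<^sub>E carrier R \<and> finite {x \<in> W. f x \<noteq> \<zero>\<^bsub>R\<^esub>}"
  "ring.zero (free_lmod R W) = (\<lambda>x\<in>W. \<zero>\<^bsub>R\<^esub>)"
  "f \<oplus>\<^bsub>free_lmod R W\<^esub> g = (\<lambda>x\<in>W. f x \<oplus>\<^bsub>R\<^esub> g x)"
  "a \<odot>\<^bsub>free_lmod R W\<^esub> f = (\<lambda>x\<in>W. a \<otimes>\<^bsub>R\<^esub> f x)"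
  by (simp_all add: free_lmod_def)

lemma (in ring) free_lmod_left_module: "left_module R (free_lmod R (W :: 'c set))"
proof -
  have fin: "finite {x \<in> W. f x \<noteq> \<zero>}" if "finite {x \<in> W. g x \<noteq> \<zero>}" "finite {x \<in> W. h x \<noteq> \<zero>}"
    "\<And>x. x \<in> W \<Longrightarrow> g x = \<zero> \<Longrightarrow> h x = \<zero> \<Longrightarrow> f x = \<zero>" for f g h :: "'c \<Rightarrow> 'a"
    by (rule finite_subset[OF _ finite_UnI[OF that(1,2)]]) (use that(3) in auto)
  have "abelian_group (free_lmod R W)"
  proof (rule abelian_groupI)
    fix f assume f: "f \<in> carrier (free_lmod R W)"
    show "\<exists>g\<in>carrier (free_lmod R W). g \<oplus>\<^bsub>free_lmod R W\<^esub> f = \<zero>\<^bsub>free_lmod R W\<^esub>"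
    proof (rule bexI)
      show "(\<lambda>x\<in>W. \<ominus> f x) \<oplus>\<^bsub>free_lmod R W\<^esub> f = \<zero>\<^bsub>free_lmod R W\<^esub>"
        using f by (auto simp: fun_eq_iff l_neg PiE_iff)
      show "(\<lambda>x\<in>W. \<ominus> f x) \<in> carrier (free_lmod R W)"
        using f by (auto simp: PiE_iff cong: conj_cong intro!: fin[of f f])
    qed
    show "\<zero>\<^bsub>free_lmod R W\<^esub> \<oplus>\<^bsub>free_lmod R W\<^esub> f = f"
      using f by (auto simp: fun_eq_iff PiE_iff extensional_def)
  next
    fix f g assume f: "f \<in> carrier (free_lmod R W)" "g \<in> carrier (free_lmod R W)"
    then show "f \<oplus>\<^bsub>free_lmod R W\<^esub> g \<in> carrier (free_lmod R W)"
      by (auto simp: PiE_iff cong: conj_cong intro!: fin[of f g])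
    show "f \<oplus>\<^bsub>free_lmod R W\<^esub> g = g \<oplus>\<^bsub>free_lmod R W\<^esub> f"
      using f by (auto simp: fun_eq_iff PiE_iff intro: a_comm)
  qed (auto simp: fun_eq_iff PiE_iff a_assoc)
  then show ?thesis
    unfolding left_module_def left_module_axioms_def
    by (auto simp: ring_axioms l_distr r_distr m_assoc fun_eq_iff PiE_iff extensional_def
        intro: finite_subset rev_finite_subset)
qed

text \<open>The data of the dual basis lemma, which characterises projectivity by elements and
  functionals. The index type is free, so that the same notion serves a projective module over its
  own carrier type and the module \<open>C\<close> with its paths as indices.\<close>

definition dual_basis :: "('r, 'q) ring_scheme \<Rightarrow> ('r, 'm, 'x) module_scheme \<Rightarrow> 'w set \<Rightarrow>
    ('w \<Rightarrow> 'm) \<Rightarrow> ('w \<Rightarrow> 'm \<Rightarrow> 'r) \<Rightarrow> bool" where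
  "dual_basis R P W x \<phi> \<longleftrightarrow> (\<forall>w\<in>W. x w \<in> carrier P) \<and>
     (\<forall>w\<in>W. \<phi> w \<in> lmod_hom R P (reg_lmod R)) \<and>
     (\<forall>p\<in>carrier P. finite {w \<in> W. \<phi> w p \<noteq> \<zero>\<^bsub>R\<^esub>} \<and> p = gfinsum P (\<lambda>w. \<phi> w p \<odot>\<^bsub>P\<^esub> x w) W)"

lemma dual_basisD:
  assumes "dual_basis R P W x \<phi>"
  shows "w \<in> W \<Longrightarrow> x w \<in> carrier P" "w \<in> W \<Longrightarrow> \<phi> w \<in> lmod_hom R P (reg_lmod R)"
    "p \<in> carrier P \<Longrightarrow> finite {w \<in> W. \<phi> w p \<noteq> \<zero>\<^bsub>R\<^esub>}"
    "p \<in> carrier P \<Longrightarrow> gfinsum P (\<lambda>w. \<phi> w p \<odot>\<^bsub>P\<^esub> x w) W = p"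
    "w \<in> W \<Longrightarrow> p \<in> carrier P \<Longrightarrow> \<phi> w p \<in> carrier R"
  using assms lmod_hom_closed[of "\<phi> w" R P "reg_lmod R" p] by (auto simp: dual_basis_def)

text \<open>This is how projectivity produces maps: prescribed elements \<open>g w\<close> are
  combined with the coordinates of \<open>p\<close> as coefficients. The elements \<open>x w\<close>
  may satisfy relations, so the map need not send \<open>x w\<close> to \<open>g w\<close>; it
  respects whatever is closed under linear combinations.\<close>

lemma dual_basis_hom:
  assumes P: "left_module R P" and N: "left_module R N" and db: "dual_basis R P W x \<phi>"
    and g: "\<And>w. w \<in> W \<Longrightarrow> g w \<in> carrier N"
  shows "(\<lambda>p\<in>carrier P. gfinsum N (\<lambda>w. \<phi> w p \<odot>\<^bsub>N\<^esub> g w) W) \<in> lmod_hom R P N"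
proof -
  interpret P: left_module R P by fact
  interpret N: left_module R N by fact
  note D = dual_basisD[OF db]
  have "(\<lambda>p\<in>carrier P. gfinsum N (\<lambda>w. (\<lambda>p\<in>carrier P. \<phi> w p \<odot>\<^bsub>N\<^esub> g w) p) W) \<in> lmod_hom R P N"
  proof (rule lmod_hom_gfinsumI[OF P N])
    fix w assume w: "w \<in> W"
    show "(\<lambda>p\<in>carrier P. \<phi> w p \<odot>\<^bsub>N\<^esub> g w) \<in> lmod_hom R P N"
      by (rule P.lmod_hom_restrictI)
        (use w g D(5)[OF w] in \<open>auto simp: lmod_hom_add[OF D(2)] lmod_hom_smult[OF D(2)] N.smult_l_distr N.smult_assoc
          intro!: N.smult_closed\<close>)
  next
    fix p assume "p \<in> carrier P"
    then show "finite {w \<in> W. (\<lambda>p\<in>carrier P. \<phi> w p \<odot>\<^bsub>N\<^esub> g w) p \<noteq> \<zero>\<^bsub>N\<^esub>}"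
      using g by (auto intro!: finite_subset[OF _ D(3)])
  qed
  then show ?thesis by (simp add: restrict_def cong: if_cong)
qed

text \<open>\<open>lmod_projective\<close> demands a basis inside the carrier type of the module,
  while bases found in practice consist of paths or of pairs. An injection of the index set into the
  carrier type relabels the free module; \<open>F\<close> and \<open>G\<close> are the two
  relabelling maps.\<close>

lemma lmod_projective_reindex:
  fixes P :: "('r, 'm, 'x) module_scheme" and j :: "'w \<Rightarrow> 'm"
  assumes P: "left_module R P"
    and i: "i \<in> lmod_hom R P (free_lmod R W)" and p: "p \<in> lmod_hom R (free_lmod R W) P"
    and pi: "\<And>x. x \<in> carrier P \<Longrightarrow> p (i x) = x"
    and j: "inj_on j W"
  shows "lmod_projective R P"
proof -
  interpret P: left_module R P by fact
  define F where "F = (\<lambda>f\<in>carrier (free_lmod R W). \<lambda>y\<in>j ` W. f (inv_into W j y))"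
  define G where "G = (\<lambda>f\<in>carrier (free_lmod R (j ` W)). \<lambda>w\<in>W. f (j w))"
  have supp: "{x \<in> j ` W. f (inv_into W j x) \<noteq> \<zero>\<^bsub>R\<^esub>} = j ` {x \<in> W. f x \<noteq> \<zero>\<^bsub>R\<^esub>}" for f
    using j by (auto simp: inv_into_f_f)
  have F: "F \<in> lmod_hom R (free_lmod R W) (free_lmod R (j ` W))"
    unfolding F_def
    by (rule left_module.lmod_hom_restrictI[OF P.R.free_lmod_left_module])
       (use j in \<open>auto simp: PiE_iff supp fun_eq_iff cong: conj_cong\<close>)
  have G: "G \<in> lmod_hom R (free_lmod R (j ` W)) (free_lmod R W)"
    unfolding G_def
  proof (rule left_module.lmod_hom_restrictI[OF P.R.free_lmod_left_module])
    fix f assume f: "f \<in> carrier (free_lmod R (j ` W))"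
    have "j ` {x \<in> W. f (j x) \<noteq> \<zero>\<^bsub>R\<^esub>} = {x \<in> j ` W. f x \<noteq> \<zero>\<^bsub>R\<^esub>}" by auto
    moreover have "inj_on j {x \<in> W. f (j x) \<noteq> \<zero>\<^bsub>R\<^esub>}" using j by (auto simp: inj_on_def)
    ultimately show "(\<lambda>w\<in>W. f (j w)) \<in> carrier (free_lmod R W)"
      using f finite_imageD[of j "{x \<in> W. f (j x) \<noteq> \<zero>\<^bsub>R\<^esub>}"] by (auto simp: PiE_iff cong: conj_cong)
  qed (auto simp: fun_eq_iff)
  have GF: "G (F f) = f" if "f \<in> carrier (free_lmod R W)" for f
  proof -
    have "F f \<in> carrier (free_lmod R (j ` W))" using lmod_hom_closed[OF F that] .
    then have "G (F f) = (\<lambda>w\<in>W. F f (j w))" by (simp add: G_def)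
    also have "\<dots> = f" using that j by (auto simp: F_def fun_eq_iff PiE_iff extensional_def)
    finally show ?thesis .
  qed
  have "compose (carrier P) F i \<in> lmod_hom R P (free_lmod R (j ` W))"
    "compose (carrier (free_lmod R (j ` W))) p G \<in> lmod_hom R (free_lmod R (j ` W)) P"
    by (rule lmod_hom_compose[OF P i F], rule lmod_hom_compose[OF P.R.free_lmod_left_module G p])
  moreover have "compose (carrier (free_lmod R (j ` W))) p G (compose (carrier P) F i x) = x"
    if "x \<in> carrier P" for x
    using GF[OF lmod_hom_closed[OF i that]] lmod_hom_closed[OF F lmod_hom_closed[OF i that]]
    by (simp only: compose_def restrict_apply' that pi)
  ultimately show ?thesis
    unfolding lmod_projective_def using P by blast
qed

lemma dual_basis_projective:
  fixes P :: "('r, 'm, 'x) module_scheme" and j :: "'w \<Rightarrow> 'm"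
  assumes P: "left_module R P" and db: "dual_basis R P W x \<phi>" and j: "inj_on j W"
  shows "lmod_projective R P"
proof (rule lmod_projective_reindex[OF P _ _ _ j])
  interpret P: left_module R P by fact
  interpret F: left_module R "free_lmod R W" by (rule P.R.free_lmod_left_module)
  note D = dual_basisD[OF db]
  \<comment> \<open>The map from the free module that sends the unit vector of \<open>w\<close> to
    \<open>x w\<close>, written as a locally finite sum of evaluations multiplied by
    \<open>x w\<close>.\<close>
  define p where "p = (\<lambda>h\<in>carrier (free_lmod R W). gfinsum P (\<lambda>w. (\<lambda>h\<in>carrier (free_lmod R W). h w \<odot>\<^bsub>P\<^esub> x w) h) W)"
  show i: "(\<lambda>y\<in>carrier P. \<lambda>w\<in>W. \<phi> w y) \<in> lmod_hom R P (free_lmod R W)"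
    by (rule P.lmod_hom_restrictI)
       (use D(3,5) in \<open>auto simp: PiE_iff fun_eq_iff lmod_hom_add[OF D(2)] lmod_hom_smult[OF D(2)] cong: conj_cong\<close>)
  show "p \<in> lmod_hom R (free_lmod R W) P"
    unfolding p_def
  proof (rule lmod_hom_gfinsumI[OF F.left_module_axioms P])
    fix w assume w: "w \<in> W"
    then show "(\<lambda>h\<in>carrier (free_lmod R W). h w \<odot>\<^bsub>P\<^esub> x w) \<in> lmod_hom R (free_lmod R W) P"
      by (intro F.lmod_hom_restrictI)
         (use D(1) w in \<open>auto simp: PiE_iff P.smult_l_distr P.smult_assoc intro!: P.smult_closed\<close>)
  next
    fix h assume "h \<in> carrier (free_lmod R W)"
    then show "finite {w \<in> W. (\<lambda>h\<in>carrier (free_lmod R W). h w \<odot>\<^bsub>P\<^esub> x w) h \<noteq> \<zero>\<^bsub>P\<^esub>}"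
      by (auto intro: rev_finite_subset simp: D(1))
  qed
  show "p ((\<lambda>y\<in>carrier P. \<lambda>w\<in>W. \<phi> w y) y) = y" if y: "y \<in> carrier P" for y
  proof -
    have "p ((\<lambda>y\<in>carrier P. \<lambda>w\<in>W. \<phi> w y) y) = gfinsum P (\<lambda>w. (\<lambda>w\<in>W. \<phi> w y) w \<odot>\<^bsub>P\<^esub> x w) W"
      using lmod_hom_closed[OF i y] y unfolding p_def by simp
    also have "\<dots> = gfinsum P (\<lambda>w. \<phi> w y \<odot>\<^bsub>P\<^esub> x w) W"
      by (rule P.gfinsum_cong) (use D y in \<open>auto intro!: P.smult_closed\<close>)
    finally show ?thesis using D(4)[OF y] by simp
  qed
qed

text \<open>Given a splitting through a free module, the elements are the images of the unit vectors
  \<open>\<delta> w\<close> under \<open>p\<close> and the functionals are the coordinates of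
  \<open>i\<close>. Expanding \<open>i y\<close> in unit vectors and applying \<open>p\<close> gives
  back \<open>y\<close>.\<close>

lemma projective_dual_basis:
  fixes P :: "('r, 'm, 'x) module_scheme"
  assumes "lmod_projective R P"
  obtains W :: "'m set" and x \<phi> where "dual_basis R P W x \<phi>"
proof -
  from assms obtain W :: "'m set" and i p where P: "left_module R P"
    and i: "i \<in> lmod_hom R P (free_lmod R W)" and p: "p \<in> lmod_hom R (free_lmod R W) P"
    and pi: "\<And>x. x \<in> carrier P \<Longrightarrow> p (i x) = x"
    unfolding lmod_projective_def by blast
  interpret P: left_module R P by fact
  interpret F: left_module R "free_lmod R W" by (rule P.R.free_lmod_left_module)
  define \<delta> where "\<delta> w = (\<lambda>y\<in>W. if y = w then \<one>\<^bsub>R\<^esub> else \<zero>\<^bsub>R\<^esub>)" for w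
  have \<delta>: "\<delta> w \<in> carrier (free_lmod R W)" if "w \<in> W" for w
    using that by (auto simp: \<delta>_def intro: rev_finite_subset[of "{w}"])
  have ev: "(\<lambda>h\<in>carrier (free_lmod R W). h w) \<in> lmod_hom R (free_lmod R W) (reg_lmod R)" if "w \<in> W" for w
    by (rule F.lmod_hom_restrictI) (use that in auto)
  have fin: "finite {w \<in> W. h w \<odot>\<^bsub>free_lmod R W\<^esub> \<delta> w \<noteq> \<zero>\<^bsub>free_lmod R W\<^esub>}"
    if h: "h \<in> carrier (free_lmod R W)" for h
    by (rule finite_subset[of _ "{w\<in>W. h w \<noteq> \<zero>\<^bsub>R\<^esub>}"]) (use h F.smult_l_null[OF \<delta>] in auto)
  have exp: "gfinsum (free_lmod R W) (\<lambda>w. h w \<odot>\<^bsub>free_lmod R W\<^esub> \<delta> w) W = h" (is "?s = h")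
    if h: "h \<in> carrier (free_lmod R W)" for h
  proof -
    have hc: "h w \<in> carrier R" if "w \<in> W" for w using h that by auto
    have c: "(\<lambda>w. h w \<odot>\<^bsub>free_lmod R W\<^esub> \<delta> w) \<in> W \<rightarrow> carrier (free_lmod R W)"
      using F.smult_closed hc \<delta> by blast
    have s: "?s \<in> carrier (free_lmod R W)" by (rule F.gfinsum_closed[OF c])
    \<comment> \<open>Two vectors of the free module are compared coordinate by coordinate.
      Evaluation at \<open>w\<close> is a module map, hence it passes through the sum, where the
      term at \<open>w\<close> is the one that remains.\<close>
    have "?s w = h w" if w: "w \<in> W" for w
    proof -
      interpret RR: left_module R "reg_lmod R" by (rule P.R.reg_lmod_left_module)
      have "(\<lambda>h\<in>carrier (free_lmod R W). h w) ?s = gfinsum (reg_lmod R) (\<lambda>v. (\<lambda>h\<in>carrier (free_lmod R W). h w) (h v \<odot>\<^bsub>free_lmod R W\<^esub> \<delta> v)) W"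
        by (rule lmod_hom_gfinsum[OF ev[OF w] F.left_module_axioms RR.left_module_axioms c fin[OF h]])
      also have "\<dots> = gfinsum (reg_lmod R) (\<lambda>v. if v = w then h w else \<zero>\<^bsub>R\<^esub>) W"
      proof (rule RR.gfinsum_cong)
        fix v assume v: "v \<in> W"
        have "(\<lambda>h\<in>carrier (free_lmod R W). h w) (h v \<odot>\<^bsub>free_lmod R W\<^esub> \<delta> v) = (h v \<odot>\<^bsub>free_lmod R W\<^esub> \<delta> v) w"
          using F.smult_closed[OF hc[OF v] \<delta>[OF v]] by (rule restrict_apply')
        then show "(\<lambda>h\<in>carrier (free_lmod R W). h w) (h v \<odot>\<^bsub>free_lmod R W\<^esub> \<delta> v) = (if v = w then h w else \<zero>\<^bsub>R\<^esub>)"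
          using w hc[OF v] by (auto simp: \<delta>_def)
      qed (use hc w in auto)
      also have "\<dots> = h w"
        by (subst RR.gfinsum_single[OF w]) (use hc w in auto)
      finally show ?thesis using s by (simp only: restrict_apply')
    qed
    then show ?thesis
      using s h by (intro extensionalityI[where A = W]) (auto simp: PiE_iff)
  qed
  show thesis
  proof (rule that)
    show "dual_basis R P W (\<lambda>w. p (\<delta> w)) (\<lambda>w. \<lambda>y\<in>carrier P. i y w)"
      unfolding dual_basis_def
    proof (intro conjI ballI)
      fix w assume w: "w \<in> W"
      show "p (\<delta> w) \<in> carrier P" by (rule lmod_hom_closed[OF p \<delta>[OF w]])
      have "compose (carrier P) (\<lambda>h\<in>carrier (free_lmod R W). h w) i \<in> lmod_hom R P (reg_lmod R)"
        by (rule lmod_hom_compose[OF P i ev[OF w]])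
      moreover have "compose (carrier P) (\<lambda>h\<in>carrier (free_lmod R W). h w) i = (\<lambda>y\<in>carrier P. i y w)"
        using lmod_hom_closed[OF i] by (auto simp: compose_def fun_eq_iff simp del: free_lmod_simps)
      ultimately show "(\<lambda>y\<in>carrier P. i y w) \<in> lmod_hom R P (reg_lmod R)" by simp
    next
      fix y assume y: "y \<in> carrier P"
      note iy = lmod_hom_closed[OF i y]
      have ic: "i y w \<in> carrier R" if "w \<in> W" for w using iy that by auto
      show "finite {w \<in> W. (\<lambda>y\<in>carrier P. i y w) y \<noteq> \<zero>\<^bsub>R\<^esub>}" using iy y by simp
      have c: "(\<lambda>w. i y w \<odot>\<^bsub>free_lmod R W\<^esub> \<delta> w) \<in> W \<rightarrow> carrier (free_lmod R W)"
        using F.smult_closed ic \<delta> by blast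
      have "y = p (gfinsum (free_lmod R W) (\<lambda>w. i y w \<odot>\<^bsub>free_lmod R W\<^esub> \<delta> w) W)"
        using exp[OF iy] pi[OF y] by simp
      also have "\<dots> = gfinsum P (\<lambda>w. p (i y w \<odot>\<^bsub>free_lmod R W\<^esub> \<delta> w)) W"
        by (rule lmod_hom_gfinsum[OF p F.left_module_axioms P c fin[OF iy]])
      also have "\<dots> = gfinsum P (\<lambda>w. (\<lambda>y\<in>carrier P. i y w) y \<odot>\<^bsub>P\<^esub> p (\<delta> w)) W"
        by (rule P.gfinsum_cong)
           (use y ic \<delta> lmod_hom_smult[OF p] lmod_hom_closed[OF p] in \<open>auto intro!: P.smult_closed simp del: free_lmod_simps\<close>)
      finally show "y = gfinsum P (\<lambda>w. (\<lambda>y\<in>carrier P. i y w) y \<odot>\<^bsub>P\<^esub> p (\<delta> w)) W" .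
    qed
  qed
qed

section \<open>Transport and direct sums of differential modules\<close>

lemma diff_moduleD:
  assumes "diff_module R M"
  shows "left_module R M" "dif M \<in> lmod_hom R M M" "x \<in> carrier M \<Longrightarrow> dif M (dif M x) = \<zero>\<^bsub>M\<^esub>"
    "x \<in> carrier M \<Longrightarrow> dif M x \<in> carrier M"
  using assms by (auto simp: diff_module_def intro: lmod_hom_closed)

lemma transport_dmodule_simps [simp]:
  "carrier (transport_dmodule e M) = e ` carrier M"
  "ring.zero (transport_dmodule e M) = e \<zero>\<^bsub>M\<^esub>"
  "x \<oplus>\<^bsub>transport_dmodule e M\<^esub> y = e (inv_into (carrier M) e x \<oplus>\<^bsub>M\<^esub> inv_into (carrier M) e y)"
  "a \<odot>\<^bsub>transport_dmodule e M\<^esub> x = e (a \<odot>\<^bsub>M\<^esub> inv_into (carrier M) e x)"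
  "dif (transport_dmodule e M) = (\<lambda>x\<in>e ` carrier M. e (dif M (inv_into (carrier M) e x)))"
  by (simp_all add: transport_dmodule_def Let_def)

text \<open>Besides the structure on the copy, the two inverse isomorphisms are recorded as
  extensional maps, so that they can be composed with other members of
  \<open>lmod_hom\<close>.\<close>

lemma transport_diff_module:
  assumes M: "diff_module R M" and e: "inj_on e (carrier M)"
  shows "diff_module R (transport_dmodule e M)"
    and "(\<lambda>x\<in>carrier M. e x) \<in> lmod_hom R M (transport_dmodule e M)"
    and "(\<lambda>y\<in>carrier (transport_dmodule e M). inv_into (carrier M) e y) \<in> lmod_hom R (transport_dmodule e M) M"
proof -
  interpret M: left_module R M by (rule diff_moduleD[OF M])
  note d = diff_moduleD[OF M]
  have "abelian_group (transport_dmodule e M)"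
  proof (rule abelian_groupI)
    fix x assume "x \<in> carrier (transport_dmodule e M)"
    then obtain y where y: "y \<in> carrier M" "x = e y" by auto
    show "\<exists>y\<in>carrier (transport_dmodule e M). y \<oplus>\<^bsub>transport_dmodule e M\<^esub> x = \<zero>\<^bsub>transport_dmodule e M\<^esub>"
      using y e by (intro bexI[of _ "e (\<ominus>\<^bsub>M\<^esub> y)"]) (auto simp: M.M.l_neg)
  qed (use e in \<open>auto simp: M.M.a_ac\<close>)
  then have "left_module R (transport_dmodule e M)"
    unfolding left_module_def left_module_axioms_def
    using e M.R.ring_axioms
    by (auto simp: M.smult_l_distr M.smult_r_distr M.smult_assoc M.smult_closed M.smult_one)
  then interpret T: left_module R "transport_dmodule e M" .
  have "restrict (\<lambda>x. e (dif M (inv_into (carrier M) e x))) (carrier (transport_dmodule e M))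
      \<in> lmod_hom R (transport_dmodule e M) (transport_dmodule e M)"
    by (rule T.lmod_hom_restrictI)
       (use e in \<open>auto simp: d lmod_hom_add[OF d(2)] lmod_hom_smult[OF d(2)] M.smult_closed\<close>)
  then show "diff_module R (transport_dmodule e M)"
    unfolding diff_module_def
    using e d T.left_module_axioms by auto
  show "(\<lambda>x\<in>carrier M. e x) \<in> lmod_hom R M (transport_dmodule e M)"
    by (rule M.lmod_hom_restrictI) (use e in auto)
  show "(\<lambda>y\<in>carrier (transport_dmodule e M). inv_into (carrier M) e y) \<in> lmod_hom R (transport_dmodule e M) M"
    by (rule T.lmod_hom_restrictI) (use e in \<open>auto simp: M.smult_closed\<close>)
qed

section \<open>Direct sums of differential modules and their place in a fixed universe\<close>

definition dsum :: "'i set \<Rightarrow> ('i \<Rightarrow> ('r, 'm) dmodule) \<Rightarrow> ('r, 'i \<Rightarrow> 'm) dmodule" where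
  "dsum I T =
    \<lparr>carrier = {f \<in> \<Pi>\<^sub>E i\<in>I. carrier (T i). finite {i \<in> I. f i \<noteq> \<zero>\<^bsub>T i\<^esub>}},
     monoid.mult = undefined, one = undefined,
     ring.zero = (\<lambda>i\<in>I. \<zero>\<^bsub>T i\<^esub>),
     ring.add = (\<lambda>f g. \<lambda>i\<in>I. f i \<oplus>\<^bsub>T i\<^esub> g i),
     smult = (\<lambda>a f. \<lambda>i\<in>I. a \<odot>\<^bsub>T i\<^esub> f i),
     dif = (\<lambda>f\<in>{f \<in> \<Pi>\<^sub>E i\<in>I. carrier (T i). finite {i \<in> I. f i \<noteq> \<zero>\<^bsub>T i\<^esub>}}. \<lambda>i\<in>I. dif (T i) (f i))\<rparr>"

lemma dsum_simps [simp]: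
  "f \<in> carrier (dsum I T) \<longleftrightarrow> (f \<in> (\<Pi>\<^sub>E i\<in>I. carrier (T i)) \<and> finite {i \<in> I. f i \<noteq> \<zero>\<^bsub>T i\<^esub>})"
  "ring.zero (dsum I T) = (\<lambda>i\<in>I. \<zero>\<^bsub>T i\<^esub>)"
  "f \<oplus>\<^bsub>dsum I T\<^esub> g = (\<lambda>i\<in>I. f i \<oplus>\<^bsub>T i\<^esub> g i)"
  "a \<odot>\<^bsub>dsum I T\<^esub> f = (\<lambda>i\<in>I. a \<odot>\<^bsub>T i\<^esub> f i)"
  by (simp_all add: dsum_def)

lemma dif_dsum: "dif (dsum I T) = (\<lambda>f\<in>carrier (dsum I T). \<lambda>i\<in>I. dif (T i) (f i))"
  by (simp add: dsum_def)

lemma dsum_left_module: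
  assumes R: "ring R" and T: "\<And>i. i \<in> I \<Longrightarrow> left_module R (T i)"
  shows "left_module R (dsum I T)"
proof -
  have fin: "finite {x \<in> I. f x \<noteq> \<zero>\<^bsub>T x\<^esub>}" if "finite {x \<in> I. g x \<noteq> \<zero>\<^bsub>T x\<^esub>}" "finite {x \<in> I. h x \<noteq> \<zero>\<^bsub>T x\<^esub>}"
    "\<And>x. x \<in> I \<Longrightarrow> g x = \<zero>\<^bsub>T x\<^esub> \<Longrightarrow> h x = \<zero>\<^bsub>T x\<^esub> \<Longrightarrow> f x = \<zero>\<^bsub>T x\<^esub>" for f g h
    by (rule finite_subset[OF _ finite_UnI[OF that(1,2)]]) (use that(3) in auto)
  have ag: "abelian_group (T i)" if "i \<in> I" for i using T[OF that] by (simp add: left_module_def)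
  note A = abelian_groupE[OF ag]
  note L = left_module.smult_closed[OF T] left_module.smult_l_distr[OF T] left_module.smult_r_distr[OF T]
    left_module.smult_assoc[OF T] left_module.smult_one[OF T] left_module.smult_r_null[OF T]
  have "abelian_group (dsum I T)"
  proof (rule abelian_groupI)
    fix f assume f: "f \<in> carrier (dsum I T)"
    show "\<exists>g\<in>carrier (dsum I T). g \<oplus>\<^bsub>dsum I T\<^esub> f = \<zero>\<^bsub>dsum I T\<^esub>"
    proof (rule bexI)
      show "(\<lambda>x\<in>I. \<ominus>\<^bsub>T x\<^esub> f x) \<oplus>\<^bsub>dsum I T\<^esub> f = \<zero>\<^bsub>dsum I T\<^esub>"
        using f by (auto simp: fun_eq_iff abelian_group.l_neg[OF ag] PiE_iff)
      show "(\<lambda>x\<in>I. \<ominus>\<^bsub>T x\<^esub> f x) \<in> carrier (dsum I T)"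
        using f by (auto simp: PiE_iff abelian_group.a_inv_closed[OF ag] abelian_groupE(2)[OF ag]
            abelian_group.minus_equality[OF ag] abelian_monoid.l_zero[OF abelian_group.axioms(1)[OF ag]]
            cong: conj_cong intro!: fin[of f f])
    qed
    show "\<zero>\<^bsub>dsum I T\<^esub> \<oplus>\<^bsub>dsum I T\<^esub> f = f"
      using f by (auto simp: fun_eq_iff PiE_iff extensional_def A(5))
  next
    fix f g assume f: "f \<in> carrier (dsum I T)" "g \<in> carrier (dsum I T)"
    then show "f \<oplus>\<^bsub>dsum I T\<^esub> g \<in> carrier (dsum I T)"
      by (auto simp: PiE_iff A(1,2,5) cong: conj_cong intro!: fin[of f g])
    show "f \<oplus>\<^bsub>dsum I T\<^esub> g = g \<oplus>\<^bsub>dsum I T\<^esub> f"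
      using f by (auto simp: fun_eq_iff PiE_iff intro: A(4))
  qed (auto simp: fun_eq_iff PiE_iff A(1,2,3))
  then show ?thesis
    unfolding left_module_def left_module_axioms_def
    by (auto simp: R L fun_eq_iff PiE_iff extensional_def cong: conj_cong
        intro: rev_finite_subset)
qed

text \<open>A direct sum described by its injections and projections instead of by its elements. In
  this form it survives a change of carrier type, which is needed because \<open>dsum\<close>
  consists of functions while an object of the category has elements of the universe.\<close>

locale dmod_sum =
  fixes R :: "('r, 'q) ring_scheme" and I :: "'i set" and T :: "'i \<Rightarrow> ('r, 'm) dmodule"
    and D :: "('r, 'n) dmodule" and \<kappa> :: "'i \<Rightarrow> 'm \<Rightarrow> 'n" and \<pi> :: "'i \<Rightarrow> 'n \<Rightarrow> 'm"
  assumes D: "diff_module R D" and T: "i \<in> I \<Longrightarrow> diff_module R (T i)"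
    and \<kappa>: "i \<in> I \<Longrightarrow> \<kappa> i \<in> lmod_hom R (T i) D" and \<pi>: "i \<in> I \<Longrightarrow> \<pi> i \<in> lmod_hom R D (T i)"
    and \<kappa>_dif: "i \<in> I \<Longrightarrow> x \<in> carrier (T i) \<Longrightarrow> \<kappa> i (dif (T i) x) = dif D (\<kappa> i x)"
    and \<pi>_dif: "i \<in> I \<Longrightarrow> y \<in> carrier D \<Longrightarrow> \<pi> i (dif D y) = dif (T i) (\<pi> i y)"
    and \<pi>\<kappa>: "i \<in> I \<Longrightarrow> j \<in> I \<Longrightarrow> x \<in> carrier (T i) \<Longrightarrow> \<pi> j (\<kappa> i x) = (if i = j then x else \<zero>\<^bsub>T j\<^esub>)"
    and fin_\<pi>: "y \<in> carrier D \<Longrightarrow> finite {i \<in> I. \<pi> i y \<noteq> \<zero>\<^bsub>T i\<^esub>}"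
    and \<kappa>\<pi>: "y \<in> carrier D \<Longrightarrow> gfinsum D (\<lambda>i. \<kappa> i (\<pi> i y)) I = y"

lemma dsum_dmod_sum:
  assumes R: "ring R" and T: "\<And>i. i \<in> I \<Longrightarrow> diff_module R (T i)"
  shows "dmod_sum R I T (dsum I T)
    (\<lambda>i. \<lambda>x\<in>carrier (T i). \<lambda>j\<in>I. if j = i then x else \<zero>\<^bsub>T j\<^esub>) (\<lambda>i. \<lambda>f\<in>carrier (dsum I T). f i)"
proof -
  note d = diff_moduleD[OF T]
  interpret D: left_module R "dsum I T" by (rule dsum_left_module[OF R d(1)])
  have ag: "abelian_group (T i)" if "i \<in> I" for i using d(1)[OF that] by (simp add: left_module_def)
  note A = abelian_groupE[OF ag]
  have dz: "dif (T i) \<zero>\<^bsub>T i\<^esub> = \<zero>\<^bsub>T i\<^esub>" if "i \<in> I" for i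
    by (rule lmod_hom_zero[OF d(2)[OF that] d(1)[OF that] d(1)[OF that]])
  have dc: "(\<lambda>i\<in>I. dif (T i) (f i)) \<in> carrier (dsum I T)" if "f \<in> carrier (dsum I T)" for f
    using that by (auto simp: PiE_iff d dz cong: conj_cong intro: rev_finite_subset)
  let ?\<kappa> = "\<lambda>i. \<lambda>x\<in>carrier (T i). \<lambda>j\<in>I. if j = i then x else \<zero>\<^bsub>T j\<^esub>"
  let ?\<pi> = "\<lambda>i. \<lambda>f\<in>carrier (dsum I T). f i"
  have \<kappa>c: "(\<lambda>j\<in>I. if j = i then x else \<zero>\<^bsub>T j\<^esub>) \<in> carrier (dsum I T)" if "i \<in> I" "x \<in> carrier (T i)" for i x
    using that by (auto simp: A(2) intro: rev_finite_subset[of "{i}"])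
  have \<kappa>: "?\<kappa> i \<in> lmod_hom R (T i) (dsum I T)" if i: "i \<in> I" for i
    by (rule left_module.lmod_hom_restrictI[OF d(1)[OF i]])
       (use i \<kappa>c[OF i] in \<open>auto simp: fun_eq_iff left_module.smult_r_null[OF d(1)] A(2,5) simp del: dsum_simps(1)\<close>)
  have \<pi>: "?\<pi> i \<in> lmod_hom R (dsum I T) (T i)" if i: "i \<in> I" for i
    by (rule D.lmod_hom_restrictI) (use i in auto)
  have dd: "diff_module R (dsum I T)"
    unfolding diff_module_def
  proof (intro conjI ballI)
    show "dif (dsum I T) \<in> lmod_hom R (dsum I T) (dsum I T)"
      unfolding dif_dsum
      by (rule D.lmod_hom_restrictI)
         (use dc in \<open>auto simp: fun_eq_iff lmod_hom_add[OF d(2)] lmod_hom_smult[OF d(2)] PiE_iff\<close>)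
    show "dif (dsum I T) (dif (dsum I T) f) = \<zero>\<^bsub>dsum I T\<^esub>" if f: "f \<in> carrier (dsum I T)" for f
      using f dc[OF f] by (auto simp: dif_dsum fun_eq_iff d PiE_iff)
  qed (fact D.left_module_axioms)
  show ?thesis
  proof (unfold_locales)
    fix i x assume i: "i \<in> I" and x: "x \<in> carrier (T i)"
    show "?\<kappa> i (dif (T i) x) = dif (dsum I T) (?\<kappa> i x)"
      using i x d(4)[OF i x] \<kappa>c[OF i x] by (auto simp: dif_dsum fun_eq_iff dz)
  next
    fix i y assume i: "i \<in> I" and y: "y \<in> carrier (dsum I T)"
    show "?\<pi> i (dif (dsum I T) y) = dif (T i) (?\<pi> i y)"
      using i y dc[OF y] by (simp add: dif_dsum)
  next
    fix i j x assume "i \<in> I" "j \<in> I" "x \<in> carrier (T i)"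
    then show "?\<pi> j (?\<kappa> i x) = (if i = j then x else \<zero>\<^bsub>T j\<^esub>)"
      using \<kappa>c[of i x] by simp
  next
    fix y assume y: "y \<in> carrier (dsum I T)"
    then show fin: "finite {i \<in> I. ?\<pi> i y \<noteq> \<zero>\<^bsub>T i\<^esub>}" by simp
    have yi: "y i \<in> carrier (T i)" if "i \<in> I" for i using y that by auto
    have c: "(\<lambda>i. ?\<kappa> i (?\<pi> i y)) \<in> I \<rightarrow> carrier (dsum I T)"
      using lmod_hom_closed[OF \<kappa>] lmod_hom_closed[OF \<pi> y] by blast
    have "?\<kappa> i (?\<pi> i y) = \<zero>\<^bsub>dsum I T\<^esub>" if "i \<in> I" "?\<pi> i y = \<zero>\<^bsub>T i\<^esub>" for i
      unfolding that(2) by (rule lmod_hom_zero[OF \<kappa>[OF that(1)] d(1)[OF that(1)] D.left_module_axioms])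
    then have "{i \<in> I. ?\<kappa> i (?\<pi> i y) \<noteq> \<zero>\<^bsub>dsum I T\<^esub>} \<subseteq> {i \<in> I. ?\<pi> i y \<noteq> \<zero>\<^bsub>T i\<^esub>}"
      by blast
    then have finc: "finite {i \<in> I. ?\<kappa> i (?\<pi> i y) \<noteq> \<zero>\<^bsub>dsum I T\<^esub>}"
      by (rule finite_subset[OF _ fin])
    have s: "gfinsum (dsum I T) (\<lambda>i. ?\<kappa> i (?\<pi> i y)) I \<in> carrier (dsum I T)" (is "?s \<in> _")
      by (rule D.gfinsum_closed[OF c])
    have ext: "f \<in> extensional I" if "f \<in> carrier (dsum I T)" for f
      using that by (simp add: PiE_iff)
    show "?s = y"
    proof (rule extensionalityI[OF ext[OF s] ext[OF y]])
      fix j assume j: "j \<in> I"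
      interpret Tj: left_module R "T j" by (rule d(1)[OF j])
      have "?\<pi> j ?s = gfinsum (T j) (\<lambda>i. ?\<pi> j (?\<kappa> i (?\<pi> i y))) I"
        by (rule lmod_hom_gfinsum[OF \<pi>[OF j] D.left_module_axioms Tj.left_module_axioms c finc])
      also have "\<dots> = gfinsum (T j) (\<lambda>i. if i = j then y j else \<zero>\<^bsub>T j\<^esub>) I"
        by (rule Tj.gfinsum_cong) (use j y yi \<kappa>c in \<open>auto simp del: dsum_simps(1)\<close>)
      also have "\<dots> = y j"
        by (subst Tj.gfinsum_single[OF j]) (use j yi in auto)
      finally show "?s j = y j" using s by (simp only: restrict_apply')
    qed
  qed (fact dd T \<kappa> \<pi>)+
qed

lemma (in dmod_sum) transport:
  assumes e: "inj_on e (carrier D)"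
  shows "dmod_sum R I T (transport_dmodule e D) (\<lambda>i. \<lambda>x\<in>carrier (T i). e (\<kappa> i x))
    (\<lambda>i. \<lambda>y\<in>carrier (transport_dmodule e D). \<pi> i (inv_into (carrier D) e y))"
proof -
  note t = transport_diff_module[OF D e]
  note Dd = diff_moduleD[OF D] and Td = diff_moduleD[OF T] and td = diff_moduleD[OF t(1)]
  have \<kappa>': "(\<lambda>x\<in>carrier (T i). e (\<kappa> i x)) \<in> lmod_hom R (T i) (transport_dmodule e D)" if i: "i \<in> I" for i
  proof -
    have "compose (carrier (T i)) (\<lambda>x\<in>carrier D. e x) (\<kappa> i) = (\<lambda>x\<in>carrier (T i). e (\<kappa> i x))"
      using lmod_hom_closed[OF \<kappa>[OF i]] by (auto simp: compose_def fun_eq_iff)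
    then show ?thesis using lmod_hom_compose[OF Td(1)[OF i] \<kappa>[OF i] t(2)] by simp
  qed
  have \<pi>': "(\<lambda>y\<in>carrier (transport_dmodule e D). \<pi> i (inv_into (carrier D) e y)) \<in> lmod_hom R (transport_dmodule e D) (T i)"
    if i: "i \<in> I" for i
    using lmod_hom_compose[OF td(1) t(3) \<pi>[OF i]] by (simp add: compose_def cong: restrict_cong)
  have im: "e x \<in> e ` carrier D" if "x \<in> carrier D" for x using that by blast
  note kc = lmod_hom_closed[OF \<kappa>] and pc = lmod_hom_closed[OF \<pi>]
  show ?thesis
  proof unfold_locales
    fix y assume y: "y \<in> carrier (transport_dmodule e D)"
    then obtain x where x: "x \<in> carrier D" "y = e x" by auto
    let ?f = "\<lambda>i. \<kappa> i (\<pi> i x)"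
    have c: "?f \<in> I \<rightarrow> carrier D" using kc[OF _ pc[OF _ x(1)]] by blast
    have fin: "finite {i \<in> I. ?f i \<noteq> \<zero>\<^bsub>D\<^esub>}"
      by (rule finite_subset[OF _ fin_\<pi>[OF x(1)]]) (use lmod_hom_zero[OF \<kappa> Td(1) Dd(1)] in auto)
    have "y = (\<lambda>x\<in>carrier D. e x) (gfinsum D ?f I)" using x \<kappa>\<pi> by simp
    also have "\<dots> = gfinsum (transport_dmodule e D) (\<lambda>i. (\<lambda>x\<in>carrier D. e x) (?f i)) I"
      by (rule lmod_hom_gfinsum[OF t(2) Dd(1) td(1) c fin])
    also have "\<dots> = gfinsum (transport_dmodule e D) (\<lambda>i. (\<lambda>x\<in>carrier (T i). e (\<kappa> i x))
       ((\<lambda>y\<in>carrier (transport_dmodule e D). \<pi> i (inv_into (carrier D) e y)) y)) I"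
      by (rule left_module.gfinsum_cong[OF td(1)]) (use x kc pc e im in auto)
    finally show "gfinsum (transport_dmodule e D) (\<lambda>i. (\<lambda>x\<in>carrier (T i). e (\<kappa> i x))
       ((\<lambda>y\<in>carrier (transport_dmodule e D). \<pi> i (inv_into (carrier D) e y)) y)) I = y" by simp
  next
    fix i x assume "i \<in> I" "x \<in> carrier (T i)"
    then show "(\<lambda>x\<in>carrier (T i). e (\<kappa> i x)) (dif (T i) x) =
        dif (transport_dmodule e D) ((\<lambda>x\<in>carrier (T i). e (\<kappa> i x)) x)"
      using e kc im Td(4) \<kappa>_dif by simp
  next
    fix i y assume i: "i \<in> I" and "y \<in> carrier (transport_dmodule e D)"
    then obtain x where "x \<in> carrier D" "y = e x" by auto
    then show "(\<lambda>y\<in>carrier (transport_dmodule e D). \<pi> i (inv_into (carrier D) e y)) (dif (transport_dmodule e D) y) =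
        dif (T i) ((\<lambda>y\<in>carrier (transport_dmodule e D). \<pi> i (inv_into (carrier D) e y)) y)"
      using e i im Dd(4) \<pi>_dif by simp
  next
    fix i j x assume "i \<in> I" "j \<in> I" "x \<in> carrier (T i)"
    then show "(\<lambda>y\<in>carrier (transport_dmodule e D). \<pi> j (inv_into (carrier D) e y)) ((\<lambda>x\<in>carrier (T i). e (\<kappa> i x)) x) =
       (if i = j then x else \<zero>\<^bsub>T j\<^esub>)"
      using e kc im \<pi>\<kappa> by simp
  next
    fix y assume "y \<in> carrier (transport_dmodule e D)"
    then obtain x where "x \<in> carrier D" "y = e x" by auto
    then show "finite {i \<in> I. (\<lambda>y\<in>carrier (transport_dmodule e D). \<pi> i (inv_into (carrier D) e y)) y \<noteq> \<zero>\<^bsub>T i\<^esub>}"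
      using e im fin_\<pi> by simp
  qed (fact t(1) T \<kappa>' \<pi>')+
qed

text \<open>Retractions of free modules onto the summands assemble to a retraction of the free
  module on the disjoint union \<open>Sigma I W\<close> of the bases. The injection \<open>j\<close>
  brings this index set into the carrier type of \<open>D\<close>.\<close>

lemma (in dmod_sum) projective:
  fixes j :: "'i \<times> 'm \<Rightarrow> 'n"
  assumes P: "\<And>i. i \<in> I \<Longrightarrow> lmod_projective R (T i)" and j: "inj j"
  shows "lmod_projective R D"
proof -
  note Td = diff_moduleD[OF T] and Dd = diff_moduleD[OF D]
  interpret D: left_module R D by fact
  let ?Q = "\<lambda>i (W :: 'm set, a, p). a \<in> lmod_hom R (T i) (free_lmod R W) \<and>
      p \<in> lmod_hom R (free_lmod R W) (T i) \<and> (\<forall>x\<in>carrier (T i). p (a x) = x)"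
  have "\<forall>i\<in>I. \<exists>z. ?Q i z"
  proof
    fix i assume "i \<in> I"
    from P[OF this] obtain W :: "'m set" and a p where "a \<in> lmod_hom R (T i) (free_lmod R W)"
      "p \<in> lmod_hom R (free_lmod R W) (T i)" "\<forall>x\<in>carrier (T i). p (a x) = x"
      unfolding lmod_projective_def by blast
    then have "?Q i (W, a, p)" by simp
    then show "\<exists>z. ?Q i z" by (rule exI)
  qed
  from bchoice[OF this] obtain z where "\<forall>i\<in>I. ?Q i (z i)" ..
  note z = bspec[OF this]
  define W a p where "W i = fst (z i)" and "a i = fst (snd (z i))" and "p i = snd (snd (z i))" for i
  have a: "a i \<in> lmod_hom R (T i) (free_lmod R (W i))"
    and p: "p i \<in> lmod_hom R (free_lmod R (W i)) (T i)"
    and pa: "x \<in> carrier (T i) \<Longrightarrow> p i (a i x) = x" if "i \<in> I" for i x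
    using z[OF that] by (auto simp: W_def a_def p_def split_beta)
  let ?F = "free_lmod R (Sigma I W)"
  interpret F: left_module R ?F by (rule D.R.free_lmod_left_module)
  note Fi = D.R.free_lmod_left_module
  define A where "A = (\<lambda>y\<in>carrier D. \<lambda>(i, w)\<in>Sigma I W. a i (\<pi> i y) w)"
  have pc: "\<pi> i y \<in> carrier (T i)" if "i \<in> I" "y \<in> carrier D" for i y
    using lmod_hom_closed[OF \<pi>] that by blast
  have ac: "a i (\<pi> i y) \<in> carrier (free_lmod R (W i))" if "i \<in> I" "y \<in> carrier D" for i y
    using lmod_hom_closed[OF a pc] that by blast
  have az: "a i \<zero>\<^bsub>T i\<^esub> = (\<lambda>w\<in>W i. \<zero>\<^bsub>R\<^esub>)" if "i \<in> I" for i
    using lmod_hom_zero[OF a[OF that] Td(1)[OF that] Fi] by simp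
  \<comment> \<open>Nonzero coordinates occur in the finitely many blocks \<open>i\<close> with
    \<open>\<pi> i y\<close> nonzero, and each block contributes finitely many of them.\<close>
  have fin: "finite {w \<in> Sigma I W. (case w of (i, w) \<Rightarrow> a i (\<pi> i y) w) \<noteq> \<zero>\<^bsub>R\<^esub>}" if y: "y \<in> carrier D" for y
  proof (rule finite_subset)
    show "{w \<in> Sigma I W. (case w of (i, w) \<Rightarrow> a i (\<pi> i y) w) \<noteq> \<zero>\<^bsub>R\<^esub>}
        \<subseteq> (SIGMA i:{i\<in>I. \<pi> i y \<noteq> \<zero>\<^bsub>T i\<^esub>}. {w\<in>W i. a i (\<pi> i y) w \<noteq> \<zero>\<^bsub>R\<^esub>})" (is "?S \<subseteq> ?S'")
    proof
      fix z assume "z \<in> ?S"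
      then obtain i w where z: "z = (i, w)" "i \<in> I" "w \<in> W i" "a i (\<pi> i y) w \<noteq> \<zero>\<^bsub>R\<^esub>" by auto
      then have "\<pi> i y \<noteq> \<zero>\<^bsub>T i\<^esub>" using az[OF z(2)] by auto
      then show "z \<in> ?S'" using z by simp
    qed
    have "finite {w\<in>W i. a i (\<pi> i y) w \<noteq> \<zero>\<^bsub>R\<^esub>}" if "i \<in> I" for i
      using ac[OF that y] by simp
    then show "finite ?S'" using fin_\<pi>[OF y] by (intro finite_SigmaI) simp_all
  qed
  have A: "A \<in> lmod_hom R D ?F"
    unfolding A_def
  proof (rule D.lmod_hom_restrictI)
    fix y assume y: "y \<in> carrier D"
    show "(\<lambda>(i, w)\<in>Sigma I W. a i (\<pi> i y) w) \<in> carrier ?F"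
      using fin[OF y] ac[OF _ y] by (auto simp: PiE_iff cong: conj_cong)
  next
    fix y z assume y: "y \<in> carrier D" "z \<in> carrier D"
    have "a i (\<pi> i (y \<oplus>\<^bsub>D\<^esub> z)) w = a i (\<pi> i y) w \<oplus>\<^bsub>R\<^esub> a i (\<pi> i z) w" if "i \<in> I" "w \<in> W i" for i w
      using that by (simp add: lmod_hom_add[OF \<pi>[OF that(1)] y] lmod_hom_add[OF a[OF that(1)] pc[OF that(1) y(1)] pc[OF that(1) y(2)]])
    then show "(\<lambda>(i, w)\<in>Sigma I W. a i (\<pi> i (y \<oplus>\<^bsub>D\<^esub> z)) w) =
        (\<lambda>(i, w)\<in>Sigma I W. a i (\<pi> i y) w) \<oplus>\<^bsub>?F\<^esub> (\<lambda>(i, w)\<in>Sigma I W. a i (\<pi> i z) w)"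
      by (simp add: fun_eq_iff)
  next
    fix r y assume r: "r \<in> carrier R" and y: "y \<in> carrier D"
    have "a i (\<pi> i (r \<odot>\<^bsub>D\<^esub> y)) w = r \<otimes>\<^bsub>R\<^esub> a i (\<pi> i y) w" if "i \<in> I" "w \<in> W i" for i w
      using that by (simp add: lmod_hom_smult[OF \<pi>[OF that(1)] r y] lmod_hom_smult[OF a[OF that(1)] r pc[OF that(1) y]])
    then show "(\<lambda>(i, w)\<in>Sigma I W. a i (\<pi> i (r \<odot>\<^bsub>D\<^esub> y)) w) =
        r \<odot>\<^bsub>?F\<^esub> (\<lambda>(i, w)\<in>Sigma I W. a i (\<pi> i y) w)"
      by (simp add: fun_eq_iff)
  qed
  \<comment> \<open>The block of \<open>i\<close> in a coordinate vector; following it by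
    \<open>p i\<close> and \<open>\<kappa> i\<close> and summing over \<open>i\<close> yields the
    retraction \<open>B\<close>.\<close>
  define s where "s i = (\<lambda>h\<in>carrier ?F. \<lambda>w\<in>W i. h (i, w))" for i
  have s: "s i \<in> lmod_hom R ?F (free_lmod R (W i))" if i: "i \<in> I" for i
    unfolding s_def
  proof (rule F.lmod_hom_restrictI)
    fix h assume h: "h \<in> carrier ?F"
    have "finite (Pair i ` {w \<in> W i. h (i, w) \<noteq> \<zero>\<^bsub>R\<^esub>})"
      by (rule finite_subset[of _ "{w \<in> Sigma I W. h w \<noteq> \<zero>\<^bsub>R\<^esub>}"]) (use h i in auto)
    then have "finite {w \<in> W i. h (i, w) \<noteq> \<zero>\<^bsub>R\<^esub>}" by (rule finite_imageD) (auto simp: inj_on_def)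
    then show "(\<lambda>w\<in>W i. h (i, w)) \<in> carrier (free_lmod R (W i))"
      using h i by (auto simp: PiE_iff cong: conj_cong)
  qed (use i in \<open>auto simp: fun_eq_iff\<close>)
  define \<psi> where "\<psi> i = compose (carrier ?F) (\<kappa> i) (compose (carrier ?F) (p i) (s i))" for i
  have \<psi>: "\<psi> i \<in> lmod_hom R ?F D" if i: "i \<in> I" for i
    unfolding \<psi>_def
    by (rule lmod_hom_compose[OF F.left_module_axioms
          lmod_hom_compose[OF F.left_module_axioms s[OF i] p[OF i]] \<kappa>[OF i]])
  have \<psi>_eq: "\<psi> i h = \<kappa> i (p i (s i h))" if "h \<in> carrier ?F" for h i
    using that by (simp only: \<psi>_def compose_def restrict_apply')
  define B where "B = (\<lambda>h\<in>carrier ?F. gfinsum D (\<lambda>i. \<psi> i h) I)"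
  have B: "B \<in> lmod_hom R ?F D"
    unfolding B_def
  proof (rule lmod_hom_gfinsumI[OF F.left_module_axioms Dd(1) \<psi>])
    fix h assume h: "h \<in> carrier ?F"
    have "\<psi> i h = \<zero>\<^bsub>D\<^esub>" if i: "i \<in> I" "i \<notin> fst ` {w \<in> Sigma I W. h w \<noteq> \<zero>\<^bsub>R\<^esub>}" for i
    proof -
      have "s i h = \<zero>\<^bsub>free_lmod R (W i)\<^esub>"
      proof -
        have "h (i, w) = \<zero>\<^bsub>R\<^esub>" if "w \<in> W i" for w
        proof (rule ccontr)
          assume "h (i, w) \<noteq> \<zero>\<^bsub>R\<^esub>"
          then have "(i, w) \<in> {w \<in> Sigma I W. h w \<noteq> \<zero>\<^bsub>R\<^esub>}" using i(1) that by simp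
          then have "fst (i, w) \<in> fst ` {w \<in> Sigma I W. h w \<noteq> \<zero>\<^bsub>R\<^esub>}" by (rule imageI)
          then show False using i(2) by simp
        qed
        then show ?thesis using h by (simp add: s_def fun_eq_iff del: free_lmod_simps(1))
      qed
      then show ?thesis
        using lmod_hom_zero[OF p[OF i(1)] Fi Td(1)[OF i(1)]] lmod_hom_zero[OF \<kappa>[OF i(1)] Td(1)[OF i(1)] Dd(1)]
        by (simp only: \<psi>_eq[OF h])
    qed
    then have sub: "{i \<in> I. \<psi> i h \<noteq> \<zero>\<^bsub>D\<^esub>} \<subseteq> fst ` {w \<in> Sigma I W. h w \<noteq> \<zero>\<^bsub>R\<^esub>}"
      by blast
    have "finite {w \<in> Sigma I W. h w \<noteq> \<zero>\<^bsub>R\<^esub>}" using h by simp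
    then show "finite {i \<in> I. \<psi> i h \<noteq> \<zero>\<^bsub>D\<^esub>}"
      by (rule finite_subset[OF sub finite_imageI])
  qed
  have BA: "B (A y) = y" if y: "y \<in> carrier D" for y
  proof -
    note Ay = lmod_hom_closed[OF A y]
    have "\<psi> i (A y) = \<kappa> i (\<pi> i y)" if i: "i \<in> I" for i
    proof -
      have "s i (A y) = (\<lambda>w\<in>W i. A y (i, w))" using Ay by (simp only: s_def restrict_apply')
      also have "\<dots> = a i (\<pi> i y)"
        using ac[OF i y] i y by (auto simp: A_def fun_eq_iff PiE_iff extensional_def)
      finally show ?thesis using \<psi>_eq[OF Ay] pa[OF i pc[OF i y]] by simp
    qed
    then have "gfinsum D (\<lambda>i. \<psi> i (A y)) I = gfinsum D (\<lambda>i. \<kappa> i (\<pi> i y)) I"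
      by (intro D.gfinsum_cong) (use pc[OF _ y] lmod_hom_closed[OF \<kappa>] in auto)
    then show ?thesis using \<kappa>\<pi>[OF y] Ay by (simp only: B_def restrict_apply')
  qed
  show ?thesis
    by (rule lmod_projective_reindex[OF Dd(1) A B BA inj_on_subset[OF j subset_UNIV]])
qed

lemma inj_prod_infinite:
  assumes "infinite (UNIV :: 'u set)"
  obtains j :: "'u \<times> 'u \<Rightarrow> 'u" where "inj j"
proof -
  have "|(UNIV :: 'u set) \<times> (UNIV :: 'u set)| \<le>o |UNIV :: 'u set|"
    using ordIso_imp_ordLeq[OF card_of_Times_same_infinite[OF assms]] by simp
  then show thesis using that by (auto simp flip: card_of_ordLeq)
qed

text \<open>An element of the direct sum is determined by its graph over its finite support. Such
  graphs are finite sets of pairs, hence finite subsets of \<open>'u\<close> after coding pairs, and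
  an infinite set has as many finite subsets as elements.\<close>

lemma dsum_embedding:
  fixes T :: "'u \<Rightarrow> ('r, 'u) dmodule"
  assumes inf: "infinite (UNIV :: 'u set)"
  obtains e :: "('u \<Rightarrow> 'u) \<Rightarrow> 'u" where "inj_on e (carrier (dsum I T))"
proof -
  obtain j :: "'u \<times> 'u \<Rightarrow> 'u" where j: "inj j" using inj_prod_infinite[OF inf] .
  have "Fpow (UNIV :: 'u set) \<approx> (UNIV :: 'u set)" by (rule eqpoll_Fpow[OF inf])
  then obtain k :: "'u set \<Rightarrow> 'u" where k: "inj_on k (Fpow UNIV)"
    by (auto simp: eqpoll_def bij_betw_def)
  \<comment> \<open>The coded graph over the support. Indices outside the support are recovered as
    those absent from the graph, where the value is zero.\<close>
  define G where "G f = (\<lambda>i. j (i, f i)) ` {i \<in> I. f i \<noteq> \<zero>\<^bsub>T i\<^esub>}" for f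
  have "inj_on G (carrier (dsum I T))"
  proof (rule inj_onI)
    fix f g assume f: "f \<in> carrier (dsum I T)" and g: "g \<in> carrier (dsum I T)" and eq: "G f = G g"
    have mem: "j (i, y) \<in> G h \<longleftrightarrow> i \<in> I \<and> h i = y \<and> y \<noteq> \<zero>\<^bsub>T i\<^esub>" for i y h
      using j by (auto simp: G_def inj_eq)
    have "f i = g i" if "i \<in> I" for i
      using mem[of i "f i" f] mem[of i "f i" g] mem[of i "g i" f] mem[of i "g i" g] eq that by metis
    then show "f = g" using f g by (auto simp: PiE_iff intro: extensionalityI)
  qed
  moreover have "inj_on k (G ` carrier (dsum I T))"
    by (rule inj_on_subset[OF k]) (auto simp: G_def Fpow_def)
  ultimately show thesis using that comp_inj_on by blast
qed

section \<open>The homotopy category\<close>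

abbreviation dmaps where "dmaps R M N \<equiv> carrier (diff_map_group R M N)"

lemma dmaps_iff:
  "f \<in> dmaps R M N \<longleftrightarrow> f \<in> lmod_hom R M N \<and> (\<forall>x\<in>carrier M. f (dif M x) = dif N (f x))"
  by (simp add: diff_map_group_def)

lemma diff_map_group_simps [simp]:
  "f \<otimes>\<^bsub>diff_map_group R M N\<^esub> g = (\<lambda>x\<in>carrier M. f x \<oplus>\<^bsub>N\<^esub> g x)"
  "\<one>\<^bsub>diff_map_group R M N\<^esub> = (\<lambda>x\<in>carrier M. \<zero>\<^bsub>N\<^esub>)"
  by (simp_all add: diff_map_group_def)

lemma dmapsD:
  assumes "f \<in> dmaps R M N"
  shows "f \<in> lmod_hom R M N" "x \<in> carrier M \<Longrightarrow> f (dif M x) = dif N (f x)"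
    "x \<in> carrier M \<Longrightarrow> f x \<in> carrier N"
  using assms lmod_hom_closed[of f R M N x] by (auto simp: dmaps_iff)

definition dhomotopy :: "('r, 'm) dmodule \<Rightarrow> ('r, 'n) dmodule \<Rightarrow> ('m \<Rightarrow> 'n) \<Rightarrow> 'm \<Rightarrow> 'n" where
  "dhomotopy M N r = (\<lambda>x\<in>carrier M. r (dif M x) \<oplus>\<^bsub>N\<^esub> dif N (r x))"

lemma null_homotopic_eq: "null_homotopic R M N = dhomotopy M N ` lmod_hom R M N"
  by (auto simp: null_homotopic_def dhomotopy_def)

locale diff_module_pair =
  fixes R :: "('r, 'q) ring_scheme" and M :: "('r, 'm) dmodule" and N :: "('r, 'n) dmodule"
  assumes M: "diff_module R M" and N: "diff_module R N"
begin

sublocale M: left_module R M by (rule diff_moduleD[OF M])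
sublocale N: left_module R N by (rule diff_moduleD[OF N])

lemmas Md = diff_moduleD[OF M] and Nd = diff_moduleD[OF N]

lemma dmaps_add:
  assumes "f \<in> dmaps R M N" "g \<in> dmaps R M N"
  shows "(\<lambda>x\<in>carrier M. f x \<oplus>\<^bsub>N\<^esub> g x) \<in> dmaps R M N"
  unfolding dmaps_iff using dmapsD[OF assms(1)] dmapsD[OF assms(2)]
  by (auto simp: lmod_hom_addI[OF Md(1) Nd(1)] Md(4) lmod_hom_add[OF Nd(2)])

lemma dmaps_neg:
  assumes "f \<in> dmaps R M N"
  shows "(\<lambda>x\<in>carrier M. \<ominus>\<^bsub>N\<^esub> f x) \<in> dmaps R M N"
  unfolding dmaps_iff using dmapsD[OF assms(1)]
  by (auto simp: lmod_hom_negI[OF Md(1) Nd(1)] Md(4) lmod_hom_minus[OF Nd(2) Nd(1) Nd(1)])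

lemma dmaps_zero: "(\<lambda>x\<in>carrier M. \<zero>\<^bsub>N\<^esub>) \<in> dmaps R M N"
  unfolding dmaps_iff
  by (auto simp: lmod_hom_zeroI[OF Md(1) Nd(1)] Md(4) lmod_hom_zero[OF Nd(2) Nd(1) Nd(1)])

lemma dmaps_comm_group: "comm_group (diff_map_group R M N)"
proof (rule comm_groupI)
  fix f assume f: "f \<in> dmaps R M N"
  note fD = dmapsD[OF f]
  show "\<one>\<^bsub>diff_map_group R M N\<^esub> \<otimes>\<^bsub>diff_map_group R M N\<^esub> f = f"
    by (rule extensionalityI[where A = "carrier M"])
       (use fD lmod_hom_extensional[OF fD(1)] in auto)
  show "\<exists>g\<in>dmaps R M N. g \<otimes>\<^bsub>diff_map_group R M N\<^esub> f = \<one>\<^bsub>diff_map_group R M N\<^esub>"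
    using dmaps_neg[OF f] fD(3) by (intro bexI) (auto simp: fun_eq_iff N.M.l_neg)
next
  fix f g h assume "f \<in> dmaps R M N" "g \<in> dmaps R M N" "h \<in> dmaps R M N"
  from this[THEN dmapsD(3)]
  show "f \<otimes>\<^bsub>diff_map_group R M N\<^esub> g \<otimes>\<^bsub>diff_map_group R M N\<^esub> h =
      f \<otimes>\<^bsub>diff_map_group R M N\<^esub> (g \<otimes>\<^bsub>diff_map_group R M N\<^esub> h)"
    by (simp add: fun_eq_iff N.M.a_assoc)
next
  fix f g assume fg: "f \<in> dmaps R M N" "g \<in> dmaps R M N"
  from this[THEN dmapsD(3)]
  show "f \<otimes>\<^bsub>diff_map_group R M N\<^esub> g = g \<otimes>\<^bsub>diff_map_group R M N\<^esub> f"
    by (simp add: fun_eq_iff N.M.a_comm)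
  show "f \<otimes>\<^bsub>diff_map_group R M N\<^esub> g \<in> dmaps R M N"
    using dmaps_add[OF fg] by simp
qed (use dmaps_zero in simp)

sublocale G: comm_group "diff_map_group R M N" by (rule dmaps_comm_group)

lemma inv_dmaps:
  assumes "f \<in> dmaps R M N"
  shows "inv\<^bsub>diff_map_group R M N\<^esub> f = (\<lambda>x\<in>carrier M. \<ominus>\<^bsub>N\<^esub> f x)"
  by (rule G.inv_equality) (use assms dmaps_neg dmapsD[OF assms] in \<open>auto simp: fun_eq_iff N.M.l_neg\<close>)

text \<open>Composing with the differential on either side leaves the single term
  \<open>dif N (r (dif M x))\<close>, because both differentials square to zero.\<close>

lemma dhomotopy_dmaps:
  assumes r: "r \<in> lmod_hom R M N"
  shows "dhomotopy M N r \<in> dmaps R M N"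
proof -
  note rc = lmod_hom_closed[OF r] and rz = lmod_hom_zero[OF r Md(1) Nd(1)]
    and dz = lmod_hom_zero[OF Nd(2) Nd(1) Nd(1)]
  have "(\<lambda>x\<in>carrier M. compose (carrier M) r (dif M) x \<oplus>\<^bsub>N\<^esub> compose (carrier M) (dif N) r x) \<in> lmod_hom R M N"
    by (rule lmod_hom_addI[OF Md(1) Nd(1) lmod_hom_compose[OF Md(1) Md(2) r] lmod_hom_compose[OF Md(1) r Nd(2)]])
  then have "dhomotopy M N r \<in> lmod_hom R M N"
    by (simp add: dhomotopy_def compose_def cong: restrict_cong)
  then show ?thesis
    by (simp add: dmaps_iff dhomotopy_def Md rc Nd rz dz lmod_hom_add[OF Nd(2)])
qed

lemma null_subgroup: "subgroup (null_homotopic R M N) (diff_map_group R M N)"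
proof (rule G.subgroupI)
  note dc = lmod_hom_closed[OF Nd(2)]
  show "null_homotopic R M N \<subseteq> dmaps R M N"
    using dhomotopy_dmaps by (auto simp: null_homotopic_eq)
  show "null_homotopic R M N \<noteq> {}"
    using lmod_hom_zeroI[OF Md(1) Nd(1)] by (auto simp: null_homotopic_eq)
  fix f assume "f \<in> null_homotopic R M N"
  then obtain r where r: "r \<in> lmod_hom R M N" "f = dhomotopy M N r" by (auto simp: null_homotopic_eq)
  note rc = lmod_hom_closed[OF r(1)]
  have "inv\<^bsub>diff_map_group R M N\<^esub> f = dhomotopy M N (\<lambda>x\<in>carrier M. \<ominus>\<^bsub>N\<^esub> r x)"
    unfolding r(2) inv_dmaps[OF dhomotopy_dmaps[OF r(1)]]
    by (auto simp: dhomotopy_def fun_eq_iff Md rc Nd N.M.minus_add lmod_hom_minus[OF Nd(2) Nd(1) Nd(1)])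
  then show "inv\<^bsub>diff_map_group R M N\<^esub> f \<in> null_homotopic R M N"
    using lmod_hom_negI[OF Md(1) Nd(1) r(1)] by (auto simp: null_homotopic_eq)
  fix g assume "g \<in> null_homotopic R M N"
  then obtain s where s: "s \<in> lmod_hom R M N" "g = dhomotopy M N s" by (auto simp: null_homotopic_eq)
  note sc = lmod_hom_closed[OF s(1)]
  have "f \<otimes>\<^bsub>diff_map_group R M N\<^esub> g = dhomotopy M N (\<lambda>x\<in>carrier M. r x \<oplus>\<^bsub>N\<^esub> s x)"
    unfolding r(2) s(2)
    by (auto simp: dhomotopy_def fun_eq_iff Md rc sc Nd lmod_hom_add[OF Nd(2)] N.M.a_ac)
  then show "f \<otimes>\<^bsub>diff_map_group R M N\<^esub> g \<in> null_homotopic R M N"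
    using lmod_hom_addI[OF Md(1) Nd(1) r(1) s(1)] by (auto simp: null_homotopic_eq)
qed

end

section \<open>Groups of homotopy classes and their composition\<close>

definition hclass :: "('r, 'q) ring_scheme \<Rightarrow> ('r, 'm) dmodule \<Rightarrow> ('r, 'n) dmodule \<Rightarrow>
    ('m \<Rightarrow> 'n) \<Rightarrow> ('m \<Rightarrow> 'n) set" where
  "hclass R M N f = null_homotopic R M N #>\<^bsub>diff_map_group R M N\<^esub> f"

abbreviation hgroup where "hgroup R M N \<equiv> diff_map_group R M N Mod null_homotopic R M N"

context diff_module_pair
begin

lemma hgroup_comm_group: "comm_group (hgroup R M N)"
  by (rule G.abelian_FactGroup[OF null_subgroup])

lemma carrier_hgroup: "carrier (hgroup R M N) = hclass R M N ` dmaps R M N"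
  by (simp add: carrier_FactGroup hclass_def)

lemma mem_hclass:
  assumes "g \<in> dmaps R M N"
  shows "f \<in> hclass R M N g \<longleftrightarrow>
    (\<exists>r\<in>lmod_hom R M N. f = (\<lambda>x\<in>carrier M. dhomotopy M N r x \<oplus>\<^bsub>N\<^esub> g x))"
  by (auto simp: hclass_def r_coset_def null_homotopic_eq)

lemma hclass_eq:
  assumes f: "f \<in> dmaps R M N" and g: "g \<in> dmaps R M N"
  shows "hclass R M N f = hclass R M N g \<longleftrightarrow>
    (\<exists>r\<in>lmod_hom R M N. f = (\<lambda>x\<in>carrier M. dhomotopy M N r x \<oplus>\<^bsub>N\<^esub> g x))"
proof -
  have "hclass R M N f = hclass R M N g \<longleftrightarrow> f \<in> hclass R M N g"
    unfolding hclass_def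
    using G.repr_independence[OF _ g null_subgroup] G.rcos_self[OF f null_subgroup] by auto
  then show ?thesis using mem_hclass[OF g] by simp
qed

lemma hclass_eqI:
  assumes f: "f \<in> dmaps R M N" and g: "g \<in> dmaps R M N" and r: "r \<in> lmod_hom R M N"
    and eq: "\<And>x. x \<in> carrier M \<Longrightarrow> f x = r (dif M x) \<oplus>\<^bsub>N\<^esub> dif N (r x) \<oplus>\<^bsub>N\<^esub> g x"
  shows "hclass R M N f = hclass R M N g"
  unfolding hclass_eq[OF f g]
proof (rule bexI[OF _ r])
  show "f = (\<lambda>x\<in>carrier M. dhomotopy M N r x \<oplus>\<^bsub>N\<^esub> g x)"
    by (rule extensionalityI[OF lmod_hom_extensional[OF dmapsD(1)[OF f]] restrict_extensional])
       (simp add: eq dhomotopy_def)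
qed

lemma hclass_eqE:
  assumes f: "f \<in> dmaps R M N" and g: "g \<in> dmaps R M N" and eq: "hclass R M N f = hclass R M N g"
  obtains r where "r \<in> lmod_hom R M N"
    "\<And>x. x \<in> carrier M \<Longrightarrow> f x = r (dif M x) \<oplus>\<^bsub>N\<^esub> dif N (r x) \<oplus>\<^bsub>N\<^esub> g x"
  using eq that unfolding hclass_eq[OF f g] by (auto simp: dhomotopy_def)

lemma hclass_mult:
  assumes "f \<in> dmaps R M N" "g \<in> dmaps R M N"
  shows "hclass R M N f \<otimes>\<^bsub>hgroup R M N\<^esub> hclass R M N g = hclass R M N (\<lambda>x\<in>carrier M. f x \<oplus>\<^bsub>N\<^esub> g x)"
  using normal.rcos_sum[OF G.normal_iff_subgroup[THEN iffD2, OF null_subgroup] assms]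
  by (simp add: hclass_def)

lemma hclass_null: "f \<in> null_homotopic R M N \<Longrightarrow> hclass R M N f = \<one>\<^bsub>hgroup R M N\<^esub>"
  using subgroup.rcos_const[OF null_subgroup G.is_group] by (simp add: hclass_def)

lemma hclass_zero: "hclass R M N (\<lambda>x\<in>carrier M. \<zero>\<^bsub>N\<^esub>) = \<one>\<^bsub>hgroup R M N\<^esub>"
  by (rule hclass_null) (use subgroup.one_closed[OF null_subgroup] in simp)

lemma hclass_one_iff:
  assumes f: "f \<in> dmaps R M N"
  shows "hclass R M N f = \<one>\<^bsub>hgroup R M N\<^esub> \<longleftrightarrow> f \<in> null_homotopic R M N"
  using hclass_null G.rcos_self[OF f null_subgroup] by (auto simp: hclass_def)

text \<open>Translates the vanishing of a Hom group, as it appears in the definition of a compact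
  generator, into a property of actual maps.\<close>

lemma hgroup_trivial_iff:
  "carrier (hgroup R M N) = {\<one>\<^bsub>hgroup R M N\<^esub>} \<longleftrightarrow> dmaps R M N \<subseteq> null_homotopic R M N"
proof
  assume "carrier (hgroup R M N) = {\<one>\<^bsub>hgroup R M N\<^esub>}"
  then show "dmaps R M N \<subseteq> null_homotopic R M N"
    using hclass_one_iff unfolding carrier_hgroup by (metis image_eqI singletonD subsetI)
next
  assume s: "dmaps R M N \<subseteq> null_homotopic R M N"
  then have "hclass R M N f = \<one>\<^bsub>hgroup R M N\<^esub>" if "f \<in> dmaps R M N" for f
    using that hclass_null by blast
  then show "carrier (hgroup R M N) = {\<one>\<^bsub>hgroup R M N\<^esub>}"
    unfolding carrier_hgroup using dmaps_zero by (auto simp del: one_FactGroup)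
qed

end

lemma dmaps_compose:
  assumes M: "diff_module R M" and f: "f \<in> dmaps R M N" and g: "g \<in> dmaps R N P"
  shows "compose (carrier M) g f \<in> dmaps R M P"
  unfolding dmaps_iff
  using lmod_hom_compose[OF diff_moduleD(1)[OF M] dmapsD(1)[OF f] dmapsD(1)[OF g]]
    dmapsD(2,3)[OF f] dmapsD(2)[OF g] diff_moduleD(4)[OF M]
  by (simp add: compose_def)

lemma dmaps_id: "diff_module R M \<Longrightarrow> (\<lambda>x\<in>carrier M. x) \<in> dmaps R M M"
  using lmod_hom_idI[OF diff_moduleD(1)] by (simp add: dmaps_iff diff_moduleD(4)[of R])

text \<open>A homotopy between the composites is \<open>s f' + g r\<close>. Using the new map
  \<open>f'\<close> in one summand and the old map \<open>g\<close> in the other absorbs the cross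
  terms.\<close>

lemma homotopic_compose:
  assumes M: "diff_module R M" and N: "diff_module R N" and P: "diff_module R P"
    and f: "f \<in> dmaps R M N" and f': "f' \<in> hclass R M N f"
    and g: "g \<in> dmaps R N P" and g': "g' \<in> hclass R N P g"
  shows "hclass R M P (compose (carrier M) g' f') = hclass R M P (compose (carrier M) g f)"
proof -
  interpret MN: diff_module_pair R M N by unfold_locales (fact M N)+
  interpret NP: diff_module_pair R N P by unfold_locales (fact N P)+
  interpret MP: diff_module_pair R M P by unfold_locales (fact M P)+
  note fD = dmapsD[OF f] and gD = dmapsD[OF g]
  from f' obtain r where r: "r \<in> lmod_hom R M N"
    and f'_eq: "f' = (\<lambda>x\<in>carrier M. dhomotopy M N r x \<oplus>\<^bsub>N\<^esub> f x)"
    unfolding MN.mem_hclass[OF f] by blast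
  from g' obtain s where s: "s \<in> lmod_hom R N P"
    and g'_eq: "g' = (\<lambda>x\<in>carrier N. dhomotopy N P s x \<oplus>\<^bsub>P\<^esub> g x)"
    unfolding NP.mem_hclass[OF g] by blast
  note rc = lmod_hom_closed[OF r] and sc = lmod_hom_closed[OF s]
  have f'd: "f' \<in> dmaps R M N"
    unfolding f'_eq by (rule MN.dmaps_add[OF MN.dhomotopy_dmaps[OF r] f])
  have g'd: "g' \<in> dmaps R N P"
    unfolding g'_eq by (rule NP.dmaps_add[OF NP.dhomotopy_dmaps[OF s] g])
  define t where "t = (\<lambda>x\<in>carrier M. compose (carrier M) s f' x \<oplus>\<^bsub>P\<^esub> compose (carrier M) g r x)"
  have t: "t \<in> lmod_hom R M P"
    unfolding t_def
    by (rule lmod_hom_addI[OF MP.Md(1) MP.Nd(1) lmod_hom_compose[OF MP.Md(1) dmapsD(1)[OF f'd] s]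
          lmod_hom_compose[OF MP.Md(1) r gD(1)]])
  show ?thesis
  proof (rule MP.hclass_eqI[OF dmaps_compose[OF M f'd g'd] dmaps_compose[OF M f g] t])
    fix x assume x: "x \<in> carrier M"
    note f'x = dmapsD(3)[OF f'd x]
    note cl = x f'x MP.Md(4) MP.Nd(4) MN.Nd(4) rc sc gD(3) fD(3)
    have "compose (carrier M) g' f' x = s (dif N (f' x)) \<oplus>\<^bsub>P\<^esub> dif P (s (f' x)) \<oplus>\<^bsub>P\<^esub> g (f' x)"
      using cl by (simp add: g'_eq compose_def dhomotopy_def)
    also have "g (f' x) = g (r (dif M x)) \<oplus>\<^bsub>P\<^esub> dif P (g (r x)) \<oplus>\<^bsub>P\<^esub> g (f x)"
      using cl by (simp add: f'_eq dhomotopy_def lmod_hom_add[OF gD(1)] gD(2))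
    also have "dif N (f' x) = f' (dif M x)" using dmapsD(2)[OF f'd x] by simp
    finally show "compose (carrier M) g' f' x =
        t (dif M x) \<oplus>\<^bsub>P\<^esub> dif P (t x) \<oplus>\<^bsub>P\<^esub> compose (carrier M) g f x"
      using cl dmapsD(3)[OF f'd]
      by (simp add: t_def compose_def lmod_hom_add[OF MP.Nd(2)] NP.N.M.a_ac)
  qed
qed

lemma K_simps:
  "M \<in> Obj (homotopy_diff_proj R) \<longleftrightarrow> diff_module R M \<and> lmod_projective R M"
  "Hom (homotopy_diff_proj R) M N = hgroup R M N"
  "Ident (homotopy_diff_proj R) M = hclass R M M (\<lambda>x\<in>carrier M. x)"
  "Shift (homotopy_diff_proj R) M = M\<lparr>dif := (\<lambda>x\<in>carrier M. \<ominus>\<^bsub>M\<^esub> dif M x)\<rparr>"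
  by (simp_all add: homotopy_diff_proj_def hclass_def)

text \<open>\<open>Comp\<close> is a union over all pairs of representatives. By the independence
  just shown every member of this union is the same coset, and the union is nonempty.\<close>

lemma Comp_hclass:
  assumes M: "diff_module R M" and N: "diff_module R N" and P: "diff_module R P"
    and f: "f \<in> dmaps R M N" and g: "g \<in> dmaps R N P"
  shows "Comp (homotopy_diff_proj R) M N P (hclass R N P g) (hclass R M N f)
    = hclass R M P (compose (carrier M) g f)"
proof -
  interpret MN: diff_module_pair R M N by unfold_locales (fact M N)+
  interpret NP: diff_module_pair R N P by unfold_locales (fact N P)+
  have "Comp (homotopy_diff_proj R) M N P (hclass R N P g) (hclass R M N f)
      = (\<Union>g'\<in>hclass R N P g. \<Union>f'\<in>hclass R M N f. hclass R M P (compose (carrier M) g' f'))"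
    by (simp add: homotopy_diff_proj_def hclass_def)
  also have "\<dots> = (\<Union>g'\<in>hclass R N P g. \<Union>f'\<in>hclass R M N f. hclass R M P (compose (carrier M) g f))"
    using homotopic_compose[OF M N P f _ g] by (intro SUP_cong refl)
  also have "f \<in> hclass R M N f" "g \<in> hclass R N P g"
    unfolding hclass_def by (rule MN.G.rcos_self[OF f MN.null_subgroup], rule NP.G.rcos_self[OF g NP.null_subgroup])
  then have "(\<Union>g'\<in>hclass R N P g. \<Union>f'\<in>hclass R M N f. hclass R M P (compose (carrier M) g f))
      = hclass R M P (compose (carrier M) g f)" by auto
  finally show ?thesis .
qed

lemma Comp_hom:
  assumes M: "diff_module R M" and N: "diff_module R N" and P: "diff_module R P"
    and G: "G \<in> carrier (hgroup R N P)"
  shows "Comp (homotopy_diff_proj R) M N P G \<in> hom (hgroup R M N) (hgroup R M P)"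
proof -
  interpret MN: diff_module_pair R M N by unfold_locales (fact M N)+
  interpret NP: diff_module_pair R N P by unfold_locales (fact N P)+
  interpret MP: diff_module_pair R M P by unfold_locales (fact M P)+
  obtain g where g: "g \<in> dmaps R N P" "G = hclass R N P g" using G NP.carrier_hgroup by auto
  note C = Comp_hclass[OF M N P _ g(1), folded g(2)]
  show ?thesis
  proof (rule homI)
    fix F assume "F \<in> carrier (hgroup R M N)"
    then show "Comp (homotopy_diff_proj R) M N P G F \<in> carrier (hgroup R M P)"
      using C dmaps_compose[OF M _ g(1)] unfolding MN.carrier_hgroup MP.carrier_hgroup by auto
  next
    fix F F' assume "F \<in> carrier (hgroup R M N)" "F' \<in> carrier (hgroup R M N)"
    then obtain f f' where f: "f \<in> dmaps R M N" "F = hclass R M N f"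
      and f': "f' \<in> dmaps R M N" "F' = hclass R M N f'"
      unfolding MN.carrier_hgroup by auto
    have "compose (carrier M) g (\<lambda>x\<in>carrier M. f x \<oplus>\<^bsub>N\<^esub> f' x)
        = (\<lambda>x\<in>carrier M. compose (carrier M) g f x \<oplus>\<^bsub>P\<^esub> compose (carrier M) g f' x)"
      using lmod_hom_add[OF dmapsD(1)[OF g(1)]] dmapsD(3)[OF f(1)] dmapsD(3)[OF f'(1)]
      by (auto simp: compose_def fun_eq_iff)
    then show "Comp (homotopy_diff_proj R) M N P G (F \<otimes>\<^bsub>hgroup R M N\<^esub> F') =
        Comp (homotopy_diff_proj R) M N P G F \<otimes>\<^bsub>hgroup R M P\<^esub> Comp (homotopy_diff_proj R) M N P G F'"
      unfolding f(2) f'(2) MN.hclass_mult[OF f(1) f'(1)] C[OF f(1)] C[OF f'(1)] C[OF MN.dmaps_add[OF f(1) f'(1)]]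
        MP.hclass_mult[OF dmaps_compose[OF M f(1) g(1)] dmaps_compose[OF M f'(1) g(1)]]
      by simp
  qed
qed

lemma Comp_closed:
  assumes "diff_module R M" "diff_module R N" "diff_module R P"
    and "G \<in> carrier (hgroup R N P)" "F \<in> carrier (hgroup R M N)"
  shows "Comp (homotopy_diff_proj R) M N P G F \<in> carrier (hgroup R M P)"
  using Comp_hom[OF assms(1-4)] assms(5) by (auto simp: hom_def)

lemma Comp_one_left:
  assumes M: "diff_module R M" and N: "diff_module R N" and P: "diff_module R P"
    and F: "F \<in> carrier (hgroup R M N)"
  shows "Comp (homotopy_diff_proj R) M N P \<one>\<^bsub>hgroup R N P\<^esub> F = \<one>\<^bsub>hgroup R M P\<^esub>"
proof -
  interpret MN: diff_module_pair R M N by unfold_locales (fact M N)+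
  interpret NP: diff_module_pair R N P by unfold_locales (fact N P)+
  interpret MP: diff_module_pair R M P by unfold_locales (fact M P)+
  obtain f where f: "f \<in> dmaps R M N" "F = hclass R M N f" using F MN.carrier_hgroup by auto
  have "compose (carrier M) (\<lambda>x\<in>carrier N. \<zero>\<^bsub>P\<^esub>) f = (\<lambda>x\<in>carrier M. \<zero>\<^bsub>P\<^esub>)"
    using dmapsD(3)[OF f(1)] by (auto simp: compose_def fun_eq_iff)
  then show ?thesis
    unfolding NP.hclass_zero[symmetric] f(2) Comp_hclass[OF M N P f(1) NP.dmaps_zero]
    by (simp add: MP.hclass_zero del: one_FactGroup)
qed

lemma Comp_one_right:
  assumes M: "diff_module R M" and N: "diff_module R N" and P: "diff_module R P"
    and G: "G \<in> carrier (hgroup R N P)"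
  shows "Comp (homotopy_diff_proj R) M N P G \<one>\<^bsub>hgroup R M N\<^esub> = \<one>\<^bsub>hgroup R M P\<^esub>"
  using hom_one[OF Comp_hom[OF assms]]
    comm_group.axioms(2)[OF diff_module_pair.hgroup_comm_group[OF diff_module_pair.intro[OF M N]]]
    comm_group.axioms(2)[OF diff_module_pair.hgroup_comm_group[OF diff_module_pair.intro[OF M P]]]
  by blast

lemma Comp_assoc:
  assumes M: "diff_module R M" and N: "diff_module R N" and P: "diff_module R P" and Z: "diff_module R Z"
    and F: "F \<in> carrier (hgroup R M N)" and G: "G \<in> carrier (hgroup R N P)" and H: "H \<in> carrier (hgroup R P Z)"
  shows "Comp (homotopy_diff_proj R) M P Z H (Comp (homotopy_diff_proj R) M N P G F)
    = Comp (homotopy_diff_proj R) M N Z (Comp (homotopy_diff_proj R) N P Z H G) F"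
proof -
  obtain f where f: "f \<in> dmaps R M N" "F = hclass R M N f"
    using F diff_module_pair.carrier_hgroup[OF diff_module_pair.intro[OF M N]] by auto
  obtain g where g: "g \<in> dmaps R N P" "G = hclass R N P g"
    using G diff_module_pair.carrier_hgroup[OF diff_module_pair.intro[OF N P]] by auto
  obtain h where h: "h \<in> dmaps R P Z" "H = hclass R P Z h"
    using H diff_module_pair.carrier_hgroup[OF diff_module_pair.intro[OF P Z]] by auto
  have "f \<in> carrier M \<rightarrow> carrier N" using dmapsD(3)[OF f(1)] by auto
  then show ?thesis
    using dmaps_compose[OF M f(1) g(1)] dmaps_compose[OF N g(1) h(1)]
    by (simp add: f g h Comp_hclass[OF M N P] Comp_hclass[OF N P Z] Comp_hclass[OF M P Z]
        Comp_hclass[OF M N Z] compose_assoc)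
qed

lemma Ident_closed: "diff_module R M \<Longrightarrow> hclass R M M (\<lambda>x\<in>carrier M. x) \<in> carrier (hgroup R M M)"
  using diff_module_pair.carrier_hgroup[OF diff_module_pair.intro] dmaps_id by blast

lemma Comp_Ident_left:
  assumes M: "diff_module R M" and N: "diff_module R N" and F: "F \<in> carrier (hgroup R M N)"
  shows "Comp (homotopy_diff_proj R) M N N (hclass R N N (\<lambda>x\<in>carrier N. x)) F = F"
proof -
  obtain f where f: "f \<in> dmaps R M N" "F = hclass R M N f"
    using F diff_module_pair.carrier_hgroup[OF diff_module_pair.intro[OF M N]] by auto
  have "compose (carrier M) (\<lambda>x\<in>carrier N. x) f = f"
    using dmapsD(3)[OF f(1)] lmod_hom_extensional[OF dmapsD(1)[OF f(1)]]
    by (intro extensionalityI[where A = "carrier M"]) (auto simp: compose_def)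
  then show ?thesis using Comp_hclass[OF M N N f(1) dmaps_id[OF N]] f by simp
qed

lemma Comp_Ident_right:
  assumes M: "diff_module R M" and N: "diff_module R N" and F: "F \<in> carrier (hgroup R M N)"
  shows "Comp (homotopy_diff_proj R) M M N F (hclass R M M (\<lambda>x\<in>carrier M. x)) = F"
proof -
  obtain f where f: "f \<in> dmaps R M N" "F = hclass R M N f"
    using F diff_module_pair.carrier_hgroup[OF diff_module_pair.intro[OF M N]] by auto
  have "compose (carrier M) f (\<lambda>x\<in>carrier M. x) = f"
    using lmod_hom_extensional[OF dmapsD(1)[OF f(1)]]
    by (intro extensionalityI[where A = "carrier M"]) (auto simp: compose_def)
  then show ?thesis using Comp_hclass[OF M M N dmaps_id[OF M] f(1)] f by simp
qed

text \<open>A contraction makes the class of the identity neutral, and every class into or out of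
  \<open>T\<close> is its own composite with that identity.\<close>

lemma contractible_zero_object:
  fixes T :: "('r, 'u) dmodule"
  assumes T: "T \<in> Obj (homotopy_diff_proj R)" and c: "(\<lambda>x\<in>carrier T. x) \<in> null_homotopic R T T"
  shows "zero_object (homotopy_diff_proj R) T" "cat_isomorphic (homotopy_diff_proj R) T T"
proof -
  have Td: "diff_module R T" using T by (simp add: K_simps)
  interpret TT: diff_module_pair R T T by unfold_locales (fact Td)+
  note i = TT.hclass_null[OF c]
  show "zero_object (homotopy_diff_proj R) T"
    unfolding zero_object_def K_simps(2)
  proof (intro conjI ballI T)
    fix W :: "('r, 'u) dmodule" assume "W \<in> Obj (homotopy_diff_proj R)"
    then have W: "diff_module R W" by (simp add: K_simps)
    interpret WT: diff_module_pair R W T by unfold_locales (fact W Td)+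
    interpret TW: diff_module_pair R T W by unfold_locales (fact W Td)+
    have "F = \<one>\<^bsub>hgroup R W T\<^esub>" if "F \<in> carrier (hgroup R W T)" for F
      using Comp_Ident_left[OF W Td that] Comp_one_left[OF W Td Td that] unfolding i by simp
    then show "carrier (hgroup R W T) = {\<one>\<^bsub>hgroup R W T\<^esub>}"
      using monoid.one_closed[OF comm_monoid.axioms(1)[OF comm_group.axioms(1)[OF WT.hgroup_comm_group]]] by blast
    have "F = \<one>\<^bsub>hgroup R T W\<^esub>" if "F \<in> carrier (hgroup R T W)" for F
      using Comp_Ident_right[OF Td W that] Comp_one_right[OF Td Td W that] unfolding i by simp
    then show "carrier (hgroup R T W) = {\<one>\<^bsub>hgroup R T W\<^esub>}"
      using monoid.one_closed[OF comm_monoid.axioms(1)[OF comm_group.axioms(1)[OF TW.hgroup_comm_group]]] by blast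
  qed
  show "cat_isomorphic (homotopy_diff_proj R) T T"
    unfolding cat_isomorphic_def K_simps
    using Comp_Ident_left[OF Td Td Ident_closed[OF Td]] Ident_closed[OF Td] by blast
qed

section \<open>Coproducts in the homotopy category\<close>

context dmod_sum
begin

lemmas Dd = diff_moduleD[OF D] and Td = diff_moduleD[OF T]

lemma \<kappa>_dmaps: "i \<in> I \<Longrightarrow> \<kappa> i \<in> dmaps R (T i) D"
  and \<pi>_dmaps: "i \<in> I \<Longrightarrow> \<pi> i \<in> dmaps R D (T i)"
  by (auto simp: dmaps_iff \<kappa> \<pi> \<kappa>_dif \<pi>_dif)

lemma \<kappa>_closed: "i \<in> I \<Longrightarrow> x \<in> carrier (T i) \<Longrightarrow> \<kappa> i x \<in> carrier D"
  and \<pi>_closed: "i \<in> I \<Longrightarrow> y \<in> carrier D \<Longrightarrow> \<pi> i y \<in> carrier (T i)"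
  using lmod_hom_closed[OF \<kappa>] lmod_hom_closed[OF \<pi>] by blast+

lemma hom_ext:
  assumes W: "left_module R W" and a: "a \<in> lmod_hom R D W" and b: "b \<in> lmod_hom R D W"
    and eq: "\<And>i x. i \<in> I \<Longrightarrow> x \<in> carrier (T i) \<Longrightarrow> a (\<kappa> i x) = b (\<kappa> i x)"
  shows "a = b"
proof (rule lmod_hom_eqI[OF a b])
  fix y assume y: "y \<in> carrier D"
  have c: "(\<lambda>i. \<kappa> i (\<pi> i y)) \<in> I \<rightarrow> carrier D" using \<kappa>_closed \<pi>_closed y by auto
  have "\<kappa> i (\<pi> i y) = \<zero>\<^bsub>D\<^esub>" if "i \<in> I" "\<pi> i y = \<zero>\<^bsub>T i\<^esub>" for i
    unfolding that(2) by (rule lmod_hom_zero[OF \<kappa>[OF that(1)] Td(1)[OF that(1)] Dd(1)])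
  then have "{i \<in> I. \<kappa> i (\<pi> i y) \<noteq> \<zero>\<^bsub>D\<^esub>} \<subseteq> {i \<in> I. \<pi> i y \<noteq> \<zero>\<^bsub>T i\<^esub>}" by blast
  then have fin: "finite {i \<in> I. \<kappa> i (\<pi> i y) \<noteq> \<zero>\<^bsub>D\<^esub>}" by (rule finite_subset[OF _ fin_\<pi>[OF y]])
  have "a y = gfinsum W (\<lambda>i. a (\<kappa> i (\<pi> i y))) I"
    using lmod_hom_gfinsum[OF a Dd(1) W c fin] \<kappa>\<pi>[OF y] by simp
  also have "\<dots> = gfinsum W (\<lambda>i. b (\<kappa> i (\<pi> i y))) I"
    by (rule left_module.gfinsum_cong[OF W])
       (use eq \<pi>_closed y \<kappa>_closed lmod_hom_closed[OF b] in auto)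
  also have "\<dots> = b y"
    using lmod_hom_gfinsum[OF b Dd(1) W c fin] \<kappa>\<pi>[OF y] by simp
  finally show "a y = b y" .
qed

text \<open>The map sends \<open>y\<close> to the sum of the \<open>g i (\<pi> i y)\<close>, which
  is finite because \<open>y\<close> has finitely many nonzero projections. Compatibility with
  differentials is left out on purpose: the lemma glues homotopies as well as differential
  maps.\<close>

lemma hom_exists:
  assumes W: "left_module R W" and g: "\<And>i. i \<in> I \<Longrightarrow> g i \<in> lmod_hom R (T i) W"
  obtains h where "h \<in> lmod_hom R D W" "\<And>i x. i \<in> I \<Longrightarrow> x \<in> carrier (T i) \<Longrightarrow> h (\<kappa> i x) = g i x"
proof -
  interpret W: left_module R W by fact
  have gz: "g i \<zero>\<^bsub>T i\<^esub> = \<zero>\<^bsub>W\<^esub>" if "i \<in> I" for i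
    by (rule lmod_hom_zero[OF g[OF that] Td(1)[OF that] W])
  define h where "h = (\<lambda>y\<in>carrier D. gfinsum W (\<lambda>i. compose (carrier D) (g i) (\<pi> i) y) I)"
  have "h \<in> lmod_hom R D W"
    unfolding h_def
  proof (rule lmod_hom_gfinsumI[OF Dd(1) W])
    fix i assume "i \<in> I"
    then show "compose (carrier D) (g i) (\<pi> i) \<in> lmod_hom R D W"
      by (intro lmod_hom_compose[OF Dd(1) \<pi> g])
  next
    fix y assume y: "y \<in> carrier D"
    show "finite {i \<in> I. compose (carrier D) (g i) (\<pi> i) y \<noteq> \<zero>\<^bsub>W\<^esub>}"
      by (rule finite_subset[OF _ fin_\<pi>[OF y]]) (use y gz in \<open>auto simp: compose_def\<close>)
  qed
  moreover have "h (\<kappa> i x) = g i x" if i: "i \<in> I" and x: "x \<in> carrier (T i)" for i x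
  proof -
    have *: "compose (carrier D) (g j) (\<pi> j) (\<kappa> i x) = (if j = i then g i x else \<zero>\<^bsub>W\<^esub>)" if "j \<in> I" for j
      using \<kappa>_closed[OF i x] \<pi>\<kappa>[OF i that x] gz[OF that] by (auto simp: compose_def)
    have "h (\<kappa> i x) = gfinsum W (\<lambda>j. compose (carrier D) (g j) (\<pi> j) (\<kappa> i x)) I"
      using \<kappa>_closed[OF i x] by (simp add: h_def)
    also have "\<dots> = compose (carrier D) (g i) (\<pi> i) (\<kappa> i x)"
      by (rule W.gfinsum_single[OF i]) (use * lmod_hom_closed[OF g[OF i] x] in auto)
    finally show ?thesis using *[OF i] by simp
  qed
  ultimately show thesis by (rule that)
qed

lemma dmaps_sum_map:
  assumes W: "diff_module R W" and g: "\<And>i. i \<in> I \<Longrightarrow> g i \<in> dmaps R (T i) W"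
    and h: "h \<in> lmod_hom R D W" "\<And>i x. i \<in> I \<Longrightarrow> x \<in> carrier (T i) \<Longrightarrow> h (\<kappa> i x) = g i x"
  shows "h \<in> dmaps R D W"
proof -
  note Wd = diff_moduleD[OF W]
  have "compose (carrier D) h (dif D) = compose (carrier D) (dif W) h"
    by (rule hom_ext[OF Wd(1) lmod_hom_compose[OF Dd(1) Dd(2) h(1)] lmod_hom_compose[OF Dd(1) h(1) Wd(2)]])
       (simp add: compose_def \<kappa>_closed flip: \<kappa>_dif, simp add: h(2) Td(4) dmapsD(2)[OF g])
  then show ?thesis
    using h(1) unfolding dmaps_iff compose_def by (metis (no_types, lifting) restrict_apply')
qed

end

text \<open>Existence is the universal property of the module direct sum. Uniqueness up to homotopy
  needs that the homotopies chosen on the summands glue to one on the sum, and this is the same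
  universal property, as homotopies are just module maps.\<close>

lemma dmod_sum_is_coproduct:
  fixes T :: "'i \<Rightarrow> ('r, 'u) dmodule" and D :: "('r, 'u) dmodule"
  assumes "dmod_sum R I T D \<kappa> \<pi>" and D: "D \<in> Obj (homotopy_diff_proj R)"
  shows "is_coproduct (homotopy_diff_proj R) I T D (\<lambda>i. hclass R (T i) D (\<kappa> i))"
  unfolding is_coproduct_def K_simps(2)
proof (intro conjI ballI allI impI D)
  interpret dmod_sum R I T D \<kappa> \<pi> by fact
  have TD: "diff_module_pair R (T i) D" if "i \<in> I" for i
    using T[OF that] Dd by unfold_locales (auto simp: D)
  show "hclass R (T i) D (\<kappa> i) \<in> carrier (hgroup R (T i) D)" if "i \<in> I" for i
    unfolding diff_module_pair.carrier_hgroup[OF TD[OF that]] by (rule imageI[OF \<kappa>_dmaps[OF that]])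
  fix W :: "('r, 'u) dmodule" and F assume "W \<in> Obj (homotopy_diff_proj R)" and F: "\<forall>i\<in>I. F i \<in> carrier (hgroup R (T i) W)"
  then have W: "diff_module R W" by (simp add: K_simps)
  note Wd = diff_moduleD[OF W]
  interpret DW: diff_module_pair R D W by unfold_locales (fact D W)+
  have TW: "diff_module_pair R (T i) W" if "i \<in> I" for i
    by unfold_locales (fact T[OF that] W)+
  have "\<forall>i\<in>I. \<exists>g. g \<in> dmaps R (T i) W \<and> F i = hclass R (T i) W g"
    using F diff_module_pair.carrier_hgroup[OF TW] by blast
  from bchoice[OF this] obtain g where g: "\<And>i. i \<in> I \<Longrightarrow> g i \<in> dmaps R (T i) W"
    and Fg: "\<And>i. i \<in> I \<Longrightarrow> F i = hclass R (T i) W (g i)" by blast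
  obtain h where h: "h \<in> lmod_hom R D W" "\<And>i x. i \<in> I \<Longrightarrow> x \<in> carrier (T i) \<Longrightarrow> h (\<kappa> i x) = g i x"
    by (rule hom_exists[OF Wd(1) dmapsD(1)[OF g]]) (blast+)
  have hd: "h \<in> dmaps R D W" by (rule dmaps_sum_map[OF W g h])
  let ?C = "\<lambda>i. Comp (homotopy_diff_proj R) (T i) D W"
  note C = Comp_hclass[OF T D W \<kappa>_dmaps]
  have Ch: "?C i (hclass R D W h) (hclass R (T i) D (\<kappa> i)) = F i" if i: "i \<in> I" for i
  proof -
    have "compose (carrier (T i)) h (\<kappa> i) = g i"
      using h(2)[OF i] lmod_hom_extensional[OF dmapsD(1)[OF g[OF i]]]
      by (intro extensionalityI[where A = "carrier (T i)"]) (auto simp: compose_def)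
    then show ?thesis using C[OF i i hd] Fg[OF i] by simp
  qed
  show "\<exists>!H. H \<in> carrier (hgroup R D W) \<and> (\<forall>i\<in>I. ?C i H (hclass R (T i) D (\<kappa> i)) = F i)"
  proof (rule ex1I)
    show "hclass R D W h \<in> carrier (hgroup R D W) \<and> (\<forall>i\<in>I. ?C i (hclass R D W h) (hclass R (T i) D (\<kappa> i)) = F i)"
      using Ch hd unfolding DW.carrier_hgroup by blast
    fix H assume H: "H \<in> carrier (hgroup R D W) \<and> (\<forall>i\<in>I. ?C i H (hclass R (T i) D (\<kappa> i)) = F i)"
    then obtain h' where h': "h' \<in> dmaps R D W" and Hh': "H = hclass R D W h'"
      unfolding DW.carrier_hgroup by blast
    have "\<forall>i\<in>I. \<exists>r. r \<in> lmod_hom R (T i) W \<and> (\<forall>x\<in>carrier (T i).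
        h' (\<kappa> i x) = r (dif (T i) x) \<oplus>\<^bsub>W\<^esub> dif W (r x) \<oplus>\<^bsub>W\<^esub> g i x)"
    proof
      fix i assume i: "i \<in> I"
      have "hclass R (T i) W (compose (carrier (T i)) h' (\<kappa> i)) = hclass R (T i) W (g i)"
        using C[OF i i h'] H i Hh' Fg[OF i] by simp
      then obtain r where r: "r \<in> lmod_hom R (T i) W" "\<And>x. x \<in> carrier (T i) \<Longrightarrow>
          compose (carrier (T i)) h' (\<kappa> i) x = r (dif (T i) x) \<oplus>\<^bsub>W\<^esub> dif W (r x) \<oplus>\<^bsub>W\<^esub> g i x"
        by (rule diff_module_pair.hclass_eqE[OF TW[OF i] dmaps_compose[OF T[OF i] \<kappa>_dmaps[OF i] h'] g[OF i]]) (blast+)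
      then show "\<exists>r. r \<in> lmod_hom R (T i) W \<and> (\<forall>x\<in>carrier (T i).
          h' (\<kappa> i x) = r (dif (T i) x) \<oplus>\<^bsub>W\<^esub> dif W (r x) \<oplus>\<^bsub>W\<^esub> g i x)"
        by (intro exI[of _ r]) (simp add: compose_def)
    qed
    from bchoice[OF this] obtain r where r: "\<And>i. i \<in> I \<Longrightarrow> r i \<in> lmod_hom R (T i) W"
      and req: "\<And>i x. i \<in> I \<Longrightarrow> x \<in> carrier (T i) \<Longrightarrow>
        h' (\<kappa> i x) = r i (dif (T i) x) \<oplus>\<^bsub>W\<^esub> dif W (r i x) \<oplus>\<^bsub>W\<^esub> g i x" by blast
    obtain s where s: "s \<in> lmod_hom R D W" "\<And>i x. i \<in> I \<Longrightarrow> x \<in> carrier (T i) \<Longrightarrow> s (\<kappa> i x) = r i x"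
      by (rule hom_exists[OF Wd(1) r]) (blast+)
    have "h' = (\<lambda>y\<in>carrier D. dhomotopy D W s y \<oplus>\<^bsub>W\<^esub> h y)"
    proof (rule hom_ext[OF Wd(1) dmapsD(1)[OF h'] dmapsD(1)[OF DW.dmaps_add[OF DW.dhomotopy_dmaps[OF s(1)] hd]]])
      fix i x assume i: "i \<in> I" and x: "x \<in> carrier (T i)"
      have "s (dif D (\<kappa> i x)) = r i (dif (T i) x)"
        using s(2)[OF i Td(4)[OF i x]] \<kappa>_dif[OF i x] by simp
      then show "h' (\<kappa> i x) = (\<lambda>y\<in>carrier D. dhomotopy D W s y \<oplus>\<^bsub>W\<^esub> h y) (\<kappa> i x)"
        using \<kappa>_closed[OF i x] by (simp add: dhomotopy_def s(2)[OF i x] h(2)[OF i x] req[OF i x])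
    qed
    then show "H = hclass R D W h"
      unfolding Hh' DW.hclass_eq[OF h' hd] using s(1) by blast
  qed
qed

text \<open>The module \<open>dsum I T\<close> has elements of type
  \<open>'u \<Rightarrow> 'u\<close>. It becomes an object of the category by transport along an
  embedding of its carrier into \<open>'u\<close>, and a coding of pairs does the same for the basis
  of the free module above it.\<close>

lemma dmod_sum_exists:
  fixes T :: "'u \<Rightarrow> ('r, 'u) dmodule"
  assumes R: "ring R" and inf: "infinite (UNIV :: 'u set)"
    and T: "\<And>i. i \<in> I \<Longrightarrow> T i \<in> Obj (homotopy_diff_proj R)"
  obtains D :: "('r, 'u) dmodule" and \<kappa> \<pi> where
    "dmod_sum R I T D \<kappa> \<pi>" "D \<in> Obj (homotopy_diff_proj R)"
proof -
  have Td: "\<And>i. i \<in> I \<Longrightarrow> diff_module R (T i)" and Tp: "\<And>i. i \<in> I \<Longrightarrow> lmod_projective R (T i)"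
    using T by (simp_all add: K_simps)
  obtain e :: "('u \<Rightarrow> 'u) \<Rightarrow> 'u" where e: "inj_on e (carrier (dsum I T))"
    using dsum_embedding[OF inf] .
  obtain j :: "'u \<times> 'u \<Rightarrow> 'u" where j: "inj j" using inj_prod_infinite[OF inf] .
  note s = dmod_sum.transport[OF dsum_dmod_sum[OF R Td] e]
  show thesis
    by (rule that[OF s]) (use dmod_sum.projective[OF s Tp j] dmod_sum.D[OF s] in \<open>simp_all add: K_simps\<close>)
qed

lemma homotopy_diff_proj_has_coproducts:
  assumes R: "ring R" and inf: "infinite (UNIV :: 'u set)"
  shows "has_coproducts (UNIV :: 'u set) (homotopy_diff_proj R :: (('r, 'u) dmodule, _) shift_category)"
  unfolding has_coproducts_def
proof (intro allI impI, elim conjE)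
  fix I :: "'u set" and T :: "'u \<Rightarrow> ('r, 'u) dmodule"
  assume "\<forall>i\<in>I. T i \<in> Obj (homotopy_diff_proj R)"
  then obtain D :: "('r, 'u) dmodule" and \<kappa> \<pi> where
    "dmod_sum R I T D \<kappa> \<pi>" "D \<in> Obj (homotopy_diff_proj R)"
    using dmod_sum_exists[OF R inf, of I T] by blast
  from dmod_sum_is_coproduct[OF this]
  show "\<exists>P \<iota>. is_coproduct (homotopy_diff_proj R) I T P \<iota>" by blast
qed

section \<open>Compactness from a finite set that detects null homotopy\<close>

lemma (in diff_module_pair) hclass_finsum:
  assumes "finite A" "\<And>i. i \<in> A \<Longrightarrow> g i \<in> dmaps R M N"
  shows "(\<lambda>x\<in>carrier M. finsum N (\<lambda>i. g i x) A) \<in> dmaps R M N"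
    and "hclass R M N (\<lambda>x\<in>carrier M. finsum N (\<lambda>i. g i x) A) = finprod (hgroup R M N) (\<lambda>i. hclass R M N (g i)) A"
proof -
  interpret H: comm_group "hgroup R M N" by (rule hgroup_comm_group)
  let ?s = "\<lambda>A. \<lambda>x\<in>carrier M. finsum N (\<lambda>i. g i x) A"
  have "?s A \<in> dmaps R M N \<and> hclass R M N (?s A) = finprod (hgroup R M N) (\<lambda>i. hclass R M N (g i)) A"
    using assms
  proof (induction A rule: finite_induct)
    case empty
    show ?case
      unfolding N.M.finsum_empty H.finprod_empty using dmaps_zero hclass_zero by blast
  next
    case (insert a A)
    note gA = insert.prems[OF insertI2] and ga = insert.prems[OF insertI1]
    have s: "?s A \<in> dmaps R M N"
      and hs: "hclass R M N (?s A) = finprod (hgroup R M N) (\<lambda>i. hclass R M N (g i)) A"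
      by (rule insert.IH[OF gA, THEN conjunct1], assumption, rule insert.IH[OF gA, THEN conjunct2], assumption)
    have gc: "(\<lambda>i. hclass R M N (g i)) \<in> A \<rightarrow> carrier (hgroup R M N)" "hclass R M N (g a) \<in> carrier (hgroup R M N)"
      unfolding carrier_hgroup
      by (rule funcsetI, rule imageI[OF gA], assumption) (rule imageI[OF ga])
    have "finsum N (\<lambda>i. g i x) (insert a A) = g a x \<oplus>\<^bsub>N\<^esub> ?s A x" if x: "x \<in> carrier M" for x
    proof -
      have "(\<lambda>i. g i x) \<in> A \<rightarrow> carrier N" using dmapsD(3)[OF gA x] by (rule funcsetI)
      then show ?thesis
        unfolding restrict_apply'[OF x] using insert.hyps dmapsD(3)[OF ga x] by (intro N.M.finsum_insert)
    qed
    then have eq: "?s (insert a A) = (\<lambda>x\<in>carrier M. g a x \<oplus>\<^bsub>N\<^esub> ?s A x)"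
      by (rule restrict_ext)
    have "hclass R M N (g a) \<otimes>\<^bsub>hgroup R M N\<^esub> hclass R M N (?s A)
        = finprod (hgroup R M N) (\<lambda>i. hclass R M N (g i)) (insert a A)"
      unfolding hs
      by (rule H.finprod_insert[OF insert.hyps gc, symmetric])
    then show ?case unfolding eq hclass_mult[OF ga s] by (rule conjI[OF dmaps_add[OF ga s]])
  qed
  then show "?s A \<in> dmaps R M N" "hclass R M N (?s A) = finprod (hgroup R M N) (\<lambda>i. hclass R M N (g i)) A"
    by (rule conjunct1, rule conjunct2)
qed

text \<open>For surjectivity, a map into a direct sum is split into its components at the finitely
  many indices met by the images of \<open>E\<close> and a remainder. The remainder vanishes on
  \<open>E\<close>, so \<open>crit\<close> makes it null homotopic, and the class of the map is a
  finite sum of classes through the summands. Injectivity follows by projecting to the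
  summands.\<close>

theorem compact_objectI:
  fixes S :: "('r, 'u) dmodule"
  assumes inf: "infinite (UNIV :: 'u set)" and S: "S \<in> Obj (homotopy_diff_proj R)"
    and E: "finite E" "E \<subseteq> carrier S"
    and crit: "\<And>(T :: ('r, 'u) dmodule) f. T \<in> Obj (homotopy_diff_proj R) \<Longrightarrow> f \<in> dmaps R S T \<Longrightarrow>
      (\<And>x. x \<in> E \<Longrightarrow> f x = \<zero>\<^bsub>T\<^esub>) \<Longrightarrow> f \<in> null_homotopic R S T"
  shows "compact_object (UNIV :: 'u set) (homotopy_diff_proj R) S"
  unfolding compact_object_def K_simps(2)
proof (intro conjI allI impI S, elim conjE)
  let ?K = "homotopy_diff_proj R :: (('r, 'u) dmodule, _) shift_category"
  have Sd: "diff_module R S" using S by (simp add: K_simps)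
  have R: "ring R" using diff_moduleD(1)[OF Sd] by (simp add: left_module_def)
  fix I :: "'u set" and T P \<iota>
  assume T: "\<forall>i\<in>I. T i \<in> Obj ?K" and cop: "is_coproduct ?K I T P \<iota>"
  have Td: "diff_module R (T i)" if "i \<in> I" for i using T that by (simp add: K_simps)
  have P: "P \<in> Obj ?K" using cop by (simp add: is_coproduct_def)
  then have Pd: "diff_module R P" by (simp add: K_simps)
  have \<iota>: "\<iota> i \<in> carrier (hgroup R (T i) P)" if "i \<in> I" for i
    using cop that by (simp add: is_coproduct_def K_simps)
  have univ: "\<exists>!h. h \<in> carrier (hgroup R P W) \<and> (\<forall>i\<in>I. Comp ?K (T i) P W h (\<iota> i) = f i)"
    if "W \<in> Obj ?K" "\<And>i. i \<in> I \<Longrightarrow> f i \<in> carrier (hgroup R (T i) W)" for W f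
    using cop that by (simp add: is_coproduct_def K_simps(2))
  interpret SP: diff_module_pair R S P by unfold_locales (fact Sd Pd)+
  interpret HP: comm_group "hgroup R S P" by (rule SP.hgroup_comm_group)
  have cgT: "comm_group (hgroup R S (T i))" if "i \<in> I" for i
    by (rule diff_module_pair.hgroup_comm_group) (unfold_locales, fact Sd, fact Td[OF that])
  define \<Phi> where "\<Phi> = (\<lambda>f. gfinprod (hgroup R S P) (\<lambda>i. Comp ?K S (T i) P (\<iota> i) (f i)) I)"
  have cs: "carrier (sum_group I (\<lambda>i. hgroup R S (T i)))
      = {x \<in> \<Pi>\<^sub>E i\<in>I. carrier (hgroup R S (T i)). finite {i \<in> I. x i \<noteq> \<one>\<^bsub>hgroup R S (T i)\<^esub>}}"
    by (rule carrier_sum_group) (use cgT comm_group.axioms(2) in blast)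
  have hom: "\<Phi> \<in> hom (sum_group I (\<lambda>i. hgroup R S (T i))) (hgroup R S P)"
    unfolding \<Phi>_def
  proof (rule HP.hom_group_sum)
    fix i assume i: "i \<in> I"
    show "Comp ?K S (T i) P (\<iota> i) \<in> hom (hgroup R S (T i)) (hgroup R S P)"
      by (rule Comp_hom[OF Sd Td[OF i] Pd \<iota>[OF i]])
    show "group (hgroup R S (T i))" by (rule comm_group.axioms(2)[OF cgT[OF i]])
  qed
    \<comment> \<open>the components of a family are recovered by the projections of the coproduct\<close>
    have "\<exists>p. p \<in> carrier (hgroup R P (T j)) \<and> (\<forall>i\<in>I. Comp ?K (T i) P (T j) p (\<iota> i) =
        (if i = j then Ident ?K (T j) else \<one>\<^bsub>hgroup R (T i) (T j)\<^esub>))" if j: "j \<in> I" for j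
    proof (rule ex1_implies_ex[OF univ[of "T j" "\<lambda>i. if i = j then Ident ?K (T j) else \<one>\<^bsub>hgroup R (T i) (T j)\<^esub>"]])
      show "T j \<in> Obj ?K" using T j by simp
      fix i assume i: "i \<in> I"
      interpret ij: diff_module_pair R "T i" "T j" by unfold_locales (fact Td[OF i] Td[OF j])+
      interpret comm_group "hgroup R (T i) (T j)" by (rule ij.hgroup_comm_group)
      show "(if i = j then Ident ?K (T j) else \<one>\<^bsub>hgroup R (T i) (T j)\<^esub>) \<in> carrier (hgroup R (T i) (T j))"
        using Ident_closed[OF Td[OF j]] one_closed by (simp add: K_simps del: one_FactGroup)
    qed
    then obtain p where p: "\<And>j. j \<in> I \<Longrightarrow> p j \<in> carrier (hgroup R P (T j))"
      and p\<iota>: "\<And>i j. j \<in> I \<Longrightarrow> i \<in> I \<Longrightarrow> Comp ?K (T i) P (T j) (p j) (\<iota> i) =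
        (if i = j then Ident ?K (T j) else \<one>\<^bsub>hgroup R (T i) (T j)\<^esub>)"
      using bchoice[of I "\<lambda>j p. p \<in> carrier (hgroup R P (T j)) \<and> (\<forall>i\<in>I. Comp ?K (T i) P (T j) p (\<iota> i) =
        (if i = j then Ident ?K (T j) else \<one>\<^bsub>hgroup R (T i) (T j)\<^esub>))"] by blast
  have inj: "inj_on \<Phi> (carrier (sum_group I (\<lambda>i. hgroup R S (T i))))"
  proof (rule inj_on_inverseI)
    fix x assume "x \<in> carrier (sum_group I (\<lambda>i. hgroup R S (T i)))"
    then have xP: "x \<in> (\<Pi>\<^sub>E i\<in>I. carrier (hgroup R S (T i)))"
      and fin: "finite {i \<in> I. x i \<noteq> \<one>\<^bsub>hgroup R S (T i)\<^esub>}" unfolding cs by auto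
    have x: "x i \<in> carrier (hgroup R S (T i))" if "i \<in> I" for i using PiE_mem[OF xP that] .
    have "Comp ?K S P (T j) (p j) (\<Phi> x) = x j" if j: "j \<in> I" for j
    proof -
      interpret Sj: diff_module_pair R S "T j" by unfold_locales (fact Sd Td[OF j])+
      interpret Hj: comm_group "hgroup R S (T j)" by (rule cgT[OF j])
      have c: "(\<lambda>i. Comp ?K S (T i) P (\<iota> i) (x i)) \<in> I \<rightarrow> carrier (hgroup R S P)"
        using Comp_closed[OF Sd Td Pd \<iota> x] by blast
      have f: "finite {i \<in> I. Comp ?K S (T i) P (\<iota> i) (x i) \<noteq> \<one>\<^bsub>hgroup R S P\<^esub>}"
      proof (rule finite_subset[OF _ fin])
        have "Comp ?K S (T i) P (\<iota> i) (x i) = \<one>\<^bsub>hgroup R S P\<^esub>" if "i \<in> I" "x i = \<one>\<^bsub>hgroup R S (T i)\<^esub>" for i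
          unfolding that(2) by (rule Comp_one_right[OF Sd Td[OF that(1)] Pd \<iota>[OF that(1)]])
        then show "{i \<in> I. Comp ?K S (T i) P (\<iota> i) (x i) \<noteq> \<one>\<^bsub>hgroup R S P\<^esub>} \<subseteq> {i \<in> I. x i \<noteq> \<one>\<^bsub>hgroup R S (T i)\<^esub>}"
          by blast
      qed
      have eq: "Comp ?K S P (T j) (p j) (Comp ?K S (T i) P (\<iota> i) (x i)) = (if i = j then x j else \<one>\<^bsub>hgroup R S (T j)\<^esub>)"
        if i: "i \<in> I" for i
        unfolding Comp_assoc[OF Sd Td[OF i] Pd Td[OF j] x[OF i] \<iota>[OF i] p[OF j]] p\<iota>[OF j i]
        using Comp_Ident_left[OF Sd Td[OF j] x[OF j]] Comp_one_left[OF Sd Td[OF i] Td[OF j] x[OF i]]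
        by (simp add: K_simps del: one_FactGroup)
      \<comment> \<open>Composition with \<open>p j\<close> is a homomorphism of Hom groups, so it
        passes through the finitely supported product, in which all factors except the one at
        \<open>j\<close> become trivial.\<close>
      have "Comp ?K S P (T j) (p j) (\<Phi> x) = gfinprod (hgroup R S (T j)) (\<lambda>i. Comp ?K S P (T j) (p j) (Comp ?K S (T i) P (\<iota> i) (x i))) I"
        unfolding \<Phi>_def
        by (rule hom_gfinprod[OF HP.comm_group_axioms Hj.comm_group_axioms Comp_hom[OF Sd Pd Td[OF j] p[OF j]] c f])
      also have "\<dots> = finprod (hgroup R S (T j)) (\<lambda>i. Comp ?K S P (T j) (p j) (Comp ?K S (T i) P (\<iota> i) (x i))) {j}"
      proof (rule gfinprod_eq[OF Hj.comm_group_axioms])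
        show "(\<lambda>i. Comp ?K S P (T j) (p j) (Comp ?K S (T i) P (\<iota> i) (x i))) \<in> I \<rightarrow> carrier (hgroup R S (T j))"
          by (rule funcsetI, rule Comp_closed[OF Sd Pd Td[OF j] p[OF j]])
             (rule Comp_closed[OF Sd Td Pd \<iota> x])
        show "Comp ?K S P (T j) (p j) (Comp ?K S (T i) P (\<iota> i) (x i)) = \<one>\<^bsub>hgroup R S (T j)\<^esub>"
          if "i \<in> I" "i \<notin> {j}" for i
          unfolding eq[OF that(1)] using that(2) by (simp del: one_FactGroup)
      qed (use j in simp_all)
      also have "\<dots> = x j \<otimes>\<^bsub>hgroup R S (T j)\<^esub> \<one>\<^bsub>hgroup R S (T j)\<^esub>"
        using Hj.finprod_insert[of "{}" j "\<lambda>i. Comp ?K S P (T j) (p j) (Comp ?K S (T i) P (\<iota> i) (x i))"]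
          eq[OF j] x[OF j] by (simp del: one_FactGroup mult_FactGroup)
      also have "\<dots> = x j" by (rule Hj.r_one[OF x[OF j]])
      finally show ?thesis .
    qed
    then have "(\<lambda>j\<in>I. Comp ?K S P (T j) (p j) (\<Phi> x)) = (\<lambda>j\<in>I. x j)" by (rule restrict_ext)
    also have "\<dots> = x" using xP by (intro extensional_restrict) (simp add: PiE_iff)
    finally show "(\<lambda>F. \<lambda>j\<in>I. Comp ?K S P (T j) (p j) F) (\<Phi> x) = x" .
  qed
  have surj: "\<exists>x\<in>carrier (sum_group I (\<lambda>i. hgroup R S (T i))). \<Phi> x = F" if F: "F \<in> carrier (hgroup R S P)" for F
  proof -
    \<comment> \<open>The given coproduct \<open>P\<close> has no accessible description of its
      elements, so \<open>F\<close> is compared with a map into an explicit direct sum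
      \<open>D\<close>. The universal properties of \<open>P\<close> and \<open>D\<close> give
      \<open>w\<close> and \<open>u\<close>, and \<open>u w\<close> is the identity since both
      restrict to \<open>\<iota> i\<close> on each summand.\<close>
    obtain D :: "('r, 'u) dmodule" and \<kappa> \<pi> where ds: "dmod_sum R I T D \<kappa> \<pi>" and D: "D \<in> Obj ?K"
      using dmod_sum_exists[OF R inf, of I T] T by blast
    interpret ds: dmod_sum R I T D \<kappa> \<pi> by fact
    have Ddd: "diff_module R D" by (rule dmod_sum.D[OF ds])
    have \<kappa>H: "hclass R (T i) D (\<kappa> i) \<in> carrier (hgroup R (T i) D)" if "i \<in> I" for i
      using ds.\<kappa>_dmaps[OF that] diff_module_pair.carrier_hgroup[OF diff_module_pair.intro[OF Td[OF that] Ddd]] by blast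
    obtain w where w: "w \<in> carrier (hgroup R P D)"
      and w\<iota>: "\<And>i. i \<in> I \<Longrightarrow> Comp ?K (T i) P D w (\<iota> i) = hclass R (T i) D (\<kappa> i)"
      using ex1_implies_ex[OF univ[OF D, of "\<lambda>i. hclass R (T i) D (\<kappa> i)"]] \<kappa>H by blast
    have "\<exists>!h. h \<in> carrier (hgroup R D P) \<and> (\<forall>i\<in>I. Comp ?K (T i) D P h (hclass R (T i) D (\<kappa> i)) = \<iota> i)"
      using dmod_sum_is_coproduct[OF ds D] P \<iota> by (simp add: is_coproduct_def K_simps(2))
    then obtain u where u: "u \<in> carrier (hgroup R D P)"
      and u\<kappa>: "\<And>i. i \<in> I \<Longrightarrow> Comp ?K (T i) D P u (hclass R (T i) D (\<kappa> i)) = \<iota> i" by blast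
    have uw: "Comp ?K P D P u w = Ident ?K P"
    proof -
      have "\<forall>i\<in>I. Comp ?K (T i) P P (Comp ?K P D P u w) (\<iota> i) = \<iota> i"
        using Comp_assoc[OF Td Pd Ddd Pd \<iota> w u] w\<iota> u\<kappa> by simp
      moreover have "\<forall>i\<in>I. Comp ?K (T i) P P (Ident ?K P) (\<iota> i) = \<iota> i"
        using Comp_Ident_left[OF Td Pd \<iota>] by (simp add: K_simps)
      ultimately show ?thesis
        using univ[OF P, of \<iota>] \<iota> Comp_closed[OF Pd Ddd Pd u w] Ident_closed[OF Pd] unfolding K_simps by blast
    qed
    interpret SD: diff_module_pair R S D by unfold_locales (fact Sd Ddd)+
    interpret HD: comm_group "hgroup R S D" by (rule SD.hgroup_comm_group)
    obtain f where f: "f \<in> dmaps R S D" and wF: "Comp ?K S P D w F = hclass R S D f"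
      using Comp_closed[OF Sd Pd Ddd w F] unfolding SD.carrier_hgroup by blast
    \<comment> \<open>The indices at which some image of an element of \<open>E\<close> has a
      nonzero component; finite because \<open>E\<close> is finite and each image has finite
      support.\<close>
    define F0 where "F0 = (\<Union>x\<in>E. {i \<in> I. \<pi> i (f x) \<noteq> \<zero>\<^bsub>T i\<^esub>})"
    have F0: "finite F0" "F0 \<subseteq> I"
      using E ds.fin_\<pi> dmapsD(3)[OF f] by (auto simp: F0_def)
    define c where "c i = compose (carrier S) (\<pi> i) f" for i
    have c: "c i \<in> dmaps R S (T i)" if "i \<in> I" for i
      unfolding c_def by (rule dmaps_compose[OF Sd f ds.\<pi>_dmaps[OF that]])
    define g where "g i = compose (carrier S) (\<kappa> i) (c i)" for i
    have g: "g i \<in> dmaps R S D" if "i \<in> I" for i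
      unfolding g_def by (rule dmaps_compose[OF Sd c ds.\<kappa>_dmaps]) (use that in auto)
    have gx: "g i x = \<kappa> i (\<pi> i (f x))" if "x \<in> carrier S" for i x
      using that by (simp add: g_def c_def compose_def)
    let ?s = "\<lambda>x\<in>carrier S. finsum D (\<lambda>i. g i x) F0"
    have s: "?s \<in> dmaps R S D" "hclass R S D ?s = finprod (hgroup R S D) (\<lambda>i. hclass R S D (g i)) F0"
      by (rule SD.hclass_finsum[OF F0(1) g[OF subsetD[OF F0(2)]]], assumption)+
    \<comment> \<open>The remainder of \<open>f\<close> after removing its components at the indices
      in \<open>F0\<close>. On \<open>E\<close> these components already make up all of
      \<open>f\<close>.\<close>
    define f' where "f' = (\<lambda>x\<in>carrier S. f x \<oplus>\<^bsub>D\<^esub> (\<lambda>x\<in>carrier S. \<ominus>\<^bsub>D\<^esub> ?s x) x)"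
    have f'd: "f' \<in> dmaps R S D"
      unfolding f'_def by (rule SD.dmaps_add[OF f SD.dmaps_neg[OF s(1)]])
    have "f' \<in> null_homotopic R S D"
    proof (rule crit[OF D f'd])
      fix x assume x: "x \<in> E"
      then have xS: "x \<in> carrier S" using E by blast
      note fx = dmapsD(3)[OF f xS]
      have "f x = gfinsum D (\<lambda>i. \<kappa> i (\<pi> i (f x))) I" using ds.\<kappa>\<pi>[OF fx] by simp
      also have "\<dots> = finsum D (\<lambda>i. \<kappa> i (\<pi> i (f x))) F0"
      proof (rule SD.N.gfinsum_eq[OF F0])
        show "(\<lambda>i. \<kappa> i (\<pi> i (f x))) \<in> I \<rightarrow> carrier D" using ds.\<kappa>_closed ds.\<pi>_closed fx by blast
        fix i assume i: "i \<in> I" "i \<notin> F0"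
        then have z: "\<pi> i (f x) = \<zero>\<^bsub>T i\<^esub>" using x by (auto simp: F0_def)
        show "\<kappa> i (\<pi> i (f x)) = \<zero>\<^bsub>D\<^esub>"
          unfolding z by (rule lmod_hom_zero[OF ds.\<kappa>[OF i(1)] diff_moduleD(1)[OF Td[OF i(1)]] SD.Nd(1)])
      qed
      finally have "f x = ?s x" using xS gx[OF xS] by simp
      then have "f' x = ?s x \<oplus>\<^bsub>D\<^esub> \<ominus>\<^bsub>D\<^esub> ?s x" using xS by (simp add: f'_def)
      then show "f' x = \<zero>\<^bsub>D\<^esub>" using dmapsD(3)[OF s(1) xS] by (simp only: SD.N.M.r_neg)
    qed
    then have f'1: "hclass R S D f' = \<one>\<^bsub>hgroup R S D\<^esub>" by (rule SD.hclass_null)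
    have "f = (\<lambda>x\<in>carrier S. f' x \<oplus>\<^bsub>D\<^esub> ?s x)"
    proof (rule extensionalityI[OF lmod_hom_extensional[OF dmapsD(1)[OF f]] restrict_extensional])
      fix x assume x: "x \<in> carrier S"
      have "f' x = f x \<oplus>\<^bsub>D\<^esub> \<ominus>\<^bsub>D\<^esub> ?s x" using x by (simp add: f'_def)
      then show "f x = (\<lambda>x\<in>carrier S. f' x \<oplus>\<^bsub>D\<^esub> ?s x) x"
        unfolding restrict_apply'[OF x] using dmapsD(3)[OF f x] dmapsD(3)[OF s(1) x] x
        by (simp only: restrict_apply' SD.N.M.a_assoc SD.N.M.l_neg SD.N.M.r_zero SD.N.M.a_inv_closed)
    qed
    then have "hclass R S D f = hclass R S D f' \<otimes>\<^bsub>hgroup R S D\<^esub> hclass R S D ?s"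
      unfolding SD.hclass_mult[OF f'd s(1)] by (rule arg_cong)
    also have "\<dots> = finprod (hgroup R S D) (\<lambda>i. hclass R S D (g i)) F0"
      unfolding f'1 s(2) by (rule HD.l_one[OF HD.finprod_closed]) (use g F0 in \<open>auto simp: SD.carrier_hgroup\<close>)
    finally have fs: "hclass R S D f = finprod (hgroup R S D) (\<lambda>i. hclass R S D (g i)) F0" .
    \<comment> \<open>The preimage of \<open>F\<close>: the components of \<open>f\<close> at the
      indices in \<open>F0\<close>, the neutral class elsewhere, so that the family has finite
      support.\<close>
    define x where "x = (\<lambda>i\<in>I. if i \<in> F0 then hclass R S (T i) (c i) else \<one>\<^bsub>hgroup R S (T i)\<^esub>)"
    have cH: "hclass R S (T i) (c i) \<in> carrier (hgroup R S (T i))" if "i \<in> I" for i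
      using c[OF that] diff_module_pair.carrier_hgroup[OF diff_module_pair.intro[OF Sd Td[OF that]]] by blast
    have oH: "\<one>\<^bsub>hgroup R S (T i)\<^esub> \<in> carrier (hgroup R S (T i))" if "i \<in> I" for i
      using cgT[OF that] by (rule monoid.one_closed[OF comm_monoid.axioms(1)[OF comm_group.axioms(1)]])
    have xc: "x i \<in> carrier (hgroup R S (T i))" if "i \<in> I" for i
      using that cH oH by (simp add: x_def del: one_FactGroup)
    have xS: "x \<in> carrier (sum_group I (\<lambda>i. hgroup R S (T i)))"
      unfolding cs
    proof (intro CollectI conjI)
      show "x \<in> (\<Pi>\<^sub>E i\<in>I. carrier (hgroup R S (T i)))"
        using xc by (simp add: PiE_iff x_def del: one_FactGroup)
      show "finite {i \<in> I. x i \<noteq> \<one>\<^bsub>hgroup R S (T i)\<^esub>}"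
        by (rule finite_subset[OF _ F0(1)]) (auto simp: x_def simp del: one_FactGroup)
    qed
    have "\<Phi> x = finprod (hgroup R S P) (\<lambda>i. Comp ?K S (T i) P (\<iota> i) (x i)) F0"
      unfolding \<Phi>_def
    proof (rule gfinprod_eq[OF HP.comm_group_axioms F0])
      show "(\<lambda>i. Comp ?K S (T i) P (\<iota> i) (x i)) \<in> I \<rightarrow> carrier (hgroup R S P)"
        using Comp_closed[OF Sd Td Pd \<iota> xc] by blast
      fix i assume i: "i \<in> I" "i \<notin> F0"
      then have "x i = \<one>\<^bsub>hgroup R S (T i)\<^esub>" by (simp add: x_def)
      then show "Comp ?K S (T i) P (\<iota> i) (x i) = \<one>\<^bsub>hgroup R S P\<^esub>"
        using Comp_one_right[OF Sd Td[OF i(1)] Pd \<iota>[OF i(1)]] by (simp del: one_FactGroup)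
    qed
    also have "\<dots> = finprod (hgroup R S P) (\<lambda>i. Comp ?K S D P u (hclass R S D (g i))) F0"
    proof (rule HP.finprod_cong')
      show "F0 = F0" ..
      have gH: "hclass R S D (g i) \<in> carrier (hgroup R S D)" if "i \<in> I" for i
        using g[OF that] unfolding SD.carrier_hgroup by blast
      show "(\<lambda>i. Comp ?K S D P u (hclass R S D (g i))) \<in> F0 \<rightarrow> carrier (hgroup R S P)"
        using Comp_closed[OF Sd Ddd Pd u gH] F0(2) by blast
      fix i assume "i \<in> F0"
      then have i: "i \<in> F0" "i \<in> I" using F0 by auto
      have "hclass R S D (g i) = Comp ?K S (T i) D (hclass R (T i) D (\<kappa> i)) (x i)"
        unfolding x_def using i Comp_hclass[OF Sd Td[OF i(2)] Ddd c[OF i(2)] ds.\<kappa>_dmaps[OF i(2)]]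
        by (simp add: g_def)
      then have "Comp ?K S D P u (hclass R S D (g i)) = Comp ?K S (T i) P (\<iota> i) (x i)"
        using Comp_assoc[OF Sd Td[OF i(2)] Ddd Pd xc[OF i(2)] \<kappa>H[OF i(2)] u] u\<kappa>[OF i(2)] by simp
      then show "Comp ?K S (T i) P (\<iota> i) (x i) = Comp ?K S D P u (hclass R S D (g i))" by (rule sym)
    qed
    also have "\<dots> = Comp ?K S D P u (hclass R S D f)"
      unfolding fs
      by (rule hom_finprod[OF HD.comm_group_axioms HP.comm_group_axioms Comp_hom[OF Sd Ddd Pd u], symmetric])
         (use g F0 in \<open>auto simp: SD.carrier_hgroup\<close>)
    also have "\<dots> = F"
      unfolding wF[symmetric] Comp_assoc[OF Sd Pd Ddd Pd F w u] uw
      using Comp_Ident_left[OF Sd Pd F] by (simp add: K_simps)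
    finally show ?thesis using xS by blast
  qed
  have "\<Phi> \<in> iso (sum_group I (\<lambda>i. hgroup R S (T i))) (hgroup R S P)"
    unfolding iso_def bij_betw_def using hom inj surj hom_carrier[OF hom] by blast
  then show "(\<lambda>f. gfinprod (hgroup R S P) (\<lambda>i. Comp ?K S (T i) P (\<iota> i) (f i)) I)
      \<in> iso (sum_group I (\<lambda>i. hgroup R S (T i))) (hgroup R S P)"
    unfolding \<Phi>_def .
qed

section \<open>Radical square zero algebras\<close>

lemma finsum_reg_lmod: "finsum (reg_lmod R) f F = finsum R f F"
  by (simp add: finsum_def finprod_def)

text \<open>\<open>ev v c\<close> is \<open>c\<close> times the idempotent of the vertex \<open>v\<close>, and \<open>ar a c\<close> is \<open>c\<close> times the arrow \<open>a\<close>;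
  \<open>cv\<close> and \<open>ca\<close> are the coefficient functionals.\<close>

locale rad_sq_zero = ring L for L :: "('r, 'q) ring_scheme" (structure) +
  fixes V :: "'v set" and A :: "'e set" and tl hd :: "'e \<Rightarrow> 'v"
    and ev :: "'v \<Rightarrow> 'k::field \<Rightarrow> 'r" and ar :: "'e \<Rightarrow> 'k \<Rightarrow> 'r"
    and cv :: "'v \<Rightarrow> 'r \<Rightarrow> 'k" and ca :: "'e \<Rightarrow> 'r \<Rightarrow> 'k"
  assumes fin_V: "finite V" and fin_A: "finite A"
    and tl: "a \<in> A \<Longrightarrow> tl a \<in> V" and hd: "a \<in> A \<Longrightarrow> hd a \<in> V"
    and ev_closed: "v \<in> V \<Longrightarrow> ev v c \<in> carrier L" and ar_closed: "a \<in> A \<Longrightarrow> ar a c \<in> carrier L"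
    and ev_zero: "v \<in> V \<Longrightarrow> ev v 0 = \<zero>" and ar_zero: "a \<in> A \<Longrightarrow> ar a 0 = \<zero>"
    and ev_ev: "v \<in> V \<Longrightarrow> w \<in> V \<Longrightarrow> ev v c \<otimes> ev w d = (if v = w then ev v (c * d) else \<zero>)"
    and ev_ar: "v \<in> V \<Longrightarrow> a \<in> A \<Longrightarrow> ev v c \<otimes> ar a d = (if v = hd a then ar a (c * d) else \<zero>)"
    and ar_ev: "v \<in> V \<Longrightarrow> a \<in> A \<Longrightarrow> ar a c \<otimes> ev v d = (if v = tl a then ar a (c * d) else \<zero>)"
    and ar_ar: "a \<in> A \<Longrightarrow> b \<in> A \<Longrightarrow> ar a c \<otimes> ar b d = \<zero>"
    and one_eq: "\<one> = finsum L (\<lambda>v. ev v 1) V"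
    and expand: "x \<in> carrier L \<Longrightarrow>
      x = finsum L (\<lambda>v. ev v (cv v x)) V \<oplus> finsum L (\<lambda>a. ar a (ca a x)) A"
    and cv_add: "v \<in> V \<Longrightarrow> x \<in> carrier L \<Longrightarrow> y \<in> carrier L \<Longrightarrow> cv v (x \<oplus> y) = cv v x + cv v y"
    and ca_add: "a \<in> A \<Longrightarrow> x \<in> carrier L \<Longrightarrow> y \<in> carrier L \<Longrightarrow> ca a (x \<oplus> y) = ca a x + ca a y"
    and cv_ev: "v \<in> V \<Longrightarrow> w \<in> V \<Longrightarrow> cv v (ev w c) = (if v = w then c else 0)"
    and cv_ar: "v \<in> V \<Longrightarrow> a \<in> A \<Longrightarrow> cv v (ar a c) = 0"
    and ca_ar: "a \<in> A \<Longrightarrow> b \<in> A \<Longrightarrow> ca a (ar b c) = (if a = b then c else 0)"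
begin

lemma cv_zero: "v \<in> V \<Longrightarrow> cv v \<zero> = 0"
  using cv_add[of v \<zero> \<zero>] add_left_imp_eq[of "cv v \<zero>" "cv v \<zero>" 0] by simp

lemma ca_zero: "a \<in> A \<Longrightarrow> ca a \<zero> = 0"
  using ca_add[of a \<zero> \<zero>] add_left_imp_eq[of "ca a \<zero>" "ca a \<zero>" 0] by simp

lemma ca_finsum: "finite F \<Longrightarrow> a \<in> A \<Longrightarrow> f \<in> F \<rightarrow> carrier L \<Longrightarrow> ca a (finsum L f F) = (\<Sum>i\<in>F. ca a (f i))"
  by (induction F rule: finite_induct) (auto simp: ca_zero ca_add Pi_iff)

lemma cv_finsum: "finite F \<Longrightarrow> v \<in> V \<Longrightarrow> f \<in> F \<rightarrow> carrier L \<Longrightarrow> cv v (finsum L f F) = (\<Sum>i\<in>F. cv v (f i))"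
  by (induction F rule: finite_induct) (auto simp: cv_zero cv_add Pi_iff)

abbreviation "e v \<equiv> ev v 1"
abbreviation "al a \<equiv> ar a 1"

lemma e_closed: "v \<in> V \<Longrightarrow> e v \<in> carrier L" and al_closed: "a \<in> A \<Longrightarrow> al a \<in> carrier L"
  by (simp_all add: ev_closed ar_closed)

lemma sums_closed:
  "finsum L (\<lambda>v. ev v (c v)) V \<in> carrier L" "finsum L (\<lambda>a. ar a (c' a)) A \<in> carrier L"
  by (auto intro!: finsum_closed simp: ev_closed ar_closed)

lemma mult_finsum: "x \<in> carrier L \<Longrightarrow> f \<in> F \<rightarrow> carrier L \<Longrightarrow> x \<otimes> finsum L f F = finsum L (\<lambda>i. x \<otimes> f i) F"
  using left_module.smult_finsum[OF reg_lmod_left_module, of x f F]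
  by (simp add: finsum_reg_lmod)

lemma finsum_mult: "x \<in> carrier L \<Longrightarrow> f \<in> F \<rightarrow> carrier L \<Longrightarrow> finsum L f F \<otimes> x = finsum L (\<lambda>i. f i \<otimes> x) F"
  using left_module.finsum_smult[OF reg_lmod_left_module, of x f F]
  by (simp add: finsum_reg_lmod)

lemma finsum_delta:
  assumes "finite F" "i \<in> F" "x \<in> carrier L"
  shows "finsum L (\<lambda>j. if j = i then x else \<zero>) F = x"
  using add.finprod_singleton_swap[OF assms(2,1), of "\<lambda>_. x"] assms by simp

text \<open>Multiplying an arrow by \<open>x\<close> from the left only sees the coefficient of
  \<open>x\<close> at the head of the arrow, and this scalar can be carried to the other side as a
  multiple of the idempotent at the tail. It is the reason why \<open>JM\<close> is closed under the
  action of \<open>L\<close>.\<close>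

lemma mult_al:
  assumes x: "x \<in> carrier L" and a: "a \<in> A"
  shows "x \<otimes> al a = al a \<otimes> ev (tl a) (cv (hd a) x)"
proof -
  have "x \<otimes> al a = finsum L (\<lambda>v. ev v (cv v x) \<otimes> al a) V \<oplus> finsum L (\<lambda>b. ar b (ca b x) \<otimes> al a) A"
    by (subst (1) expand[OF x])
       (simp add: l_distr sums_closed al_closed a finsum_mult ev_closed ar_closed)
  also have "finsum L (\<lambda>b. ar b (ca b x) \<otimes> al a) A = \<zero>"
    by (rule add.finprod_one_eqI) (simp add: ar_ar a)
  also have "finsum L (\<lambda>v. ev v (cv v x) \<otimes> al a) V = finsum L (\<lambda>v. if v = hd a then ar a (cv (hd a) x) else \<zero>) V"
    by (rule finsum_cong') (auto simp: ev_ar a ar_closed)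
  also have "\<dots> = ar a (cv (hd a) x)"
    by (rule finsum_delta) (use a fin_V hd ar_closed in auto)
  finally show ?thesis by (simp add: ar_ev a tl ar_closed)
qed

lemma al_mult:
  assumes x: "x \<in> carrier L" and a: "a \<in> A"
  shows "al a \<otimes> x = ar a (cv (tl a) x)"
proof -
  have "al a \<otimes> x = finsum L (\<lambda>v. al a \<otimes> ev v (cv v x)) V \<oplus> finsum L (\<lambda>b. al a \<otimes> ar b (ca b x)) A"
    by (subst (1) expand[OF x])
       (simp add: r_distr sums_closed al_closed a mult_finsum ev_closed ar_closed)
  also have "finsum L (\<lambda>b. al a \<otimes> ar b (ca b x)) A = \<zero>"
    by (rule add.finprod_one_eqI) (simp add: ar_ar a)
  also have "finsum L (\<lambda>v. al a \<otimes> ev v (cv v x)) V = finsum L (\<lambda>v. if v = tl a then ar a (cv (tl a) x) else \<zero>) V"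
    by (rule finsum_cong') (auto simp: ar_ev a ar_closed)
  also have "\<dots> = ar a (cv (tl a) x)"
    by (rule finsum_delta) (use a fin_V tl ar_closed in auto)
  finally show ?thesis by (simp add: ar_closed a)
qed

lemma cv_e_mult:
  assumes x: "x \<in> carrier L" and v: "v \<in> V" and w: "w \<in> V"
  shows "cv w (e v \<otimes> x) = (if w = v then cv v x else 0)"
proof -
  have "e v \<otimes> x = finsum L (\<lambda>u. e v \<otimes> ev u (cv u x)) V \<oplus> finsum L (\<lambda>b. e v \<otimes> ar b (ca b x)) A"
    by (subst (1) expand[OF x])
       (simp add: r_distr sums_closed e_closed v mult_finsum ev_closed ar_closed)
  also have "cv w \<dots> = cv w (finsum L (\<lambda>u. e v \<otimes> ev u (cv u x)) V) + cv w (finsum L (\<lambda>b. e v \<otimes> ar b (ca b x)) A)"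
    by (rule cv_add[OF w]) (auto intro!: finsum_closed simp: ev_closed ar_closed v)
  also have "cv w (finsum L (\<lambda>b. e v \<otimes> ar b (ca b x)) A) = (\<Sum>b\<in>A. cv w (e v \<otimes> ar b (ca b x)))"
    by (rule cv_finsum[OF fin_A w]) (auto simp: ev_closed ar_closed v)
  also have "\<dots> = 0"
    by (rule sum.neutral) (simp add: ev_ar v w cv_ar cv_zero)
  also have "cv w (finsum L (\<lambda>u. e v \<otimes> ev u (cv u x)) V) = (\<Sum>u\<in>V. cv w (e v \<otimes> ev u (cv u x)))"
    by (rule cv_finsum[OF fin_V w]) (auto simp: ev_closed v)
  also have "\<dots> = (\<Sum>u\<in>V. if u = v then (if w = v then cv v x else 0) else 0)"
    by (rule sum.cong) (auto simp: ev_ev v w cv_ev cv_zero)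
  finally show ?thesis using v fin_V by simp
qed

text \<open>Separates the action of \<open>x\<close> on vectors at the vertex \<open>v\<close> into
  a scalar and a combination of arrows, which is a radical part.\<close>

lemma mult_e_closed: "x \<in> carrier L \<Longrightarrow> v \<in> V \<Longrightarrow>
  x \<otimes> e v = ev v (cv v x) \<oplus> finsum L (\<lambda>a. if tl a = v then ar a (ca a x) else \<zero>) A"
proof -
  assume x: "x \<in> carrier L" and v: "v \<in> V"
  have "x \<otimes> e v = finsum L (\<lambda>w. ev w (cv w x) \<otimes> e v) V \<oplus> finsum L (\<lambda>b. ar b (ca b x) \<otimes> e v) A"
    by (subst (1) expand[OF x])
       (simp add: l_distr sums_closed e_closed v finsum_mult ev_closed ar_closed)
  also have "finsum L (\<lambda>w. ev w (cv w x) \<otimes> e v) V = finsum L (\<lambda>w. if w = v then ev v (cv v x) else \<zero>) V"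
    by (rule finsum_cong') (auto simp: ev_ev v ev_closed)
  also have "\<dots> = ev v (cv v x)"
    by (rule finsum_delta) (use v fin_V ev_closed in auto)
  also have "finsum L (\<lambda>b. ar b (ca b x) \<otimes> e v) A = finsum L (\<lambda>a. if tl a = v then ar a (ca a x) else \<zero>) A"
    by (rule finsum_cong') (auto simp: ar_ev v ar_closed)
  finally show ?thesis .
qed

lemma al_al: "a \<in> A \<Longrightarrow> b \<in> A \<Longrightarrow> al a \<otimes> al b = \<zero>" by (simp add: ar_ar)

lemma al_e_tl: "a \<in> A \<Longrightarrow> al a \<otimes> e (tl a) = al a" by (simp add: ar_ev tl)

lemma e_hd_al: "a \<in> A \<Longrightarrow> v \<in> V \<Longrightarrow> e v \<otimes> al a = (if v = hd a then al a else \<zero>)" by (simp add: ev_ar)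

lemma e_e: "v \<in> V \<Longrightarrow> e v \<otimes> e v = e v" by (simp add: ev_ev)

text \<open>The submodule \<open>J M\<close>. In \<open>L\<close> the ideal \<open>J\<close> is
  spanned by the arrows, so one vector for each arrow is enough, and membership is literally the
  solvability of an equation with the arrows as coefficients.\<close>

definition JM :: "('r, 'm, 'x) module_scheme \<Rightarrow> 'm set" where
  "JM M = {finsum M (\<lambda>a. al a \<odot>\<^bsub>M\<^esub> t a) A | t. t \<in> A \<rightarrow> carrier M}"

end

section \<open>The radical submodule, and solving equations whose coefficients are the
  arrows\<close>

locale rsz_module = rad_sq_zero L V A tl hd ev ar cv ca + M: left_module L M
  for L :: "('r, 'q) ring_scheme" (structure) and V :: "'v set" and A :: "'e set" and tl hd
    and ev :: "'v \<Rightarrow> 'k::field \<Rightarrow> 'r" and ar cv ca and M :: "('r, 'm, 'x) module_scheme"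
begin

abbreviation smultM (infixr "\<bullet>" 75) where "a \<bullet> x \<equiv> a \<odot>\<^bsub>M\<^esub> x"

lemma al_smult_closed: "t \<in> A \<rightarrow> carrier M \<Longrightarrow> (\<lambda>a. al a \<bullet> t a) \<in> A \<rightarrow> carrier M"
  by (auto intro!: M.smult_closed al_closed)

lemma JM_subset: "j \<in> JM M \<Longrightarrow> j \<in> carrier M"
  by (auto simp: JM_def intro!: M.M.finsum_closed M.smult_closed al_closed)

lemma JM_I: "t \<in> A \<rightarrow> carrier M \<Longrightarrow> finsum M (\<lambda>a. al a \<bullet> t a) A \<in> JM M"
  by (auto simp: JM_def)

lemma JM_zero: "\<zero>\<^bsub>M\<^esub> \<in> JM M"
proof -
  have "finsum M (\<lambda>a. al a \<bullet> \<zero>\<^bsub>M\<^esub>) A = \<zero>\<^bsub>M\<^esub>"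
    by (rule M.M.add.finprod_one_eqI) (simp add: al_closed)
  then show ?thesis using JM_I[of "\<lambda>_. \<zero>\<^bsub>M\<^esub>"] by simp
qed

lemma JM_add: "x \<in> JM M \<Longrightarrow> y \<in> JM M \<Longrightarrow> x \<oplus>\<^bsub>M\<^esub> y \<in> JM M"
proof -
  assume "x \<in> JM M" "y \<in> JM M"
  then obtain s t where s: "s \<in> A \<rightarrow> carrier M" "x = finsum M (\<lambda>a. al a \<bullet> s a) A"
    and t: "t \<in> A \<rightarrow> carrier M" "y = finsum M (\<lambda>a. al a \<bullet> t a) A" by (auto simp: JM_def)
  have "finsum M (\<lambda>a. al a \<bullet> (s a \<oplus>\<^bsub>M\<^esub> t a)) A = finsum M (\<lambda>a. al a \<bullet> s a \<oplus>\<^bsub>M\<^esub> al a \<bullet> t a) A"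
    by (rule M.M.finsum_cong')
       (use s t al_closed in \<open>auto simp: Pi_iff M.smult_r_distr intro!: M.smult_closed\<close>)
  also have "\<dots> = x \<oplus>\<^bsub>M\<^esub> y"
    unfolding s(2) t(2)
    by (rule M.M.finsum_addf[OF al_smult_closed[OF s(1)] al_smult_closed[OF t(1)]])
  finally show ?thesis using JM_I[of "\<lambda>a. s a \<oplus>\<^bsub>M\<^esub> t a"] s t by (auto simp: Pi_iff)
qed

lemma JM_smult:
  assumes x: "x \<in> carrier L" and j: "j \<in> JM M"
  shows "x \<bullet> j \<in> JM M"
proof -
  obtain t where t: "t \<in> A \<rightarrow> carrier M" "j = finsum M (\<lambda>a. al a \<bullet> t a) A" using j by (auto simp: JM_def)
  let ?t = "\<lambda>a. ev (tl a) (cv (hd a) x) \<bullet> t a"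
  have t': "?t \<in> A \<rightarrow> carrier M" using t tl by (auto intro!: M.smult_closed ev_closed)
  have "x \<bullet> j = finsum M (\<lambda>a. x \<bullet> al a \<bullet> t a) A"
    unfolding t(2) by (rule M.smult_finsum[OF x al_smult_closed[OF t(1)]])
  also have "\<dots> = finsum M (\<lambda>a. al a \<bullet> ?t a) A"
  proof (rule M.M.finsum_cong'[OF refl al_smult_closed[OF t']])
    fix a assume a: "a \<in> A"
    then have ta: "t a \<in> carrier M" using t by auto
    show "x \<bullet> al a \<bullet> t a = al a \<bullet> ?t a"
      using M.smult_assoc[OF x al_closed[OF a] ta] M.smult_assoc[OF al_closed[OF a] ev_closed[OF tl[OF a]] ta]
        mult_al[OF x a] by simp
  qed
  finally show ?thesis using JM_I[OF t'] by simp
qed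

lemma JM_minus: "j \<in> JM M \<Longrightarrow> \<ominus>\<^bsub>M\<^esub> j \<in> JM M"
proof -
  assume j: "j \<in> JM M"
  have jc: "j \<in> carrier M" by (rule JM_subset[OF j])
  have "(\<ominus> \<one>) \<bullet> j \<oplus>\<^bsub>M\<^esub> j = (\<ominus> \<one> \<oplus> \<one>) \<bullet> j"
    using jc by (simp add: M.smult_l_distr M.smult_one)
  then have "\<ominus>\<^bsub>M\<^esub> j = (\<ominus> \<one>) \<bullet> j"
    using jc by (intro M.M.minus_equality) (auto simp: l_neg intro!: M.smult_closed)
  then show ?thesis using JM_smult[OF _ j] by simp
qed

lemma JM_diff: "x \<in> JM M \<Longrightarrow> y \<in> JM M \<Longrightarrow> x \<ominus>\<^bsub>M\<^esub> y \<in> JM M"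
  by (simp add: a_minus_def JM_add JM_minus)

lemma JM_finsum: "finite F \<Longrightarrow> (\<And>i. i \<in> F \<Longrightarrow> f i \<in> JM M) \<Longrightarrow> finsum M f F \<in> JM M"
  by (induction F rule: finite_induct) (auto simp: JM_zero JM_add JM_subset Pi_iff)

lemma al_in_JM:
  assumes a: "a \<in> A" and x: "x \<in> carrier M"
  shows "al a \<bullet> x \<in> JM M"
proof -
  let ?t = "\<lambda>b. if b = a then x else \<zero>\<^bsub>M\<^esub>"
  have "finsum M (\<lambda>b. al b \<bullet> ?t b) A = finsum M (\<lambda>b. if b = a then al a \<bullet> x else \<zero>\<^bsub>M\<^esub>) A"
    by (rule M.M.finsum_cong') (auto simp: x a al_closed M.smult_closed)
  also have "\<dots> = al a \<bullet> x"
    using M.M.add.finprod_singleton_swap[OF a fin_A, of "\<lambda>_. al a \<bullet> x"] M.smult_closed[OF al_closed[OF a] x] by simp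
  finally show ?thesis using JM_I[of ?t] x by auto
qed

lemma ar_in_JM: "a \<in> A \<Longrightarrow> x \<in> carrier M \<Longrightarrow> ar a c \<bullet> x \<in> JM M"
  using al_in_JM[of a "ev (tl a) c \<bullet> x"] M.smult_assoc[OF al_closed ev_closed[OF tl], of a a x c]
  by (simp add: ar_ev tl M.smult_closed ev_closed)

lemma al_JM:
  assumes a: "a \<in> A" and j: "j \<in> JM M"
  shows "al a \<bullet> j = \<zero>\<^bsub>M\<^esub>"
proof -
  obtain t where t: "t \<in> A \<rightarrow> carrier M" "j = finsum M (\<lambda>a. al a \<bullet> t a) A" using j by (auto simp: JM_def)
  have "al a \<bullet> j = finsum M (\<lambda>b. al a \<bullet> al b \<bullet> t b) A"
    unfolding t(2) by (rule M.smult_finsum[OF al_closed[OF a] al_smult_closed[OF t(1)]])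
  also have "\<dots> = \<zero>\<^bsub>M\<^esub>"
    by (rule M.M.add.finprod_one_eqI)
       (use t in \<open>auto simp: Pi_iff al_al a al_closed simp flip: M.smult_assoc\<close>)
  finally show ?thesis .
qed

lemma e_sum: "x \<in> carrier M \<Longrightarrow> finsum M (\<lambda>v. e v \<bullet> x) V = x"
  using M.finsum_smult[of x "\<lambda>v. e v" V] by (simp add: e_closed M.smult_one flip: one_eq)

lemma e_idem: "v \<in> V \<Longrightarrow> x \<in> carrier M \<Longrightarrow> e v \<bullet> e v \<bullet> x = e v \<bullet> x"
  by (simp add: e_closed e_e flip: M.smult_assoc)

text \<open>Replacing \<open>t a\<close> by its part at the tail of \<open>a\<close> does not change
  the product with the arrow, and multiplying by \<open>e v\<close> removes the arrows that do not
  end at \<open>v\<close>. The solution is thereby indexed by the arrows that extend an opposite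
  path ending at \<open>v\<close>.\<close>

lemma JM_decompose:
  assumes j: "j \<in> JM M" and v: "v \<in> V" and ej: "e v \<bullet> j = j"
  obtains t where "\<And>a. a \<in> A \<Longrightarrow> t a \<in> carrier M" "\<And>a. a \<in> A \<Longrightarrow> e (tl a) \<bullet> t a = t a"
    "finsum M (\<lambda>a. al a \<bullet> t a) {a \<in> A. hd a = v} = j"
proof -
  obtain t where t: "t \<in> A \<rightarrow> carrier M" "j = finsum M (\<lambda>a. al a \<bullet> t a) A" using j by (auto simp: JM_def)
  then have tc: "t a \<in> carrier M" if "a \<in> A" for a using that by auto
  show thesis
  proof (rule that[of "\<lambda>a. e (tl a) \<bullet> t a"])
    fix a assume a: "a \<in> A"
    show "e (tl a) \<bullet> t a \<in> carrier M" by (rule M.smult_closed[OF e_closed[OF tl[OF a]] tc[OF a]])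
    show "e (tl a) \<bullet> e (tl a) \<bullet> t a = e (tl a) \<bullet> t a" by (rule e_idem[OF tl[OF a] tc[OF a]])
  next
    have eq: "al a \<bullet> e (tl a) \<bullet> t a = al a \<bullet> t a" if "a \<in> A" for a
      using M.smult_assoc[OF al_closed[OF that] e_closed[OF tl[OF that]] tc[OF that]] by (simp add: al_e_tl that)
    have "finsum M (\<lambda>a. al a \<bullet> e (tl a) \<bullet> t a) {a \<in> A. hd a = v} = finsum M (\<lambda>a. e v \<bullet> al a \<bullet> t a) A"
    proof (rule M.M.add.finprod_mono_neutral_cong_left[OF fin_A])
      fix a assume a: "a \<in> A - {a \<in> A. hd a = v}"
      then show "e v \<bullet> al a \<bullet> t a = \<zero>\<^bsub>M\<^esub>"
        using M.smult_assoc[OF e_closed[OF v] al_closed tc, of a a] by (auto simp: e_hd_al v tc)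
    next
      fix a assume a: "a \<in> {a \<in> A. hd a = v}"
      then show "al a \<bullet> e (tl a) \<bullet> t a = e v \<bullet> al a \<bullet> t a"
        using M.smult_assoc[OF e_closed[OF v] al_closed tc, of a a] eq by (auto simp: e_hd_al v)
    qed (auto intro!: M.smult_closed e_closed al_closed v tc)
    also have "\<dots> = e v \<bullet> j"
      unfolding t(2) by (rule M.smult_finsum[OF e_closed[OF v] al_smult_closed[OF t(1)], symmetric])
    finally show "finsum M (\<lambda>a. al a \<bullet> e (tl a) \<bullet> t a) {a \<in> A. hd a = v} = j" using ej by simp
  qed
qed

text \<open>On a vector at \<open>v\<close> the action of \<open>L\<close> is by scalars modulo
  \<open>JM\<close>. This is where the semisimplicity of \<open>L\<close> modulo its radical enters,
  in a form that avoids the quotient.\<close>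

lemma smult_mod_JM:
  assumes x: "x \<in> carrier L" and v: "v \<in> V" and z: "z \<in> carrier M" and ez: "e v \<bullet> z = z"
  shows "\<exists>j\<in>JM M. x \<bullet> z = ev v (cv v x) \<bullet> z \<oplus>\<^bsub>M\<^esub> j"
proof
  let ?f = "\<lambda>a. if tl a = v then ar a (ca a x) else \<zero>"
  have f: "?f \<in> A \<rightarrow> carrier L" by (auto simp: ar_closed)
  have "x \<bullet> z = (x \<otimes> e v) \<bullet> z" using M.smult_assoc[OF x e_closed[OF v] z] ez by simp
  also have "\<dots> = ev v (cv v x) \<bullet> z \<oplus>\<^bsub>M\<^esub> finsum L ?f A \<bullet> z"
    unfolding mult_e_closed[OF x v]
    by (rule M.smult_l_distr[OF ev_closed[OF v] finsum_closed[OF f] z])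
  also have "finsum L ?f A \<bullet> z = finsum M (\<lambda>a. ?f a \<bullet> z) A" by (rule M.finsum_smult[OF z f])
  finally show "x \<bullet> z = ev v (cv v x) \<bullet> z \<oplus>\<^bsub>M\<^esub> finsum M (\<lambda>a. ?f a \<bullet> z) A" .
  show "finsum M (\<lambda>a. ?f a \<bullet> z) A \<in> JM M"
    by (rule JM_finsum[OF fin_A]) (auto simp: ar_in_JM z JM_zero)
qed

text \<open>In a dual basis the relation becomes a relation between elements \<open>y a\<close> of
  \<open>L\<close>. The product of the arrow \<open>a\<close> with \<open>y a\<close> is a multiple
  of \<open>a\<close>, the factor being the coefficient of \<open>y a\<close> at the tail. Distinct
  arrows are independent, so this coefficient vanishes for \<open>b\<close>, and what remains of
  \<open>y b\<close> is a combination of arrows.\<close>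

lemma projective_arrow_injective:
  assumes P: "lmod_projective L M"
    and t: "\<And>a. a \<in> A \<Longrightarrow> t a \<in> carrier M" and et: "\<And>a. a \<in> A \<Longrightarrow> e (tl a) \<bullet> t a = t a"
    and z: "finsum M (\<lambda>a. al a \<bullet> t a) A = \<zero>\<^bsub>M\<^esub>" and b: "b \<in> A"
  shows "t b \<in> JM M"
proof -
  obtain W :: "'m set" and x \<phi> where db: "dual_basis L M W x \<phi>" using projective_dual_basis[OF P] .
  note D = dual_basisD[OF db]
  have tb: "t b \<in> carrier M" by (rule t[OF b])
  have in_JM: "\<phi> w (t b) \<bullet> x w \<in> JM M" if w: "w \<in> W" for w
  proof -
    let ?y = "\<lambda>a. \<phi> w (t a)"
    have y: "?y a \<in> carrier L" if "a \<in> A" for a by (rule D(5)[OF w t[OF that]])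
    have "\<phi> w \<zero>\<^bsub>M\<^esub> = \<zero>" using lmod_hom_zero[OF D(2)[OF w] M.left_module_axioms reg_lmod_left_module] by simp
    then have "\<zero> = finsum L (\<lambda>a. \<phi> w (al a \<bullet> t a)) A"
      using lmod_hom_finsum[OF D(2)[OF w] M.left_module_axioms reg_lmod_left_module, of "\<lambda>a. al a \<bullet> t a" A]
      by (simp add: z finsum_reg_lmod Pi_iff M.smult_closed al_closed t)
    also have "\<dots> = finsum L (\<lambda>a. ar a (cv (tl a) (?y a))) A"
      by (rule finsum_cong')
         (auto simp: lmod_hom_smult[OF D(2)[OF w]] al_closed t al_mult y ar_closed)
    finally have z0: "\<zero> = finsum L (\<lambda>a. ar a (cv (tl a) (?y a))) A" .
    \<comment> \<open>The coefficient of the arrow \<open>b\<close> isolates the term with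
      \<open>a = b\<close>.\<close>
    have "0 = ca b (finsum L (\<lambda>a. ar a (cv (tl a) (?y a))) A)" by (simp add: ca_zero b flip: z0)
    also have "\<dots> = (\<Sum>a\<in>A. ca b (ar a (cv (tl a) (?y a))))"
      by (rule ca_finsum[OF fin_A b]) (auto simp: ar_closed)
    also have "\<dots> = (\<Sum>a\<in>A. if a = b then cv (tl b) (?y b) else 0)"
      by (rule sum.cong) (auto simp: ca_ar b)
    also have "\<dots> = cv (tl b) (?y b)" using b fin_A by simp
    finally have cb: "cv (tl b) (?y b) = 0" by simp
    \<comment> \<open>Since \<open>t b\<close> lives at the tail of \<open>b\<close>, so do its
      coordinates, and their coefficients at all other vertices are zero as well.\<close>
    have "?y b = \<phi> w (e (tl b) \<bullet> t b)" using et[OF b] by simp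
    also have "\<dots> = e (tl b) \<otimes> ?y b"
      using lmod_hom_smult[OF D(2)[OF w] e_closed[OF tl[OF b]] tb] by simp
    finally have "cv v (?y b) = (if v = tl b then cv (tl b) (?y b) else 0)" if "v \<in> V" for v
      using cv_e_mult[OF y[OF b] tl[OF b] that] by simp
    then have cv0: "cv v (?y b) = 0" if "v \<in> V" for v using that cb by simp
    have "finsum L (\<lambda>v. ev v (cv v (?y b))) V = \<zero>"
      by (rule add.finprod_one_eqI) (simp add: cv0 ev_zero)
    then have "?y b = finsum L (\<lambda>a. ar a (ca a (?y b))) A"
      using expand[OF y[OF b]] sums_closed(2) by simp
    then have "?y b \<bullet> x w = finsum L (\<lambda>a. ar a (ca a (?y b))) A \<bullet> x w" by simp
    also have "\<dots> = finsum M (\<lambda>a. ar a (ca a (?y b)) \<bullet> x w) A"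
      by (rule M.finsum_smult[OF D(1)[OF w]]) (auto simp: ar_closed)
    finally show ?thesis
      using JM_finsum[OF fin_A, of "\<lambda>a. ar a (ca a (?y b)) \<bullet> x w"] ar_in_JM D(1)[OF w] by simp
  qed
  let ?F = "{w \<in> W. \<phi> w (t b) \<noteq> \<zero>}"
  have "t b = gfinsum M (\<lambda>w. \<phi> w (t b) \<bullet> x w) W" using D(4)[OF tb] by simp
  also have "\<dots> = finsum M (\<lambda>w. \<phi> w (t b) \<bullet> x w) ?F"
    by (rule M.gfinsum_eq[OF D(3)[OF tb]]) (auto simp: D(1) in_JM JM_subset)
  also have "\<dots> \<in> JM M" by (rule JM_finsum[OF D(3)[OF tb]]) (use in_JM in auto)
  finally show ?thesis .
qed

lemma hom_JM:
  assumes f: "f \<in> lmod_hom L M M" and j: "j \<in> JM M"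
  shows "f j \<in> JM M"
proof -
  obtain t where t: "t \<in> A \<rightarrow> carrier M" "j = finsum M (\<lambda>a. al a \<bullet> t a) A" using j by (auto simp: JM_def)
  have "f j = finsum M (\<lambda>a. f (al a \<bullet> t a)) A"
    unfolding t(2) by (rule lmod_hom_finsum[OF f M.left_module_axioms M.left_module_axioms al_smult_closed[OF t(1)]])
  also have "\<dots> = finsum M (\<lambda>a. al a \<bullet> f (t a)) A"
    by (rule M.M.finsum_cong')
       (use t lmod_hom_closed[OF f] lmod_hom_smult[OF f] al_closed in \<open>auto simp: Pi_iff intro!: M.smult_closed\<close>)
  also have "\<dots> \<in> JM M" by (rule JM_I) (use t lmod_hom_closed[OF f] in auto)
  finally show ?thesis .
qed

text \<open>A map is linear over the arrows, and an arrow times a value in \<open>JM\<close> is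
  zero. Applied to a map with values in \<open>JM\<close> it shows that the square of this map
  vanishes.\<close>

lemma hom_null_JM:
  assumes f: "f \<in> lmod_hom L M M" and im: "\<And>x. x \<in> carrier M \<Longrightarrow> f x \<in> JM M" and j: "j \<in> JM M"
  shows "f j = \<zero>\<^bsub>M\<^esub>"
proof -
  obtain t where t: "t \<in> A \<rightarrow> carrier M" "j = finsum M (\<lambda>a. al a \<bullet> t a) A" using j by (auto simp: JM_def)
  have "f j = finsum M (\<lambda>a. f (al a \<bullet> t a)) A"
    unfolding t(2) by (rule lmod_hom_finsum[OF f M.left_module_axioms M.left_module_axioms al_smult_closed[OF t(1)]])
  also have "\<dots> = \<zero>\<^bsub>M\<^esub>"
    by (rule M.M.add.finprod_one_eqI)
       (use t in \<open>auto simp: Pi_iff lmod_hom_smult[OF f] al_closed al_JM im\<close>)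
  finally show ?thesis .
qed

end

section \<open>Lifting along the opposite quiver\<close>

text \<open>A path of the opposite quiver is recorded by its source \<open>u\<close> and by the list of its arrows
  with the arrow traversed last in front.\<close>

context rad_sq_zero
begin

fun path_end :: "'v \<Rightarrow> 'e list \<Rightarrow> 'v" where
  "path_end u [] = u"
| "path_end u (a # l) = tl a"

fun op_path :: "'v \<Rightarrow> 'e list \<Rightarrow> bool" where
  "op_path u [] \<longleftrightarrow> u \<in> V"
| "op_path u (a # l) \<longleftrightarrow> op_path u l \<and> a \<in> A \<and> hd a = path_end u l"

lemma path_end_V: "op_path u l \<Longrightarrow> path_end u l \<in> V"
  by (cases l) (auto simp: tl)

end

context rsz_module
begin

lemma restricted_sum:
  assumes "\<And>a. a \<in> A \<Longrightarrow> P a \<Longrightarrow> t a \<in> carrier M"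
  shows "finsum M (\<lambda>a. al a \<bullet> (if P a then t a else \<zero>\<^bsub>M\<^esub>)) A = finsum M (\<lambda>a. al a \<bullet> t a) {a \<in> A. P a}"
  by (rule M.M.add.finprod_mono_neutral_cong_left[symmetric])
     (use assms fin_A in \<open>auto simp: al_closed intro!: M.smult_closed\<close>)

lemma koszul_lift:
  assumes P: "lmod_projective L M"
    and \<delta>: "\<delta> \<in> lmod_hom L M M" and \<delta>\<delta>: "\<And>x. x \<in> carrier M \<Longrightarrow> \<delta> (\<delta> x) = \<zero>\<^bsub>M\<^esub>"
    and g: "\<And>u l. op_path u l \<Longrightarrow> g u l \<in> carrier M" "\<And>u l. op_path u l \<Longrightarrow> e (path_end u l) \<bullet> g u l = g u l"
    and \<delta>g: "\<And>u l. op_path u l \<Longrightarrow>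
      \<delta> (g u l) \<oplus>\<^bsub>M\<^esub> finsum M (\<lambda>a. al a \<bullet> g u (a # l)) {a \<in> A. hd a = path_end u l} = \<zero>\<^bsub>M\<^esub>"
    and x: "\<And>u. u \<in> V \<Longrightarrow> x u \<in> carrier M" "\<And>u. u \<in> V \<Longrightarrow> e u \<bullet> x u = x u"
      "\<And>u. u \<in> V \<Longrightarrow> g u [] \<oplus>\<^bsub>M\<^esub> \<delta> (x u) \<in> JM M"
  obtains r where "\<And>u. r u [] = x u" "\<And>u l. op_path u l \<Longrightarrow> r u l \<in> carrier M"
    "\<And>u l. op_path u l \<Longrightarrow> e (path_end u l) \<bullet> r u l = r u l"
    "\<And>u l. op_path u l \<Longrightarrow>
      finsum M (\<lambda>a. al a \<bullet> r u (a # l)) {a \<in> A. hd a = path_end u l} = g u l \<oplus>\<^bsub>M\<^esub> \<delta> (r u l)"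
proof -
  \<comment> \<open>A fixed choice of solution for each right-hand side \<open>j\<close> at the
    vertex \<open>v\<close>, so that all extensions of one path use components of the same
    solution.\<close>
  define dec where "dec v j = (SOME t. (\<forall>a\<in>A. t a \<in> carrier M \<and> e (tl a) \<bullet> t a = t a) \<and>
      finsum M (\<lambda>a. al a \<bullet> t a) {a \<in> A. hd a = v} = j)" for v j
  have dec: "(\<forall>a\<in>A. dec v j a \<in> carrier M \<and> e (tl a) \<bullet> dec v j a = dec v j a) \<and>
      finsum M (\<lambda>a. al a \<bullet> dec v j a) {a \<in> A. hd a = v} = j"
    if jv: "j \<in> JM M" "v \<in> V" "e v \<bullet> j = j" for v j
  proof -
    have "\<exists>t. (\<forall>a\<in>A. t a \<in> carrier M \<and> e (tl a) \<bullet> t a = t a) \<and>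
      finsum M (\<lambda>a. al a \<bullet> t a) {a \<in> A. hd a = v} = j"
    proof (rule JM_decompose[OF jv])
      fix t assume "\<And>a. a \<in> A \<Longrightarrow> t a \<in> carrier M" "\<And>a. a \<in> A \<Longrightarrow> e (tl a) \<bullet> t a = t a"
        "finsum M (\<lambda>a. al a \<bullet> t a) {a \<in> A. hd a = v} = j"
      then show ?thesis by (intro exI[of _ t] conjI ballI)
    qed
    then show ?thesis
      unfolding dec_def by (rule someI_ex)
  qed
  \<comment> \<open>Lists carry the arrow traversed last in front, so extending a path is
    \<open>Cons\<close> and the construction is primitive recursion on the list.\<close>
  define r where "r u l = rec_list (x u) (\<lambda>a l y. dec (path_end u l) (g u l \<oplus>\<^bsub>M\<^esub> \<delta> y) a) l" for u l
  have r_Nil: "r u [] = x u" for u by (simp add: r_def)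
  have r_Cons: "r u (a # l) = dec (path_end u l) (g u l \<oplus>\<^bsub>M\<^esub> \<delta> (r u l)) a" for u a l by (simp add: r_def)
  note \<delta>c = lmod_hom_closed[OF \<delta>]
  have main: "r u l \<in> carrier M \<and> e (path_end u l) \<bullet> r u l = r u l \<and> g u l \<oplus>\<^bsub>M\<^esub> \<delta> (r u l) \<in> JM M"
    if "op_path u l" for u l
    using that
  proof (induction l)
    case Nil
    then show ?case using x by (simp add: r_Nil)
  next
    case (Cons b l)
    then have l: "op_path u l" and b: "b \<in> A" "hd b = path_end u l" by auto
    let ?v = "path_end u l" and ?j = "g u l \<oplus>\<^bsub>M\<^esub> \<delta> (r u l)"
    have v: "?v \<in> V" by (rule path_end_V[OF l])
    from Cons.IH[OF l] have rc: "r u l \<in> carrier M" and er: "e ?v \<bullet> r u l = r u l" and j: "?j \<in> JM M" by auto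
    have ej: "e ?v \<bullet> ?j = ?j"
      using er lmod_hom_smult[OF \<delta> e_closed[OF v] rc, symmetric]
      by (simp add: M.smult_r_distr e_closed v g l \<delta>c rc)
    let ?t = "r u \<circ> (\<lambda>a. a # l)"
    have t: "?t a \<in> carrier M" "e (tl a) \<bullet> ?t a = ?t a" if "a \<in> A" for a
      using dec[OF j v ej] that by (auto simp: r_Cons)
    have tsum: "finsum M (\<lambda>a. al a \<bullet> ?t a) {a \<in> A. hd a = ?v} = ?j"
      using dec[OF j v ej] by (simp add: r_Cons)
    let ?B = "{a \<in> A. hd a = ?v}"
    have gc: "g u (a # l) \<in> carrier M" "e (tl a) \<bullet> g u (a # l) = g u (a # l)" if "a \<in> ?B" for a
      using g[of u "a # l"] that l by auto
    have al\<delta>: "al a \<bullet> \<delta> (?t a) = \<delta> (al a \<bullet> ?t a)" if "a \<in> A" for a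
      using lmod_hom_smult[OF \<delta> al_closed[OF that] t(1)[OF that]] by simp
    \<comment> \<open>The right-hand sides of the equations at the extended paths. The computation
      below shows that, multiplied by their arrows, they sum to \<open>\<delta> (g u l)\<close> plus
      the sum in the hypothesis on \<open>g\<close>, which is zero.\<close>
    let ?s = "\<lambda>a. g u (a # l) \<oplus>\<^bsub>M\<^esub> \<delta> (?t a)"
    have sc: "?s a \<in> carrier M" if "a \<in> ?B" for a using that gc t \<delta>c by auto
    have c1: "(\<lambda>a. al a \<bullet> g u (a # l)) \<in> ?B \<rightarrow> carrier M" using gc by (auto intro!: M.smult_closed al_closed)
    have c2: "(\<lambda>a. al a \<bullet> ?t a) \<in> ?B \<rightarrow> carrier M" using t by (auto intro!: M.smult_closed al_closed)
    have c3: "(\<lambda>a. al a \<bullet> \<delta> (?t a)) \<in> ?B \<rightarrow> carrier M" using t \<delta>c by (auto intro!: M.smult_closed al_closed)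
    have "finsum M (\<lambda>a. al a \<bullet> ?s a) ?B = finsum M (\<lambda>a. al a \<bullet> g u (a # l) \<oplus>\<^bsub>M\<^esub> al a \<bullet> \<delta> (?t a)) ?B"
      by (rule M.M.finsum_cong'[OF refl])
         (use c1 c3 gc t \<delta>c in \<open>auto simp: M.smult_r_distr al_closed Pi_iff\<close>)
    also have "\<dots> = finsum M (\<lambda>a. al a \<bullet> g u (a # l)) ?B \<oplus>\<^bsub>M\<^esub> finsum M (\<lambda>a. al a \<bullet> \<delta> (?t a)) ?B"
      by (rule M.M.finsum_addf[OF c1 c3])
    also have "finsum M (\<lambda>a. al a \<bullet> \<delta> (?t a)) ?B = finsum M (\<lambda>a. \<delta> (al a \<bullet> ?t a)) ?B"
      by (rule M.M.finsum_cong'[OF refl]) (use c2 \<delta>c al\<delta> in \<open>auto simp: Pi_iff\<close>)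
    also have "\<dots> = \<delta> ?j"
      unfolding tsum[symmetric]
      by (rule lmod_hom_finsum[OF \<delta> M.left_module_axioms M.left_module_axioms c2, symmetric])
    also have "\<delta> ?j = \<delta> (g u l)"
      by (simp add: lmod_hom_add[OF \<delta>] g l \<delta>c rc \<delta>\<delta>)
    also have "finsum M (\<lambda>a. al a \<bullet> g u (a # l)) ?B \<oplus>\<^bsub>M\<^esub> \<delta> (g u l) = \<zero>\<^bsub>M\<^esub>"
      using \<delta>g[OF l] M.M.a_comm[OF \<delta>c[OF g(1)[OF l]] M.M.finsum_closed[OF c1]] by simp
    finally have s0: "finsum M (\<lambda>a. al a \<bullet> ?s a) ?B = \<zero>\<^bsub>M\<^esub>" .
    \<comment> \<open>Injectivity is stated for sums over all arrows, so arrows that do not extend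
      the path receive the vector zero.\<close>
    let ?s' = "\<lambda>a. if hd a = ?v then ?s a else \<zero>\<^bsub>M\<^esub>"
    have "?s' b \<in> JM M"
    proof (rule projective_arrow_injective[OF P _ _ _ b(1)])
      show "?s' a \<in> carrier M" if "a \<in> A" for a using sc that by auto
      show "e (tl a) \<bullet> ?s' a = ?s' a" if a: "a \<in> A" for a
        using gc[of a] t[OF a] a lmod_hom_smult[OF \<delta> e_closed[OF tl[OF a]] t(1)[OF a], symmetric]
        by (auto simp: M.smult_r_distr e_closed tl \<delta>c)
      show "finsum M (\<lambda>a. al a \<bullet> ?s' a) A = \<zero>\<^bsub>M\<^esub>"
        using restricted_sum[of "\<lambda>a. hd a = ?v" ?s] sc s0 by simp
    qed
    then show ?case using b t by simp
  qed
  show thesis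
  proof (rule that[of r])
    fix u l assume l: "op_path u l"
    let ?v = "path_end u l" and ?j = "g u l \<oplus>\<^bsub>M\<^esub> \<delta> (r u l)"
    from main[OF l] show rc: "r u l \<in> carrier M" and er: "e ?v \<bullet> r u l = r u l" by auto
    have v: "?v \<in> V" by (rule path_end_V[OF l])
    have "e ?v \<bullet> ?j = ?j"
      using er lmod_hom_smult[OF \<delta> e_closed[OF v] rc, symmetric]
      by (simp add: M.smult_r_distr e_closed v g l \<delta>c rc)
    with dec[OF _ v this] main[OF l]
    show "finsum M (\<lambda>a. al a \<bullet> r u (a # l)) {a \<in> A. hd a = ?v} = ?j"
      by (simp add: r_Cons)
  qed (rule r_Nil)
qed

end

section \<open>Contractibility\<close>

locale rsz_dmodule = rsz_module L V A tl hd ev ar cv ca M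
  for L :: "('r, 'q) ring_scheme" (structure) and V :: "'v set" and A :: "'e set" and tl hd
    and ev :: "'v \<Rightarrow> 'k::field \<Rightarrow> 'r" and ar cv ca and M :: "('r, 'm) dmodule" +
  assumes diff: "diff_module L M" and proj: "lmod_projective L M"
begin

lemmas d = diff_moduleD[OF diff]

text \<open>The preimage in \<open>M\<close> of the cycles of \<open>M/JM\<close>.\<close>

definition cycles where "cycles = {x \<in> carrier M. dif M x \<in> JM M}"

lemma d_zero: "dif M \<zero>\<^bsub>M\<^esub> = \<zero>\<^bsub>M\<^esub>"
  by (rule lmod_hom_zero[OF d(2) d(1) d(1)])

lemma d_minus: "x \<in> carrier M \<Longrightarrow> dif M (\<ominus>\<^bsub>M\<^esub> x) = \<ominus>\<^bsub>M\<^esub> dif M x"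
  by (rule lmod_hom_minus[OF d(2) d(1) d(1)])

lemma JM_cancel: "x \<in> carrier M \<Longrightarrow> j \<in> JM M \<Longrightarrow> x \<oplus>\<^bsub>M\<^esub> j \<in> JM M \<Longrightarrow> x \<in> JM M"
proof -
  assume x: "x \<in> carrier M" and j: "j \<in> JM M" and xj: "x \<oplus>\<^bsub>M\<^esub> j \<in> JM M"
  have "x \<oplus>\<^bsub>M\<^esub> j \<ominus>\<^bsub>M\<^esub> j = x"
    using x JM_subset[OF j] by (simp add: a_minus_def M.M.a_assoc M.M.r_neg)
  then show ?thesis using JM_diff[OF xj j] by simp
qed

text \<open>Graphs of submodules of \<open>M \<times> M\<close> that are partial right inverses of the differential modulo the radical.\<close>

definition partial_contraction :: "('m \<times> 'm) set \<Rightarrow> bool" where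
  "partial_contraction G \<longleftrightarrow> G \<subseteq> cycles \<times> carrier M \<and> JM M \<times> JM M \<subseteq> G \<and>
     (\<forall>x y x' y'. (x, y) \<in> G \<longrightarrow> (x', y') \<in> G \<longrightarrow> (x \<oplus>\<^bsub>M\<^esub> x', y \<oplus>\<^bsub>M\<^esub> y') \<in> G) \<and>
     (\<forall>a\<in>carrier L. \<forall>x y. (x, y) \<in> G \<longrightarrow> (a \<bullet> x, a \<bullet> y) \<in> G) \<and>
     (\<forall>x y. (x, y) \<in> G \<longrightarrow> (\<exists>j\<in>JM M. dif M y = x \<oplus>\<^bsub>M\<^esub> j)) \<and>
     (\<forall>x y. (x, y) \<in> G \<longrightarrow> x \<in> JM M \<longrightarrow> y \<in> JM M)"

lemma partial_contractionD:
  assumes "partial_contraction G"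
  shows "(x, y) \<in> G \<Longrightarrow> x \<in> cycles" "(x, y) \<in> G \<Longrightarrow> x \<in> carrier M" "(x, y) \<in> G \<Longrightarrow> y \<in> carrier M"
    "i \<in> JM M \<Longrightarrow> j \<in> JM M \<Longrightarrow> (i, j) \<in> G"
    "(x, y) \<in> G \<Longrightarrow> (x', y') \<in> G \<Longrightarrow> (x \<oplus>\<^bsub>M\<^esub> x', y \<oplus>\<^bsub>M\<^esub> y') \<in> G"
    "a \<in> carrier L \<Longrightarrow> (x, y) \<in> G \<Longrightarrow> (a \<bullet> x, a \<bullet> y) \<in> G"
    "(x, y) \<in> G \<Longrightarrow> \<exists>j\<in>JM M. dif M y = x \<oplus>\<^bsub>M\<^esub> j"
    "(x, y) \<in> G \<Longrightarrow> x \<in> JM M \<Longrightarrow> y \<in> JM M"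
proof -
  from assms have *: "G \<subseteq> cycles \<times> carrier M" "JM M \<times> JM M \<subseteq> G"
    and "\<forall>x y x' y'. (x, y) \<in> G \<longrightarrow> (x', y') \<in> G \<longrightarrow> (x \<oplus>\<^bsub>M\<^esub> x', y \<oplus>\<^bsub>M\<^esub> y') \<in> G"
    and "\<forall>a\<in>carrier L. \<forall>x y. (x, y) \<in> G \<longrightarrow> (a \<bullet> x, a \<bullet> y) \<in> G"
    and "\<forall>x y. (x, y) \<in> G \<longrightarrow> (\<exists>j\<in>JM M. dif M y = x \<oplus>\<^bsub>M\<^esub> j)"
    and "\<forall>x y. (x, y) \<in> G \<longrightarrow> x \<in> JM M \<longrightarrow> y \<in> JM M"
    unfolding partial_contraction_def by simp_all
  then show "(x, y) \<in> G \<Longrightarrow> (x', y') \<in> G \<Longrightarrow> (x \<oplus>\<^bsub>M\<^esub> x', y \<oplus>\<^bsub>M\<^esub> y') \<in> G"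
    "a \<in> carrier L \<Longrightarrow> (x, y) \<in> G \<Longrightarrow> (a \<bullet> x, a \<bullet> y) \<in> G"
    "(x, y) \<in> G \<Longrightarrow> \<exists>j\<in>JM M. dif M y = x \<oplus>\<^bsub>M\<^esub> j"
    "(x, y) \<in> G \<Longrightarrow> x \<in> JM M \<Longrightarrow> y \<in> JM M" by simp_all
  from * show "(x, y) \<in> G \<Longrightarrow> x \<in> cycles" "(x, y) \<in> G \<Longrightarrow> y \<in> carrier M"
    "i \<in> JM M \<Longrightarrow> j \<in> JM M \<Longrightarrow> (i, j) \<in> G" by auto
  then show "(x, y) \<in> G \<Longrightarrow> x \<in> carrier M" by (simp add: cycles_def)
qed

text \<open>The starting point for Zorn's lemma: over \<open>M/JM\<close> this is the zero map on
  the zero submodule. That a relation contains \<open>JM \<times> JM\<close> lets it descend to the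
  quotient, and the last clause of the definition makes it single valued there.\<close>

lemma partial_contraction_JM: "partial_contraction (JM M \<times> JM M)"
proof -
  have "\<exists>j\<in>JM M. dif M y = x \<oplus>\<^bsub>M\<^esub> j" if "x \<in> JM M" "y \<in> JM M" for x y
  proof (rule bexI)
    note c = JM_subset[OF that(1)] JM_subset[OF hom_JM[OF d(2) that(2)]]
    show "dif M y = x \<oplus>\<^bsub>M\<^esub> (dif M y \<ominus>\<^bsub>M\<^esub> x)"
      using c by (simp add: a_minus_def M.M.a_lcomm[of x] M.M.r_neg)
    show "dif M y \<ominus>\<^bsub>M\<^esub> x \<in> JM M" by (rule JM_diff[OF hom_JM[OF d(2) that(2)] that(1)])
  qed
  then show ?thesis
    unfolding partial_contraction_def cycles_def
    using JM_add JM_smult JM_subset hom_JM[OF d(2)] by auto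
qed

lemma partial_contraction_chain:
  assumes C: "\<C> \<noteq> {}" "subset.chain {G. partial_contraction G} \<C>"
  shows "partial_contraction (\<Union>\<C>)"
proof -
  have pc: "partial_contraction G" if "G \<in> \<C>" for G using C that by (auto simp: subset.chain_def)
  note D = partial_contractionD[OF pc]
  have "(x \<oplus>\<^bsub>M\<^esub> x', y \<oplus>\<^bsub>M\<^esub> y') \<in> \<Union>\<C>" if xy: "(x, y) \<in> \<Union>\<C>" "(x', y') \<in> \<Union>\<C>" for x y x' y'
  proof -
    obtain G G' where G: "G \<in> \<C>" "(x, y) \<in> G" "G' \<in> \<C>" "(x', y') \<in> G'" using xy by blast
    then have "G \<subseteq> G' \<or> G' \<subseteq> G" using C by (auto simp: subset.chain_def)
    then show ?thesis using G D(5)[of G] D(5)[of G'] by blast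
  qed
  moreover have "\<Union>\<C> \<subseteq> cycles \<times> carrier M"
  proof
    fix p assume "p \<in> \<Union>\<C>"
    then show "p \<in> cycles \<times> carrier M" using D(1,3) by (cases p) auto
  qed
  moreover have "JM M \<times> JM M \<subseteq> \<Union>\<C>"
  proof -
    obtain G where "G \<in> \<C>" using C(1) by blast
    then show ?thesis using D(4)[of G] by auto
  qed
  moreover have "(a \<bullet> x, a \<bullet> y) \<in> \<Union>\<C>" if "a \<in> carrier L" "(x, y) \<in> \<Union>\<C>" for a x y
    using D(6) that by (elim UnionE) (rule UnionI)
  moreover have "\<exists>j\<in>JM M. dif M y = x \<oplus>\<^bsub>M\<^esub> j" if "(x, y) \<in> \<Union>\<C>" for x y
    using D(7) that by (elim UnionE)
  moreover have "y \<in> JM M" if "(x, y) \<in> \<Union>\<C>" "x \<in> JM M" for x y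
    using D(8) that by (elim UnionE)
  ultimately show ?thesis
    unfolding partial_contraction_def by (intro conjI allI impI ballI)
qed

lemma cycles_smult: "a \<in> carrier L \<Longrightarrow> x \<in> cycles \<Longrightarrow> a \<bullet> x \<in> cycles"
  by (auto simp: cycles_def lmod_hom_smult[OF d(2)] intro!: M.smult_closed JM_smult)

lemma cycles_add: "x \<in> cycles \<Longrightarrow> y \<in> cycles \<Longrightarrow> x \<oplus>\<^bsub>M\<^esub> y \<in> cycles"
  by (auto simp: cycles_def lmod_hom_add[OF d(2)] intro!: JM_add)

lemma partial_contraction_finsum:
  assumes G: "partial_contraction G" and "finite F" "\<And>i. i \<in> F \<Longrightarrow> (x i, y i) \<in> G"
  shows "(finsum M x F, finsum M y F) \<in> G"
  using assms(2,3)
proof (induction F rule: finite_induct)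
  case empty
  then show ?case using partial_contractionD(4)[OF G JM_zero JM_zero] by simp
next
  case (insert i F)
  then have "x \<in> F \<rightarrow> carrier M" "y \<in> F \<rightarrow> carrier M" "x i \<in> carrier M" "y i \<in> carrier M"
    using partial_contractionD(2,3)[OF G] by blast+
  then show ?case
    using insert partial_contractionD(5)[OF G] by simp
qed

lemma partial_contraction_extend:
  assumes G: "partial_contraction G" and v: "v \<in> V"
    and z: "z \<in> cycles" "e v \<bullet> z = z" "z \<notin> fst ` G"
    and y: "y \<in> carrier M" "e v \<bullet> y = y" and j: "j \<in> JM M" "dif M y = z \<oplus>\<^bsub>M\<^esub> j"
  shows "partial_contraction {(x \<oplus>\<^bsub>M\<^esub> a \<bullet> z, w \<oplus>\<^bsub>M\<^esub> a \<bullet> y) | x w a. (x, w) \<in> G \<and> a \<in> carrier L}"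
    (is "partial_contraction ?G'")
proof -
  note D = partial_contractionD[OF G]
  have zc: "z \<in> carrier M" using z by (simp add: cycles_def)
  have I: "(x \<oplus>\<^bsub>M\<^esub> a \<bullet> z, w \<oplus>\<^bsub>M\<^esub> a \<bullet> y) \<in> ?G'" if "(x, w) \<in> G" "a \<in> carrier L" for x w a
    using that by blast
  note sc = M.smult_closed
  show ?thesis
    unfolding partial_contraction_def
  proof (intro conjI allI impI ballI)
    show "?G' \<subseteq> cycles \<times> carrier M"
      using D(1,3) sc[OF _ y(1)] cycles_add[OF _ cycles_smult[OF _ z(1)]] by fastforce
    show "JM M \<times> JM M \<subseteq> ?G'"
    proof
      fix p assume "p \<in> JM M \<times> JM M"
      then obtain i k where p: "p = (i, k)" "i \<in> JM M" "k \<in> JM M" by blast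
      show "p \<in> ?G'"
        using I[OF D(4)[OF p(2,3)] zero_closed] p JM_subset zc y by simp
    qed
  next
    fix p q p' q' assume "(p, q) \<in> ?G'" "(p', q') \<in> ?G'"
    then obtain x w a x' w' a' where eq: "p = x \<oplus>\<^bsub>M\<^esub> a \<bullet> z" "q = w \<oplus>\<^bsub>M\<^esub> a \<bullet> y" "(x, w) \<in> G" "a \<in> carrier L"
      "p' = x' \<oplus>\<^bsub>M\<^esub> a' \<bullet> z" "q' = w' \<oplus>\<^bsub>M\<^esub> a' \<bullet> y" "(x', w') \<in> G" "a' \<in> carrier L" by blast
    note c = D(2,3)[OF eq(3)] D(2,3)[OF eq(7)]
    have "p \<oplus>\<^bsub>M\<^esub> p' = (x \<oplus>\<^bsub>M\<^esub> x') \<oplus>\<^bsub>M\<^esub> (a \<oplus> a') \<bullet> z" "q \<oplus>\<^bsub>M\<^esub> q' = (w \<oplus>\<^bsub>M\<^esub> w') \<oplus>\<^bsub>M\<^esub> (a \<oplus> a') \<bullet> y"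
      unfolding eq using c eq(4,8) zc y by (simp_all add: M.smult_l_distr sc M.M.a_ac)
    then show "(p \<oplus>\<^bsub>M\<^esub> p', q \<oplus>\<^bsub>M\<^esub> q') \<in> ?G'"
      using I[OF D(5)[OF eq(3,7)] add.m_closed[OF eq(4,8)]] by simp
  next
    fix b p q assume b: "b \<in> carrier L" and "(p, q) \<in> ?G'"
    then obtain x w a where eq: "p = x \<oplus>\<^bsub>M\<^esub> a \<bullet> z" "q = w \<oplus>\<^bsub>M\<^esub> a \<bullet> y" "(x, w) \<in> G" "a \<in> carrier L" by blast
    note c = D(2,3)[OF eq(3)]
    have "b \<bullet> p = b \<bullet> x \<oplus>\<^bsub>M\<^esub> (b \<otimes> a) \<bullet> z" "b \<bullet> q = b \<bullet> w \<oplus>\<^bsub>M\<^esub> (b \<otimes> a) \<bullet> y"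
      unfolding eq using c eq(4) zc y b by (simp_all add: M.smult_r_distr M.smult_assoc sc)
    then show "(b \<bullet> p, b \<bullet> q) \<in> ?G'"
      using I[OF D(6)[OF b eq(3)] m_closed[OF b eq(4)]] by simp
  next
    fix p q assume "(p, q) \<in> ?G'"
    then obtain x w a where eq: "p = x \<oplus>\<^bsub>M\<^esub> a \<bullet> z" "q = w \<oplus>\<^bsub>M\<^esub> a \<bullet> y" "(x, w) \<in> G" "a \<in> carrier L" by blast
    note c = D(2,3)[OF eq(3)]
    obtain i where i: "i \<in> JM M" "dif M w = x \<oplus>\<^bsub>M\<^esub> i" using D(7)[OF eq(3)] by blast
    have "dif M q = dif M w \<oplus>\<^bsub>M\<^esub> a \<bullet> dif M y"
      unfolding eq using c eq(4) y by (simp add: lmod_hom_add[OF d(2)] lmod_hom_smult[OF d(2)] sc)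
    also have "\<dots> = p \<oplus>\<^bsub>M\<^esub> (i \<oplus>\<^bsub>M\<^esub> a \<bullet> j)"
      unfolding i(2) j(2) eq(1) using c eq(4) zc JM_subset[OF i(1)] JM_subset[OF j(1)]
      by (simp add: M.smult_r_distr sc M.M.a_ac)
    finally have dq: "dif M q = p \<oplus>\<^bsub>M\<^esub> (i \<oplus>\<^bsub>M\<^esub> a \<bullet> j)" .
    then show "\<exists>j\<in>JM M. dif M q = p \<oplus>\<^bsub>M\<^esub> j"
      by (rule bexI) (intro JM_add i JM_smult eq j)
    assume p: "p \<in> JM M"
    obtain i1 where i1: "i1 \<in> JM M" "a \<bullet> z = ev v (cv v a) \<bullet> z \<oplus>\<^bsub>M\<^esub> i1"
      using smult_mod_JM[OF eq(4) v zc z(2)] by blast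
    obtain i2 where i2: "i2 \<in> JM M" "a \<bullet> y = ev v (cv v a) \<bullet> y \<oplus>\<^bsub>M\<^esub> i2"
      using smult_mod_JM[OF eq(4) v y] by blast
    let ?c = "cv v a"
    note i1c = JM_subset[OF i1(1)] and evc = ev_closed[OF v, of ?c]
    have pJ: "x \<oplus>\<^bsub>M\<^esub> ev v ?c \<bullet> z \<in> JM M"
      by (rule JM_cancel[OF _ i1(1)])
         (use p c zc i1c evc in \<open>auto simp: eq(1) i1(2) sc M.M.a_assoc\<close>)
    have c0: "?c = 0"
    proof (rule ccontr)
      assume c0: "?c \<noteq> 0"
      define k where "k = ev v (- inverse ?c)"
      have k: "k \<in> carrier L" by (simp add: k_def ev_closed v)
      have "k \<bullet> (x \<oplus>\<^bsub>M\<^esub> ev v ?c \<bullet> z) = k \<bullet> x \<oplus>\<^bsub>M\<^esub> (k \<otimes> ev v ?c) \<bullet> z"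
        using k evc c zc by (simp add: M.smult_r_distr M.smult_assoc sc)
      also have "k \<otimes> ev v ?c = ev v (-1)"
        using c0 by (simp add: k_def ev_ev v)
      finally have kx: "k \<bullet> x \<oplus>\<^bsub>M\<^esub> ev v (-1) \<bullet> z \<in> JM M" (is "?i \<in> _")
        using JM_smult[OF k pJ] by simp
      have "ev v (-1) \<otimes> ev v (-1) = e v" by (simp add: ev_ev v)
      then have "ev v (-1) \<bullet> ev v (-1) \<bullet> z = z"
        using M.smult_assoc[OF ev_closed[OF v] ev_closed[OF v] zc, of "-1" "-1"] z(2) by simp
      moreover have "ev v (-1) \<bullet> ?i = ev v (-1) \<bullet> k \<bullet> x \<oplus>\<^bsub>M\<^esub> ev v (-1) \<bullet> ev v (-1) \<bullet> z"
        by (rule M.smult_r_distr) (use k c zc in \<open>auto intro!: sc ev_closed v\<close>)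
      ultimately have i': "ev v (-1) \<bullet> ?i = ev v (-1) \<bullet> k \<bullet> x \<oplus>\<^bsub>M\<^esub> z" by simp
      \<comment> \<open>With this \<open>b\<close> the vector \<open>z\<close> equals
        \<open>b \<bullet> x\<close> plus an element of \<open>JM\<close>; in effect
        \<open>b\<close> acts at \<open>v\<close> as the negative inverse of the scalar
        \<open>c\<close>. Both summands have partners under \<open>G\<close>, hence so does
        \<open>z\<close>.\<close>
      define b where "b = \<ominus> \<one> \<otimes> ev v (-1) \<otimes> k"
      have b: "b \<in> carrier L" using k by (simp add: b_def ev_closed v)
      have bx: "b \<bullet> x = \<ominus>\<^bsub>M\<^esub> (ev v (-1) \<bullet> k \<bullet> x)"
      proof -
        let ?w = "ev v (-1) \<bullet> k \<bullet> x"
        have w: "?w \<in> carrier M" using k c by (auto intro!: sc ev_closed v)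
        have "b \<bullet> x = (\<ominus> \<one>) \<bullet> ?w"
          unfolding b_def using k c by (simp add: M.smult_assoc sc ev_closed v)
        moreover have "(\<ominus> \<one>) \<bullet> ?w \<oplus>\<^bsub>M\<^esub> ?w = (\<ominus> \<one> \<oplus> \<one>) \<bullet> ?w"
          using w by (simp add: M.smult_l_distr M.smult_one)
        ultimately show ?thesis
          using w by (simp add: l_neg sc M.M.minus_equality)
      qed
      have "(b \<bullet> x \<oplus>\<^bsub>M\<^esub> ev v (-1) \<bullet> ?i, b \<bullet> w \<oplus>\<^bsub>M\<^esub> \<zero>\<^bsub>M\<^esub>) \<in> G"
        by (rule D(5)[OF D(6)[OF b eq(3)] D(4)[OF JM_smult[OF ev_closed[OF v] kx] JM_zero]])
      moreover have "b \<bullet> x \<oplus>\<^bsub>M\<^esub> ev v (-1) \<bullet> ?i = z"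
        unfolding bx i' using k c zc
        by (simp add: sc ev_closed v M.M.l_neg flip: M.M.a_assoc)
      ultimately show False using z(3) by (metis fst_conv imageI)
    qed
    then have ev0: "ev v ?c \<bullet> z = \<zero>\<^bsub>M\<^esub>" "ev v ?c \<bullet> y = \<zero>\<^bsub>M\<^esub>" using ev_zero[OF v] zc y by auto
    then have "x \<in> JM M" using pJ c by simp
    then have "w \<in> JM M" by (rule D(8)[OF eq(3)])
    then show "q \<in> JM M" unfolding eq(2) i2(2) using ev0 JM_subset[OF i2(1)] i2(1) by (simp add: JM_add)
  qed
qed

text \<open>A maximal partial contraction must contain every homogeneous cycle
  \<open>e v \<bullet> x\<close> in its domain, because exactness provides the preimage needed to
  adjoin it. A general cycle is the finite sum of its homogeneous parts.\<close>

lemma contraction_relation: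
  assumes exact: "\<And>x. x \<in> cycles \<Longrightarrow> \<exists>y\<in>carrier M. \<exists>j\<in>JM M. dif M y = x \<oplus>\<^bsub>M\<^esub> j"
  obtains G where "partial_contraction G" "cycles \<subseteq> fst ` G"
proof -
  let ?P = "{G. partial_contraction G}"
  have "?P \<noteq> {}" using partial_contraction_JM by blast
  then have "\<exists>K\<in>?P. \<forall>H\<in>?P. K \<subseteq> H \<longrightarrow> H = K"
    by (rule subset_Zorn_nonempty) (use partial_contraction_chain in blast)
  then obtain G where G: "partial_contraction G"
    and max: "\<And>H. partial_contraction H \<Longrightarrow> G \<subseteq> H \<Longrightarrow> H = G" by blast
  note D = partial_contractionD[OF G]
  have hom: "e v \<bullet> x \<in> fst ` G" if x: "x \<in> cycles" and v: "v \<in> V" for x v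
  proof (rule ccontr)
    let ?z = "e v \<bullet> x"
    assume n: "?z \<notin> fst ` G"
    have xc: "x \<in> carrier M" using x by (simp add: cycles_def)
    have z: "?z \<in> cycles" by (rule cycles_smult[OF e_closed[OF v] x])
    have zc: "?z \<in> carrier M" using z by (simp add: cycles_def)
    obtain y j where y: "y \<in> carrier M" and j: "j \<in> JM M" "dif M y = ?z \<oplus>\<^bsub>M\<^esub> j" using exact[OF z] by blast
    let ?G = "{(p \<oplus>\<^bsub>M\<^esub> a \<bullet> ?z, w \<oplus>\<^bsub>M\<^esub> a \<bullet> e v \<bullet> y) | p w a. (p, w) \<in> G \<and> a \<in> carrier L}"
    have eyc: "e v \<bullet> y \<in> carrier M" by (rule M.smult_closed[OF e_closed[OF v] y])
    have "dif M (e v \<bullet> y) = e v \<bullet> ?z \<oplus>\<^bsub>M\<^esub> e v \<bullet> j"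
      using lmod_hom_smult[OF d(2) e_closed[OF v] y] M.smult_r_distr[OF e_closed[OF v] zc JM_subset[OF j(1)]] j(2)
      by simp
    then have "partial_contraction ?G"
      by (intro partial_contraction_extend[OF G v z e_idem[OF v xc] n eyc e_idem[OF v y] JM_smult[OF e_closed[OF v] j(1)]])
         (simp add: e_idem v xc)
    moreover have "G \<subseteq> ?G"
    proof
      fix p assume "p \<in> G"
      moreover obtain x' w where p: "p = (x', w)" by (cases p)
      ultimately have "(x', w) \<in> G" "(x' \<oplus>\<^bsub>M\<^esub> \<zero> \<bullet> ?z, w \<oplus>\<^bsub>M\<^esub> \<zero> \<bullet> e v \<bullet> y) = p" using D(2,3) zc eyc by auto
      then show "p \<in> ?G" using zero_closed by blast
    qed
    \<comment> \<open>By maximality the extension is nothing new, yet it contains the pair obtained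
      from \<open>(0, 0)\<close> and the scalar \<open>1\<close>, whose first component is the
      vector assumed to be missing.\<close>
    ultimately have "?G = G" by (rule max)
    moreover have "(\<zero>\<^bsub>M\<^esub> \<oplus>\<^bsub>M\<^esub> \<one> \<bullet> ?z, \<zero>\<^bsub>M\<^esub> \<oplus>\<^bsub>M\<^esub> \<one> \<bullet> e v \<bullet> y) \<in> ?G"
      using D(4)[OF JM_zero JM_zero] one_closed by blast
    ultimately have "(\<zero>\<^bsub>M\<^esub> \<oplus>\<^bsub>M\<^esub> \<one> \<bullet> ?z, \<zero>\<^bsub>M\<^esub> \<oplus>\<^bsub>M\<^esub> \<one> \<bullet> e v \<bullet> y) \<in> G"
      by (rule subst)
    then have "\<zero>\<^bsub>M\<^esub> \<oplus>\<^bsub>M\<^esub> \<one> \<bullet> ?z \<in> fst ` G" by (rule image_eqI[rotated]) simp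
    then show False using n zc by (simp add: M.smult_one)
  qed
  have "x \<in> fst ` G" if x: "x \<in> cycles" for x
  proof -
    have xc: "x \<in> carrier M" using x by (simp add: cycles_def)
    have "\<forall>v\<in>V. \<exists>w. (e v \<bullet> x, w) \<in> G"
    proof
      fix v assume "v \<in> V"
      then show "\<exists>w. (e v \<bullet> x, w) \<in> G" using hom[OF x] by fastforce
    qed
    from bchoice[OF this] obtain w where "\<forall>v\<in>V. (e v \<bullet> x, w v) \<in> G" ..
    note bspec[OF this]
    then have "(finsum M (\<lambda>v. e v \<bullet> x) V, finsum M w V) \<in> G" by (rule partial_contraction_finsum[OF G fin_V])
    then show ?thesis using e_sum[OF xc] by (metis fst_conv imageI)
  qed
  then show thesis using that G by blast
qed

lemma minus_one_smult: "x \<in> carrier M \<Longrightarrow> (\<ominus> \<one>) \<bullet> x = \<ominus>\<^bsub>M\<^esub> x"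
proof -
  assume x: "x \<in> carrier M"
  have "(\<ominus> \<one>) \<bullet> x \<oplus>\<^bsub>M\<^esub> x = (\<ominus> \<one> \<oplus> \<one>) \<bullet> x"
    using x by (simp add: M.smult_l_distr M.smult_one)
  then show ?thesis
    using x by (intro M.M.minus_equality[symmetric]) (auto simp: l_neg intro!: M.smult_closed)
qed

text \<open>The contraction modulo \<open>JM\<close> is kept as a relation \<open>S\<close> that is
  total and closed under addition and scalars. Closure is what a dual basis needs: any choice of
  partners for the elements \<open>b w\<close> extends to a module map whose graph stays inside
  \<open>S\<close>, although the choice itself is not linear.\<close>

lemma exact_contractible:
  assumes exact: "\<And>x. x \<in> cycles \<Longrightarrow> \<exists>y\<in>carrier M. \<exists>j\<in>JM M. dif M y = x \<oplus>\<^bsub>M\<^esub> j"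
  shows "(\<lambda>x\<in>carrier M. x) \<in> null_homotopic L M M"
proof -
  obtain G where G: "partial_contraction G" and tot: "cycles \<subseteq> fst ` G" using contraction_relation[OF exact] .
  note D = partial_contractionD[OF G]
  interpret MM: diff_module_pair L M M by unfold_locales (fact diff)+
  have neg: "(\<ominus>\<^bsub>M\<^esub> x, \<ominus>\<^bsub>M\<^esub> y) \<in> G" if "(x, y) \<in> G" for x y
    using D(6)[OF add.inv_closed[OF one_closed] that] minus_one_smult D(2,3)[OF that] by simp
  text \<open>If \<open>h\<close> is a right inverse of the differential on cycles modulo the radical, then
    \<open>x \<mapsto> h (x - h (d x))\<close> is a contraction modulo the radical; \<open>S\<close> is the corresponding relation.\<close>
  define S where "S = {(x, y). x \<in> carrier M \<and> (\<exists>w. (dif M x, w) \<in> G \<and> (x \<ominus>\<^bsub>M\<^esub> w, y) \<in> G)}"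
  have Sc: "x \<in> carrier M" "y \<in> carrier M" if "(x, y) \<in> S" for x y
    using that D(3) by (auto simp: S_def)
  have S_add: "(x \<oplus>\<^bsub>M\<^esub> x', y \<oplus>\<^bsub>M\<^esub> y') \<in> S" if xy: "(x, y) \<in> S" "(x', y') \<in> S" for x y x' y'
  proof -
    obtain w where x: "x \<in> carrier M" and w: "(dif M x, w) \<in> G" "(x \<ominus>\<^bsub>M\<^esub> w, y) \<in> G"
      using xy(1) by (auto simp: S_def)
    obtain w' where x': "x' \<in> carrier M" and w': "(dif M x', w') \<in> G" "(x' \<ominus>\<^bsub>M\<^esub> w', y') \<in> G"
      using xy(2) by (auto simp: S_def)
    note wc = D(3)[OF w(1)] D(3)[OF w'(1)]
    have "x \<oplus>\<^bsub>M\<^esub> x' \<ominus>\<^bsub>M\<^esub> (w \<oplus>\<^bsub>M\<^esub> w') = (x \<ominus>\<^bsub>M\<^esub> w) \<oplus>\<^bsub>M\<^esub> (x' \<ominus>\<^bsub>M\<^esub> w')"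
      using x x' wc by (simp add: a_minus_def M.M.minus_add M.M.a_ac)
    then show ?thesis
      using D(5)[OF w(1) w'(1)] D(5)[OF w(2) w'(2)] x x'
      unfolding S_def by (auto simp: lmod_hom_add[OF d(2)])
  qed
  have S_smult: "(a \<bullet> x, a \<bullet> y) \<in> S" if a: "a \<in> carrier L" and xy: "(x, y) \<in> S" for a x y
  proof -
    obtain w where x: "x \<in> carrier M" and w: "(dif M x, w) \<in> G" "(x \<ominus>\<^bsub>M\<^esub> w, y) \<in> G"
      using xy by (auto simp: S_def)
    note wc = D(3)[OF w(1)]
    have "a \<bullet> x \<ominus>\<^bsub>M\<^esub> a \<bullet> w = a \<bullet> (x \<ominus>\<^bsub>M\<^esub> w)"
      using x wc a by (simp add: a_minus_def M.smult_r_distr M.smult_r_minus)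
    then show ?thesis
      using D(6)[OF a w(1)] D(6)[OF a w(2)] x a
      unfolding S_def by (auto simp: lmod_hom_smult[OF d(2)] M.smult_closed)
  qed
  have S_zero: "(\<zero>\<^bsub>M\<^esub>, \<zero>\<^bsub>M\<^esub>) \<in> S"
  proof -
    have "\<zero>\<^bsub>M\<^esub> \<ominus>\<^bsub>M\<^esub> \<zero>\<^bsub>M\<^esub> = \<zero>\<^bsub>M\<^esub>" unfolding a_minus_def by (rule M.M.r_neg[OF M.M.zero_closed])
    then show ?thesis
      using D(4)[OF JM_zero JM_zero] unfolding S_def mem_Collect_eq prod.case d_zero
      by (intro conjI M.M.zero_closed exI[of _ "\<zero>\<^bsub>M\<^esub>"]) (assumption, simp only:)
  qed
  have S_finsum: "(finsum M p F, finsum M q F) \<in> S" if "finite F" "\<And>i. i \<in> F \<Longrightarrow> (p i, q i) \<in> S"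
    for F :: "'m set" and p q
    using that
  proof (induction F rule: finite_induct)
    case empty
    then show ?case using S_zero by simp
  next
    case (insert i F)
    then have "p \<in> F \<rightarrow> carrier M" "q \<in> F \<rightarrow> carrier M" "p i \<in> carrier M" "q i \<in> carrier M"
      using Sc by blast+
    then show ?case using insert S_add by simp
  qed
  have S_tot: "\<exists>y. (x, y) \<in> S" if x: "x \<in> carrier M" for x
  proof -
    have "dif M x \<in> cycles" using x d JM_zero by (simp add: cycles_def)
    then obtain w where w: "(dif M x, w) \<in> G" using tot by fastforce
    obtain j where j: "j \<in> JM M" "dif M w = dif M x \<oplus>\<^bsub>M\<^esub> j" using D(7)[OF w] by blast
    note c = x D(3)[OF w] d(4)[OF x] JM_subset[OF j(1)]
    have "dif M (x \<ominus>\<^bsub>M\<^esub> w) = \<ominus>\<^bsub>M\<^esub> j"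
      using c by (simp add: a_minus_def lmod_hom_add[OF d(2)] d_minus j(2) M.M.minus_add M.M.r_neg
          flip: M.M.a_assoc)
    then have "x \<ominus>\<^bsub>M\<^esub> w \<in> cycles" using c JM_minus[OF j(1)] by (simp add: cycles_def)
    then obtain y where "(x \<ominus>\<^bsub>M\<^esub> w, y) \<in> G" using tot by fastforce
    then show ?thesis using x w by (auto simp: S_def)
  qed
  have S_htpy: "\<exists>j\<in>JM M. dif M y \<oplus>\<^bsub>M\<^esub> y' = x \<oplus>\<^bsub>M\<^esub> j" if xy: "(x, y) \<in> S" "(dif M x, y') \<in> S" for x y y'
  proof -
    obtain w where x: "x \<in> carrier M" and w: "(dif M x, w) \<in> G" "(x \<ominus>\<^bsub>M\<^esub> w, y) \<in> G"
      using xy(1) by (auto simp: S_def)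
    \<comment> \<open>The partner of the differential of the differential of \<open>x\<close>, that
      is, of zero; single-valuedness places it in \<open>JM\<close>.\<close>
    obtain w0 where w0: "(\<zero>\<^bsub>M\<^esub>, w0) \<in> G" "(dif M x \<ominus>\<^bsub>M\<^esub> w0, y') \<in> G"
      using xy(2) d(3)[OF x] by (auto simp: S_def)
    have w0J: "w0 \<in> JM M" by (rule D(8)[OF w0(1) JM_zero])
    obtain j where j: "j \<in> JM M" "dif M y = x \<ominus>\<^bsub>M\<^esub> w \<oplus>\<^bsub>M\<^esub> j" using D(7)[OF w(2)] by blast
    note c = x d(4)[OF x] D(3)[OF w(1)] D(3)[OF w0(2)] JM_subset[OF w0J] JM_subset[OF j(1)]
    have "(dif M x \<ominus>\<^bsub>M\<^esub> w0) \<oplus>\<^bsub>M\<^esub> \<ominus>\<^bsub>M\<^esub> dif M x = \<ominus>\<^bsub>M\<^esub> w0"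
      using c M.M.a_lcomm[of "dif M x" "\<ominus>\<^bsub>M\<^esub> w0" "\<ominus>\<^bsub>M\<^esub> dif M x"]
      by (simp add: a_minus_def M.M.a_assoc M.M.r_neg)
    \<comment> \<open>Subtracting the pair of the differential of \<open>x\<close> leaves a pair
      whose first component lies in \<open>JM\<close>, so its second component does too. Thus
      \<open>y'\<close> agrees with \<open>w\<close> modulo \<open>JM\<close>.\<close>
    then have "(\<ominus>\<^bsub>M\<^esub> w0, y' \<oplus>\<^bsub>M\<^esub> \<ominus>\<^bsub>M\<^esub> w) \<in> G" using D(5)[OF w0(2) neg[OF w(1)]] by simp
    then have J: "y' \<oplus>\<^bsub>M\<^esub> \<ominus>\<^bsub>M\<^esub> w \<in> JM M" by (rule D(8)) (rule JM_minus[OF w0J])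
    have "dif M y \<oplus>\<^bsub>M\<^esub> y' = x \<oplus>\<^bsub>M\<^esub> (j \<oplus>\<^bsub>M\<^esub> (y' \<oplus>\<^bsub>M\<^esub> \<ominus>\<^bsub>M\<^esub> w))"
      unfolding j(2) using c by (simp add: a_minus_def M.M.a_ac)
    then show ?thesis using JM_add[OF j(1) J] by blast
  qed
  \<comment> \<open>An arbitrary partner under \<open>S\<close>, neither additive nor compatible
    with scalars.\<close>
  define s where "s x = (SOME y. (x, y) \<in> S)" for x
  have s: "(x, s x) \<in> S" if "x \<in> carrier M" for x
    unfolding s_def by (rule someI_ex[OF S_tot[OF that]])
  obtain W :: "'m set" and b \<phi> where db: "dual_basis L M W b \<phi>" using projective_dual_basis[OF proj] .
  note B = dual_basisD[OF db]
  have sb: "s (b w) \<in> carrier M" if "w \<in> W" for w using Sc(2)[OF s[OF B(1)[OF that]]] .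
  \<comment> \<open>The module map obtained by prescribing the chosen partners on the dual basis.
    Its graph lies in \<open>S\<close>, so it is a contraction modulo \<open>JM\<close>.\<close>
  define r where "r = (\<lambda>x\<in>carrier M. gfinsum M (\<lambda>w. \<phi> w x \<bullet> s (b w)) W)"
  have r: "r \<in> lmod_hom L M M" unfolding r_def by (rule dual_basis_hom[OF d(1) d(1) db sb])
  note rc = lmod_hom_closed[OF r]
  have rS: "(x, r x) \<in> S" if x: "x \<in> carrier M" for x
  proof -
    let ?F = "{w \<in> W. \<phi> w x \<noteq> \<zero>}"
    have "x = gfinsum M (\<lambda>w. \<phi> w x \<bullet> b w) W" using B(4)[OF x] by simp
    also have "\<dots> = finsum M (\<lambda>w. \<phi> w x \<bullet> b w) ?F"
      by (rule M.gfinsum_eq[OF B(3)[OF x]]) (use B(1) B(5)[OF _ x] in \<open>auto intro!: M.smult_closed\<close>)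
    finally have 1: "x = finsum M (\<lambda>w. \<phi> w x \<bullet> b w) ?F" .
    have "r x = finsum M (\<lambda>w. \<phi> w x \<bullet> s (b w)) ?F"
      unfolding r_def restrict_apply'[OF x]
      by (rule M.gfinsum_eq[OF B(3)[OF x]]) (use sb B(5)[OF _ x] in \<open>auto intro!: M.smult_closed\<close>)
    then show ?thesis
      using S_finsum[OF B(3)[OF x], of "\<lambda>w. \<phi> w x \<bullet> b w" "\<lambda>w. \<phi> w x \<bullet> s (b w)"]
        S_smult[OF B(5)[OF _ x] s[OF B(1)]] 1 by simp
  qed
  define h where "h = dhomotopy M M r"
  have h: "h \<in> dmaps L M M" unfolding h_def by (rule MM.dhomotopy_dmaps[OF r])
  have hx: "h x = r (dif M x) \<oplus>\<^bsub>M\<^esub> dif M (r x)" if "x \<in> carrier M" for x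
    using that by (simp add: h_def dhomotopy_def)
  note hc = dmapsD(3)[OF h]
  \<comment> \<open>The error \<open>n = h - 1\<close> of the homotopy identity. It commutes with
    the differential and has values in \<open>JM\<close>, so its square is zero.\<close>
  define n where "n = (\<lambda>x\<in>carrier M. h x \<oplus>\<^bsub>M\<^esub> (\<lambda>x\<in>carrier M. \<ominus>\<^bsub>M\<^esub> (\<lambda>x\<in>carrier M. x) x) x)"
  have n: "n \<in> dmaps L M M"
    unfolding n_def by (rule MM.dmaps_add[OF h MM.dmaps_neg[OF dmaps_id[OF diff]]])
  note nc = dmapsD(3)[OF n]
  have nJ: "n x \<in> JM M" and hn: "h x = x \<oplus>\<^bsub>M\<^esub> n x" if x: "x \<in> carrier M" for x
  proof -
    obtain j where j: "j \<in> JM M" "dif M (r x) \<oplus>\<^bsub>M\<^esub> r (dif M x) = x \<oplus>\<^bsub>M\<^esub> j"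
      using S_htpy[OF rS[OF x] rS[OF d(4)[OF x]]] by blast
    note jc = JM_subset[OF j(1)]
    have hj: "h x = x \<oplus>\<^bsub>M\<^esub> j" using hx[OF x] j(2) x by (simp add: M.M.a_comm rc d(4))
    then have "n x = j" using x jc by (simp add: n_def M.M.a_ac M.M.r_neg)
    then show "n x \<in> JM M" "h x = x \<oplus>\<^bsub>M\<^esub> n x" using j hj by simp_all
  qed
  have nn: "n (n x) = \<zero>\<^bsub>M\<^esub>" if "x \<in> carrier M" for x
    by (rule hom_null_JM[OF dmapsD(1)[OF n] nJ nJ[OF that]])
  \<comment> \<open>The corrected contraction \<open>(1 - n) r\<close>. As \<open>n\<close> commutes
    with the differential, its homotopy is \<open>(1 - n) h = (1 - n) (1 + n) = 1\<close>.\<close>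
  define q where "q = (\<lambda>x\<in>carrier M. r x \<oplus>\<^bsub>M\<^esub> (\<lambda>x\<in>carrier M. \<ominus>\<^bsub>M\<^esub> compose (carrier M) n r x) x)"
  have q: "q \<in> lmod_hom L M M"
    unfolding q_def
    by (rule lmod_hom_addI[OF d(1) d(1) r lmod_hom_negI[OF d(1) d(1) lmod_hom_compose[OF d(1) r dmapsD(1)[OF n]]]])
  have qx: "q x = r x \<oplus>\<^bsub>M\<^esub> \<ominus>\<^bsub>M\<^esub> n (r x)" if "x \<in> carrier M" for x
    using that by (simp add: q_def compose_def)
  have "q (dif M x) \<oplus>\<^bsub>M\<^esub> dif M (q x) = x" if x: "x \<in> carrier M" for x
  proof -
    have "dif M (q x) = dif M (r x) \<oplus>\<^bsub>M\<^esub> \<ominus>\<^bsub>M\<^esub> n (dif M (r x))"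
      using x by (simp add: qx lmod_hom_add[OF d(2)] d_minus rc nc dmapsD(2)[OF n])
    moreover have "q (dif M x) = r (dif M x) \<oplus>\<^bsub>M\<^esub> \<ominus>\<^bsub>M\<^esub> n (r (dif M x))"
      using x d(4) by (simp add: qx)
    ultimately have "q (dif M x) \<oplus>\<^bsub>M\<^esub> dif M (q x) = h x \<oplus>\<^bsub>M\<^esub> \<ominus>\<^bsub>M\<^esub> n (h x)"
      using x by (simp add: hx lmod_hom_add[OF dmapsD(1)[OF n]] rc nc d(4) M.M.minus_add M.M.a_ac)
    also have "n (h x) = n x"
      unfolding hn[OF x] using x nc by (simp add: lmod_hom_add[OF dmapsD(1)[OF n]] nn)
    also have "h x \<oplus>\<^bsub>M\<^esub> \<ominus>\<^bsub>M\<^esub> n x = x"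
      unfolding hn[OF x] using x nc by (simp add: M.M.a_assoc M.M.r_neg)
    finally show ?thesis .
  qed
  then have "(\<lambda>x\<in>carrier M. x) = dhomotopy M M q"
    unfolding dhomotopy_def by (intro restrict_ext) simp
  then show ?thesis unfolding null_homotopic_eq using q by (rule image_eqI)
qed

end

section \<open>The generator\<close>

text \<open>The properties of \<open>C\<close> on which the rest depends, for a module on an
  arbitrary carrier type. Stated in this way they can be verified on the tensor product and then
  carried over to its copy in the universe. The condition on \<open>\<phi>\<close> says that
  \<open>b u l\<close> generates a copy of the left ideal of the idempotent at the end of the
  path.\<close>

locale rsz_generator = rad_sq_zero L V A tl hd ev ar cv ca
  for L :: "('r, 'q) ring_scheme" (structure) and V :: "'v set" and A :: "'e set" and tl hd
    and ev :: "'v \<Rightarrow> 'k::field \<Rightarrow> 'r" and ar cv ca +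
  fixes S :: "('r, 's) dmodule" and b :: "'v \<Rightarrow> 'e list \<Rightarrow> 's" and \<phi> :: "'v \<times> 'e list \<Rightarrow> 's \<Rightarrow> 'r"
  assumes S: "diff_module L S"
    and db: "dual_basis L S {(u, l). op_path u l} (\<lambda>(u, l). b u l) \<phi>"
    and e_b: "op_path u l \<Longrightarrow> e (path_end u l) \<odot>\<^bsub>S\<^esub> b u l = b u l"
    and \<phi>_b: "op_path u l \<Longrightarrow> op_path u' l' \<Longrightarrow>
      \<phi> (u, l) (b u' l') = (if (u, l) = (u', l') then e (path_end u l) else \<zero>)"
    and d_b: "op_path u l \<Longrightarrow>
      dif S (b u l) = finsum S (\<lambda>a. al a \<odot>\<^bsub>S\<^esub> b u (a # l)) {a \<in> A. hd a = path_end u l}"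
begin

sublocale S: left_module L S by (rule diff_moduleD[OF S])

lemma b_closed: "op_path u l \<Longrightarrow> b u l \<in> carrier S"
  using dual_basisD(1)[OF db, of "(u, l)"] by simp

lemma b_ext:
  assumes N: "left_module L N" and f: "f \<in> lmod_hom L S N" and g: "g \<in> lmod_hom L S N"
    and eq: "\<And>u l. op_path u l \<Longrightarrow> f (b u l) = g (b u l)"
  shows "f = g"
proof (rule lmod_hom_eqI[OF f g])
  interpret N: left_module L N by fact
  fix s assume s: "s \<in> carrier S"
  let ?Z = "{(u, l). op_path u l}"
  let ?h = "\<lambda>z. \<phi> z s \<odot>\<^bsub>S\<^esub> (case z of (u, l) \<Rightarrow> b u l)"
  note D = dual_basisD[OF db]
  have c: "?h \<in> ?Z \<rightarrow> carrier S"
    using D(1) D(5)[OF _ s] by (auto intro!: S.smult_closed)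
  have fin: "finite {z \<in> ?Z. ?h z \<noteq> \<zero>\<^bsub>S\<^esub>}"
    by (rule finite_subset[OF _ D(3)[OF s]]) (auto simp: b_closed)
  have "f s = gfinsum N (\<lambda>z. f (?h z)) ?Z"
    using lmod_hom_gfinsum[OF f S.left_module_axioms N c fin] D(4)[OF s] by simp
  also have "\<dots> = gfinsum N (\<lambda>z. g (?h z)) ?Z"
  proof (rule N.gfinsum_cong)
    show "(\<lambda>z. g (?h z)) \<in> ?Z \<rightarrow> carrier N" using c lmod_hom_closed[OF g] by blast
    fix z assume z: "z \<in> ?Z"
    then obtain u l where z': "z = (u, l)" "op_path u l" by auto
    show "f (?h z) = g (?h z)"
      using lmod_hom_smult[OF f D(5)[OF z s] b_closed[OF z'(2)]]
        lmod_hom_smult[OF g D(5)[OF z s] b_closed[OF z'(2)]] eq[OF z'(2)] by (simp add: z'(1))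
  qed
  also have "\<dots> = g s"
    using lmod_hom_gfinsum[OF g S.left_module_axioms N c fin] D(4)[OF s] by simp
  finally show "f s = g s" .
qed

text \<open>The value at a generator of type \<open>L e\<close> may be any vector fixed by the
  idempotent \<open>e\<close>. The condition \<open>eg\<close> is needed for the value at
  \<open>b u l\<close> itself, where the coordinate is this idempotent and not the unit.\<close>

lemma b_hom:
  assumes N: "left_module L N" and g: "\<And>u l. op_path u l \<Longrightarrow> g u l \<in> carrier N"
    and eg: "\<And>u l. op_path u l \<Longrightarrow> e (path_end u l) \<odot>\<^bsub>N\<^esub> g u l = g u l"
  obtains f where "f \<in> lmod_hom L S N" "\<And>u l. op_path u l \<Longrightarrow> f (b u l) = g u l"
proof -
  interpret N: left_module L N by fact
  let ?Z = "{(u, l). op_path u l}"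
  let ?f = "\<lambda>s\<in>carrier S. gfinsum N (\<lambda>z. \<phi> z s \<odot>\<^bsub>N\<^esub> (case z of (u, l) \<Rightarrow> g u l)) ?Z"
  have "?f \<in> lmod_hom L S N"
    by (rule dual_basis_hom[OF S.left_module_axioms N db]) (use g in auto)
  moreover have "?f (b u l) = g u l" if z: "op_path u l" for u l
  proof -
    have *: "\<phi> z (b u l) \<odot>\<^bsub>N\<^esub> (case z of (u, l) \<Rightarrow> g u l) = (if z = (u, l) then g u l else \<zero>\<^bsub>N\<^esub>)" if "z \<in> ?Z" for z
      using that \<phi>_b[OF _ z] eg g by (auto split: prod.split)
    have "gfinsum N (\<lambda>z'. \<phi> z' (b u l) \<odot>\<^bsub>N\<^esub> (case z' of (u, l) \<Rightarrow> g u l)) ?Z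
        = \<phi> (u, l) (b u l) \<odot>\<^bsub>N\<^esub> (case (u, l) of (u, l) \<Rightarrow> g u l)"
      by (rule N.gfinsum_single) (use z * g in auto)
    also have "\<dots> = g u l" using *[of "(u, l)"] z by simp
    finally show ?thesis using b_closed[OF z] by simp
  qed
  ultimately show thesis by (rule that)
qed

text \<open>The coordinate of a generator at itself is an idempotent, which is nonzero because its
  coefficient at the vertex is \<open>1\<close>. Injectivity lets the generators serve as labels of
  a basis inside the carrier type of \<open>S\<close>.\<close>

lemma inj_b: "inj_on (\<lambda>(u, l). b u l) {(u, l). op_path u l}"
proof (rule inj_onI, clarify)
  fix u l u' l' assume z: "op_path u l" "op_path u' l'" and eq: "b u l = b u' l'"
  have "e (path_end u l) \<noteq> \<zero>"
    using cv_ev[of "path_end u l" "path_end u l" 1] cv_zero path_end_V[OF z(1)] by auto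
  then show "u = u' \<and> l = l'"
    using \<phi>_b[OF z(1,1)] \<phi>_b[OF z] eq by (auto split: if_splits)
qed

lemma S_projective: "lmod_projective L S"
  by (rule dual_basis_projective[OF S.left_module_axioms db inj_b])

text \<open>Reduces commuting with differentials, and homotopy formulas, to equations between the
  values on generators; these are the equations of \<open>koszul_lift\<close>.\<close>

lemma d_b_hom:
  assumes N: "left_module L N" and f: "f \<in> lmod_hom L S N" and z: "op_path u l"
  shows "f (dif S (b u l)) = finsum N (\<lambda>a. al a \<odot>\<^bsub>N\<^esub> f (b u (a # l))) {a \<in> A. hd a = path_end u l}"
proof -
  interpret N: left_module L N by fact
  have bc: "b u (a # l) \<in> carrier S" if "a \<in> A" "hd a = path_end u l" for a
    using that z by (intro b_closed) auto
  have "f (dif S (b u l)) = finsum N (\<lambda>a. f (al a \<odot>\<^bsub>S\<^esub> b u (a # l))) {a \<in> A. hd a = path_end u l}"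
    unfolding d_b[OF z]
    by (rule lmod_hom_finsum[OF f S.left_module_axioms N]) (use bc al_closed in \<open>auto intro!: S.smult_closed\<close>)
  also have "\<dots> = finsum N (\<lambda>a. al a \<odot>\<^bsub>N\<^esub> f (b u (a # l))) {a \<in> A. hd a = path_end u l}"
    by (rule N.M.finsum_cong')
       (use bc al_closed lmod_hom_closed[OF f] lmod_hom_smult[OF f] in \<open>auto intro!: N.smult_closed\<close>)
  finally show ?thesis .
qed

text \<open>The homotopy condition at a generator asks that the values of \<open>\<rho>\<close> at
  the extensions, multiplied by their arrows, sum to \<open>f (b u l)\<close> minus the differential
  of \<open>\<rho> (b u l)\<close>. This is the recursion with the negated differential and
  \<open>g\<close> given by \<open>f\<close>. The hypothesis of the recursion is that
  \<open>f\<close> is a differential map, and the initial value zero is admissible by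
  \<open>f0\<close>.\<close>

lemma null_homotopicI:
  assumes T: "diff_module L T" "lmod_projective L T" and f: "f \<in> dmaps L S T"
    and f0: "\<And>u. u \<in> V \<Longrightarrow> f (b u []) = \<zero>\<^bsub>T\<^esub>"
  shows "f \<in> null_homotopic L S T"
proof -
  interpret T: rsz_dmodule L V A tl hd ev ar cv ca T
    by (intro rsz_dmodule.intro rsz_module.intro rad_sq_zero_axioms diff_moduleD(1)[OF T(1)] rsz_dmodule_axioms.intro T)
  interpret ST: diff_module_pair L S T by unfold_locales (fact S T)+
  note fD = dmapsD[OF f]
  let ?\<delta> = "\<lambda>x\<in>carrier T. \<ominus>\<^bsub>T\<^esub> dif T x"
  have \<delta>: "?\<delta> \<in> lmod_hom L T T" by (rule lmod_hom_negI[OF T.d(1) T.d(1) T.d(2)])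
  have m0: "\<ominus>\<^bsub>T\<^esub> \<zero>\<^bsub>T\<^esub> = \<zero>\<^bsub>T\<^esub>" by (rule T.M.M.minus_equality) auto
  have fb: "f (b u l) \<in> carrier T" "e (path_end u l) \<odot>\<^bsub>T\<^esub> f (b u l) = f (b u l)" if "op_path u l" for u l
    using fD(3)[OF b_closed[OF that]]
      lmod_hom_smult[OF fD(1) e_closed[OF path_end_V[OF that]] b_closed[OF that]] e_b[OF that] by simp_all
  obtain r where r: "\<And>u. r u [] = \<zero>\<^bsub>T\<^esub>" "\<And>u l. op_path u l \<Longrightarrow> r u l \<in> carrier T"
    "\<And>u l. op_path u l \<Longrightarrow> e (path_end u l) \<odot>\<^bsub>T\<^esub> r u l = r u l"
    and rs: "\<And>u l. op_path u l \<Longrightarrow>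
      finsum T (\<lambda>a. al a \<odot>\<^bsub>T\<^esub> r u (a # l)) {a \<in> A. hd a = path_end u l} = f (b u l) \<oplus>\<^bsub>T\<^esub> ?\<delta> (r u l)"
  proof (rule T.koszul_lift[OF T(2) \<delta>, of "\<lambda>u l. f (b u l)" "\<lambda>_. \<zero>\<^bsub>T\<^esub>"])
    fix x assume "x \<in> carrier T"
    then show "?\<delta> (?\<delta> x) = \<zero>\<^bsub>T\<^esub>" using T.d(3,4) by (simp add: T.d_minus)
  next
    fix u l assume z: "op_path u l"
    show "f (b u l) \<in> carrier T" "e (path_end u l) \<odot>\<^bsub>T\<^esub> f (b u l) = f (b u l)" by (rule fb[OF z])+
    have "finsum T (\<lambda>a. al a \<odot>\<^bsub>T\<^esub> f (b u (a # l))) {a \<in> A. hd a = path_end u l} = dif T (f (b u l))"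
      using d_b_hom[OF T.d(1) fD(1) z] fD(2)[OF b_closed[OF z]] by simp
    then show "?\<delta> (f (b u l)) \<oplus>\<^bsub>T\<^esub> finsum T (\<lambda>a. al a \<odot>\<^bsub>T\<^esub> f (b u (a # l))) {a \<in> A. hd a = path_end u l} = \<zero>\<^bsub>T\<^esub>"
      using fb[OF z] T.d(4) by (simp add: T.M.M.l_neg)
  next
    fix u assume "u \<in> V"
    then show "f (b u []) \<oplus>\<^bsub>T\<^esub> ?\<delta> \<zero>\<^bsub>T\<^esub> \<in> JM T" using f0 by (simp add: T.d_zero m0 T.JM_zero)
    show "e u \<odot>\<^bsub>T\<^esub> \<zero>\<^bsub>T\<^esub> = \<zero>\<^bsub>T\<^esub>" using \<open>u \<in> V\<close> by (simp add: e_closed)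
    show "\<zero>\<^bsub>T\<^esub> \<in> carrier T" by simp
  qed blast
  obtain \<rho> where \<rho>: "\<rho> \<in> lmod_hom L S T" and \<rho>b: "\<And>u l. op_path u l \<Longrightarrow> \<rho> (b u l) = r u l"
    by (rule b_hom[OF T.d(1) r(2,3)]) blast+
  have "f = dhomotopy S T \<rho>"
  proof (rule b_ext[OF T.d(1) fD(1) dmapsD(1)[OF ST.dhomotopy_dmaps[OF \<rho>]]])
    fix u l assume z: "op_path u l"
    let ?B = "{a \<in> A. hd a = path_end u l}"
    have "\<rho> (dif S (b u l)) = finsum T (\<lambda>a. al a \<odot>\<^bsub>T\<^esub> r u (a # l)) ?B"
      unfolding d_b_hom[OF T.d(1) \<rho> z]
      by (rule T.M.M.finsum_cong') (use z \<rho>b r(2) in \<open>auto intro!: T.M.smult_closed al_closed\<close>)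
    also have "\<dots> = f (b u l) \<oplus>\<^bsub>T\<^esub> \<ominus>\<^bsub>T\<^esub> dif T (r u l)" using rs[OF z] r(2)[OF z] by simp
    finally show "f (b u l) = dhomotopy S T \<rho> (b u l)"
      using b_closed[OF z] \<rho>b[OF z] fb(1)[OF z] T.d(4)[OF r(2)[OF z]]
      by (simp add: dhomotopy_def T.M.M.a_assoc T.M.M.l_neg)
  qed
  then show ?thesis unfolding null_homotopic_eq using \<rho> by (rule image_eqI)
qed

text \<open>With \<open>g\<close> zero and initial values \<open>e u \<bullet> x\<close>, the
  recursion yields a differential map whose values on the trivial paths are the homogeneous parts of
  \<open>x\<close>. A null homotopy of this map exhibits each part as a boundary modulo
  \<open>JM\<close>.\<close>

lemma exact_if_no_maps:
  assumes T: "diff_module L T" "lmod_projective L T" and triv: "dmaps L S T \<subseteq> null_homotopic L S T"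
    and x: "x \<in> carrier T" "dif T x \<in> JM T"
  shows "\<exists>y\<in>carrier T. \<exists>j\<in>JM T. dif T y = x \<oplus>\<^bsub>T\<^esub> j"
proof -
  interpret T: rsz_dmodule L V A tl hd ev ar cv ca T
    by (intro rsz_dmodule.intro rsz_module.intro rad_sq_zero_axioms diff_moduleD(1)[OF T(1)] rsz_dmodule_axioms.intro T)
  let ?X = "\<lambda>u. e u \<odot>\<^bsub>T\<^esub> x"
  have Xc: "?X u \<in> carrier T" if "u \<in> V" for u by (rule T.M.smult_closed[OF e_closed[OF that] x(1)])
  have dX: "dif T (?X u) \<in> JM T" if "u \<in> V" for u
    using T.JM_smult[OF e_closed[OF that] x(2)] lmod_hom_smult[OF T.d(2) e_closed[OF that] x(1)] by simp
  obtain r where r: "\<And>u. r u [] = ?X u" "\<And>u l. op_path u l \<Longrightarrow> r u l \<in> carrier T"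
    "\<And>u l. op_path u l \<Longrightarrow> e (path_end u l) \<odot>\<^bsub>T\<^esub> r u l = r u l"
    and rs: "\<And>u l. op_path u l \<Longrightarrow>
      finsum T (\<lambda>a. al a \<odot>\<^bsub>T\<^esub> r u (a # l)) {a \<in> A. hd a = path_end u l} = \<zero>\<^bsub>T\<^esub> \<oplus>\<^bsub>T\<^esub> dif T (r u l)"
  proof (rule T.koszul_lift[OF T(2) T.d(2,3), of "\<lambda>u l. \<zero>\<^bsub>T\<^esub>" ?X])
    fix u l assume z: "op_path u l"
    show "\<zero>\<^bsub>T\<^esub> \<in> carrier T" by simp
    show "e (path_end u l) \<odot>\<^bsub>T\<^esub> \<zero>\<^bsub>T\<^esub> = \<zero>\<^bsub>T\<^esub>" using path_end_V[OF z] by (simp add: e_closed)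
    have "finsum T (\<lambda>a. al a \<odot>\<^bsub>T\<^esub> \<zero>\<^bsub>T\<^esub>) {a \<in> A. hd a = path_end u l} = \<zero>\<^bsub>T\<^esub>"
      by (rule T.M.M.add.finprod_one_eqI) (simp add: al_closed)
    then show "dif T \<zero>\<^bsub>T\<^esub> \<oplus>\<^bsub>T\<^esub> finsum T (\<lambda>a. al a \<odot>\<^bsub>T\<^esub> \<zero>\<^bsub>T\<^esub>) {a \<in> A. hd a = path_end u l} = \<zero>\<^bsub>T\<^esub>"
      by (simp add: T.d_zero)
  next
    fix u assume u: "u \<in> V"
    show "?X u \<in> carrier T" "e u \<odot>\<^bsub>T\<^esub> ?X u = ?X u" by (rule Xc[OF u], rule T.e_idem[OF u x(1)])
    show "\<zero>\<^bsub>T\<^esub> \<oplus>\<^bsub>T\<^esub> dif T (?X u) \<in> JM T" using dX[OF u] T.d(4)[OF Xc[OF u]] by simp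
  next
    fix r assume r: "\<And>u. r u [] = ?X u" "\<And>u l. op_path u l \<Longrightarrow> r u l \<in> carrier T"
      "\<And>u l. op_path u l \<Longrightarrow> e (path_end u l) \<odot>\<^bsub>T\<^esub> r u l = r u l"
      "\<And>u l. op_path u l \<Longrightarrow>
        finsum T (\<lambda>a. al a \<odot>\<^bsub>T\<^esub> r u (a # l)) {a \<in> A. hd a = path_end u l} = \<zero>\<^bsub>T\<^esub> \<oplus>\<^bsub>T\<^esub> dif T (r u l)"
    show thesis by (rule that[OF r])
  qed
  obtain f where f: "f \<in> lmod_hom L S T" and fb: "\<And>u l. op_path u l \<Longrightarrow> f (b u l) = r u l"
    by (rule b_hom[OF T.d(1) r(2,3)]) blast+
  \<comment> \<open>The equations solved by \<open>r\<close> say that \<open>f\<close> commutes with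
    the differentials on the generators, and maps out of \<open>S\<close> are determined
    there.\<close>
  have cf: "compose (carrier S) f (dif S) = compose (carrier S) (dif T) f"
  proof (rule b_ext[OF T.d(1)])
    note Sd = diff_moduleD[OF S]
    show "compose (carrier S) f (dif S) \<in> lmod_hom L S T" by (rule lmod_hom_compose[OF Sd(1) Sd(2) f])
    show "compose (carrier S) (dif T) f \<in> lmod_hom L S T" by (rule lmod_hom_compose[OF Sd(1) f T.d(2)])
    fix u l assume z: "op_path u l"
    have "f (dif S (b u l)) = finsum T (\<lambda>a. al a \<odot>\<^bsub>T\<^esub> r u (a # l)) {a \<in> A. hd a = path_end u l}"
      unfolding d_b_hom[OF T.d(1) f z]
      by (rule T.M.M.finsum_cong') (use z fb r(2) in \<open>auto intro!: T.M.smult_closed al_closed\<close>)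
    also have "\<dots> = dif T (r u l)" using rs[OF z] T.d(4)[OF r(2)[OF z]] by simp
    finally show "compose (carrier S) f (dif S) (b u l) = compose (carrier S) (dif T) f (b u l)"
      using b_closed[OF z] fb[OF z] by (simp add: compose_def)
  qed
  have "f (dif S s) = dif T (f s)" if "s \<in> carrier S" for s
    using fun_cong[OF cf, of s] that by (simp add: compose_def)
  then have "f \<in> dmaps L S T" using f by (simp add: dmaps_iff)
  then obtain \<rho> where \<rho>: "\<rho> \<in> lmod_hom L S T" and f\<rho>: "f = dhomotopy S T \<rho>"
    using triv unfolding null_homotopic_eq by blast
  note \<rho>c = lmod_hom_closed[OF \<rho>]
  \<comment> \<open>In the homotopy formula at \<open>b u []\<close> the term with the differential
    of \<open>S\<close> is a sum of arrows times vectors, so it lies in \<open>JM\<close>.\<close>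
  have split: "?X u \<oplus>\<^bsub>T\<^esub> \<ominus>\<^bsub>T\<^esub> dif T (\<rho> (b u [])) \<in> JM T" if u: "u \<in> V" for u
  proof -
    have z: "op_path u []" using u by simp
    have "\<rho> (dif S (b u [])) \<in> JM T"
      unfolding d_b_hom[OF T.d(1) \<rho> z]
    proof (rule T.JM_finsum)
      fix a assume "a \<in> {a \<in> A. hd a = path_end u []}"
      then show "al a \<odot>\<^bsub>T\<^esub> \<rho> (b u [a]) \<in> JM T"
        using u by (intro T.al_in_JM \<rho>c b_closed) auto
    qed (use fin_A in simp)
    moreover have "?X u = \<rho> (dif S (b u [])) \<oplus>\<^bsub>T\<^esub> dif T (\<rho> (b u []))"
      using fb[OF z] r(1) b_closed[OF z] f\<rho> by (simp add: dhomotopy_def)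
    ultimately show ?thesis
      using T.JM_subset T.d(4)[OF \<rho>c[OF b_closed[OF z]]] by (simp add: T.M.M.a_assoc T.M.M.r_neg)
  qed
  let ?Y = "\<lambda>u. \<rho> (b u [])"
  have Yc: "?Y u \<in> carrier T" if "u \<in> V" for u using that by (intro \<rho>c b_closed) simp
  have nc: "\<ominus>\<^bsub>T\<^esub> dif T (?Y u) \<in> carrier T" if "u \<in> V" for u using T.d(4)[OF Yc[OF that]] by simp
  \<comment> \<open>The homogeneous parts of \<open>x\<close> add up to \<open>x\<close>, and the
    sum of their preimages is a preimage of \<open>x\<close> modulo \<open>JM\<close>.\<close>
  let ?y = "finsum T ?Y V"
  have yc: "?y \<in> carrier T" by (rule T.M.M.finsum_closed) (use Yc in auto)
  have "finsum T (\<lambda>u. ?X u \<oplus>\<^bsub>T\<^esub> \<ominus>\<^bsub>T\<^esub> dif T (?Y u)) V = finsum T ?X V \<oplus>\<^bsub>T\<^esub> finsum T (\<lambda>u. \<ominus>\<^bsub>T\<^esub> dif T (?Y u)) V"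
    by (rule T.M.M.finsum_addf) (use Xc nc in auto)
  also have "finsum T (\<lambda>u. \<ominus>\<^bsub>T\<^esub> dif T (?Y u)) V = (\<lambda>x\<in>carrier T. \<ominus>\<^bsub>T\<^esub> dif T x) ?y"
    using lmod_hom_finsum[OF lmod_hom_negI[OF T.d(1) T.d(1) T.d(2)] T.d(1) T.d(1), of ?Y V] Yc nc
    by (auto simp: Pi_iff intro!: T.M.M.finsum_cong')
  also have "\<dots> = \<ominus>\<^bsub>T\<^esub> dif T ?y" using yc by simp
  also have "finsum T ?X V = x" by (rule T.e_sum[OF x(1)])
  finally have J: "x \<oplus>\<^bsub>T\<^esub> \<ominus>\<^bsub>T\<^esub> dif T ?y \<in> JM T"
    using T.JM_finsum[OF fin_V, of "\<lambda>u. ?X u \<oplus>\<^bsub>T\<^esub> \<ominus>\<^bsub>T\<^esub> dif T (?Y u)"] split by simp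
  let ?j = "\<ominus>\<^bsub>T\<^esub> (x \<oplus>\<^bsub>T\<^esub> \<ominus>\<^bsub>T\<^esub> dif T ?y)"
  have dyc: "dif T ?y \<in> carrier T" by (rule T.d(4)[OF yc])
  have "x \<oplus>\<^bsub>T\<^esub> ?j = dif T ?y"
    using x(1) dyc by (simp add: T.M.M.minus_add T.M.M.r_neg flip: T.M.M.a_assoc)
  then show ?thesis using yc T.JM_minus[OF J] by (intro bexI[of _ ?y] bexI[of _ ?j]) auto
qed

end

theorem (in rsz_generator) compact_generator:
  assumes inf: "infinite (UNIV :: 's set)"
  shows "compact_generator (UNIV :: 's set) (homotopy_diff_proj L) S"
  unfolding compact_generator_def
proof (intro conjI ballI impI)
  have SO: "S \<in> Obj (homotopy_diff_proj L)" using S S_projective by (simp add: K_simps)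
  show "has_coproducts (UNIV :: 's set) (homotopy_diff_proj L :: (('r, 's) dmodule, _) shift_category)"
    by (rule homotopy_diff_proj_has_coproducts[OF ring_axioms inf])
  show "compact_object (UNIV :: 's set) (homotopy_diff_proj L) S"
  proof (rule compact_objectI[OF inf SO])
    \<comment> \<open>The generators of the trivial paths form the detecting set; it is finite
      because the quiver has finitely many vertices.\<close>
    show "finite ((\<lambda>u. b u []) ` V)" using fin_V by simp
    show "(\<lambda>u. b u []) ` V \<subseteq> carrier S" using b_closed by auto
    fix T :: "('r, 's) dmodule" and f
    assume "T \<in> Obj (homotopy_diff_proj L)" "f \<in> dmaps L S T" "\<And>x. x \<in> (\<lambda>u. b u []) ` V \<Longrightarrow> f x = \<zero>\<^bsub>T\<^esub>"
    then show "f \<in> null_homotopic L S T" by (intro null_homotopicI) (auto simp: K_simps)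
  qed
  fix T :: "('r, 's) dmodule"
  assume TO: "T \<in> Obj (homotopy_diff_proj L)"
    and triv: "\<forall>n. carrier (Hom (homotopy_diff_proj L) (shift_pow (homotopy_diff_proj L) n S) T) =
      {\<one>\<^bsub>Hom (homotopy_diff_proj L) (shift_pow (homotopy_diff_proj L) n S) T\<^esub>}"
  then have T: "diff_module L T" "lmod_projective L T" by (simp_all add: K_simps)
  interpret ST: diff_module_pair L S T by unfold_locales (fact S T)+
  interpret T: rsz_dmodule L V A tl hd ev ar cv ca T
    by (intro rsz_dmodule.intro rsz_module.intro rad_sq_zero_axioms diff_moduleD(1)[OF T(1)] rsz_dmodule_axioms.intro T)
  \<comment> \<open>At \<open>n = 0\<close> the iterated translation is the identity, so the
    hypothesis speaks of maps from \<open>S\<close> itself.\<close>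
  have "dmaps L S T \<subseteq> null_homotopic L S T"
    using triv[rule_format, of 0] unfolding ST.hgroup_trivial_iff[symmetric] K_simps by (simp add: shift_pow_def)
  then have "(\<lambda>x\<in>carrier T. x) \<in> null_homotopic L T T"
    by (intro T.exact_contractible exact_if_no_maps[OF T]) (auto simp: T.cycles_def)
  then show "\<exists>Z. zero_object (homotopy_diff_proj L) Z \<and> cat_isomorphic (homotopy_diff_proj L) T Z"
    using contractible_zero_object[OF TO] by blast
qed

section \<open>The path algebra\<close>

lemma poly_mapping_expand: "(\<Sum>p\<in>Poly_Mapping.keys f. Poly_Mapping.single p (Poly_Mapping.lookup f p)) = f"
  by (rule poly_mapping_eqI)
     (auto simp: lookup_sum lookup_single when_def in_keys_iff sum.delta' cong: if_cong)

lemma poly_mapping_induct_single [case_names zero single add]: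
  fixes f :: "'a \<Rightarrow>\<^sub>0 'b::comm_monoid_add"
  assumes "P 0" "\<And>p c. P (Poly_Mapping.single p c)" "\<And>f g. P f \<Longrightarrow> P g \<Longrightarrow> P (f + g)"
  shows "P f"
proof -
  have "P (\<Sum>p\<in>F. Poly_Mapping.single p (Poly_Mapping.lookup f p))" if "finite F" for F
    using that by (induction F rule: finite_induct) (auto intro: assms)
  from this[OF finite_keys[of f]] show ?thesis by (simp add: poly_mapping_expand)
qed

text \<open>The product of two monomials under a name of its own, so that composability is examined
  in one place and \<open>path_mult\<close> is visibly a double sum of such terms.\<close>

definition path_term :: "('v, 'e) qpath \<Rightarrow> ('v, 'e) qpath \<Rightarrow> 'k::field \<Rightarrow> ('v, 'e) qpath \<Rightarrow>\<^sub>0 'k" where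
  "path_term q p c = (if path_target p = path_source q then Poly_Mapping.single (path_comp q p) c else 0)"

definition path_mult :: "(('v, 'e) qpath \<Rightarrow>\<^sub>0 'k::field) \<Rightarrow> (('v, 'e) qpath \<Rightarrow>\<^sub>0 'k) \<Rightarrow> ('v, 'e) qpath \<Rightarrow>\<^sub>0 'k" where
  "path_mult f g = (\<Sum>q\<in>Poly_Mapping.keys f. \<Sum>p\<in>Poly_Mapping.keys g.
     path_term q p (Poly_Mapping.lookup f q * Poly_Mapping.lookup g p))"

lemma path_algebra_simps [simp]:
  "f \<in> carrier (path_algebra Q) \<longleftrightarrow> Poly_Mapping.keys f \<subseteq> qpaths Q"
  "monoid.mult (path_algebra Q) = path_mult"
  "\<one>\<^bsub>path_algebra Q\<^esub> = (\<Sum>v\<in>verts Q. Poly_Mapping.single (triv_path v) 1)"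
  "\<zero>\<^bsub>path_algebra Q\<^esub> = 0" "ring.add (path_algebra Q) = (+)"
  by (simp_all add: path_algebra_def path_mult_def path_term_def fun_eq_iff)

lemma path_term_0 [simp]: "path_term q p 0 = 0"
  by (simp add: path_term_def)

lemma path_term_add: "path_term q p (c + d) = path_term q p c + path_term q p d"
  by (simp add: path_term_def single_add)

text \<open>The keys of a sum may be fewer than those of its summands because of cancellation.
  Enlarging the index sets to common finite sets is what makes additivity a matter of distributing
  sums.\<close>

lemma path_mult_eq:
  assumes "finite K" "Poly_Mapping.keys f \<subseteq> K" "finite N" "Poly_Mapping.keys g \<subseteq> N"
  shows "path_mult f g = (\<Sum>q\<in>K. \<Sum>p\<in>N. path_term q p (Poly_Mapping.lookup f q * Poly_Mapping.lookup g p))"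
proof -
  have "(\<Sum>p\<in>Poly_Mapping.keys g. path_term q p (Poly_Mapping.lookup f q * Poly_Mapping.lookup g p))
      = (\<Sum>p\<in>N. path_term q p (Poly_Mapping.lookup f q * Poly_Mapping.lookup g p))" for q
    by (rule sum.mono_neutral_left) (use assms in \<open>auto simp: in_keys_iff\<close>)
  then have "path_mult f g = (\<Sum>q\<in>Poly_Mapping.keys f. \<Sum>p\<in>N. path_term q p (Poly_Mapping.lookup f q * Poly_Mapping.lookup g p))"
    by (simp add: path_mult_def)
  also have "\<dots> = (\<Sum>q\<in>K. \<Sum>p\<in>N. path_term q p (Poly_Mapping.lookup f q * Poly_Mapping.lookup g p))"
    by (rule sum.mono_neutral_left) (use assms in \<open>auto simp: in_keys_iff\<close>)
  finally show ?thesis .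
qed

lemma path_mult_add_left: "path_mult (f + f') g = path_mult f g + path_mult f' g"
proof -
  let ?K = "Poly_Mapping.keys f \<union> Poly_Mapping.keys f'"
  have "path_mult h g = (\<Sum>q\<in>?K. \<Sum>p\<in>Poly_Mapping.keys g. path_term q p (Poly_Mapping.lookup h q * Poly_Mapping.lookup g p))"
    if "Poly_Mapping.keys h \<subseteq> ?K" for h
    by (rule path_mult_eq) (use that in auto)
  from this[of f] this[of f'] this[OF keys_add] show ?thesis
    by (simp add: lookup_add distrib_right path_term_add sum.distrib)
qed

lemma path_mult_add_right: "path_mult f (g + g') = path_mult f g + path_mult f g'"
proof -
  let ?K = "Poly_Mapping.keys g \<union> Poly_Mapping.keys g'"
  have "path_mult f h = (\<Sum>q\<in>Poly_Mapping.keys f. \<Sum>p\<in>?K. path_term q p (Poly_Mapping.lookup f q * Poly_Mapping.lookup h p))"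
    if "Poly_Mapping.keys h \<subseteq> ?K" for h
    by (rule path_mult_eq) (use that in auto)
  from this[of g] this[of g'] this[OF keys_add] show ?thesis
    by (simp add: lookup_add distrib_left path_term_add sum.distrib)
qed

lemma path_mult_0 [simp]: "path_mult 0 g = 0" "path_mult f 0 = 0"
  by (simp_all add: path_mult_def)

lemma path_mult_single: "path_mult (Poly_Mapping.single q c) (Poly_Mapping.single p d) = path_term q p (c * d)"
  using path_mult_eq[of "{q}" "Poly_Mapping.single q c" "{p}" "Poly_Mapping.single p d"]
  by (simp split: if_splits)

lemma path_mult_sum_left: "path_mult (sum f F) g = (\<Sum>i\<in>F. path_mult (f i) g)"
  by (induction F rule: infinite_finite_induct) (auto simp: path_mult_add_left)

lemma path_mult_sum_right: "path_mult g (sum f F) = (\<Sum>i\<in>F. path_mult g (f i))"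
  by (induction F rule: infinite_finite_induct) (auto simp: path_mult_add_right)

lemma path_comp_source_target [simp]:
  "path_source (path_comp q p) = path_source p" "path_target (path_comp q p) = path_target q"
  by (simp_all add: path_comp_def path_source_def path_target_def)

lemma path_comp_assoc: "path_comp (path_comp r q) p = path_comp r (path_comp q p)"
  by (simp add: path_comp_def path_source_def path_target_def)

text \<open>Additivity in each argument reduces the identity to three monomials, where both
  bracketings vanish under the same conditions and otherwise concatenate the same lists.\<close>

lemma path_mult_assoc: "path_mult (path_mult f g) h = path_mult f (path_mult g h)"
proof (induction f rule: poly_mapping_induct_single)
  case (single r c)
  show ?case
  proof (induction g rule: poly_mapping_induct_single)
    case (single q c')
    show ?case
    proof (induction h rule: poly_mapping_induct_single)
      case (single p c'')
      show ?case
        by (auto simp: path_mult_single path_term_def path_comp_assoc mult.assoc)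
    qed (simp_all add: path_mult_add_right)
  qed (simp_all add: path_mult_add_left path_mult_add_right)
qed (simp_all add: path_mult_add_left)

lemma keys_path_mult:
  assumes "r \<in> Poly_Mapping.keys (path_mult f g)"
  obtains q p where "q \<in> Poly_Mapping.keys f" "p \<in> Poly_Mapping.keys g"
    "path_target p = path_source q" "r = path_comp q p"
proof -
  obtain q where q: "q \<in> Poly_Mapping.keys f" and r: "r \<in> Poly_Mapping.keys (\<Sum>p\<in>Poly_Mapping.keys g.
      path_term q p (Poly_Mapping.lookup f q * Poly_Mapping.lookup g p))"
    using subsetD[OF keys_sum assms[unfolded path_mult_def]] by (rule UN_E)
  obtain p where p: "p \<in> Poly_Mapping.keys g"
    and rp: "r \<in> Poly_Mapping.keys (path_term q p (Poly_Mapping.lookup f q * Poly_Mapping.lookup g p))"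
    using subsetD[OF keys_sum r] by (rule UN_E)
  show thesis
    by (rule that[OF q p]) (use rp in \<open>simp_all add: path_term_def split: if_splits\<close>)
qed

abbreviation path_length :: "('v, 'e) qpath \<Rightarrow> nat" where
  "path_length p \<equiv> length (fst (snd p))"

lemma path_length_comp: "path_length (path_comp q p) = path_length q + path_length p"
  by (simp add: path_comp_def)

lemma path_comp_triv: "path_comp (triv_path (path_target p)) p = p" "path_comp p (triv_path (path_source p)) = p"
  by (simp_all add: path_comp_def triv_path_def path_source_def path_target_def)

lemma path_comp_triv_triv: "path_comp (triv_path v) (triv_path v) = triv_path v"
  by (simp add: path_comp_def triv_path_def path_source_def path_target_def)

lemma triv_path_source_target [simp]: "path_source (triv_path v) = v" "path_target (triv_path v) = v"
  by (simp_all add: triv_path_def path_source_def path_target_def)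

lemma arrow_path_source_target [simp]: "path_source (arrow_path Q a) = tail Q a" "path_target (arrow_path Q a) = head Q a"
  by (simp_all add: arrow_path_def path_source_def path_target_def)

lemma triv_path_eq [simp]: "triv_path v = triv_path w \<longleftrightarrow> v = w"
  and arrow_path_eq [simp]: "arrow_path Q a = arrow_path Q b \<longleftrightarrow> a = b"
  and triv_arrow_path [simp]: "triv_path v \<noteq> arrow_path Q a" "arrow_path Q a \<noteq> triv_path v"
  by (auto simp: triv_path_def arrow_path_def)

context fin_digraph
begin

lemma qpaths_comp: "p \<in> qpaths G \<Longrightarrow> q \<in> qpaths G \<Longrightarrow> path_target p = path_source q \<Longrightarrow> path_comp q p \<in> qpaths G"
  by (auto simp: qpaths_def path_comp_def path_source_def path_target_def intro: awalk_appendI)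

lemma qpaths_verts: "p \<in> qpaths G \<Longrightarrow> path_source p \<in> verts G" "p \<in> qpaths G \<Longrightarrow> path_target p \<in> verts G"
  by (auto simp: qpaths_def path_source_def path_target_def)

lemma triv_path_qpaths: "v \<in> verts G \<Longrightarrow> triv_path v \<in> qpaths G"
  by (simp add: qpaths_def triv_path_def awalk_Nil_iff)

lemma arrow_path_qpaths: "a \<in> arcs G \<Longrightarrow> arrow_path G a \<in> qpaths G"
  by (simp add: qpaths_def arrow_path_def awalk_Cons_iff awalk_Nil_iff)

lemma qpath_short:
  assumes "p \<in> qpaths G" "path_length p < 2"
  shows "p \<in> triv_path ` verts G \<union> arrow_path G ` arcs G"
proof (cases "fst (snd p)")
  case Nil
  then show ?thesis using assms by (auto simp: qpaths_def triv_path_def awalk_Nil_iff image_iff)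
next
  case (Cons a l)
  then show ?thesis using assms by (auto simp: qpaths_def arrow_path_def awalk_Cons_iff awalk_Nil_iff image_iff)
qed

lemma path_algebra_one_left:
  assumes "Poly_Mapping.keys f \<subseteq> qpaths G"
  shows "path_mult (\<Sum>v\<in>verts G. Poly_Mapping.single (triv_path v) 1) f = f"
proof -
  have *: "path_mult (\<Sum>v\<in>verts G. Poly_Mapping.single (triv_path v) 1) (Poly_Mapping.single p c) = Poly_Mapping.single p c"
    if "p \<in> qpaths G" for p c
  proof -
    have "path_mult (\<Sum>v\<in>verts G. Poly_Mapping.single (triv_path v) 1) (Poly_Mapping.single p c)
        = (\<Sum>v\<in>verts G. if v = path_target p then Poly_Mapping.single p c else 0)"
      unfolding path_mult_sum_left
      by (rule sum.cong) (auto simp: path_mult_single path_term_def path_comp_triv)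
    then show ?thesis using qpaths_verts(2)[OF that] finite_verts by simp
  qed
  have "path_mult (\<Sum>v\<in>verts G. Poly_Mapping.single (triv_path v) 1)
      (\<Sum>p\<in>Poly_Mapping.keys f. Poly_Mapping.single p (Poly_Mapping.lookup f p))
      = (\<Sum>p\<in>Poly_Mapping.keys f. Poly_Mapping.single p (Poly_Mapping.lookup f p))"
    unfolding path_mult_sum_right by (intro sum.cong refl * subsetD[OF assms])
  then show ?thesis by (simp only: poly_mapping_expand)
qed

lemma path_algebra_one_right:
  assumes "Poly_Mapping.keys f \<subseteq> qpaths G"
  shows "path_mult f (\<Sum>v\<in>verts G. Poly_Mapping.single (triv_path v) 1) = f"
proof -
  have *: "path_mult (Poly_Mapping.single p c) (\<Sum>v\<in>verts G. Poly_Mapping.single (triv_path v) 1) = Poly_Mapping.single p c"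
    if "p \<in> qpaths G" for p c
  proof -
    have "path_mult (Poly_Mapping.single p c) (\<Sum>v\<in>verts G. Poly_Mapping.single (triv_path v) 1)
        = (\<Sum>v\<in>verts G. if v = path_source p then Poly_Mapping.single p c else 0)"
      unfolding path_mult_sum_right
      by (rule sum.cong) (auto simp: path_mult_single path_term_def path_comp_triv)
    then show ?thesis using qpaths_verts(1)[OF that] finite_verts by simp
  qed
  have "path_mult (\<Sum>p\<in>Poly_Mapping.keys f. Poly_Mapping.single p (Poly_Mapping.lookup f p))
      (\<Sum>v\<in>verts G. Poly_Mapping.single (triv_path v) 1)
      = (\<Sum>p\<in>Poly_Mapping.keys f. Poly_Mapping.single p (Poly_Mapping.lookup f p))"
    unfolding path_mult_sum_left by (intro sum.cong refl * subsetD[OF assms])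
  then show ?thesis by (simp only: poly_mapping_expand)
qed

lemma path_mult_closed:
  assumes "Poly_Mapping.keys f \<subseteq> qpaths G" "Poly_Mapping.keys g \<subseteq> qpaths G"
  shows "Poly_Mapping.keys (path_mult f g) \<subseteq> qpaths G"
proof
  fix r assume "r \<in> Poly_Mapping.keys (path_mult f g)"
  then show "r \<in> qpaths G" proof (rule keys_path_mult)
    fix q p assume "q \<in> Poly_Mapping.keys f" "p \<in> Poly_Mapping.keys g" "path_target p = path_source q" "r = path_comp q p"
    then show "r \<in> qpaths G" using assms qpaths_comp[of p q] by blast
  qed
qed

lemma path_algebra_ring: "ring (path_algebra G :: (('a, 'b) qpath \<Rightarrow>\<^sub>0 'k::field) ring)"
proof (rule ringI)
  show "abelian_group (path_algebra G :: (('a, 'b) qpath \<Rightarrow>\<^sub>0 'k) ring)"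
  proof (rule abelian_groupI)
    fix f :: "('a, 'b) qpath \<Rightarrow>\<^sub>0 'k" assume "f \<in> carrier (path_algebra G)"
    then show "\<exists>g\<in>carrier (path_algebra G). g \<oplus>\<^bsub>path_algebra G\<^esub> f = \<zero>\<^bsub>path_algebra G\<^esub>"
      by (intro bexI[of _ "- f"]) auto
  next
    fix f g :: "('a, 'b) qpath \<Rightarrow>\<^sub>0 'k" assume "f \<in> carrier (path_algebra G)" "g \<in> carrier (path_algebra G)"
    then show "f \<oplus>\<^bsub>path_algebra G\<^esub> g \<in> carrier (path_algebra G)" using keys_add[of f g] by auto
  qed (auto simp: add.assoc add.commute)
  show "Group.monoid (path_algebra G :: (('a, 'b) qpath \<Rightarrow>\<^sub>0 'k) ring)"
  proof (rule monoidI)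
    have "Poly_Mapping.keys (\<Sum>v\<in>verts G. Poly_Mapping.single (triv_path v) 1 :: ('a, 'b) qpath \<Rightarrow>\<^sub>0 'k) \<subseteq> qpaths G"
      by (rule order_trans[OF keys_sum]) (use triv_path_qpaths in auto)
    then show "\<one>\<^bsub>path_algebra G\<^esub> \<in> carrier (path_algebra G :: (('a, 'b) qpath \<Rightarrow>\<^sub>0 'k) ring)" by simp
  qed (simp_all add: path_mult_closed path_mult_assoc path_algebra_one_left path_algebra_one_right)
qed (simp_all add: path_mult_add_left path_mult_add_right)

section \<open>The filtration of the path algebra by path length\<close>

definition filt :: "nat \<Rightarrow> (('a, 'b) qpath \<Rightarrow>\<^sub>0 'k::field) set" where
  "filt n = {f. Poly_Mapping.keys f \<subseteq> {p \<in> qpaths G. n \<le> path_length p}}"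

lemma filt_mult: "f \<in> filt m \<Longrightarrow> g \<in> filt n \<Longrightarrow> path_mult f g \<in> filt (m + n)"
proof -
  assume f: "f \<in> filt m" and g: "g \<in> filt n"
  have "r \<in> {p \<in> qpaths G. m + n \<le> path_length p}" if "r \<in> Poly_Mapping.keys (path_mult f g)" for r
    using that
  proof (rule keys_path_mult)
    fix q p assume qp: "q \<in> Poly_Mapping.keys f" "p \<in> Poly_Mapping.keys g" "path_target p = path_source q" "r = path_comp q p"
    then have "q \<in> qpaths G" "m \<le> path_length q" "p \<in> qpaths G" "n \<le> path_length p"
      using f g by (auto simp: filt_def)
    then show ?thesis unfolding qp(4) using qpaths_comp[of p q] qp(3) by (simp add: path_length_comp)
  qed
  then show ?thesis by (auto simp: filt_def)
qed

lemma filt_add: "f \<in> filt n \<Longrightarrow> g \<in> filt n \<Longrightarrow> f + g \<in> filt n"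
  using keys_add[of f g] by (auto simp: filt_def)

lemma filt_0: "f \<in> filt 0 \<longleftrightarrow> Poly_Mapping.keys f \<subseteq> qpaths G"
  by (auto simp: filt_def)

lemma filt_single: "p \<in> qpaths G \<Longrightarrow> n \<le> path_length p \<Longrightarrow> Poly_Mapping.single p c \<in> filt n"
  by (auto simp: filt_def)

lemma filt_ideal: "ideal (filt n) (path_algebra G :: (('a, 'b) qpath \<Rightarrow>\<^sub>0 'k::field) ring)"
proof (rule idealI)
  interpret A: ring "path_algebra G :: (('a, 'b) qpath \<Rightarrow>\<^sub>0 'k) ring" by (rule path_algebra_ring)
  show "ring (path_algebra G :: (('a, 'b) qpath \<Rightarrow>\<^sub>0 'k) ring)" by (rule path_algebra_ring)
  have inv: "\<ominus>\<^bsub>path_algebra G\<^esub> f = - f" if "f \<in> carrier (path_algebra G :: (('a, 'b) qpath \<Rightarrow>\<^sub>0 'k) ring)" for f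
    by (rule A.minus_equality) (use that in auto)
  show "subgroup (filt n) (add_monoid (path_algebra G :: (('a, 'b) qpath \<Rightarrow>\<^sub>0 'k) ring))"
  proof (rule A.add.subgroupI)
    show "filt n \<subseteq> carrier (path_algebra G :: (('a, 'b) qpath \<Rightarrow>\<^sub>0 'k) ring)" by (auto simp: filt_def)
    have "(0 :: ('a, 'b) qpath \<Rightarrow>\<^sub>0 'k) \<in> filt n" by (simp add: filt_def)
    then show "filt n \<noteq> ({} :: (('a, 'b) qpath \<Rightarrow>\<^sub>0 'k) set)" by blast
    fix f :: "('a, 'b) qpath \<Rightarrow>\<^sub>0 'k" assume f: "f \<in> filt n"
    then have "f \<in> carrier (path_algebra G)" by (auto simp: filt_def)
    from inv[OF this] show "\<ominus>\<^bsub>path_algebra G\<^esub> f \<in> filt n" using f by (simp add: filt_def)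
    fix g :: "('a, 'b) qpath \<Rightarrow>\<^sub>0 'k" assume g: "g \<in> filt n"
    show "f \<oplus>\<^bsub>path_algebra G\<^esub> g \<in> filt n" using filt_add[OF f g] by simp
  qed
  fix f x :: "('a, 'b) qpath \<Rightarrow>\<^sub>0 'k" assume f: "f \<in> filt n" and x: "x \<in> carrier (path_algebra G)"
  show "x \<otimes>\<^bsub>path_algebra G\<^esub> f \<in> filt n" using filt_mult[of x 0 f n] f x by (simp add: filt_0)
  show "f \<otimes>\<^bsub>path_algebra G\<^esub> x \<in> filt n" using filt_mult[of f n x 0] f x by (simp add: filt_0)
qed

lemma arrow_elem_filt: "a \<in> arcs G \<Longrightarrow> arrow_elem G a \<in> filt 1"
  unfolding arrow_elem_def by (rule filt_single) (auto simp: arrow_path_qpaths, simp add: arrow_path_def)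

lemma filt_closed: "f \<in> filt n \<Longrightarrow> f \<in> carrier (path_algebra G)"
  by (auto simp: filt_def)

lemma arrow_ideal_ideal: "ideal (arrow_ideal G) (path_algebra G :: (('a, 'b) qpath \<Rightarrow>\<^sub>0 'k::field) ring)"
  unfolding arrow_ideal_def
  by (rule ring.genideal_ideal[OF path_algebra_ring]) (use arrow_elem_filt filt_closed in blast)

lemma arrow_ideal_sq_ideal: "ideal (arrow_ideal_sq G) (path_algebra G :: (('a, 'b) qpath \<Rightarrow>\<^sub>0 'k::field) ring)"
  unfolding arrow_ideal_sq_def
  by (rule ring.ideal_prod_is_ideal[OF path_algebra_ring arrow_ideal_ideal arrow_ideal_ideal])

text \<open>The list is in order of traversal while products are written the other way round, so the
  head of the list is the rightmost factor.\<close>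

lemma qpath_Cons:
  assumes "(u, a # l, v) \<in> qpaths G"
  shows "a \<in> arcs G" "(head G a, l, v) \<in> qpaths G"
    "Poly_Mapping.single (u, a # l, v) (c :: 'k::field) =
      Poly_Mapping.single (head G a, l, v) c \<otimes>\<^bsub>path_algebra G\<^esub> arrow_elem G a"
  using assms
  by (auto simp: qpaths_def awalk_Cons_iff arrow_elem_def path_mult_single path_term_def path_comp_def
      arrow_path_def path_source_def path_target_def)

lemma single_arrow_ideal:
  assumes "(u, a # l, v) \<in> qpaths G"
  shows "Poly_Mapping.single (u, a # l, v) (c :: 'k::field) \<in> arrow_ideal G"
proof -
  note q = qpath_Cons[OF assms]
  have sub: "arrow_elem G ` arcs G \<subseteq> carrier (path_algebra G :: (('a, 'b) qpath \<Rightarrow>\<^sub>0 'k) ring)"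
    using arrow_elem_filt filt_closed by blast
  have "arrow_elem G a \<in> (arrow_ideal G :: (('a, 'b) qpath \<Rightarrow>\<^sub>0 'k) set)"
    unfolding arrow_ideal_def using ring.genideal_self[OF path_algebra_ring sub] q(1) by blast
  then show ?thesis
    unfolding q(3) by (rule ideal.I_l_closed[OF arrow_ideal_ideal]) (use q(2) in simp)
qed

lemma single_arrow_ideal_sq:
  assumes p: "p \<in> qpaths G" "2 \<le> path_length p"
  shows "Poly_Mapping.single p (c :: 'k::field) \<in> arrow_ideal_sq G"
proof -
  obtain u a b l v where p': "p = (u, a # b # l, v)"
    using p(2) by (cases p; cases "fst (snd p)"; cases "tl (fst (snd p))") auto
  note q = qpath_Cons[OF p(1)[unfolded p']]
  have sub: "arrow_elem G ` arcs G \<subseteq> carrier (path_algebra G :: (('a, 'b) qpath \<Rightarrow>\<^sub>0 'k) ring)"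
    using arrow_elem_filt filt_closed by blast
  have "arrow_elem G a \<in> (arrow_ideal G :: (('a, 'b) qpath \<Rightarrow>\<^sub>0 'k) set)"
    unfolding arrow_ideal_def using ring.genideal_self[OF path_algebra_ring sub] q(1) by blast
  then show ?thesis
    unfolding p' q(3) arrow_ideal_sq_def
    by (rule ideal_prod.prod[OF single_arrow_ideal[OF q(2)]])
qed

text \<open>The filtration is multiplicative and contains the arrows in degree 1, which bounds the
  square of the arrow ideal. Conversely a path of length at least 2 factors as a nontrivial path
  times its first arrow, and both factors lie in the arrow ideal.\<close>

lemma arrow_ideal_sq_eq: "(arrow_ideal_sq G :: (('a, 'b) qpath \<Rightarrow>\<^sub>0 'k::field) set) = filt 2"
proof
  have "arrow_ideal G \<subseteq> (filt 1 :: (('a, 'b) qpath \<Rightarrow>\<^sub>0 'k) set)"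
    unfolding arrow_ideal_def
    by (rule ring.genideal_minimal[OF path_algebra_ring filt_ideal]) (use arrow_elem_filt in blast)
  note J = subsetD[OF this]
  show "arrow_ideal_sq G \<subseteq> (filt 2 :: (('a, 'b) qpath \<Rightarrow>\<^sub>0 'k) set)"
  proof
    fix f :: "('a, 'b) qpath \<Rightarrow>\<^sub>0 'k" assume "f \<in> arrow_ideal_sq G"
    then show "f \<in> filt 2"
      unfolding arrow_ideal_sq_def
    proof (induction f rule: ideal_prod.induct)
      case (prod i j)
      then show ?case using filt_mult[OF J J, of i j] by (simp add: numeral_2_eq_2)
    qed (simp add: filt_add)
  qed
  show "(filt 2 :: (('a, 'b) qpath \<Rightarrow>\<^sub>0 'k) set) \<subseteq> arrow_ideal_sq G"
  proof
    fix f :: "('a, 'b) qpath \<Rightarrow>\<^sub>0 'k" assume f: "f \<in> filt 2"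
    note I = ideal.axioms(1)[OF arrow_ideal_sq_ideal]
    have "(\<Sum>p\<in>F. Poly_Mapping.single p (Poly_Mapping.lookup f p)) \<in> arrow_ideal_sq G"
      if "finite F" "F \<subseteq> Poly_Mapping.keys f" for F
      using that
    proof (induction F rule: finite_induct)
      case empty
      then show ?case using additive_subgroup.zero_closed[OF I] by simp
    next
      case (insert p F)
      then have "p \<in> qpaths G" "2 \<le> path_length p" using f by (auto simp: filt_def)
      then show ?case
        using additive_subgroup.a_closed[OF I single_arrow_ideal_sq] insert by simp
    qed
    from this[OF finite_keys order_refl] show "f \<in> arrow_ideal_sq G" by (simp only: poly_mapping_expand)
  qed
qed

end

section \<open>The quotient algebra, its coefficients and its multiplication table\<close>

context fin_digraph
begin

lemma rad_sq_zero_proj_hom: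
  "rad_sq_zero_proj G \<in> ring_hom (path_algebra G :: (('a, 'b) qpath \<Rightarrow>\<^sub>0 'k::field) ring) (rad_sq_zero_algebra G)"
  unfolding rad_sq_zero_proj_def rad_sq_zero_algebra_def
  using ideal.rcos_ring_hom[OF arrow_ideal_sq_ideal] by simp

lemma rad_sq_zero_algebra_ring: "ring (rad_sq_zero_algebra G :: (('a, 'b) qpath \<Rightarrow>\<^sub>0 'k::field) set ring)"
  unfolding rad_sq_zero_algebra_def by (rule ideal.quotient_is_ring[OF arrow_ideal_sq_ideal])

lemma proj_closed:
  "Poly_Mapping.keys f \<subseteq> qpaths G \<Longrightarrow> rad_sq_zero_proj G f \<in> carrier (rad_sq_zero_algebra G)"
  using ring_hom_closed[OF rad_sq_zero_proj_hom, of f] by simp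

lemma proj_add:
  "Poly_Mapping.keys f \<subseteq> qpaths G \<Longrightarrow> Poly_Mapping.keys g \<subseteq> qpaths G \<Longrightarrow>
    rad_sq_zero_proj G (f + g) = rad_sq_zero_proj G f \<oplus>\<^bsub>rad_sq_zero_algebra G\<^esub> rad_sq_zero_proj G g"
  using ring_hom_add[OF rad_sq_zero_proj_hom, of f g] by simp

lemma proj_mult:
  "Poly_Mapping.keys f \<subseteq> qpaths G \<Longrightarrow> Poly_Mapping.keys g \<subseteq> qpaths G \<Longrightarrow>
    rad_sq_zero_proj G (path_mult f g) = rad_sq_zero_proj G f \<otimes>\<^bsub>rad_sq_zero_algebra G\<^esub> rad_sq_zero_proj G g"
  using ring_hom_mult[OF rad_sq_zero_proj_hom, of f g] by simp

lemma proj_one: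
  "rad_sq_zero_proj G (\<Sum>v\<in>verts G. Poly_Mapping.single (triv_path v) 1) = \<one>\<^bsub>rad_sq_zero_algebra G\<^esub>"
  using ring_hom_one[OF rad_sq_zero_proj_hom] by simp

lemma proj_zero: "rad_sq_zero_proj G 0 = \<zero>\<^bsub>rad_sq_zero_algebra G\<^esub>"
  using ring_hom_zero[OF rad_sq_zero_proj_hom path_algebra_ring rad_sq_zero_algebra_ring] by simp

lemma proj_sum:
  assumes "\<And>i. i \<in> F \<Longrightarrow> Poly_Mapping.keys (f i) \<subseteq> qpaths G"
  shows "rad_sq_zero_proj G (sum f F) = finsum (rad_sq_zero_algebra G) (\<lambda>i. rad_sq_zero_proj G (f i)) F"
proof -
  interpret L: ring "rad_sq_zero_algebra G :: (('a, 'b) qpath \<Rightarrow>\<^sub>0 'k::field) set ring"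
    by (rule rad_sq_zero_algebra_ring)
  show ?thesis
    using assms
  proof (induction F rule: infinite_finite_induct)
    case (insert i F)
    then have "Poly_Mapping.keys (sum f F) \<subseteq> qpaths G"
      by (intro order_trans[OF keys_sum]) auto
    then show ?case using insert by (simp add: proj_add Pi_iff proj_closed)
  qed (simp_all add: proj_zero)
qed

lemma proj_surj:
  assumes "x \<in> carrier (rad_sq_zero_algebra G)"
  obtains f where "Poly_Mapping.keys f \<subseteq> qpaths G" "x = rad_sq_zero_proj G f"
proof -
  from assms obtain f where "f \<in> carrier (path_algebra G)" "x = rad_sq_zero_proj G f"
    unfolding rad_sq_zero_algebra_def rad_sq_zero_proj_def FactRing_simps by (auto simp del: path_algebra_simps)
  then show thesis using that by simp
qed

text \<open>Equality in the quotient is equality of the coefficients at trivial paths and arrows.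
  This is what makes the coefficient functionals on the quotient well defined.\<close>

lemma proj_eq_iff:
  assumes f: "Poly_Mapping.keys f \<subseteq> qpaths G" and g: "Poly_Mapping.keys g \<subseteq> qpaths G"
  shows "rad_sq_zero_proj G f = rad_sq_zero_proj G g \<longleftrightarrow>
    (\<forall>p\<in>qpaths G. path_length p < 2 \<longrightarrow> Poly_Mapping.lookup f p = Poly_Mapping.lookup g p)"
proof -
  interpret A: ring "path_algebra G :: (('a, 'b) qpath \<Rightarrow>\<^sub>0 'k::field) ring" by (rule path_algebra_ring)
  have "f \<ominus>\<^bsub>path_algebra G\<^esub> g = f - g"
    using g A.minus_equality[of "- g" g] by (simp add: a_minus_def)
  then have "rad_sq_zero_proj G f = rad_sq_zero_proj G g \<longleftrightarrow> f - g \<in> filt 2"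
    unfolding rad_sq_zero_proj_def
    using A.quotient_eq_iff_same_a_r_cos[OF arrow_ideal_sq_ideal, of f g] f g
    by (simp add: arrow_ideal_sq_eq)
  also have "\<dots> \<longleftrightarrow> (\<forall>p\<in>Poly_Mapping.keys (f - g). \<not> path_length p < 2)"
    using keys_diff[of f g] f g by (auto simp: filt_def)
  also have "\<dots> \<longleftrightarrow> (\<forall>p\<in>qpaths G. p \<in> Poly_Mapping.keys (f - g) \<longrightarrow> \<not> path_length p < 2)"
    using keys_diff[of f g] f g by blast
  also have "\<dots> \<longleftrightarrow> (\<forall>p\<in>qpaths G. path_length p < 2 \<longrightarrow> Poly_Mapping.lookup f p = Poly_Mapping.lookup g p)"
    by (auto simp: in_keys_iff lookup_minus)
  finally show ?thesis .
qed

text \<open>A chosen representative of a coset. Its coefficients at paths of length less than 2 are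
  independent of the choice.\<close>

definition rsz_rep :: "(('a, 'b) qpath \<Rightarrow>\<^sub>0 'k::field) set \<Rightarrow> ('a, 'b) qpath \<Rightarrow>\<^sub>0 'k" where
  "rsz_rep x = (SOME f. Poly_Mapping.keys f \<subseteq> qpaths G \<and> x = rad_sq_zero_proj G f)"

lemma lookup_rsz_rep:
  assumes "Poly_Mapping.keys f \<subseteq> qpaths G" "p \<in> qpaths G" "path_length p < 2"
  shows "Poly_Mapping.lookup (rsz_rep (rad_sq_zero_proj G f)) p = Poly_Mapping.lookup f p"
proof -
  have "\<exists>g. Poly_Mapping.keys g \<subseteq> qpaths G \<and> rad_sq_zero_proj G f = rad_sq_zero_proj G g"
    using assms(1) by blast
  from someI_ex[OF this] have "Poly_Mapping.keys (rsz_rep (rad_sq_zero_proj G f)) \<subseteq> qpaths G"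
    and "rad_sq_zero_proj G f = rad_sq_zero_proj G (rsz_rep (rad_sq_zero_proj G f))"
    unfolding rsz_rep_def by simp_all
  then show ?thesis
    using proj_eq_iff[OF assms(1)] assms(2,3) by simp
qed

definition rsz_ev :: "'a \<Rightarrow> 'k::field \<Rightarrow> (('a, 'b) qpath \<Rightarrow>\<^sub>0 'k) set" where
  "rsz_ev v c = rad_sq_zero_proj G (Poly_Mapping.single (triv_path v) c)"

definition rsz_ar :: "'b \<Rightarrow> 'k::field \<Rightarrow> (('a, 'b) qpath \<Rightarrow>\<^sub>0 'k) set" where
  "rsz_ar a c = rad_sq_zero_proj G (Poly_Mapping.single (arrow_path G a) c)"

definition rsz_cv :: "'a \<Rightarrow> (('a, 'b) qpath \<Rightarrow>\<^sub>0 'k::field) set \<Rightarrow> 'k" where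
  "rsz_cv v x = Poly_Mapping.lookup (rsz_rep x) (triv_path v)"

definition rsz_ca :: "'b \<Rightarrow> (('a, 'b) qpath \<Rightarrow>\<^sub>0 'k::field) set \<Rightarrow> 'k" where
  "rsz_ca a x = Poly_Mapping.lookup (rsz_rep x) (arrow_path G a)"

lemma rsz_cv_proj: "Poly_Mapping.keys f \<subseteq> qpaths G \<Longrightarrow> v \<in> verts G \<Longrightarrow>
    rsz_cv v (rad_sq_zero_proj G f) = Poly_Mapping.lookup f (triv_path v)"
  unfolding rsz_cv_def by (rule lookup_rsz_rep) (auto simp: triv_path_qpaths, simp add: triv_path_def)

lemma rsz_ca_proj: "Poly_Mapping.keys f \<subseteq> qpaths G \<Longrightarrow> a \<in> arcs G \<Longrightarrow>
    rsz_ca a (rad_sq_zero_proj G f) = Poly_Mapping.lookup f (arrow_path G a)"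
  unfolding rsz_ca_def by (rule lookup_rsz_rep) (auto simp: arrow_path_qpaths, simp add: arrow_path_def)

lemma keys_single_triv: "v \<in> verts G \<Longrightarrow> Poly_Mapping.keys (Poly_Mapping.single (triv_path v) c) \<subseteq> qpaths G"
  by (auto simp: triv_path_qpaths)

lemma keys_single_arrow: "a \<in> arcs G \<Longrightarrow> Poly_Mapping.keys (Poly_Mapping.single (arrow_path G a) c) \<subseteq> qpaths G"
  by (auto simp: arrow_path_qpaths)

lemma rsz_expand:
  assumes f: "Poly_Mapping.keys f \<subseteq> qpaths G"
  shows "rad_sq_zero_proj G f =
    finsum (rad_sq_zero_algebra G) (\<lambda>v. rsz_ev v (Poly_Mapping.lookup f (triv_path v))) (verts G)
    \<oplus>\<^bsub>rad_sq_zero_algebra G\<^esub>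
    finsum (rad_sq_zero_algebra G) (\<lambda>a. rsz_ar a (Poly_Mapping.lookup f (arrow_path G a))) (arcs G)"
proof -
  let ?g = "\<Sum>v\<in>verts G. Poly_Mapping.single (triv_path v) (Poly_Mapping.lookup f (triv_path v))"
  let ?h = "\<Sum>a\<in>arcs G. Poly_Mapping.single (arrow_path G a) (Poly_Mapping.lookup f (arrow_path G a))"
  have g: "Poly_Mapping.keys ?g \<subseteq> qpaths G"
    by (rule order_trans[OF keys_sum]) (use triv_path_qpaths in auto)
  have h: "Poly_Mapping.keys ?h \<subseteq> qpaths G"
    by (rule order_trans[OF keys_sum]) (use arrow_path_qpaths in auto)
  have "Poly_Mapping.lookup f p = Poly_Mapping.lookup (?g + ?h) p" if "p \<in> qpaths G" "path_length p < 2" for p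
    using qpath_short[OF that]
  proof
    assume "p \<in> triv_path ` verts G"
    then obtain u where u: "u \<in> verts G" "p = triv_path u" by auto
    have "Poly_Mapping.lookup ?g p = (\<Sum>v\<in>verts G. if v = u then Poly_Mapping.lookup f p else 0)"
      unfolding lookup_sum by (rule sum.cong) (auto simp: u lookup_single)
    moreover have "Poly_Mapping.lookup ?h p = 0"
      unfolding lookup_sum by (rule sum.neutral) (auto simp: u lookup_single)
    ultimately show ?thesis using u finite_verts by (simp add: lookup_add)
  next
    assume "p \<in> arrow_path G ` arcs G"
    then obtain b where b: "b \<in> arcs G" "p = arrow_path G b" by auto
    have "Poly_Mapping.lookup ?h p = (\<Sum>a\<in>arcs G. if a = b then Poly_Mapping.lookup f p else 0)"
      unfolding lookup_sum by (rule sum.cong) (auto simp: b lookup_single)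
    moreover have "Poly_Mapping.lookup ?g p = 0"
      unfolding lookup_sum by (rule sum.neutral) (auto simp: b lookup_single)
    ultimately show ?thesis using b finite_arcs by (simp add: lookup_add)
  qed
  then have "rad_sq_zero_proj G f = rad_sq_zero_proj G (?g + ?h)"
    using proj_eq_iff[OF f, of "?g + ?h"] keys_add[of ?g ?h] g h by blast
  also have "\<dots> = rad_sq_zero_proj G ?g \<oplus>\<^bsub>rad_sq_zero_algebra G\<^esub> rad_sq_zero_proj G ?h"
    by (rule proj_add[OF g h])
  also have "rad_sq_zero_proj G ?g = finsum (rad_sq_zero_algebra G) (\<lambda>v. rsz_ev v (Poly_Mapping.lookup f (triv_path v))) (verts G)"
    unfolding rsz_ev_def by (rule proj_sum) (rule keys_single_triv)
  also have "rad_sq_zero_proj G ?h = finsum (rad_sq_zero_algebra G) (\<lambda>a. rsz_ar a (Poly_Mapping.lookup f (arrow_path G a))) (arcs G)"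
    unfolding rsz_ar_def by (rule proj_sum) (rule keys_single_arrow)
  finally show ?thesis .
qed

lemma proj_long:
  assumes "p \<in> qpaths G" "2 \<le> path_length p"
  shows "rad_sq_zero_proj G (Poly_Mapping.single p c) = \<zero>\<^bsub>rad_sq_zero_algebra G\<^esub>"
  unfolding proj_zero[symmetric]
  by (subst proj_eq_iff) (use assms in \<open>auto simp: lookup_single when_def\<close>)

lemma keys_single_qpath: "p \<in> qpaths G \<Longrightarrow> Poly_Mapping.keys (Poly_Mapping.single p c) \<subseteq> qpaths G"
  by auto

lemma proj_single_mult:
  "q \<in> qpaths G \<Longrightarrow> p \<in> qpaths G \<Longrightarrow>
    rad_sq_zero_proj G (Poly_Mapping.single q c) \<otimes>\<^bsub>rad_sq_zero_algebra G\<^esub> rad_sq_zero_proj G (Poly_Mapping.single p d)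
    = rad_sq_zero_proj G (path_term q p (c * d))"
  using proj_mult[OF keys_single_qpath keys_single_qpath, of q p c d] by (simp only: path_mult_single)

lemma rsz_ev_closed: "v \<in> verts G \<Longrightarrow> rsz_ev v c \<in> carrier (rad_sq_zero_algebra G)"
  unfolding rsz_ev_def by (rule proj_closed[OF keys_single_triv])

lemma rsz_ar_closed: "a \<in> arcs G \<Longrightarrow> rsz_ar a c \<in> carrier (rad_sq_zero_algebra G)"
  unfolding rsz_ar_def by (rule proj_closed[OF keys_single_arrow])

text \<open>All assumptions of the abstract setting are checked on representatives. From here on the
  quotient is used through its multiplication table and its coefficient functionals.\<close>

lemma rad_sq_zero_algebra_rad_sq_zero:
  "rad_sq_zero (rad_sq_zero_algebra G :: (('a, 'b) qpath \<Rightarrow>\<^sub>0 'k::field) set ring) (verts G) (arcs G) (tail G) (head G)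
    rsz_ev rsz_ar rsz_cv rsz_ca"
proof (rule rad_sq_zero.intro[OF rad_sq_zero_algebra_ring], rule rad_sq_zero_axioms.intro)
  let ?L = "rad_sq_zero_algebra G :: (('a, 'b) qpath \<Rightarrow>\<^sub>0 'k) set ring"
  interpret L: ring ?L by (rule rad_sq_zero_algebra_ring)
  note t = triv_path_qpaths and a = arrow_path_qpaths
  show "finite (verts G)" "finite (arcs G)" by simp_all
  show "b \<in> arcs G \<Longrightarrow> tail G b \<in> verts G" "b \<in> arcs G \<Longrightarrow> head G b \<in> verts G" for b by simp_all
  show "v \<in> verts G \<Longrightarrow> rsz_ev v c \<in> carrier ?L" for v c by (rule rsz_ev_closed)
  show "b \<in> arcs G \<Longrightarrow> rsz_ar b c \<in> carrier ?L" for b c by (rule rsz_ar_closed)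
  show "rsz_ev v 0 = \<zero>\<^bsub>?L\<^esub>" for v by (simp add: rsz_ev_def proj_zero)
  show "rsz_ar b 0 = \<zero>\<^bsub>?L\<^esub>" for b by (simp add: rsz_ar_def proj_zero)
  show "rsz_ev v c \<otimes>\<^bsub>?L\<^esub> rsz_ev w d = (if v = w then rsz_ev v (c * d) else \<zero>\<^bsub>?L\<^esub>)"
    if "v \<in> verts G" "w \<in> verts G" for v w and c d :: 'k
    using proj_single_mult[OF t[OF that(1)] t[OF that(2)], of c d]
    by (auto simp: rsz_ev_def path_term_def proj_zero path_comp_triv_triv)
  show "rsz_ev v c \<otimes>\<^bsub>?L\<^esub> rsz_ar b d = (if v = head G b then rsz_ar b (c * d) else \<zero>\<^bsub>?L\<^esub>)"
    if "v \<in> verts G" "b \<in> arcs G" for v b and c d :: 'k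
    using proj_single_mult[OF t[OF that(1)] a[OF that(2)], of c d] path_comp_triv(1)[of "arrow_path G b"]
    by (auto simp: rsz_ev_def rsz_ar_def path_term_def proj_zero)
  show "rsz_ar b c \<otimes>\<^bsub>?L\<^esub> rsz_ev v d = (if v = tail G b then rsz_ar b (c * d) else \<zero>\<^bsub>?L\<^esub>)"
    if "v \<in> verts G" "b \<in> arcs G" for v b and c d :: 'k
    using proj_single_mult[OF a[OF that(2)] t[OF that(1)], of c d] path_comp_triv(2)[of "arrow_path G b"]
    by (auto simp: rsz_ev_def rsz_ar_def path_term_def proj_zero)
  show "rsz_ar b c \<otimes>\<^bsub>?L\<^esub> rsz_ar b' d = \<zero>\<^bsub>?L\<^esub>" if "b \<in> arcs G" "b' \<in> arcs G" for b b' and c d :: 'k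
  \<comment> \<open>Two composable arrows give a path of length 2, which is zero in the quotient;
    otherwise the product vanishes already in the path algebra.\<close>
  proof (cases "head G b' = tail G b")
    case True
    have "path_length (path_comp (arrow_path G b) (arrow_path G b')) = 2"
      unfolding path_length_comp by (simp add: arrow_path_def)
    then show ?thesis
      using True proj_single_mult[OF a[OF that(1)] a[OF that(2)], of c d]
        qpaths_comp[OF a[OF that(2)] a[OF that(1)]]
      by (simp add: rsz_ar_def path_term_def proj_long)
  next
    case False
    then show ?thesis
      using proj_single_mult[OF a[OF that(1)] a[OF that(2)], of c d]
      by (simp add: rsz_ar_def path_term_def proj_zero)
  qed
  show "\<one>\<^bsub>?L\<^esub> = finsum ?L (\<lambda>v. rsz_ev v 1) (verts G)"
    unfolding rsz_ev_def proj_one[symmetric] by (rule proj_sum[OF keys_single_triv])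
  show "x = finsum ?L (\<lambda>v. rsz_ev v (rsz_cv v x)) (verts G) \<oplus>\<^bsub>?L\<^esub> finsum ?L (\<lambda>b. rsz_ar b (rsz_ca b x)) (arcs G)"
    if "x \<in> carrier ?L" for x
  proof -
    obtain f where f: "Poly_Mapping.keys f \<subseteq> qpaths G" "x = rad_sq_zero_proj G f" using \<open>x \<in> carrier ?L\<close> by (rule proj_surj)
    have "finsum ?L (\<lambda>v. rsz_ev v (rsz_cv v x)) (verts G) = finsum ?L (\<lambda>v. rsz_ev v (Poly_Mapping.lookup f (triv_path v))) (verts G)"
      by (rule L.finsum_cong') (use f in \<open>auto simp: rsz_cv_proj rsz_ev_closed\<close>)
    moreover have "finsum ?L (\<lambda>b. rsz_ar b (rsz_ca b x)) (arcs G) = finsum ?L (\<lambda>b. rsz_ar b (Poly_Mapping.lookup f (arrow_path G b))) (arcs G)"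
      by (rule L.finsum_cong') (use f in \<open>auto simp: rsz_ca_proj rsz_ar_closed\<close>)
    ultimately show ?thesis using rsz_expand[OF f(1)] f(2) by simp
  qed
  \<comment> \<open>Representatives of both summands whose sum represents the sum, so that
    additivity of the functionals becomes additivity of \<open>lookup\<close>.\<close>
  have split: "\<exists>f g. Poly_Mapping.keys f \<subseteq> qpaths G \<and> x = rad_sq_zero_proj G f \<and>
      Poly_Mapping.keys g \<subseteq> qpaths G \<and> y = rad_sq_zero_proj G g \<and>
      Poly_Mapping.keys (f + g) \<subseteq> qpaths G \<and> x \<oplus>\<^bsub>?L\<^esub> y = rad_sq_zero_proj G (f + g)"
    if xy: "x \<in> carrier ?L" "y \<in> carrier ?L" for x y
  proof -
    obtain f where f: "Poly_Mapping.keys f \<subseteq> qpaths G" "x = rad_sq_zero_proj G f" using xy(1) by (rule proj_surj)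
    obtain g where g: "Poly_Mapping.keys g \<subseteq> qpaths G" "y = rad_sq_zero_proj G g" using xy(2) by (rule proj_surj)
    show ?thesis
      using f g keys_add[of f g] proj_add[OF f(1) g(1)] by (intro exI[of _ f] exI[of _ g]) auto
  qed
  show "rsz_cv v (x \<oplus>\<^bsub>?L\<^esub> y) = rsz_cv v x + rsz_cv v y"
    if v: "v \<in> verts G" and xy: "x \<in> carrier ?L" "y \<in> carrier ?L" for v x y
  proof -
    obtain f g where fg: "Poly_Mapping.keys f \<subseteq> qpaths G" "x = rad_sq_zero_proj G f"
      "Poly_Mapping.keys g \<subseteq> qpaths G" "y = rad_sq_zero_proj G g"
      "Poly_Mapping.keys (f + g) \<subseteq> qpaths G" "x \<oplus>\<^bsub>?L\<^esub> y = rad_sq_zero_proj G (f + g)"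
      using split[OF xy] by blast
    show ?thesis
      unfolding fg(6) rsz_cv_proj[OF fg(5) v] unfolding fg(2,4) rsz_cv_proj[OF fg(1) v] rsz_cv_proj[OF fg(3) v]
      by (rule lookup_add)
  qed
  show "rsz_ca b (x \<oplus>\<^bsub>?L\<^esub> y) = rsz_ca b x + rsz_ca b y"
    if b: "b \<in> arcs G" and xy: "x \<in> carrier ?L" "y \<in> carrier ?L" for b x y
  proof -
    obtain f g where fg: "Poly_Mapping.keys f \<subseteq> qpaths G" "x = rad_sq_zero_proj G f"
      "Poly_Mapping.keys g \<subseteq> qpaths G" "y = rad_sq_zero_proj G g"
      "Poly_Mapping.keys (f + g) \<subseteq> qpaths G" "x \<oplus>\<^bsub>?L\<^esub> y = rad_sq_zero_proj G (f + g)"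
      using split[OF xy] by blast
    show ?thesis
      unfolding fg(6) rsz_ca_proj[OF fg(5) b] unfolding fg(2,4) rsz_ca_proj[OF fg(1) b] rsz_ca_proj[OF fg(3) b]
      by (rule lookup_add)
  qed
  show "rsz_cv v (rsz_ev w c) = (if v = w then c else 0)" if "v \<in> verts G" "w \<in> verts G" for v w and c :: 'k
    unfolding rsz_ev_def rsz_cv_proj[OF keys_single_triv[OF that(2)] that(1)] by (simp add: lookup_single)
  show "rsz_cv v (rsz_ar b c) = 0" if "v \<in> verts G" "b \<in> arcs G" for v b and c :: 'k
    unfolding rsz_ar_def rsz_cv_proj[OF keys_single_arrow[OF that(2)] that(1)] by (simp add: lookup_single)
  show "rsz_ca b (rsz_ar b' c) = (if b = b' then c else 0)" if "b \<in> arcs G" "b' \<in> arcs G" for b b' and c :: 'k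
    unfolding rsz_ar_def rsz_ca_proj[OF keys_single_arrow[OF that(2)] that(1)] by (simp add: lookup_single)
qed

end

section \<open>Tensor products\<close>

locale tensor_product =
  A: abelian_group A + B: abelian_group B
  for A :: "('a, 'x) ring_scheme" and B :: "('b, 'y) ring_scheme" +
  fixes ra :: "'a \<Rightarrow> 's \<Rightarrow> 'a" and S :: "'s set" and la :: "'s \<Rightarrow> 'b \<Rightarrow> 'b"
  assumes ra_closed: "a \<in> carrier A \<Longrightarrow> s \<in> S \<Longrightarrow> ra a s \<in> carrier A"
    and la_closed: "s \<in> S \<Longrightarrow> b \<in> carrier B \<Longrightarrow> la s b \<in> carrier B"
begin

abbreviation "F \<equiv> free_Abelian_group (carrier A \<times> carrier B)"
abbreviation "N \<equiv> tensor_null A ra S la B"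
abbreviation "T \<equiv> tensor_group A ra S la B"

definition tcl :: "('a \<times> 'b \<Rightarrow>\<^sub>0 int) \<Rightarrow> ('a \<times> 'b \<Rightarrow>\<^sub>0 int) set" where
  "tcl x = N #>\<^bsub>F\<^esub> x"

definition tens :: "'a \<Rightarrow> 'b \<Rightarrow> ('a \<times> 'b \<Rightarrow>\<^sub>0 int) set" where
  "tens a b = tcl (frag_of (a, b))"

text \<open>The condition for a map on pairs to induce a homomorphism on the tensor product. The
  target is written multiplicatively, to match \<open>tensor_group\<close>, which is a quotient in
  multiplicative notation.\<close>

definition balanced :: "('h, 'z) monoid_scheme \<Rightarrow> ('a \<Rightarrow> 'b \<Rightarrow> 'h) \<Rightarrow> bool" where
  "balanced H \<beta> \<longleftrightarrow> (\<forall>a\<in>carrier A. \<forall>b\<in>carrier B. \<beta> a b \<in> carrier H) \<and>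
     (\<forall>a\<in>carrier A. \<forall>a'\<in>carrier A. \<forall>b\<in>carrier B. \<beta> (a \<oplus>\<^bsub>A\<^esub> a') b = \<beta> a b \<otimes>\<^bsub>H\<^esub> \<beta> a' b) \<and>
     (\<forall>a\<in>carrier A. \<forall>b\<in>carrier B. \<forall>b'\<in>carrier B. \<beta> a (b \<oplus>\<^bsub>B\<^esub> b') = \<beta> a b \<otimes>\<^bsub>H\<^esub> \<beta> a b') \<and>
     (\<forall>a\<in>carrier A. \<forall>s\<in>S. \<forall>b\<in>carrier B. \<beta> (ra a s) b = \<beta> a (la s b))"

lemma frag_of_closed: "a \<in> carrier A \<Longrightarrow> b \<in> carrier B \<Longrightarrow> frag_of (a, b) \<in> carrier F"
  by simp

lemma diff_closed: "x \<in> carrier F \<Longrightarrow> y \<in> carrier F \<Longrightarrow> x - y \<in> carrier F"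
  using keys_diff[of x y] by auto

lemma rels_closed: "tensor_rels A ra S la B \<subseteq> carrier F"
  unfolding tensor_rels_def
  by (auto intro!: diff_closed frag_of_closed simp: ra_closed la_closed simp del: carrier_free_Abelian_group_iff)

sublocale F: comm_group F by (rule abelian_free_Abelian_group)

lemma N_subgroup: "subgroup N F"
  unfolding tensor_null_def by (rule F.generate_is_subgroup[OF rels_closed])

lemma N_normal: "N \<lhd> F"
  by (rule F.normal_iff_subgroup[THEN iffD2, OF N_subgroup])

lemma T_comm_group: "comm_group T"
  unfolding tensor_group_def by (rule F.abelian_FactGroup[OF N_subgroup])

sublocale T: comm_group T by (rule T_comm_group)

lemma carrier_T: "carrier T = tcl ` carrier F"
  by (simp add: tensor_group_def carrier_FactGroup tcl_def)

lemma tcl_hom: "tcl \<in> hom F T"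
  using normal.r_coset_hom_Mod[OF N_normal] by (simp add: tensor_group_def tcl_def[abs_def])

lemma hom_diff:
  assumes H: "group H" and f: "f \<in> hom F H" and xy: "x \<in> carrier F" "y \<in> carrier F"
  shows "f (x - y) = f x \<otimes>\<^bsub>H\<^esub> inv\<^bsub>H\<^esub> f y"
proof -
  interpret H: group H by fact
  interpret f: group_hom F H f by unfold_locales (rule f)
  have "x - y = x \<otimes>\<^bsub>F\<^esub> inv\<^bsub>F\<^esub> y" using xy(2) by simp
  then have "f (x - y) = f (x \<otimes>\<^bsub>F\<^esub> inv\<^bsub>F\<^esub> y)" by (rule arg_cong)
  also have "\<dots> = f x \<otimes>\<^bsub>H\<^esub> f (inv\<^bsub>F\<^esub> y)" by (rule f.hom_mult[OF xy(1) F.inv_closed[OF xy(2)]])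
  also have "\<dots> = f x \<otimes>\<^bsub>H\<^esub> inv\<^bsub>H\<^esub> f y" unfolding f.hom_inv[OF xy(2)] ..
  finally show ?thesis .
qed

lemma tcl_diff: "x \<in> carrier F \<Longrightarrow> y \<in> carrier F \<Longrightarrow> tcl (x - y) = tcl x \<otimes>\<^bsub>T\<^esub> inv\<^bsub>T\<^esub> tcl y"
  by (rule hom_diff[OF T.is_group tcl_hom])

lemma tens_closed: "a \<in> carrier A \<Longrightarrow> b \<in> carrier B \<Longrightarrow> tens a b \<in> carrier T"
  unfolding tens_def carrier_T by (rule imageI) simp

lemma hom_eq_on_free:
  assumes H: "group H" and f: "f \<in> hom F H" and g: "g \<in> hom F H"
    and eq: "\<And>a b. a \<in> carrier A \<Longrightarrow> b \<in> carrier B \<Longrightarrow> f (frag_of (a, b)) = g (frag_of (a, b))"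
    and x: "x \<in> carrier F"
  shows "f x = g x"
proof -
  interpret H: group H by fact
  interpret f: group_hom F H f by unfold_locales (rule f)
  interpret g: group_hom F H g by unfold_locales (rule g)
  have "Poly_Mapping.keys x \<subseteq> carrier A \<times> carrier B" using x by simp
  then show ?thesis
  proof (rule free_Abelian_group_induct[where P = "\<lambda>x. f x = g x"])
    show "f 0 = g 0" using f.hom_one g.hom_one by simp
  next
    fix x y assume xy: "Poly_Mapping.keys x \<subseteq> carrier A \<times> carrier B" "Poly_Mapping.keys y \<subseteq> carrier A \<times> carrier B"
      "f x = g x" "f y = g y"
    then have "x \<in> carrier F" "y \<in> carrier F" by simp_all
    then show "f (x - y) = g (x - y)" using xy(3,4) hom_diff[OF H f] hom_diff[OF H g] by simp
  next
    fix p assume "p \<in> carrier A \<times> carrier B"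
    then show "f (frag_of p) = g (frag_of p)" using eq by auto
  qed
qed

lemma hom_eqI:
  assumes H: "group H" and f: "f \<in> hom T H" and g: "g \<in> hom T H"
    and eq: "\<And>a b. a \<in> carrier A \<Longrightarrow> b \<in> carrier B \<Longrightarrow> f (tens a b) = g (tens a b)"
    and x: "x \<in> carrier T"
  shows "f x = g x"
proof -
  obtain y where y: "y \<in> carrier F" "x = tcl y" using x unfolding carrier_T by blast
  have "(f \<circ> tcl) y = (g \<circ> tcl) y"
    by (rule hom_eq_on_free[OF H Group.hom_compose[OF tcl_hom f] Group.hom_compose[OF tcl_hom g] _ y(1)])
       (use eq in \<open>simp add: tens_def\<close>)
  then show ?thesis using y by simp
qed

text \<open>Closure under quotients instead of products and inverses mirrors the induction principle
  of the free abelian group, whose step is subtraction.\<close>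

lemma tensor_induct [consumes 1, case_names tens diff one]:
  assumes x: "x \<in> carrier T"
    and tens: "\<And>a b. a \<in> carrier A \<Longrightarrow> b \<in> carrier B \<Longrightarrow> P (tens a b)"
    and diff: "\<And>x y. x \<in> carrier T \<Longrightarrow> y \<in> carrier T \<Longrightarrow> P x \<Longrightarrow> P y \<Longrightarrow> P (x \<otimes>\<^bsub>T\<^esub> inv\<^bsub>T\<^esub> y)"
    and one: "P \<one>\<^bsub>T\<^esub>"
  shows "P x"
proof -
  interpret c: group_hom F T tcl by unfold_locales (rule tcl_hom)
  obtain y where y: "y \<in> carrier F" "x = tcl y" using x unfolding carrier_T by blast
  then have "Poly_Mapping.keys y \<subseteq> carrier A \<times> carrier B" by simp
  then have "P (tcl y)"
  proof (rule free_Abelian_group_induct[where P = "\<lambda>y. P (tcl y)"])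
    show "P (tcl 0)" using one c.hom_one by simp
  next
    fix x y assume xy: "Poly_Mapping.keys x \<subseteq> carrier A \<times> carrier B" "Poly_Mapping.keys y \<subseteq> carrier A \<times> carrier B"
      "P (tcl x)" "P (tcl y)"
    have "tcl (x - y) = tcl x \<otimes>\<^bsub>T\<^esub> inv\<^bsub>T\<^esub> tcl y" using xy by (simp add: tcl_diff)
    then show "P (tcl (x - y))" using xy diff c.hom_closed by simp
  next
    fix p assume "p \<in> carrier A \<times> carrier B"
    then show "P (tcl (frag_of p))" using tens by (auto simp: tens_def)
  qed
  then show ?thesis using y by simp
qed

text \<open>The map extends to the free abelian group, and being balanced says that the generating
  relations lie in the kernel; hence it factors through the quotient.\<close>

lemma balanced_hom:
  assumes H: "comm_group H" and \<beta>: "balanced H \<beta>"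
  obtains h where "h \<in> hom T H" "\<And>a b. a \<in> carrier A \<Longrightarrow> b \<in> carrier B \<Longrightarrow> h (tens a b) = \<beta> a b"
proof -
  interpret H: comm_group H by fact
  have c: "\<beta> a b \<in> carrier H" if "a \<in> carrier A" "b \<in> carrier B" for a b
    using \<beta> that by (simp add: balanced_def)
  have "(\<lambda>(a, b). \<beta> a b) ` (carrier A \<times> carrier B) \<subseteq> carrier H" using c by auto
  then obtain g where g: "g \<in> hom F H"
    and gb: "\<And>p. p \<in> carrier A \<times> carrier B \<Longrightarrow> g (frag_of p) = (\<lambda>(a, b). \<beta> a b) p"
    by (rule H.free_Abelian_group_universal) blast
  interpret g: group_hom F H g by unfold_locales (rule g)
  have gd: "g (x - y) = g x \<otimes>\<^bsub>H\<^esub> inv\<^bsub>H\<^esub> g y" if "x \<in> carrier F" "y \<in> carrier F" for x y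
    by (rule hom_diff[OF H.is_group g that])
  have gf: "g (frag_of (a, b)) = \<beta> a b" if "a \<in> carrier A" "b \<in> carrier B" for a b
    using gb[of "(a, b)"] that by simp
  note fc = frag_of_closed and dc = diff_closed
  have "tensor_rels A ra S la B \<subseteq> kernel F H g"
  proof
    fix x assume x: "x \<in> tensor_rels A ra S la B"
    have "g x = \<one>\<^bsub>H\<^esub>"
      using x unfolding tensor_rels_def
    proof (elim UnE CollectE exE conjE, goal_cases)
      case (1 a a' b)
      then have "g x = \<beta> a b \<otimes>\<^bsub>H\<^esub> \<beta> a' b \<otimes>\<^bsub>H\<^esub> inv\<^bsub>H\<^esub> \<beta> a b \<otimes>\<^bsub>H\<^esub> inv\<^bsub>H\<^esub> \<beta> a' b"
        using \<beta> by (simp add: gd gf fc dc balanced_def del: carrier_free_Abelian_group_iff)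
      then show ?case using 1 c by (simp add: H.m_ac)
    next
      case (2 a b b')
      then have "g x = \<beta> a b \<otimes>\<^bsub>H\<^esub> \<beta> a b' \<otimes>\<^bsub>H\<^esub> inv\<^bsub>H\<^esub> \<beta> a b \<otimes>\<^bsub>H\<^esub> inv\<^bsub>H\<^esub> \<beta> a b'"
        using \<beta> by (simp add: gd gf fc dc balanced_def del: carrier_free_Abelian_group_iff)
      then show ?case using 2 c by (simp add: H.m_ac)
    next
      case (3 a s b)
      then have "g x = \<beta> a (la s b) \<otimes>\<^bsub>H\<^esub> inv\<^bsub>H\<^esub> \<beta> a (la s b)"
        using \<beta> by (simp add: gd gf fc dc ra_closed la_closed balanced_def del: carrier_free_Abelian_group_iff)
      then show ?case using 3 c la_closed by simp
    qed
    then show "x \<in> kernel F H g" using subsetD[OF rels_closed x] by (simp add: kernel_def)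
  qed
  then have "N \<subseteq> kernel F H g"
    unfolding tensor_null_def by (rule F.generate_subgroup_incl[OF _ g.subgroup_kernel])
  then obtain h where h: "h \<in> hom (F Mod N) H" "\<And>x. x \<in> carrier F \<Longrightarrow> h (N #>\<^bsub>F\<^esub> x) = g x"
    by (rule g.FactGroup_universal_kernel[OF N_normal]) blast
  show thesis
  proof (rule that)
    show "h \<in> hom T H" using h(1) by (simp add: tensor_group_def)
    show "h (tens a b) = \<beta> a b" if "a \<in> carrier A" "b \<in> carrier B" for a b
      using h(2)[OF fc[OF that]] gf[OF that] by (simp add: tens_def tcl_def)
  qed
qed

lemma tens_balanced: "balanced T tens"
proof -
  interpret c: group_hom F T tcl by unfold_locales (rule tcl_hom)
  note fc = frag_of_closed and dc = diff_closed
  have cd: "tcl (x - y) = tcl x \<otimes>\<^bsub>T\<^esub> inv\<^bsub>T\<^esub> tcl y" if "x \<in> carrier F" "y \<in> carrier F" for x y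
    by (rule tcl_diff[OF that])
  have rel: "tcl x = \<one>\<^bsub>T\<^esub>" if "x \<in> tensor_rels A ra S la B" for x
  proof -
    have "x \<in> N" unfolding tensor_null_def by (rule generate.incl[OF that])
    then show ?thesis
      using subgroup.rcos_const[OF N_subgroup F.is_group] by (simp add: tcl_def tensor_group_def)
  qed
  \<comment> \<open>The relations are given as vanishing differences; this turns the two additivity
    relations into equations between tensors.\<close>
  have solve: "x = y \<otimes>\<^bsub>T\<^esub> z" if "x \<otimes>\<^bsub>T\<^esub> inv\<^bsub>T\<^esub> y \<otimes>\<^bsub>T\<^esub> inv\<^bsub>T\<^esub> z = \<one>\<^bsub>T\<^esub>"
    "x \<in> carrier T" "y \<in> carrier T" "z \<in> carrier T" for x y z
  proof -
    note c = that(2-4)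
    have "x \<otimes>\<^bsub>T\<^esub> inv\<^bsub>T\<^esub> (y \<otimes>\<^bsub>T\<^esub> z) = \<one>\<^bsub>T\<^esub>"
      using that(1) T.inv_mult[OF c(2,3)] T.m_assoc[OF c(1) T.inv_closed[OF c(2)] T.inv_closed[OF c(3)]] by simp
    from T.inv_equality[OF this] show ?thesis using c by simp
  qed
  show ?thesis
    unfolding balanced_def
  proof (intro conjI ballI)
    show "tens a b \<in> carrier T" if "a \<in> carrier A" "b \<in> carrier B" for a b using that by (rule tens_closed)
  next
    fix a a' b assume c: "a \<in> carrier A" "a' \<in> carrier A" "b \<in> carrier B"
    have "tcl (frag_of (a \<oplus>\<^bsub>A\<^esub> a', b) - frag_of (a, b) - frag_of (a', b)) = \<one>\<^bsub>T\<^esub>"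
      by (rule rel) (use c in \<open>auto simp: tensor_rels_def\<close>)
    then show "tens (a \<oplus>\<^bsub>A\<^esub> a') b = tens a b \<otimes>\<^bsub>T\<^esub> tens a' b"
      using c tens_closed by (intro solve) (auto simp: tens_def cd fc dc simp del: carrier_free_Abelian_group_iff)
  next
    fix a b b' assume c: "a \<in> carrier A" "b \<in> carrier B" "b' \<in> carrier B"
    have "tcl (frag_of (a, b \<oplus>\<^bsub>B\<^esub> b') - frag_of (a, b) - frag_of (a, b')) = \<one>\<^bsub>T\<^esub>"
      by (rule rel) (use c in \<open>auto simp: tensor_rels_def\<close>)
    then show "tens a (b \<oplus>\<^bsub>B\<^esub> b') = tens a b \<otimes>\<^bsub>T\<^esub> tens a b'"
      using c tens_closed by (intro solve) (auto simp: tens_def cd fc dc simp del: carrier_free_Abelian_group_iff)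
  next
    fix a s b assume c: "a \<in> carrier A" "s \<in> S" "b \<in> carrier B"
    have "tcl (frag_of (ra a s, b) - frag_of (a, la s b)) = \<one>\<^bsub>T\<^esub>"
      by (rule rel) (use c in \<open>auto simp: tensor_rels_def\<close>)
    then have "tens (ra a s) b \<otimes>\<^bsub>T\<^esub> inv\<^bsub>T\<^esub> tens a (la s b) = \<one>\<^bsub>T\<^esub>"
      using c by (simp add: tens_def cd fc ra_closed la_closed del: carrier_free_Abelian_group_iff)
    then show "tens (ra a s) b = tens a (la s b)"
      using c tens_closed ra_closed la_closed T.inv_equality[of "tens (ra a s) b" "inv\<^bsub>T\<^esub> tens a (la s b)"] by simp
  qed
qed

lemma tens_add_left: "a \<in> carrier A \<Longrightarrow> a' \<in> carrier A \<Longrightarrow> b \<in> carrier B \<Longrightarrow>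
    tens (a \<oplus>\<^bsub>A\<^esub> a') b = tens a b \<otimes>\<^bsub>T\<^esub> tens a' b"
  and tens_add_right: "a \<in> carrier A \<Longrightarrow> b \<in> carrier B \<Longrightarrow> b' \<in> carrier B \<Longrightarrow>
    tens a (b \<oplus>\<^bsub>B\<^esub> b') = tens a b \<otimes>\<^bsub>T\<^esub> tens a b'"
  and tens_balance: "a \<in> carrier A \<Longrightarrow> s \<in> S \<Longrightarrow> b \<in> carrier B \<Longrightarrow> tens (ra a s) b = tens a (la s b)"
  using tens_balanced unfolding balanced_def by blast+

lemma tens_zero_left: "b \<in> carrier B \<Longrightarrow> tens \<zero>\<^bsub>A\<^esub> b = \<one>\<^bsub>T\<^esub>"
  using tens_add_left[of "\<zero>\<^bsub>A\<^esub>" "\<zero>\<^bsub>A\<^esub>" b] tens_closed[of "\<zero>\<^bsub>A\<^esub>" b] by simp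

lemma tens_zero_right: "a \<in> carrier A \<Longrightarrow> tens a \<zero>\<^bsub>B\<^esub> = \<one>\<^bsub>T\<^esub>"
  using tens_add_right[of a "\<zero>\<^bsub>B\<^esub>" "\<zero>\<^bsub>B\<^esub>"] tens_closed[of a "\<zero>\<^bsub>B\<^esub>"] by simp

text \<open>\<open>tensor_map\<close> is the unique element of the image of a coset, so it is
  meaningful when all representatives have the same image. The homomorphism supplied by the
  universal property agrees with the formula on every representative, which settles this and
  additivity together.\<close>

lemma tensor_map_hom:
  assumes \<psi>: "\<And>a b. a \<in> carrier A \<Longrightarrow> b \<in> carrier B \<Longrightarrow> \<psi> (a, b) \<in> carrier F"
    and bal: "balanced T (\<lambda>a b. tcl (\<psi> (a, b)))"
  shows "tensor_map A ra S la B \<psi> \<in> hom T T"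
    and "\<And>a b. a \<in> carrier A \<Longrightarrow> b \<in> carrier B \<Longrightarrow> tensor_map A ra S la B \<psi> (tens a b) = tcl (\<psi> (a, b))"
proof -
  obtain h where h: "h \<in> hom T T" and ht: "\<And>a b. a \<in> carrier A \<Longrightarrow> b \<in> carrier B \<Longrightarrow> h (tens a b) = tcl (\<psi> (a, b))"
    by (rule balanced_hom[OF T_comm_group bal]) blast
  have ext: "frag_extend \<psi> x \<in> carrier F" if "x \<in> carrier F" for x
  proof -
    have "Poly_Mapping.keys (\<psi> p) \<subseteq> carrier A \<times> carrier B" if p: "p \<in> Poly_Mapping.keys x" for p
    proof -
      obtain a b where p': "p = (a, b)" by (cases p)
      then have "a \<in> carrier A" "b \<in> carrier B" using p \<open>x \<in> carrier F\<close> by auto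
      then show ?thesis using \<psi> p' by simp
    qed
    then have "(\<Union>p\<in>Poly_Mapping.keys x. Poly_Mapping.keys (\<psi> p)) \<subseteq> carrier A \<times> carrier B" by (rule UN_least)
    then show ?thesis using keys_frag_extend[of \<psi> x] by (simp add: subset_trans)
  qed
  have fh: "frag_extend \<psi> \<in> hom F F"
    by (rule homI) (use ext in \<open>auto simp: frag_extend_add\<close>)
  have eq: "h (tcl x) = tcl (frag_extend \<psi> x)" if "x \<in> carrier F" for x
  proof -
    have "(h \<circ> tcl) x = (tcl \<circ> frag_extend \<psi>) x"
      by (rule hom_eq_on_free[OF T.is_group Group.hom_compose[OF tcl_hom h] Group.hom_compose[OF fh tcl_hom] _ that])
         (use ht in \<open>simp add: tens_def\<close>)
    then show ?thesis by simp
  qed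
  have tm: "tensor_map A ra S la B \<psi> c = h c" if c: "c \<in> carrier T" for c
  proof -
    obtain x where x: "x \<in> carrier F" "c = tcl x" using c unfolding carrier_T by blast
    have mem: "x \<in> c" unfolding x(2) tcl_def by (rule F.rcos_self[OF x(1) N_subgroup])
    have "tcl (frag_extend \<psi> y) = h c" if "y \<in> c" for y
    proof -
      have y: "y \<in> N #>\<^bsub>F\<^esub> x" using that x(2) by (simp add: tcl_def)
      then have yc: "y \<in> carrier F"
        using subgroup.elemrcos_carrier[OF N_subgroup F.is_group x(1)] by blast
      have "c = tcl y" unfolding x(2) tcl_def by (rule F.repr_independence[OF y x(1) N_subgroup])
      then show ?thesis using eq[OF yc] by simp
    qed
    \<comment> \<open>The image of the coset is a singleton, so \<open>the_elem\<close> returns the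
      value of \<open>h\<close>.\<close>
    then have "(\<lambda>y. tcl (frag_extend \<psi> y)) ` c = {h c}" using mem by auto
    then show ?thesis using c by (simp add: tensor_map_def flip: tcl_def)
  qed
  show "tensor_map A ra S la B \<psi> \<in> hom T T"
    using h tm by (auto simp: hom_def Pi_iff)
  show "tensor_map A ra S la B \<psi> (tens a b) = tcl (\<psi> (a, b))" if "a \<in> carrier A" "b \<in> carrier B" for a b
    using tm[OF tens_closed[OF that]] ht[OF that] by simp
qed

text \<open>The balancing clause evaluates the maps at results of the two actions, so the closure of
  these actions is used to stay where the maps agree.\<close>

lemma balanced_cong:
  assumes "\<And>a b. a \<in> carrier A \<Longrightarrow> b \<in> carrier B \<Longrightarrow> \<beta> a b = \<beta>' a b"
  shows "balanced H \<beta> \<longleftrightarrow> balanced H \<beta>'"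
  unfolding balanced_def by (simp add: assms ra_closed la_closed cong: ball_cong)

lemma balanced_finprod:
  assumes "\<And>i. i \<in> I \<Longrightarrow> balanced T (\<beta> i)"
  shows "balanced T (\<lambda>a b. finprod T (\<lambda>i. \<beta> i a b) I)"
proof -
  have c: "\<And>a b. a \<in> carrier A \<Longrightarrow> b \<in> carrier B \<Longrightarrow> (\<lambda>i. \<beta> i a b) \<in> I \<rightarrow> carrier T"
    using assms by (simp add: balanced_def)
  show ?thesis
    unfolding balanced_def
  proof (intro conjI ballI)
    show "finprod T (\<lambda>i. \<beta> i a b) I \<in> carrier T" if "a \<in> carrier A" "b \<in> carrier B" for a b
      by (rule T.finprod_closed[OF c[OF that]])
  next
    fix a a' b assume ab: "a \<in> carrier A" "a' \<in> carrier A" "b \<in> carrier B"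
    have "finprod T (\<lambda>i. \<beta> i (a \<oplus>\<^bsub>A\<^esub> a') b) I = finprod T (\<lambda>i. \<beta> i a b \<otimes>\<^bsub>T\<^esub> \<beta> i a' b) I"
      by (rule T.finprod_cong') (use assms ab c in \<open>auto simp: balanced_def\<close>)
    then show "finprod T (\<lambda>i. \<beta> i (a \<oplus>\<^bsub>A\<^esub> a') b) I = finprod T (\<lambda>i. \<beta> i a b) I \<otimes>\<^bsub>T\<^esub> finprod T (\<lambda>i. \<beta> i a' b) I"
      using T.finprod_multf[OF c[OF ab(1,3)] c[OF ab(2,3)]] by simp
  next
    fix a b b' assume ab: "a \<in> carrier A" "b \<in> carrier B" "b' \<in> carrier B"
    have "finprod T (\<lambda>i. \<beta> i a (b \<oplus>\<^bsub>B\<^esub> b')) I = finprod T (\<lambda>i. \<beta> i a b \<otimes>\<^bsub>T\<^esub> \<beta> i a b') I"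
      by (rule T.finprod_cong') (use assms ab c in \<open>auto simp: balanced_def\<close>)
    then show "finprod T (\<lambda>i. \<beta> i a (b \<oplus>\<^bsub>B\<^esub> b')) I = finprod T (\<lambda>i. \<beta> i a b) I \<otimes>\<^bsub>T\<^esub> finprod T (\<lambda>i. \<beta> i a b') I"
      using T.finprod_multf[OF c[OF ab(1,2)] c[OF ab(1,3)]] by simp
  next
    fix a s b assume ab: "a \<in> carrier A" "s \<in> S" "b \<in> carrier B"
    show "finprod T (\<lambda>i. \<beta> i (ra a s) b) I = finprod T (\<lambda>i. \<beta> i a (la s b)) I"
      by (rule T.finprod_cong') (use assms ab c la_closed in \<open>auto simp: balanced_def\<close>)
  qed
qed

lemma sum_free_closed:
  "(\<And>i. i \<in> I \<Longrightarrow> f i \<in> carrier F) \<Longrightarrow> sum f I \<in> carrier F"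
  using order_trans[OF keys_sum, of f I "carrier A \<times> carrier B"] by (auto simp: UN_subset_iff)

lemma tcl_sum:
  assumes "finite I" "\<And>i. i \<in> I \<Longrightarrow> f i \<in> carrier F"
  shows "tcl (sum f I) = finprod T (\<lambda>i. tcl (f i)) I"
  using assms
proof (induction I rule: finite_induct)
  case empty
  then show ?case using hom_one[OF tcl_hom F.is_group T.is_group] by simp
next
  case (insert i I)
  have s: "sum f I \<in> carrier F" by (rule sum_free_closed) (use insert.prems in blast)
  have t: "tcl x \<in> carrier T" if "x \<in> carrier F" for x
    using that unfolding carrier_T by (rule imageI)
  have "tcl (sum f (insert i I)) = tcl (f i) \<otimes>\<^bsub>T\<^esub> tcl (sum f I)"
    using hom_mult[OF tcl_hom insert.prems[OF insertI1] s] insert.hyps by simp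
  also have "\<dots> = tcl (f i) \<otimes>\<^bsub>T\<^esub> finprod T (\<lambda>i. tcl (f i)) I"
    using insert.IH insert.prems by simp
  also have "\<dots> = finprod T (\<lambda>i. tcl (f i)) (insert i I)"
    by (rule T.finprod_insert[symmetric]) (use insert t in \<open>auto simp del: carrier_free_Abelian_group_iff\<close>)
  finally show ?case .
qed

lemma hom_mult_pointwise:
  assumes "f \<in> hom T T" "g \<in> hom T T"
  shows "(\<lambda>x. f x \<otimes>\<^bsub>T\<^esub> g x) \<in> hom T T"
  using assms by (auto simp: hom_def Pi_iff T.m_ac)

end

section \<open>The module C\<close>

lemma poly_mapping_induct_on [consumes 1, case_names zero single add]:
  fixes f :: "'a \<Rightarrow>\<^sub>0 'b::comm_monoid_add"
  assumes "Poly_Mapping.keys f \<subseteq> K"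
    and "P 0" "\<And>p c. p \<in> K \<Longrightarrow> P (Poly_Mapping.single p c)"
    and "\<And>f g. Poly_Mapping.keys f \<subseteq> K \<Longrightarrow> Poly_Mapping.keys g \<subseteq> K \<Longrightarrow> P f \<Longrightarrow> P g \<Longrightarrow> P (f + g)"
  shows "P f"
proof -
  have "Poly_Mapping.keys (\<Sum>p\<in>F. Poly_Mapping.single p (Poly_Mapping.lookup f p)) \<subseteq> K \<and>
      P (\<Sum>p\<in>F. Poly_Mapping.single p (Poly_Mapping.lookup f p))" if "finite F" "F \<subseteq> K" for F
    using that
  proof (induction F rule: finite_induct)
    case (insert p F)
    have "Poly_Mapping.keys (Poly_Mapping.single p (Poly_Mapping.lookup f p)) \<subseteq> K" using insert by auto
    moreover have "P (Poly_Mapping.single p (Poly_Mapping.lookup f p))" using insert by (intro assms(3)) simp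
    moreover note insert.IH
    ultimately show ?case
      using insert assms(4) order_trans[OF keys_add Un_least, of "Poly_Mapping.single p (Poly_Mapping.lookup f p)" K]
      by (simp del: keys_single)
  qed (simp add: assms)
  from this[OF finite_keys assms(1)] show ?thesis by (simp add: poly_mapping_expand)
qed

text \<open>A combination of trivial paths acts on a path by a scalar, namely its coefficient at the
  target; multiplied from the right, it acts by the coefficient at the source.\<close>

lemma vertex_mult_single:
  assumes "Poly_Mapping.keys s \<subseteq> triv_path ` V"
  shows "path_mult s (Poly_Mapping.single p c) = Poly_Mapping.single p (Poly_Mapping.lookup s (triv_path (path_target p)) * c)"
  using assms
proof (induction s rule: poly_mapping_induct_on)
  case (single q d)
  then show ?case by (auto simp: path_mult_single path_term_def path_comp_triv lookup_single when_def)
qed (simp_all add: path_mult_add_left lookup_add distrib_right single_add)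

lemma single_mult_vertex:
  assumes "Poly_Mapping.keys s \<subseteq> triv_path ` V"
  shows "path_mult (Poly_Mapping.single p c) s = Poly_Mapping.single p (c * Poly_Mapping.lookup s (triv_path (path_source p)))"
  using assms
proof (induction s rule: poly_mapping_induct_on)
  case (single q d)
  then show ?case by (auto simp: path_mult_single path_term_def path_comp_triv lookup_single when_def)
qed (simp_all add: path_mult_add_right lookup_add distrib_left single_add)

lemma lookup_vertex_mult:
  assumes "Poly_Mapping.keys s \<subseteq> triv_path ` V"
  shows "Poly_Mapping.lookup (path_mult s z) p = Poly_Mapping.lookup s (triv_path (path_target p)) * Poly_Mapping.lookup z p"
  by (induction z rule: poly_mapping_induct_single)
     (auto simp: vertex_mult_single[OF assms] path_mult_add_right lookup_add distrib_left lookup_single when_def)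

lemma (in fin_digraph) op_quiver_fin_digraph: "fin_digraph (op_quiver G)"
  by unfold_locales (auto simp: op_quiver_def)

lemma op_quiver_simps [simp]:
  "verts (op_quiver Q) = verts Q" "arcs (op_quiver Q) = arcs Q"
  "tail (op_quiver Q) = head Q" "head (op_quiver Q) = tail Q"
  by (simp_all add: op_quiver_def)

section \<open>The tensor product \<open>C\<close> as a left module with differential\<close>

locale quiver_C = fin_digraph G for G :: "('a, 'b) pre_digraph" +
  fixes K :: "'k::field itself"
begin

abbreviation "L \<equiv> rad_sq_zero_algebra G :: (('a, 'b) qpath \<Rightarrow>\<^sub>0 'k) set ring"
abbreviation "B \<equiv> path_algebra (op_quiver G) :: (('a, 'b) qpath \<Rightarrow>\<^sub>0 'k) ring"
abbreviation "VA \<equiv> vertex_algebra G :: (('a, 'b) qpath \<Rightarrow>\<^sub>0 'k) set"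

text \<open>A name for the right action in \<open>C_group\<close>, so that the tensor product is
  formed with an opaque parameter which the simplifier does not rewrite. The left action is treated
  in the same way.\<close>

definition right_act :: "(('a, 'b) qpath \<Rightarrow>\<^sub>0 'k) set \<Rightarrow> (('a, 'b) qpath \<Rightarrow>\<^sub>0 'k) \<Rightarrow> (('a, 'b) qpath \<Rightarrow>\<^sub>0 'k) set" where
  "right_act = (\<lambda>y s. y \<otimes>\<^bsub>L\<^esub> rad_sq_zero_proj G s)"

definition left_act :: "(('a, 'b) qpath \<Rightarrow>\<^sub>0 'k) \<Rightarrow> (('a, 'b) qpath \<Rightarrow>\<^sub>0 'k) \<Rightarrow> (('a, 'b) qpath \<Rightarrow>\<^sub>0 'k)" where
  "left_act = (\<lambda>s z. s \<otimes>\<^bsub>B\<^esub> z)"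

sublocale op: fin_digraph "op_quiver G" by (rule op_quiver_fin_digraph)

sublocale L: rad_sq_zero L "verts G" "arcs G" "tail G" "head G" rsz_ev rsz_ar rsz_cv rsz_ca
  by (rule rad_sq_zero_algebra_rad_sq_zero)

sublocale B: ring B by (rule op.path_algebra_ring)

lemma VA_qpaths: "s \<in> VA \<Longrightarrow> Poly_Mapping.keys s \<subseteq> qpaths G"
  and VA_op_qpaths: "s \<in> VA \<Longrightarrow> Poly_Mapping.keys s \<subseteq> qpaths (op_quiver G)"
  and VA_keys: "s \<in> VA \<Longrightarrow> Poly_Mapping.keys s \<subseteq> triv_path ` verts G"
  using triv_path_qpaths op.triv_path_qpaths by (auto simp: vertex_algebra_def)

sublocale tensor_product L B right_act VA left_act
proof (rule tensor_product.intro[OF L.is_abelian_group B.is_abelian_group tensor_product_axioms.intro])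
  show "right_act a s \<in> carrier L" if "a \<in> carrier L" "s \<in> VA" for a s
    unfolding right_act_def by (rule L.m_closed[OF that(1) proj_closed[OF VA_qpaths[OF that(2)]]])
  show "left_act s b \<in> carrier B" if "s \<in> VA" "b \<in> carrier B" for s b
    unfolding left_act_def using that by (simp add: op.path_mult_closed VA_op_qpaths)
qed

abbreviation "C \<equiv> C_dmodule G :: ((('a, 'b) qpath \<Rightarrow>\<^sub>0 'k) set, ('a, 'b, 'k) C_carrier) dmodule"

abbreviation "sm a \<equiv> tensor_map L right_act VA left_act B (\<lambda>(y, z). frag_of (a \<otimes>\<^bsub>L\<^esub> y, z))"

abbreviation "dm \<equiv> tensor_map L right_act VA left_act B (\<lambda>(y, z). \<Sum>\<alpha>\<in>arcs G.
  frag_of (y \<otimes>\<^bsub>L\<^esub> rsz_ar \<alpha> 1, arrow_elem (op_quiver G) \<alpha> \<otimes>\<^bsub>B\<^esub> z))"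

lemma proj_arrow: "rad_sq_zero_proj G (arrow_elem G \<alpha>) = rsz_ar \<alpha> 1"
  by (simp add: arrow_elem_def rsz_ar_def)

lemma C_simps:
  "carrier C = carrier T" "ring.add C = monoid.mult T" "\<zero>\<^bsub>C\<^esub> = \<one>\<^bsub>T\<^esub>" "smult C = sm" "dif C = dm"
  by (simp_all add: C_dmodule_def C_group_def C_map_def right_act_def left_act_def proj_arrow[abs_def] del: path_algebra_simps)

lemma finsum_C: "finsum C = finprod T"
  by (simp add: finsum_def finprod_def C_simps fun_eq_iff)

lemma e_c: "v \<in> verts G \<Longrightarrow> rsz_ev v c \<in> carrier L" and al_c: "\<alpha> \<in> arcs G \<Longrightarrow> rsz_ar \<alpha> c \<in> carrier L"
  by (simp_all add: rsz_ev_closed rsz_ar_closed)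

lemma
  assumes a: "a \<in> carrier L"
  shows sm_hom: "sm a \<in> hom T T"
    and sm_tens: "\<And>y z. y \<in> carrier L \<Longrightarrow> z \<in> carrier B \<Longrightarrow> sm a (tens y z) = tens (a \<otimes>\<^bsub>L\<^esub> y) z"
proof -
  have c: "(\<lambda>(y, z). frag_of (a \<otimes>\<^bsub>L\<^esub> y, z)) (y, z) \<in> carrier F" if "y \<in> carrier L" "z \<in> carrier B" for y z
    using frag_of_closed[OF L.m_closed[OF a that(1)] that(2)] by (simp only: prod.case)
  have "balanced T (\<lambda>y z. tens (a \<otimes>\<^bsub>L\<^esub> y) z)"
    unfolding balanced_def
  proof (intro conjI ballI)
    fix y s z assume c: "y \<in> carrier L" "s \<in> VA" "z \<in> carrier B"
    have "a \<otimes>\<^bsub>L\<^esub> right_act y s = right_act (a \<otimes>\<^bsub>L\<^esub> y) s"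
      using L.m_assoc[OF a c(1) proj_closed[OF VA_qpaths[OF c(2)]]] by (simp only: right_act_def)
    then show "tens (a \<otimes>\<^bsub>L\<^esub> right_act y s) z = tens (a \<otimes>\<^bsub>L\<^esub> y) (left_act s z)"
      using tens_balance[OF L.m_closed[OF a c(1)] c(2,3)] by simp
  next
    fix y y' z assume c: "y \<in> carrier L" "y' \<in> carrier L" "z \<in> carrier B"
    show "tens (a \<otimes>\<^bsub>L\<^esub> (y \<oplus>\<^bsub>L\<^esub> y')) z = tens (a \<otimes>\<^bsub>L\<^esub> y) z \<otimes>\<^bsub>T\<^esub> tens (a \<otimes>\<^bsub>L\<^esub> y') z"
      unfolding L.r_distr[OF c(1,2) a] using c a by (intro tens_add_left L.m_closed)
  next
    fix y z z' assume c: "y \<in> carrier L" "z \<in> carrier B" "z' \<in> carrier B"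
    show "tens (a \<otimes>\<^bsub>L\<^esub> y) (z \<oplus>\<^bsub>B\<^esub> z') = tens (a \<otimes>\<^bsub>L\<^esub> y) z \<otimes>\<^bsub>T\<^esub> tens (a \<otimes>\<^bsub>L\<^esub> y) z'"
      using c a by (intro tens_add_right L.m_closed)
  qed (use a in \<open>intro tens_closed L.m_closed\<close>)
  then have bal: "balanced T (\<lambda>y z. tcl ((\<lambda>(y, z). frag_of (a \<otimes>\<^bsub>L\<^esub> y, z)) (y, z)))"
    by (simp only: prod.case tens_def)
  show "sm a \<in> hom T T" by (rule tensor_map_hom(1)[OF c bal])
  show "sm a (tens y z) = tens (a \<otimes>\<^bsub>L\<^esub> y) z" if "y \<in> carrier L" "z \<in> carrier B" for y z
    using tensor_map_hom(2)[OF c bal that] by (simp only: prod.case tens_def)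
qed

abbreviation "dterm \<equiv> \<lambda>\<alpha> y z. tens (y \<otimes>\<^bsub>L\<^esub> rsz_ar \<alpha> 1) (path_mult (arrow_elem (op_quiver G) \<alpha>) z)"

lemma arrow_mult_closed: "\<alpha> \<in> arcs G \<Longrightarrow> z \<in> carrier B \<Longrightarrow> path_mult (arrow_elem (op_quiver G) \<alpha>) z \<in> carrier B"
  using op.path_mult_closed[of "arrow_elem (op_quiver G) \<alpha>" z] op.keys_single_arrow[of \<alpha> 1]
  by (simp add: arrow_elem_def del: keys_single)

text \<open>Each summand of the differential is balanced separately, and balanced maps are closed
  under finite products of values. The subtle clause is the balancing one, where a vertex element
  has to cross an arrow.\<close>

lemma dterm_balanced:
  assumes \<alpha>: "\<alpha> \<in> arcs G"
  shows "balanced T (dterm \<alpha>)"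
  unfolding balanced_def
proof (intro conjI ballI)
  note alc = al_c[OF \<alpha>, of 1] and am = arrow_mult_closed[OF \<alpha>]
  fix y s z assume c: "y \<in> carrier L" "s \<in> VA" "z \<in> carrier B"
  note pc = proj_closed[OF VA_qpaths[OF c(2)]]
  \<comment> \<open>Crossing the arrow changes the vertex: multiplying \<open>\<alpha>\<close> by
    \<open>s\<close> from the left gives the coefficient of \<open>s\<close> at the head, which
    equals multiplying from the right by that coefficient at the tail. In the opposite quiver the
    arrow runs from head to tail, so the same \<open>?s\<close> on the left of it matches
    \<open>s\<close> on its right.\<close>
  let ?s = "Poly_Mapping.single (triv_path (tail G \<alpha>)) (Poly_Mapping.lookup s (triv_path (head G \<alpha>)))"
  have s': "?s \<in> VA" using \<alpha> by (auto simp: vertex_algebra_def)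
  note pc' = proj_closed[OF VA_qpaths[OF s']]
  have "rad_sq_zero_proj G s \<otimes>\<^bsub>L\<^esub> rsz_ar \<alpha> 1 = rad_sq_zero_proj G (path_mult s (Poly_Mapping.single (arrow_path G \<alpha>) 1))"
    unfolding rsz_ar_def by (rule proj_mult[OF VA_qpaths[OF c(2)] keys_single_arrow[OF \<alpha>], symmetric])
  also have "path_mult s (Poly_Mapping.single (arrow_path G \<alpha>) 1) = path_mult (Poly_Mapping.single (arrow_path G \<alpha>) 1) ?s"
    by (simp add: vertex_mult_single[OF VA_keys[OF c(2)]] single_mult_vertex[OF VA_keys[OF s']] lookup_single)
  also have "rad_sq_zero_proj G \<dots> = rsz_ar \<alpha> 1 \<otimes>\<^bsub>L\<^esub> rad_sq_zero_proj G ?s"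
    unfolding rsz_ar_def by (rule proj_mult[OF keys_single_arrow[OF \<alpha>] VA_qpaths[OF s']])
  finally have 1: "right_act y s \<otimes>\<^bsub>L\<^esub> rsz_ar \<alpha> 1 = right_act (y \<otimes>\<^bsub>L\<^esub> rsz_ar \<alpha> 1) ?s"
    unfolding right_act_def by (simp only: L.m_assoc[OF c(1) pc alc] L.m_assoc[OF c(1) alc pc'])
  have "path_mult ?s (arrow_elem (op_quiver G) \<alpha>) = path_mult (arrow_elem (op_quiver G) \<alpha>) s"
    unfolding arrow_elem_def
    by (simp add: vertex_mult_single[OF VA_keys[OF s']] single_mult_vertex[OF VA_keys[OF c(2)]] lookup_single)
  then have 2: "left_act ?s (path_mult (arrow_elem (op_quiver G) \<alpha>) z) = path_mult (arrow_elem (op_quiver G) \<alpha>) (left_act s z)"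
    by (simp add: left_act_def flip: path_mult_assoc)
  show "dterm \<alpha> (right_act y s) z = dterm \<alpha> y (left_act s z)"
    unfolding 1 2[symmetric] by (rule tens_balance[OF L.m_closed[OF c(1) alc] s' am[OF c(3)]])
next
  note alc = al_c[OF \<alpha>, of 1] and am = arrow_mult_closed[OF \<alpha>]
  fix y y' z assume c: "y \<in> carrier L" "y' \<in> carrier L" "z \<in> carrier B"
  show "dterm \<alpha> (y \<oplus>\<^bsub>L\<^esub> y') z = dterm \<alpha> y z \<otimes>\<^bsub>T\<^esub> dterm \<alpha> y' z"
    unfolding L.l_distr[OF c(1,2) alc] by (intro tens_add_left L.m_closed c alc am)
next
  note alc = al_c[OF \<alpha>, of 1] and am = arrow_mult_closed[OF \<alpha>]
  fix y z z' assume c: "y \<in> carrier L" "z \<in> carrier B" "z' \<in> carrier B"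
  show "dterm \<alpha> y (z \<oplus>\<^bsub>B\<^esub> z') = dterm \<alpha> y z \<otimes>\<^bsub>T\<^esub> dterm \<alpha> y z'"
    using tens_add_right[OF L.m_closed[OF c(1) alc] am[OF c(2)] am[OF c(3)]]
    by (simp add: path_mult_add_right)
next
  fix y z assume "y \<in> carrier L" "z \<in> carrier B"
  then show "dterm \<alpha> y z \<in> carrier T" by (intro tens_closed L.m_closed al_c[OF \<alpha>] arrow_mult_closed[OF \<alpha>])
qed

lemma dterm_closed: "\<alpha> \<in> arcs G \<Longrightarrow> y \<in> carrier L \<Longrightarrow> z \<in> carrier B \<Longrightarrow> dterm \<alpha> y z \<in> carrier T"
  by (intro tens_closed L.m_closed al_c arrow_mult_closed)

lemma dm_hom: "dm \<in> hom T T"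
  and dm_tens: "\<And>y z. y \<in> carrier L \<Longrightarrow> z \<in> carrier B \<Longrightarrow> dm (tens y z) = finprod T (\<lambda>\<alpha>. dterm \<alpha> y z) (arcs G)"
proof -
  let ?\<psi> = "\<lambda>(y, z). \<Sum>\<alpha>\<in>arcs G. frag_of (y \<otimes>\<^bsub>L\<^esub> rsz_ar \<alpha> 1, arrow_elem (op_quiver G) \<alpha> \<otimes>\<^bsub>B\<^esub> z)"
  have t: "frag_of (y \<otimes>\<^bsub>L\<^esub> rsz_ar \<alpha> 1, arrow_elem (op_quiver G) \<alpha> \<otimes>\<^bsub>B\<^esub> z) \<in> carrier F"
    if "y \<in> carrier L" "z \<in> carrier B" "\<alpha> \<in> arcs G" for y z \<alpha>
    unfolding path_algebra_simps(2) by (intro frag_of_closed L.m_closed al_c arrow_mult_closed that)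
  have c: "?\<psi> (y, z) \<in> carrier F" if "y \<in> carrier L" "z \<in> carrier B" for y z
    unfolding prod.case by (rule sum_free_closed[OF t[OF that]])
  have eq: "tcl (?\<psi> (y, z)) = finprod T (\<lambda>\<alpha>. dterm \<alpha> y z) (arcs G)" if "y \<in> carrier L" "z \<in> carrier B" for y z
  proof -
    have "tcl (?\<psi> (y, z)) = finprod T (\<lambda>\<alpha>. tcl (frag_of (y \<otimes>\<^bsub>L\<^esub> rsz_ar \<alpha> 1, arrow_elem (op_quiver G) \<alpha> \<otimes>\<^bsub>B\<^esub> z))) (arcs G)"
      unfolding prod.case by (rule tcl_sum[OF finite_arcs t[OF that]])
    then show ?thesis by (simp only: tens_def path_algebra_simps(2))
  qed
  have "balanced T (\<lambda>y z. finprod T (\<lambda>\<alpha>. dterm \<alpha> y z) (arcs G))"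
    by (rule balanced_finprod[OF dterm_balanced])
  then have bal: "balanced T (\<lambda>y z. tcl (?\<psi> (y, z)))"
    by (subst balanced_cong[OF eq])
  show "dm \<in> hom T T" by (rule tensor_map_hom(1)[OF c bal])
  show "dm (tens y z) = finprod T (\<lambda>\<alpha>. dterm \<alpha> y z) (arcs G)" if "y \<in> carrier L" "z \<in> carrier B" for y z
    using tensor_map_hom(2)[OF c bal that] eq[OF that] by simp
qed

text \<open>Both sides of each module law are homomorphisms in the tensor, so they are compared on
  pure tensors, where the laws are those of the ring \<open>L\<close>.\<close>

lemma C_left_module: "left_module L C"
proof (intro left_module.intro left_module_axioms.intro)
  show "ring L" by (rule rad_sq_zero_algebra_ring)
  show "abelian_group C"
  proof (rule abelian_groupI)
    fix x assume "x \<in> carrier C"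
    then show "\<exists>y\<in>carrier C. y \<oplus>\<^bsub>C\<^esub> x = \<zero>\<^bsub>C\<^esub>"
      by (intro bexI[of _ "inv\<^bsub>T\<^esub> x"]) (simp_all add: C_simps)
  qed (simp_all add: C_simps T.m_ac)
  note hm = T.is_group
  show "a \<odot>\<^bsub>C\<^esub> x \<in> carrier C" if "a \<in> carrier L" "x \<in> carrier C" for a x
    using hom_in_carrier[OF sm_hom[OF that(1)]] that(2) by (simp add: C_simps)
  show "(a \<oplus>\<^bsub>L\<^esub> b) \<odot>\<^bsub>C\<^esub> x = a \<odot>\<^bsub>C\<^esub> x \<oplus>\<^bsub>C\<^esub> b \<odot>\<^bsub>C\<^esub> x" if "a \<in> carrier L" "b \<in> carrier L" "x \<in> carrier C" for a b x
  proof -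
    have "sm (a \<oplus>\<^bsub>L\<^esub> b) x = sm a x \<otimes>\<^bsub>T\<^esub> sm b x"
    proof (rule hom_eqI[OF hm sm_hom[OF L.a_closed[OF that(1,2)]] hom_mult_pointwise[OF sm_hom[OF that(1)] sm_hom[OF that(2)]]])
      show "x \<in> carrier T" using that by (simp add: C_simps)
      fix y z assume c: "y \<in> carrier L" "z \<in> carrier B"
      show "sm (a \<oplus>\<^bsub>L\<^esub> b) (tens y z) = sm a (tens y z) \<otimes>\<^bsub>T\<^esub> sm b (tens y z)"
        unfolding sm_tens[OF L.a_closed[OF that(1,2)] c] sm_tens[OF that(1) c] sm_tens[OF that(2) c] L.l_distr[OF that(1,2) c(1)]
        by (intro tens_add_left L.m_closed that c)
    qed
    then show ?thesis by (simp only: C_simps)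
  qed
  show "a \<odot>\<^bsub>C\<^esub> (x \<oplus>\<^bsub>C\<^esub> y) = a \<odot>\<^bsub>C\<^esub> x \<oplus>\<^bsub>C\<^esub> a \<odot>\<^bsub>C\<^esub> y" if "a \<in> carrier L" "x \<in> carrier C" "y \<in> carrier C" for a x y
    using hom_mult[OF sm_hom[OF that(1)], of x y] that(2,3) by (simp only: C_simps)
  show "(a \<otimes>\<^bsub>L\<^esub> b) \<odot>\<^bsub>C\<^esub> x = a \<odot>\<^bsub>C\<^esub> (b \<odot>\<^bsub>C\<^esub> x)" if "a \<in> carrier L" "b \<in> carrier L" "x \<in> carrier C" for a b x
  proof -
    have "sm (a \<otimes>\<^bsub>L\<^esub> b) x = (sm a \<circ> sm b) x"
    proof (rule hom_eqI[OF hm sm_hom[OF L.m_closed[OF that(1,2)]] Group.hom_compose[OF sm_hom[OF that(2)] sm_hom[OF that(1)]]])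
      show "x \<in> carrier T" using that by (simp add: C_simps)
      fix y z assume c: "y \<in> carrier L" "z \<in> carrier B"
      show "sm (a \<otimes>\<^bsub>L\<^esub> b) (tens y z) = (sm a \<circ> sm b) (tens y z)"
        unfolding o_apply sm_tens[OF L.m_closed[OF that(1,2)] c] sm_tens[OF that(2) c]
          sm_tens[OF that(1) L.m_closed[OF that(2) c(1)] c(2)] L.m_assoc[OF that(1,2) c(1)] ..
    qed
    then show ?thesis by (simp only: C_simps o_apply)
  qed
  show "\<one>\<^bsub>L\<^esub> \<odot>\<^bsub>C\<^esub> x = x" if "x \<in> carrier C" for x
  proof -
    have "sm \<one>\<^bsub>L\<^esub> x = id x"
    proof (rule hom_eqI[OF hm sm_hom[OF L.one_closed]])
      show "id \<in> hom T T" by (simp add: hom_def)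
      show "x \<in> carrier T" using that by (simp add: C_simps)
      fix y z assume c: "y \<in> carrier L" "z \<in> carrier B"
      show "sm \<one>\<^bsub>L\<^esub> (tens y z) = id (tens y z)"
        unfolding sm_tens[OF L.one_closed c] L.l_one[OF c(1)] by simp
    qed
    then show ?thesis by (simp only: C_simps id_apply)
  qed
qed

sublocale C: left_module L C by (rule C_left_module)

lemma al_al: "\<alpha> \<in> arcs G \<Longrightarrow> \<beta> \<in> arcs G \<Longrightarrow> y \<in> carrier L \<Longrightarrow>
    y \<otimes>\<^bsub>L\<^esub> rsz_ar \<alpha> 1 \<otimes>\<^bsub>L\<^esub> rsz_ar \<beta> 1 = \<zero>\<^bsub>L\<^esub>"
  using L.m_assoc[OF _ al_c al_c, of y \<alpha> \<beta> 1 1] L.ar_ar[of \<alpha> \<beta> 1 1] by simp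

text \<open>On a pure tensor the differential multiplies the left factor by an arrow from the right.
  It therefore commutes with left multiplication, and applied twice it produces products of two
  arrows, which are zero in \<open>L\<close>.\<close>

lemma C_diff_module: "diff_module L C"
  unfolding diff_module_def
proof (intro conjI ballI)
  show "left_module L C" by (rule C_left_module)
  show "dif C \<in> lmod_hom L C C"
    unfolding C_simps(5)
  proof (rule lmod_homI)
    show "dm x \<in> carrier C" if "x \<in> carrier C" for x
      using hom_in_carrier[OF dm_hom] that by (simp add: C_simps)
    show "dm \<in> extensional (carrier C)" by (simp add: C_simps tensor_map_def)
    show "dm (x \<oplus>\<^bsub>C\<^esub> y) = dm x \<oplus>\<^bsub>C\<^esub> dm y" if "x \<in> carrier C" "y \<in> carrier C" for x y
      using hom_mult[OF dm_hom, of x y] that by (simp only: C_simps)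
    fix a x assume a: "a \<in> carrier L" and x: "x \<in> carrier C"
    have "(dm \<circ> sm a) x = (sm a \<circ> dm) x"
    proof (rule hom_eqI[OF T.is_group Group.hom_compose[OF sm_hom[OF a] dm_hom] Group.hom_compose[OF dm_hom sm_hom[OF a]]])
      show "x \<in> carrier T" using x by (simp add: C_simps)
      fix y z assume c: "y \<in> carrier L" "z \<in> carrier B"
      have t: "dterm \<alpha> (a \<otimes>\<^bsub>L\<^esub> y) z = sm a (dterm \<alpha> y z)" if "\<alpha> \<in> arcs G" for \<alpha>
        unfolding sm_tens[OF a L.m_closed[OF c(1) al_c[OF that]] arrow_mult_closed[OF that c(2)]]
          L.m_assoc[OF a c(1) al_c[OF that]] ..
      have "dm (sm a (tens y z)) = finprod T (\<lambda>\<alpha>. dterm \<alpha> (a \<otimes>\<^bsub>L\<^esub> y) z) (arcs G)"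
        unfolding sm_tens[OF a c] by (rule dm_tens[OF L.m_closed[OF a c(1)] c(2)])
      also have "\<dots> = finprod T (\<lambda>\<alpha>. sm a (dterm \<alpha> y z)) (arcs G)"
        by (rule T.finprod_cong') (use t hom_in_carrier[OF sm_hom[OF a]] dterm_closed c in \<open>auto simp del: path_algebra_simps\<close>)
      also have "\<dots> = sm a (finprod T (\<lambda>\<alpha>. dterm \<alpha> y z) (arcs G))"
        by (rule hom_finprod[OF T.comm_group_axioms T.comm_group_axioms sm_hom[OF a], symmetric])
           (intro Pi_I dterm_closed c)
      finally show "(dm \<circ> sm a) (tens y z) = (sm a \<circ> dm) (tens y z)"
        unfolding o_apply dm_tens[OF c] .
    qed
    then show "dm (a \<odot>\<^bsub>C\<^esub> x) = a \<odot>\<^bsub>C\<^esub> dm x" by (simp only: C_simps o_apply)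
  qed
  fix x assume x: "x \<in> carrier C"
  have "(dm \<circ> dm) x = (\<lambda>_. \<one>\<^bsub>T\<^esub>) x"
  proof (rule hom_eqI[OF T.is_group Group.hom_compose[OF dm_hom dm_hom]])
    show "x \<in> carrier T" using x by (simp add: C_simps)
    show "(\<lambda>_. \<one>\<^bsub>T\<^esub>) \<in> hom T T" by (simp add: hom_def)
    fix y z assume c: "y \<in> carrier L" "z \<in> carrier B"
    have "dm (dm (tens y z)) = finprod T (\<lambda>\<alpha>. dm (dterm \<alpha> y z)) (arcs G)"
      unfolding dm_tens[OF c]
      by (rule hom_finprod[OF T.comm_group_axioms T.comm_group_axioms dm_hom]) (intro Pi_I dterm_closed c)
    also have "\<dots> = \<one>\<^bsub>T\<^esub>"
    proof (rule T.finprod_one_eqI)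
      fix \<alpha> assume \<alpha>: "\<alpha> \<in> arcs G"
      show "dm (dterm \<alpha> y z) = \<one>\<^bsub>T\<^esub>"
        unfolding dm_tens[OF L.m_closed[OF c(1) al_c[OF \<alpha>]] arrow_mult_closed[OF \<alpha> c(2)]]
      proof (rule T.finprod_one_eqI)
        fix \<beta> assume \<beta>: "\<beta> \<in> arcs G"
        show "dterm \<beta> (y \<otimes>\<^bsub>L\<^esub> rsz_ar \<alpha> 1) (path_mult (arrow_elem (op_quiver G) \<alpha>) z) = \<one>\<^bsub>T\<^esub>"
          unfolding al_al[OF \<alpha> \<beta> c(1)]
          by (rule tens_zero_left[OF arrow_mult_closed[OF \<beta> arrow_mult_closed[OF \<alpha> c(2)]]])
      qed
    qed
    finally show "(dm \<circ> dm) (tens y z) = \<one>\<^bsub>T\<^esub>" unfolding o_apply .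
  qed
  then show "dif C (dif C x) = \<zero>\<^bsub>C\<^esub>" by (simp only: C_simps o_apply)
qed

end

section \<open>The basis of \<open>C\<close> indexed by paths of the opposite quiver\<close>

context quiver_C
begin

text \<open>The recursion along paths prepends the arrow traversed last, whereas a path lists its
  arrows in order of traversal; hence the reversal.\<close>

abbreviation code_path :: "'a \<Rightarrow> 'b list \<Rightarrow> ('a, 'b) qpath" where
  "code_path u l \<equiv> (u, rev l, L.path_end u l)"

lemma op_awalk_snoc: "op.awalk u (w @ [\<alpha>]) v \<longleftrightarrow> op.awalk u w (head G \<alpha>) \<and> \<alpha> \<in> arcs G \<and> v = tail G \<alpha>"
proof
  assume "op.awalk u (w @ [\<alpha>]) v"
  then obtain x where "op.awalk u w x" "op.awalk x [\<alpha>] v" unfolding op.awalk_append_iff by (rule conjE)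
  then show "op.awalk u w (head G \<alpha>) \<and> \<alpha> \<in> arcs G \<and> v = tail G \<alpha>" by (auto simp: op.awalk_Cons_iff op.awalk_Nil_iff)
next
  assume "op.awalk u w (head G \<alpha>) \<and> \<alpha> \<in> arcs G \<and> v = tail G \<alpha>"
  moreover then have "op.awalk (head G \<alpha>) [\<alpha>] v" by (simp add: op.awalk_Cons_iff op.awalk_Nil_iff)
  ultimately show "op.awalk u (w @ [\<alpha>]) v" by (blast intro: op.awalk_appendI)
qed

text \<open>Reversing a list turns \<open>Cons\<close> into appending at the end, so the recursive
  description used for lifting matches walks in the opposite quiver by induction on the last
  arrow.\<close>

lemma op_awalk_iff: "op.awalk u (rev l) v \<longleftrightarrow> L.op_path u l \<and> v = L.path_end u l"
proof (induction l arbitrary: v)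
  case Nil
  show ?case by (auto simp: op.awalk_Nil_iff)
next
  case (Cons \<alpha> l)
  show ?case unfolding rev.simps op_awalk_snoc Cons.IH by auto
qed

lemma code_path_qpaths: "L.op_path u l \<Longrightarrow> code_path u l \<in> qpaths (op_quiver G)"
  by (simp add: qpaths_def op_awalk_iff)

lemma qpaths_code_path:
  assumes "p \<in> qpaths (op_quiver G)"
  obtains u l where "L.op_path u l" "p = code_path u l"
proof -
  obtain u w v where p: "p = (u, w, v)" by (cases p)
  then have "op.awalk u (rev (rev w)) v" using assms by (simp add: qpaths_def)
  then have "L.op_path u (rev w)" "v = L.path_end u (rev w)" unfolding op_awalk_iff by simp_all
  then show thesis using that[of u "rev w"] p by simp
qed

definition basis :: "'a \<Rightarrow> 'b list \<Rightarrow> ('a, 'b, 'k) C_carrier" where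
  "basis u l = tens (rsz_ev (L.path_end u l) 1) (Poly_Mapping.single (code_path u l) 1)"

lemma single_code_path_closed: "L.op_path u l \<Longrightarrow> Poly_Mapping.single (code_path u l) c \<in> carrier B"
  using op.keys_single_qpath[OF code_path_qpaths] by (simp del: keys_single)

lemma path_end_e_c: "L.op_path u l \<Longrightarrow> rsz_ev (L.path_end u l) c \<in> carrier L"
  by (rule e_c[OF L.path_end_V])

lemma basis_closed: "L.op_path u l \<Longrightarrow> basis u l \<in> carrier T"
  unfolding basis_def by (intro tens_closed path_end_e_c single_code_path_closed)

lemma smult_basis: "a \<in> carrier L \<Longrightarrow> L.op_path u l \<Longrightarrow>
    a \<odot>\<^bsub>C\<^esub> basis u l = tens (a \<otimes>\<^bsub>L\<^esub> rsz_ev (L.path_end u l) 1) (Poly_Mapping.single (code_path u l) 1)"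
  unfolding basis_def C_simps by (intro sm_tens path_end_e_c single_code_path_closed)

text \<open>The functional multiplies the left factor by the coefficient of the path in the right
  factor, placed at the end vertex \<open>v\<close> of the path. It is balanced because a vertex
  element acts on both sides through its coefficient at \<open>v\<close>.\<close>

lemma coordinate_exists:
  assumes ul: "L.op_path u l"
  shows "\<exists>h \<in> lmod_hom L C (reg_lmod L). \<forall>y\<in>carrier L. \<forall>z\<in>carrier B.
    h (tens y z) = y \<otimes>\<^bsub>L\<^esub> rsz_ev (L.path_end u l) (Poly_Mapping.lookup z (code_path u l))"
proof -
  define v where "v = L.path_end u l"
  define p where "p = code_path u l"
  have v: "v \<in> verts G" unfolding v_def by (rule L.path_end_V[OF ul])
  have pt: "path_target p = v" by (simp add: p_def v_def path_target_def)
  let ?H = "add_monoid (reg_lmod L)"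
  let ?\<beta> = "\<lambda>y z. y \<otimes>\<^bsub>L\<^esub> rsz_ev v (Poly_Mapping.lookup z p)"
  have H: "comm_group ?H" by (rule left_module_a_comm_group[OF L.reg_lmod_left_module])
  have ev_add: "rsz_ev v (c + d) = rsz_ev v c \<oplus>\<^bsub>L\<^esub> rsz_ev v d" for c d :: 'k
    unfolding rsz_ev_def single_add by (rule proj_add[OF keys_single_triv[OF v] keys_single_triv[OF v]])
  have "balanced ?H ?\<beta>"
    unfolding balanced_def
  proof (intro conjI ballI)
    fix y s z assume c: "y \<in> carrier L" "s \<in> VA" "z \<in> carrier B"
    note pc = proj_closed[OF VA_qpaths[OF c(2)]]
    have "rad_sq_zero_proj G s \<otimes>\<^bsub>L\<^esub> rsz_ev v (Poly_Mapping.lookup z p)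
        = rad_sq_zero_proj G (path_mult s (Poly_Mapping.single (triv_path v) (Poly_Mapping.lookup z p)))"
      unfolding rsz_ev_def by (rule proj_mult[OF VA_qpaths[OF c(2)] keys_single_triv[OF v], symmetric])
    also have "\<dots> = rsz_ev v (Poly_Mapping.lookup (left_act s z) p)"
      by (simp add: vertex_mult_single[OF VA_keys[OF c(2)]] left_act_def lookup_vertex_mult[OF VA_keys[OF c(2)]] rsz_ev_def pt)
    finally show "?\<beta> (right_act y s) z = ?\<beta> y (left_act s z)"
      unfolding right_act_def L.m_assoc[OF c(1) pc e_c[OF v]] by simp
  next
    fix y y' z assume c: "y \<in> carrier L" "y' \<in> carrier L" "z \<in> carrier B"
    show "?\<beta> (y \<oplus>\<^bsub>L\<^esub> y') z = ?\<beta> y z \<otimes>\<^bsub>?H\<^esub> ?\<beta> y' z"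
      using L.l_distr[OF c(1,2) e_c[OF v]] by simp
  next
    fix y z z' assume c: "y \<in> carrier L" "z \<in> carrier B" "z' \<in> carrier B"
    show "?\<beta> y (z \<oplus>\<^bsub>B\<^esub> z') = ?\<beta> y z \<otimes>\<^bsub>?H\<^esub> ?\<beta> y z'"
      using L.r_distr[OF e_c[OF v] e_c[OF v] c(1)] by (simp add: lookup_add ev_add)
  next
    fix y z assume "y \<in> carrier L"
    then show "?\<beta> y z \<in> carrier ?H" using L.m_closed[OF _ e_c[OF v]] by simp
  qed
  then obtain h where h: "h \<in> hom T ?H" and ht: "\<And>y z. y \<in> carrier L \<Longrightarrow> z \<in> carrier B \<Longrightarrow> h (tens y z) = ?\<beta> y z"
    by (rule balanced_hom[OF H]) blast
  show ?thesis
  proof (intro bexI ballI)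
    show "restrict h (carrier C) \<in> lmod_hom L C (reg_lmod L)"
    proof (rule C.lmod_hom_restrictI)
      show "h x \<in> carrier (reg_lmod L)" if "x \<in> carrier C" for x
        using hom_in_carrier[OF h] that by (simp add: C_simps)
      show "h (x \<oplus>\<^bsub>C\<^esub> y) = h x \<oplus>\<^bsub>reg_lmod L\<^esub> h y" if "x \<in> carrier C" "y \<in> carrier C" for x y
        using hom_mult[OF h, of x y] that by (simp add: C_simps)
      fix a x assume a: "a \<in> carrier L" and x: "x \<in> carrier C"
      have la: "(\<lambda>w. a \<otimes>\<^bsub>L\<^esub> w) \<in> hom ?H ?H"
        using a by (auto simp: hom_def L.r_distr)
      have "(h \<circ> sm a) x = ((\<lambda>w. a \<otimes>\<^bsub>L\<^esub> w) \<circ> h) x"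
      proof (rule hom_eqI[OF comm_group.axioms(2)[OF H] Group.hom_compose[OF sm_hom[OF a] h] Group.hom_compose[OF h la]])
        show "x \<in> carrier T" using x by (simp add: C_simps)
        fix y z assume c: "y \<in> carrier L" "z \<in> carrier B"
        show "(h \<circ> sm a) (tens y z) = ((\<lambda>w. a \<otimes>\<^bsub>L\<^esub> w) \<circ> h) (tens y z)"
          unfolding o_apply sm_tens[OF a c] ht[OF c] ht[OF L.m_closed[OF a c(1)] c(2)] by (rule L.m_assoc[OF a c(1) e_c[OF v]])
      qed
      then show "h (a \<odot>\<^bsub>C\<^esub> x) = a \<odot>\<^bsub>reg_lmod L\<^esub> h x" by (simp add: C_simps)
    qed
    show "restrict h (carrier C) (tens y z) = y \<otimes>\<^bsub>L\<^esub> rsz_ev (L.path_end u l) (Poly_Mapping.lookup z (code_path u l))"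
      if "y \<in> carrier L" "z \<in> carrier B" for y z
      using ht[OF that] tens_closed[OF that] by (simp add: C_simps(1) v_def p_def)
  qed
qed

text \<open>The universal property only asserts that the functional exists, so it is selected by
  \<open>SOME\<close> and used through its values on pure tensors.\<close>

definition coordinate :: "'a \<times> 'b list \<Rightarrow> ('a, 'b, 'k) C_carrier \<Rightarrow> (('a, 'b) qpath \<Rightarrow>\<^sub>0 'k) set" where
  "coordinate = (\<lambda>(u, l). SOME h. h \<in> lmod_hom L C (reg_lmod L) \<and> (\<forall>y\<in>carrier L. \<forall>z\<in>carrier B.
    h (tens y z) = y \<otimes>\<^bsub>L\<^esub> rsz_ev (L.path_end u l) (Poly_Mapping.lookup z (code_path u l))))"

lemma coordinate:
  assumes "L.op_path u l"
  shows "coordinate (u, l) \<in> lmod_hom L C (reg_lmod L)"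
    and "\<And>y z. y \<in> carrier L \<Longrightarrow> z \<in> carrier B \<Longrightarrow> coordinate (u, l) (tens y z)
      = y \<otimes>\<^bsub>L\<^esub> rsz_ev (L.path_end u l) (Poly_Mapping.lookup z (code_path u l))"
  using someI_ex[OF coordinate_exists[OF assms, unfolded Bex_def]] unfolding coordinate_def prod.case
  by (blast, blast)

lemma coordinate_single:
  assumes ul: "L.op_path u l" "L.op_path u' l'" and y: "y \<in> carrier L"
  shows "coordinate (u, l) (tens y (Poly_Mapping.single (code_path u' l') c))
    = (if (u, l) = (u', l') then y \<otimes>\<^bsub>L\<^esub> rsz_ev (L.path_end u l) c else \<zero>\<^bsub>L\<^esub>)"
proof -
  have "code_path u l = code_path u' l' \<longleftrightarrow> (u, l) = (u', l')" by auto
  then show ?thesis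
    unfolding coordinate(2)[OF ul(1) y single_code_path_closed[OF ul(2)]]
    using y L.ev_zero[OF L.path_end_V[OF ul(1)]] by (auto simp: lookup_single when_def)
qed

lemma basis_coordinate:
  assumes ul: "L.op_path u l" "L.op_path u' l'"
  shows "coordinate (u, l) (basis u' l') = (if (u, l) = (u', l') then rsz_ev (L.path_end u l) 1 else \<zero>\<^bsub>L\<^esub>)"
  unfolding basis_def coordinate_single[OF ul path_end_e_c[OF ul(2)]]
  using L.ev_ev[OF L.path_end_V[OF ul(1)] L.path_end_V[OF ul(1)], of 1 1] by auto

lemma coordinate_hom: "L.op_path u l \<Longrightarrow> coordinate (u, l) \<in> hom T (add_monoid L)"
  using lmod_hom_closed[OF coordinate(1)] lmod_hom_add[OF coordinate(1)]
  by (intro homI) (simp_all add: C_simps(1,2))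

text \<open>For a pure tensor the nonzero coordinates belong to paths among the keys of the right
  factor. Finiteness passes to quotients in the tensor group because the coordinates are
  additive.\<close>

lemma coordinate_finite:
  assumes "x \<in> carrier T"
  shows "finite {w \<in> {(u, l). L.op_path u l}. coordinate w x \<noteq> \<zero>\<^bsub>L\<^esub>}"
  using assms
proof (induction x rule: tensor_induct)
  case (tens y z)
  have "{w \<in> {(u, l). L.op_path u l}. coordinate w (tens y z) \<noteq> \<zero>\<^bsub>L\<^esub>}
      \<subseteq> (\<lambda>(u, w, v). (u, rev w)) ` Poly_Mapping.keys z"
  proof
    fix w assume w: "w \<in> {w \<in> {(u, l). L.op_path u l}. coordinate w (tens y z) \<noteq> \<zero>\<^bsub>L\<^esub>}"
    then obtain u l where ul: "w = (u, l)" "L.op_path u l" by auto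
    have "Poly_Mapping.lookup z (code_path u l) \<noteq> 0"
      using w ul tens L.ev_zero[OF L.path_end_V[OF ul(2)]] coordinate(2)[OF ul(2) tens] by auto
    then show "w \<in> (\<lambda>(u, w, v). (u, rev w)) ` Poly_Mapping.keys z"
      by (intro image_eqI[of _ _ "code_path u l"]) (simp_all add: ul(1) in_keys_iff)
  qed
  then show ?case by (rule finite_subset) simp
next
  case (diff x y)
  have "coordinate w (x \<otimes>\<^bsub>T\<^esub> inv\<^bsub>T\<^esub> y) = \<zero>\<^bsub>L\<^esub>"
    if w: "w \<in> {(u, l). L.op_path u l}" "coordinate w x = \<zero>\<^bsub>L\<^esub>" "coordinate w y = \<zero>\<^bsub>L\<^esub>" for w
  proof -
    obtain u l where ul: "w = (u, l)" "L.op_path u l" using w(1) by auto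
    interpret c: group_hom T "add_monoid L" "coordinate w"
      by (intro group_hom.intro group_hom_axioms.intro T.is_group L.a_group) (rule coordinate_hom[OF ul(2), folded ul(1)])
    show ?thesis
      using c.hom_mult[OF diff(1) T.inv_closed[OF diff(2)]] c.hom_inv[OF diff(2)] w(2,3) L.minus_zero
      by (simp add: a_inv_def)
  qed
  then show ?case
    by (intro finite_subset[OF _ finite_UnI[OF diff(3,4)]]) blast
next
  case one
  have "coordinate w \<one>\<^bsub>T\<^esub> = \<zero>\<^bsub>L\<^esub>" if "w \<in> {(u, l). L.op_path u l}" for w
    using that hom_one[OF coordinate_hom T.is_group L.a_group] by auto
  then have "{w \<in> {(u, l). L.op_path u l}. coordinate w \<one>\<^bsub>T\<^esub> \<noteq> \<zero>\<^bsub>L\<^esub>} = {}" by blast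
  then show ?case by (simp only: finite.emptyI)
qed

text \<open>The right-hand side defines an additive map, so it suffices to compare it with the
  identity on pure tensors, and there on a single path in the right factor.\<close>

lemma coordinate_expansion:
  assumes x: "x \<in> carrier C"
  shows "x = gfinsum C (\<lambda>w. coordinate w x \<odot>\<^bsub>C\<^esub> (case w of (u, l) \<Rightarrow> basis u l)) {(u, l). L.op_path u l}"
proof -
  let ?W = "{(u, l). L.op_path u l}"
  let ?\<psi> = "\<lambda>w. \<lambda>x\<in>carrier C. coordinate w x \<odot>\<^bsub>C\<^esub> (case w of (u, l) \<Rightarrow> basis u l)"
  define h where "h = (\<lambda>x\<in>carrier C. gfinsum C (\<lambda>w. ?\<psi> w x) ?W)"
  have cc: "coordinate w x \<in> carrier L" if "w \<in> ?W" "x \<in> carrier C" for w x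
    using that lmod_hom_closed[OF coordinate(1)] by fastforce
  have bc: "(case w of (u, l) \<Rightarrow> basis u l) \<in> carrier C" if "w \<in> ?W" for w
    using that basis_closed by (auto simp: C_simps)
  have \<psi>: "?\<psi> w \<in> lmod_hom L C C" if w: "w \<in> ?W" for w
  proof (rule C.lmod_hom_restrictI)
    obtain u l where ul: "w = (u, l)" "L.op_path u l" using w by auto
    note c1 = coordinate(1)[OF ul(2), folded ul(1)]
    fix x assume x: "x \<in> carrier C"
    show "coordinate w x \<odot>\<^bsub>C\<^esub> (case w of (u, l) \<Rightarrow> basis u l) \<in> carrier C"
      by (rule C.smult_closed[OF cc[OF w x] bc[OF w]])
    show "coordinate w (x \<oplus>\<^bsub>C\<^esub> y) \<odot>\<^bsub>C\<^esub> (case w of (u, l) \<Rightarrow> basis u l) =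
        coordinate w x \<odot>\<^bsub>C\<^esub> (case w of (u, l) \<Rightarrow> basis u l) \<oplus>\<^bsub>C\<^esub> coordinate w y \<odot>\<^bsub>C\<^esub> (case w of (u, l) \<Rightarrow> basis u l)"
      if y: "y \<in> carrier C" for y
      using lmod_hom_add[OF c1 x y] C.smult_l_distr[OF cc[OF w x] cc[OF w y] bc[OF w]] by simp
    show "coordinate w (a \<odot>\<^bsub>C\<^esub> x) \<odot>\<^bsub>C\<^esub> (case w of (u, l) \<Rightarrow> basis u l) =
        a \<odot>\<^bsub>C\<^esub> (coordinate w x \<odot>\<^bsub>C\<^esub> (case w of (u, l) \<Rightarrow> basis u l))" if a: "a \<in> carrier L" for a
      using lmod_hom_smult[OF c1 a x] C.smult_assoc[OF a cc[OF w x] bc[OF w]] by simp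
  qed
  have fin: "finite {w \<in> ?W. ?\<psi> w x \<noteq> \<zero>\<^bsub>C\<^esub>}" if x: "x \<in> carrier C" for x
  proof (rule finite_subset)
    show "finite {w \<in> ?W. coordinate w x \<noteq> \<zero>\<^bsub>L\<^esub>}" using coordinate_finite x by (simp only: C_simps(1))
    have "?\<psi> w x = \<zero>\<^bsub>C\<^esub>" if "w \<in> ?W" "coordinate w x = \<zero>\<^bsub>L\<^esub>" for w
      unfolding restrict_apply'[OF x] that(2) by (rule C.smult_l_null[OF bc[OF that(1)]])
    then show "{w \<in> ?W. ?\<psi> w x \<noteq> \<zero>\<^bsub>C\<^esub>} \<subseteq> {w \<in> ?W. coordinate w x \<noteq> \<zero>\<^bsub>L\<^esub>}"
      by (intro Collect_mono impI) blast
  qed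
  have h: "h \<in> lmod_hom L C C"
    unfolding h_def by (rule lmod_hom_gfinsumI[OF C_left_module C_left_module \<psi> fin])
  have hh: "h \<in> hom T T" using h by (auto simp: hom_def lmod_hom_def C_simps)
  have hx: "h x = gfinsum C (\<lambda>w. coordinate w x \<odot>\<^bsub>C\<^esub> (case w of (u, l) \<Rightarrow> basis u l)) ?W" if "x \<in> carrier C" for x
    unfolding h_def restrict_apply'[OF that] by simp
  have "id x = h x"
  proof (rule hom_eqI[OF T.is_group _ hh])
    show "id \<in> hom T T" by (simp add: hom_def)
    show "x \<in> carrier T" using x by (simp add: C_simps)
    fix y z assume y: "y \<in> carrier L" and z: "z \<in> carrier B"
    have "Poly_Mapping.keys z \<subseteq> qpaths (op_quiver G)" using z by simp
    then show "id (tens y z) = h (tens y z)"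
    \<comment> \<open>Both sides are additive in the right factor, which may therefore be taken to
      be a multiple of one path.\<close>
    proof (induction z rule: poly_mapping_induct_on)
      case zero
      show ?case using tens_zero_right[OF y] hom_one[OF hh T.is_group T.is_group] by simp
    next
      case (add f g)
      have fg: "f \<in> carrier B" "g \<in> carrier B" using add by simp_all
      have "tens y (f + g) = tens y f \<otimes>\<^bsub>T\<^esub> tens y g" using tens_add_right[OF y fg] by simp
      then have "id (tens y (f + g)) = id (tens y f) \<otimes>\<^bsub>T\<^esub> id (tens y g)" by (simp only: id_apply)
      also have "\<dots> = h (tens y f) \<otimes>\<^bsub>T\<^esub> h (tens y g)" by (rule arg_cong2[OF add(3,4)])
      also have "\<dots> = h (tens y f \<otimes>\<^bsub>T\<^esub> tens y g)"
        by (rule hom_mult[OF hh tens_closed[OF y fg(1)] tens_closed[OF y fg(2)], symmetric])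
      also have "\<dots> = h (tens y (f + g))" using tens_add_right[OF y fg] by (simp only: path_algebra_simps)
      finally show ?case .
    next
      case (single p c)
      obtain u l where ul: "L.op_path u l" "p = code_path u l" by (rule qpaths_code_path[OF single])
      note v = L.path_end_V[OF ul(1)]
      let ?t = "tens y (Poly_Mapping.single p c)"
      have tC: "?t \<in> carrier C" unfolding C_simps(1) ul(2) by (rule tens_closed[OF y single_code_path_closed[OF ul(1)]])
      have "h ?t = coordinate (u, l) ?t \<odot>\<^bsub>C\<^esub> (case (u, l) of (u, l) \<Rightarrow> basis u l)"
        unfolding hx[OF tC]
      proof (rule C.gfinsum_single)
        show "(u, l) \<in> ?W" using ul by simp
        show "(\<lambda>w. coordinate w ?t \<odot>\<^bsub>C\<^esub> (case w of (u, l) \<Rightarrow> basis u l)) \<in> ?W \<rightarrow> carrier C"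
          by (intro Pi_I C.smult_closed cc bc tC)
        fix w assume w: "w \<in> ?W" "w \<noteq> (u, l)"
        then obtain u' l' where w': "w = (u', l')" "L.op_path u' l'" by auto
        have "coordinate w ?t = \<zero>\<^bsub>L\<^esub>"
          unfolding w'(1) ul(2) coordinate_single[OF w'(2) ul(1) y] using w w' by auto
        then show "coordinate w ?t \<odot>\<^bsub>C\<^esub> (case w of (u, l) \<Rightarrow> basis u l) = \<zero>\<^bsub>C\<^esub>"
          using bc[OF w(1)] by simp
      qed
      also have "\<dots> = tens (y \<otimes>\<^bsub>L\<^esub> rsz_ev (L.path_end u l) c \<otimes>\<^bsub>L\<^esub> rsz_ev (L.path_end u l) 1) (Poly_Mapping.single p 1)"
        unfolding prod.case ul(2) coordinate_single[OF ul(1) ul(1) y]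
        using smult_basis[OF L.m_closed[OF y e_c[OF v]] ul(1)] by simp
      \<comment> \<open>The scalar \<open>c\<close> sits in the left factor as a multiple of an
        idempotent. Read as the right action of a vertex element, it crosses the tensor sign and
        becomes the coefficient of the path.\<close>
      also have "y \<otimes>\<^bsub>L\<^esub> rsz_ev (L.path_end u l) c \<otimes>\<^bsub>L\<^esub> rsz_ev (L.path_end u l) 1
          = right_act y (Poly_Mapping.single (triv_path (L.path_end u l)) c)"
        using L.m_assoc[OF y e_c[OF v] e_c[OF v], of c 1] L.ev_ev[OF v v, of c 1] by (simp add: right_act_def rsz_ev_def)
      also have "tens \<dots> (Poly_Mapping.single p 1) = tens y (left_act (Poly_Mapping.single (triv_path (L.path_end u l)) c) (Poly_Mapping.single p 1))"
        unfolding ul(2)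
        by (rule tens_balance[OF y _ single_code_path_closed[OF ul(1)]]) (use v in \<open>auto simp: vertex_algebra_def\<close>)
      also have "left_act (Poly_Mapping.single (triv_path (L.path_end u l)) c) (Poly_Mapping.single p 1) = Poly_Mapping.single p c"
        by (simp add: left_act_def path_mult_single path_term_def ul(2) path_comp_def path_source_def path_target_def triv_path_def)
      finally show ?case by simp
    qed
  qed
  then show ?thesis using hx[OF x] by simp
qed

text \<open>The idempotent in the left factor removes all arrows that do not end at the current
  vertex. For the others it may be exchanged for the idempotent at the tail on the other side of the
  arrow, which is the left factor of the generator of the extended path.\<close>

lemma dif_basis:
  assumes ul: "L.op_path u l"
  shows "dif C (basis u l) = finsum C (\<lambda>\<alpha>. rsz_ar \<alpha> 1 \<odot>\<^bsub>C\<^esub> basis u (\<alpha> # l)) {\<alpha> \<in> arcs G. head G \<alpha> = L.path_end u l}"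
proof -
  define v where "v = L.path_end u l"
  have v: "v \<in> verts G" unfolding v_def by (rule L.path_end_V[OF ul])
  let ?z = "Poly_Mapping.single (code_path u l) 1 :: ('a, 'b) qpath \<Rightarrow>\<^sub>0 'k"
  have t: "dterm \<alpha> (rsz_ev v 1) ?z = (if head G \<alpha> = v then rsz_ar \<alpha> 1 \<odot>\<^bsub>C\<^esub> basis u (\<alpha> # l) else \<one>\<^bsub>T\<^esub>)"
    if \<alpha>: "\<alpha> \<in> arcs G" for \<alpha>
  proof (cases "head G \<alpha> = v")
    case True
    have p: "L.op_path u (\<alpha> # l)" using ul \<alpha> True by (simp add: v_def)
    have "path_mult (arrow_elem (op_quiver G) \<alpha>) ?z = Poly_Mapping.single (code_path u (\<alpha> # l)) 1"
      using True by (simp add: arrow_elem_def path_mult_single path_term_def arrow_path_def path_comp_def path_source_def path_target_def v_def)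
    moreover have "rsz_ev v 1 \<otimes>\<^bsub>L\<^esub> rsz_ar \<alpha> 1 = rsz_ar \<alpha> 1 \<otimes>\<^bsub>L\<^esub> rsz_ev (L.path_end u (\<alpha> # l)) 1"
      using L.ev_ar[OF v \<alpha>, of 1 1] L.ar_ev[OF L.tl[OF \<alpha>] \<alpha>, of 1 1] True by simp
    ultimately show ?thesis using smult_basis[OF al_c[OF \<alpha>] p] True by simp
  next
    case False
    then have "rsz_ev v 1 \<otimes>\<^bsub>L\<^esub> rsz_ar \<alpha> 1 = \<zero>\<^bsub>L\<^esub>" using L.ev_ar[OF v \<alpha>, of 1 1] by auto
    then show ?thesis using False tens_zero_left[OF arrow_mult_closed[OF \<alpha> single_code_path_closed[OF ul]]] by simp
  qed
  have ac: "rsz_ar \<alpha> 1 \<odot>\<^bsub>C\<^esub> basis u (\<alpha> # l) \<in> carrier T" if "\<alpha> \<in> arcs G" "head G \<alpha> = v" for \<alpha>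
    using C.smult_closed[OF al_c[OF that(1)], of "basis u (\<alpha> # l)" 1] basis_closed[of u "\<alpha> # l"] ul that
    by (simp add: C_simps(1) v_def)
  have "dif C (basis u l) = finprod T (\<lambda>\<alpha>. dterm \<alpha> (rsz_ev v 1) ?z) (arcs G)"
    unfolding C_simps basis_def v_def by (rule dm_tens[OF path_end_e_c[OF ul] single_code_path_closed[OF ul]])
  also have "\<dots> = finprod T (\<lambda>\<alpha>. rsz_ar \<alpha> 1 \<odot>\<^bsub>C\<^esub> basis u (\<alpha> # l)) {\<alpha> \<in> arcs G. head G \<alpha> = v}"
    by (rule T.finprod_mono_neutral_cong_right) (use t ac finite_arcs in \<open>auto simp del: path_algebra_simps\<close>)
  finally show ?thesis unfolding finsum_C v_def .
qed

lemma C_generator: "rsz_generator L (verts G) (arcs G) (tail G) (head G) rsz_ev rsz_ar rsz_cv rsz_ca C basis coordinate"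
proof (rule rsz_generator.intro[OF L.rad_sq_zero_axioms rsz_generator_axioms.intro])
  show "diff_module L C" by (rule C_diff_module)
  show "dual_basis L C {(u, l). L.op_path u l} (\<lambda>(u, l). basis u l) coordinate"
    unfolding dual_basis_def
  proof (intro conjI ballI)
    show "(case w of (u, l) \<Rightarrow> basis u l) \<in> carrier C" if "w \<in> {(u, l). L.op_path u l}" for w
      using that basis_closed by (auto simp: C_simps(1))
    show "coordinate w \<in> lmod_hom L C (reg_lmod L)" if "w \<in> {(u, l). L.op_path u l}" for w
      using that coordinate(1) by auto
    show "finite {w \<in> {(u, l). L.op_path u l}. coordinate w x \<noteq> \<zero>\<^bsub>L\<^esub>}" if "x \<in> carrier C" for x
      using coordinate_finite that by (simp add: C_simps(1))
  qed (rule coordinate_expansion)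
  show "rsz_ev (L.path_end u l) 1 \<odot>\<^bsub>C\<^esub> basis u l = basis u l" if "L.op_path u l" for u l
    unfolding smult_basis[OF path_end_e_c[OF that] that] using L.ev_ev[OF L.path_end_V[OF that] L.path_end_V[OF that], of 1 1]
    by (simp add: basis_def)
qed (rule basis_coordinate dif_basis; assumption)+

end

text \<open>Elements of \<open>C\<close> are cosets of formal sums, while objects of the homotopy
  category have elements of the universe. The generators and coordinates are carried along the
  injection, so that the general theorem applies to the copy.\<close>

lemma (in rsz_generator) transport:
  assumes e: "inj_on emb (carrier S)"
  shows "rsz_generator L V A tl hd ev ar cv ca (transport_dmodule emb S) (\<lambda>u l. emb (b u l))
    (\<lambda>z. compose (emb ` carrier S) (\<phi> z) (inv_into (carrier S) emb))"
proof -
  let ?S = "transport_dmodule emb S" and ?inv = "inv_into (carrier S) emb"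
  let ?\<phi> = "\<lambda>z. compose (emb ` carrier S) (\<phi> z) ?inv" and ?Z = "{(u, l). op_path u l}"
  note tr = transport_diff_module[OF S e]
  note D = dual_basisD[OF db]
  interpret T: left_module L ?S by (rule diff_moduleD[OF tr(1)])
  let ?g = "\<lambda>x\<in>carrier S. emb x"
  have \<phi>e: "?\<phi> z (emb x) = \<phi> z x" if "x \<in> carrier S" for z x
    using that e by (simp add: compose_def)
  have sm: "a \<odot>\<^bsub>?S\<^esub> emb x = emb (a \<odot>\<^bsub>S\<^esub> x)" if "x \<in> carrier S" for a x
    using that e by simp
  have bs: "(case z of (u, l) \<Rightarrow> emb (b u l)) = emb (case z of (u, l) \<Rightarrow> b u l)" for z
    by (cases z) simp
  have "dual_basis L ?S ?Z (\<lambda>(u, l). emb (b u l)) ?\<phi>"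
    unfolding dual_basis_def
  proof (intro conjI ballI)
    show "(case z of (u, l) \<Rightarrow> emb (b u l)) \<in> carrier ?S" if "z \<in> ?Z" for z
      unfolding bs transport_dmodule_simps by (rule imageI[OF D(1)[OF that]])
    show "?\<phi> z \<in> lmod_hom L ?S (reg_lmod L)" if z: "z \<in> ?Z" for z
    proof (rule lmod_homI)
      fix x assume x: "x \<in> carrier ?S"
      then obtain x' where x': "x' \<in> carrier S" "x = emb x'" by auto
      show "?\<phi> z x \<in> carrier (reg_lmod L)" unfolding x'(2) \<phi>e[OF x'(1)] using D(5)[OF z x'(1)] by simp
      show "?\<phi> z (a \<odot>\<^bsub>?S\<^esub> x) = a \<odot>\<^bsub>reg_lmod L\<^esub> ?\<phi> z x" if a: "a \<in> carrier L" for a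
        unfolding x'(2) sm[OF x'(1)] \<phi>e[OF x'(1)] \<phi>e[OF S.smult_closed[OF a x'(1)]]
        by (rule lmod_hom_smult[OF D(2)[OF z] a x'(1)])
      show "?\<phi> z (x \<oplus>\<^bsub>?S\<^esub> y) = ?\<phi> z x \<oplus>\<^bsub>reg_lmod L\<^esub> ?\<phi> z y" if y: "y \<in> carrier ?S" for y
      proof -
        obtain y' where y': "y' \<in> carrier S" "y = emb y'" using y by auto
        have "x \<oplus>\<^bsub>?S\<^esub> y = emb (x' \<oplus>\<^bsub>S\<^esub> y')" using x' y' e by simp
        then show ?thesis
          using lmod_hom_add[OF D(2)[OF z] x'(1) y'(1)] \<phi>e[OF S.M.a_closed[OF x'(1) y'(1)]]
          by (simp only: x'(2) y'(2) \<phi>e[OF x'(1)] \<phi>e[OF y'(1)])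
      qed
    qed (simp add: compose_def)
    fix p assume "p \<in> carrier ?S"
    then obtain q where q: "q \<in> carrier S" "p = emb q" by auto
    show "finite {z \<in> ?Z. ?\<phi> z p \<noteq> \<zero>}" unfolding q(2) \<phi>e[OF q(1)] by (rule D(3)[OF q(1)])
    let ?h = "\<lambda>z. \<phi> z q \<odot>\<^bsub>S\<^esub> (case z of (u, l) \<Rightarrow> b u l)"
    have h: "?h z \<in> carrier S" if "z \<in> ?Z" for z by (rule S.smult_closed[OF D(5)[OF that q(1)] D(1)[OF that]])
    have "?h z = \<zero>\<^bsub>S\<^esub>" if "z \<in> ?Z" "\<phi> z q = \<zero>" for z
      unfolding that(2) by (rule S.smult_l_null[OF D(1)[OF that(1)]])
    then have fin: "finite {z \<in> ?Z. ?h z \<noteq> \<zero>\<^bsub>S\<^esub>}"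
      by (intro finite_subset[OF _ D(3)[OF q(1)]]) blast
    have "p = ?g (gfinsum S ?h ?Z)" unfolding D(4)[OF q(1)] using q by simp
    also have "\<dots> = gfinsum ?S (\<lambda>z. ?g (?h z)) ?Z"
      by (rule lmod_hom_gfinsum[OF tr(2) S.left_module_axioms T.left_module_axioms _ fin]) (use h in blast)
    also have "\<dots> = gfinsum ?S (\<lambda>z. ?\<phi> z p \<odot>\<^bsub>?S\<^esub> (case z of (u, l) \<Rightarrow> emb (b u l))) ?Z"
    proof (rule T.gfinsum_cong)
      fix z assume z: "z \<in> ?Z"
      show "?g (?h z) = ?\<phi> z p \<odot>\<^bsub>?S\<^esub> (case z of (u, l) \<Rightarrow> emb (b u l))"
        unfolding bs q(2) \<phi>e[OF q(1)] sm[OF D(1)[OF z]] using h[OF z] by simp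
    next
      show "(\<lambda>z. ?\<phi> z p \<odot>\<^bsub>?S\<^esub> (case z of (u, l) \<Rightarrow> emb (b u l))) \<in> ?Z \<rightarrow> carrier ?S"
      proof (rule Pi_I)
        fix z assume z: "z \<in> ?Z"
        show "?\<phi> z p \<odot>\<^bsub>?S\<^esub> (case z of (u, l) \<Rightarrow> emb (b u l)) \<in> carrier ?S"
          unfolding bs q(2) \<phi>e[OF q(1)] sm[OF D(1)[OF z]] unfolding transport_dmodule_simps by (rule imageI[OF h[OF z]])
      qed
    qed
    finally show "p = gfinsum ?S (\<lambda>z. ?\<phi> z p \<odot>\<^bsub>?S\<^esub> (case z of (u, l) \<Rightarrow> emb (b u l))) ?Z" .
  qed
  moreover have "e (path_end u l) \<odot>\<^bsub>?S\<^esub> emb (b u l) = emb (b u l)" if "op_path u l" for u l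
    unfolding sm[OF b_closed[OF that]] e_b[OF that] ..
  moreover have "?\<phi> (u, l) (emb (b u' l')) = (if (u, l) = (u', l') then e (path_end u l) else \<zero>)"
    if "op_path u l" "op_path u' l'" for u l u' l'
    unfolding \<phi>e[OF b_closed[OF that(2)]] by (rule \<phi>_b[OF that])
  moreover have "dif ?S (emb (b u l)) = finsum ?S (\<lambda>a. al a \<odot>\<^bsub>?S\<^esub> emb (b u (a # l))) {a \<in> A. hd a = path_end u l}"
    if ul: "op_path u l" for u l
  proof -
    let ?A = "{a \<in> A. hd a = path_end u l}"
    have bc: "b u (a # l) \<in> carrier S" if "a \<in> ?A" for a
      using that ul by (intro b_closed) simp
    have c: "al a \<odot>\<^bsub>S\<^esub> b u (a # l) \<in> carrier S" if "a \<in> ?A" for a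
      by (rule S.smult_closed[OF al_closed bc[OF that]]) (use that in simp)
    have "dif ?S (emb (b u l)) = emb (dif S (b u l))" using b_closed[OF ul] e by simp
    also have "\<dots> = ?g (finsum S (\<lambda>a. al a \<odot>\<^bsub>S\<^esub> b u (a # l)) ?A)"
      unfolding d_b[OF ul, symmetric] using diff_moduleD(4)[OF S b_closed[OF ul]] by simp
    also have "\<dots> = finsum ?S (\<lambda>a. ?g (al a \<odot>\<^bsub>S\<^esub> b u (a # l))) ?A"
      by (rule lmod_hom_finsum[OF tr(2) S.left_module_axioms T.left_module_axioms]) (use c in blast)
    also have "\<dots> = finsum ?S (\<lambda>a. al a \<odot>\<^bsub>?S\<^esub> emb (b u (a # l))) ?A"
    proof (rule T.M.finsum_cong'[OF refl])
      show "?g (al a \<odot>\<^bsub>S\<^esub> b u (a # l)) = al a \<odot>\<^bsub>?S\<^esub> emb (b u (a # l))" if "a \<in> ?A" for a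
        unfolding sm[OF bc[OF that]] using c[OF that] by simp
      show "(\<lambda>a. al a \<odot>\<^bsub>?S\<^esub> emb (b u (a # l))) \<in> ?A \<rightarrow> carrier ?S"
      proof (rule Pi_I)
        show "al a \<odot>\<^bsub>?S\<^esub> emb (b u (a # l)) \<in> carrier ?S" if "a \<in> ?A" for a
          unfolding sm[OF bc[OF that]] unfolding transport_dmodule_simps by (rule imageI[OF c[OF that]])
      qed
    qed
    finally show ?thesis .
  qed
  ultimately show ?thesis
    by (intro rsz_generator.intro rad_sq_zero_axioms rsz_generator_axioms.intro tr(1))
qed

theorem theorem1p3:
  fixes Q :: "('v, 'e) pre_digraph"
    and emb :: "('v, 'e, 'k::field) C_carrier \<Rightarrow> 'u"
  assumes "fin_digraph Q"
    and "infinite (UNIV :: 'u set)"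
    and "inj_on emb (carrier (C_dmodule Q))"
  shows "compact_generator (UNIV :: 'u set)
           (homotopy_diff_proj (rad_sq_zero_algebra Q :: (('v, 'e) qpath \<Rightarrow>\<^sub>0 'k) set ring))
           (transport_dmodule emb (C_dmodule Q))"
proof -
  interpret quiver_C Q "TYPE('k)" by (rule quiver_C.intro[OF assms(1)])
  show ?thesis
    by (rule rsz_generator.compact_generator[OF rsz_generator.transport[OF C_generator assms(3)] assms(2)])
qed

end
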